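(* Let $\rho_0,\rho_1\in\mathcal P(\mathbb T^d)$ have finite entropies $H(\rho_0),H(\rho_1)<\infty$, and let $\rho=(\rho_t)_{t\in[0,1]}$ be a solution of the optimal transport problem $\mathsf{OT}(\rho_0,\rho_1)$, or of the Schrödinger problem $\mathsf{Sch}_\alpha(\rho_0,\rho_1)$ for a fixed diffusivity $\alpha>0$. Then $t\mapsto H(\rho_t)$ is convex on $[0,1]$.
   Context: $\mathbb T^d=\mathbb R^d/\mathbb Z^d$ is the flat torus with normalized Lebesgue measure $\mathrm{Leb}=dx$. $\mathcal P(\mathbb T^d)$ is the set of Borel probability measures endowed with the quadratic Wasserstein distance. $H(\mu)=\int\mu\log\mu\,dx$ if $\mu\ll\mathrm{Leb}$ (identifying $\mu$ with its density), and $+\infty$ otherwise. $AC^2([0,1];\mathcal P(\mathbb T^d))$ is the set of curves $\rho=(\rho_t)$ that are absolutely continuous for the Wasserstein distance with square-integrable metric speed; equivalently, narrowly continuous curves for which there is a measurable vector field $c=c_t(x)$ with $\int_0^1\int|c_t|^2d\rho_t\,dt<\infty$ and $\partial_t\rho_t+\mathrm{div}(\rho_tc_t)=0$ weakly. $\mathcal A(\rho):=\min_c\frac12\int_0^1\int|c_t|^2d\rho_t\,dt$ over such $c$ if $\rho\in AC^2$, and $+\infty$ otherwise. $\mathcal F(\rho):=\frac18\int_0^1\int|\nabla\log\rho_t|^2d\rho_t\,dt=\frac12\int_0^1\int|\nabla\sqrt{\rho_t}|^2dx\,dt$ if $\sqrt\rho\in L^2([0,1];H^1(\mathbb T^d))$,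 and $+\infty$ otherwise. $\mathcal H_\alpha:=\mathcal A+\alpha^2\mathcal F$. A solution to $\mathsf{OT}(\rho_0,\rho_1)$ is a minimizer of $\mathcal A$ among curves in $AC^2([0,1];\mathcal P(\mathbb T^d))$ equal to $\rho_0$ at $t=0$ and $\rho_1$ at $t=1$. A solution to $\mathsf{Sch}_\alpha(\rho_0,\rho_1)$ is a minimizer of $\mathcal H_\alpha$ among curves in $AC^2([0,1];\mathcal P(\mathbb T^d))$ with these same endpoints and $\mathcal F(\rho)<+\infty$. *)

theory Defs
  imports "HOL-Probability.Probability"
begin

section \<open>The flat torus\<close>

definition lattice_equiv :: "real^'n \<Rightarrow> real^'n \<Rightarrow> bool" where
  "lattice_equiv x y \<longleftrightarrow> (\<forall>i. x $ i - y $ i \<in> \<int>)"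

lemma equivp_lattice_equiv: "equivp (lattice_equiv :: real^'n \<Rightarrow> real^'n \<Rightarrow> bool)"
proof (rule equivpI)
  show "reflp (lattice_equiv :: real^'n \<Rightarrow> real^'n \<Rightarrow> bool)"
    by (simp add: reflp_def lattice_equiv_def)
  show "symp (lattice_equiv :: real^'n \<Rightarrow> real^'n \<Rightarrow> bool)"
    unfolding symp_def lattice_equiv_def by (metis Ints_minus minus_diff_eq)
  show "transp (lattice_equiv :: real^'n \<Rightarrow> real^'n \<Rightarrow> bool)"
    unfolding transp_def lattice_equiv_def
  proof (intro allI impI)
    fix x y z :: "real^'n" and i
    assume "\<forall>i. x $ i - y $ i \<in> \<int>" "\<forall>i. y $ i - z $ i \<in> \<int>"
    then have "(x $ i - y $ i) + (y $ i - z $ i) \<in> \<int>"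
      by (intro Ints_add) auto
    then show "x $ i - z $ i \<in> \<int>" by simp
  qed
qed

quotient_type 'n torus = "real^('n::finite)" / lattice_equiv
  morphisms torus_rep torus_proj
  by (rule equivp_lattice_equiv)

instantiation torus :: (finite) topological_space
begin

definition open_torus :: "'a torus set \<Rightarrow> bool" where
  "open_torus U \<longleftrightarrow> open (torus_proj -` U)"

instance
proof
  show "open (UNIV :: 'a torus set)"
    by (simp add: open_torus_def)
  show "open (S \<inter> T)" if "open S" "open T" for S T :: "'a torus set"
    using that by (simp add: open_torus_def vimage_Int open_Int)
  show "open (\<Union>K)" if "\<forall>S\<in>K. open S" for K :: "'a torus set set"
    using that by (auto simp: open_torus_def vimage_Union)
qed

end

lemma continuous_on_torus_proj: "continuous_on UNIV torus_proj"
  by (simp add: continuous_on_open_vimage open_torus_def)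

lemma torus_proj_measurable [measurable]: "torus_proj \<in> borel_measurable borel"
  by (rule borel_measurable_continuous_onI[OF continuous_on_torus_proj])

definition Leb :: "('n::finite) torus measure" where
  "Leb = distr (restrict_space lborel (cbox 0 1)) borel torus_proj"

lemma prob_space_Leb: "prob_space (Leb :: ('n::finite) torus measure)"
proof -
  have one: "(1 :: real^'n) \<bullet> b = 1" if "b \<in> Basis" for b
    using that by (auto simp: Basis_vec_def inner_axis)
  have "emeasure lborel (cbox 0 (1 :: real^'n)) = 1"
    by (subst emeasure_lborel_cbox) (auto simp: one)
  then have "prob_space (restrict_space lborel (cbox 0 (1 :: real^'n)))"
    by (intro prob_spaceI) (simp add: emeasure_restrict_space space_restrict_space)
  then show ?thesis
    unfolding Leb_def by (rule prob_space.prob_space_distr) (simp add: measurable_restrict_space1)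
qed

definition prob_measures :: "('n::finite) torus measure set" where
  "prob_measures = {\<mu>. prob_space \<mu> \<and> sets \<mu> = sets borel}"

section \<open>Entropy\<close>

text \<open>
  Since \<open>s * ln s\<close> is bounded below and \<open>Leb\<close> is finite, the integral of \<open>f * ln f\<close> always
  makes sense in \<open>(-\<infinity>, \<infinity>]\<close>, and the failure of integrability means that its value is \<open>\<infinity>\<close>.
  Note that \<open>0 * ln 0 = 0\<close>.
\<close>

definition entropy_H :: "('n::finite) torus measure \<Rightarrow> ereal" where
  "entropy_H \<mu> =
    (let f = (\<lambda>x. enn2real (RN_deriv Leb \<mu> x)) in
     if absolutely_continuous Leb \<mu> \<and> integrable Leb (\<lambda>x. f x * ln (f x))
     then ereal (LINT x|Leb. f x * ln (f x)) else \<infinity>)"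

section \<open>Differentiable functions on the torus\<close>

text \<open>\<open>\<phi>\<close> is continuously differentiable with gradient \<open>G\<close>; derivatives are those of the periodic lift.\<close>

definition C1_torus :: "('n::finite torus \<Rightarrow> real) \<Rightarrow> ('n torus \<Rightarrow> real^'n) \<Rightarrow> bool" where
  "C1_torus \<phi> G \<longleftrightarrow> continuous_on UNIV G \<and>
    (\<forall>x. ((\<lambda>y. \<phi> (torus_proj y)) has_derivative (\<lambda>h. G (torus_proj x) \<bullet> h)) (at x))"

text \<open>
  \<open>\<psi>\<close> is a continuously differentiable function on \<open>(0,1)\<close> times the torus with compact support,
  with time derivative \<open>\<psi>t\<close> and space gradient \<open>\<psi>x\<close>.
\<close>

definition spacetime_test ::
  "(real \<Rightarrow> 'n::finite torus \<Rightarrow> real) \<Rightarrow> (real \<Rightarrow> 'n torus \<Rightarrow> real) \<Rightarrow> (real \<Rightarrow> 'n torus \<Rightarrow> real^'n) \<Rightarrow> bool"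
  where
  "spacetime_test \<psi> \<psi>t \<psi>x \<longleftrightarrow>
    continuous_on UNIV (\<lambda>(t, x). \<psi>t t x) \<and> continuous_on UNIV (\<lambda>(t, x). \<psi>x t x) \<and>
    (\<forall>t x. ((\<lambda>(s, y). \<psi> s (torus_proj y)) has_derivative
             (\<lambda>(s, h). \<psi>t t (torus_proj x) * s + \<psi>x t (torus_proj x) \<bullet> h)) (at (t, x))) \<and>
    (\<exists>a b. 0 < a \<and> a < b \<and> b < 1 \<and> (\<forall>t x. t \<notin> {a..b} \<longrightarrow> \<psi> t x = 0))"

section \<open>Curves of finite action\<close>

definition narrowly_continuous :: "(real \<Rightarrow> 'n::finite torus measure) \<Rightarrow> bool" where
  "narrowly_continuous \<rho> \<longleftrightarrow>
    (\<forall>\<phi> :: 'n torus \<Rightarrow> real. continuous_on UNIV \<phi> \<longrightarrow> continuous_on {0..1} (\<lambda>t. LINT x|\<rho> t. \<phi> x))"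

text \<open>
  The equation \<open>\<partial>\<^sub>t \<rho> + div (\<rho> c) = 0\<close> on \<open>(0,1)\<close> in the weak sense. It only involves first derivatives
  of the test function, so (for \<open>c\<close> of finite energy, by density) testing with \<open>C\<^sup>1\<close> or with smooth
  compactly supported functions is the same.
\<close>

definition continuity_eq ::
  "(real \<Rightarrow> 'n::finite torus measure) \<Rightarrow> (real \<Rightarrow> 'n torus \<Rightarrow> real^'n) \<Rightarrow> bool" where
  "continuity_eq \<rho> c \<longleftrightarrow>
    (\<forall>\<psi> \<psi>t \<psi>x. spacetime_test \<psi> \<psi>t \<psi>x \<longrightarrow>
      (LINT t:{0..1}|lborel. (LINT x|\<rho> t. \<psi>t t x + \<psi>x t x \<bullet> c t x)) = 0)"

definition kinetic_energy ::
  "(real \<Rightarrow> 'n::finite torus measure) \<Rightarrow> (real \<Rightarrow> 'n torus \<Rightarrow> real^'n) \<Rightarrow> ennreal" where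
  "kinetic_energy \<rho> c = (\<integral>\<^sup>+t\<in>{0..1}. (\<integral>\<^sup>+x. ennreal ((norm (c t x))\<^sup>2) \<partial>\<rho> t) \<partial>lborel)"

definition velocity_fields ::
  "(real \<Rightarrow> 'n::finite torus measure) \<Rightarrow> (real \<Rightarrow> 'n torus \<Rightarrow> real^'n) set" where
  "velocity_fields \<rho> =
    {c. (\<lambda>(t, x). c t x) \<in> borel_measurable (borel \<Otimes>\<^sub>M borel) \<and>
        kinetic_energy \<rho> c < \<infinity> \<and> continuity_eq \<rho> c}"

text \<open>
  The class \<open>AC\<^sup>2([0,1]; P)\<close>, in the form given by the continuity equation. A curve is a
  function on \<open>real\<close> of which only the restriction to \<open>{0..1}\<close> matters.
\<close>

definition AC2 :: "(real \<Rightarrow> 'n::finite torus measure) set" where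
  "AC2 = {\<rho>. (\<forall>t\<in>{0..1}. \<rho> t \<in> prob_measures) \<and> narrowly_continuous \<rho> \<and> velocity_fields \<rho> \<noteq> {}}"

definition action :: "(real \<Rightarrow> 'n::finite torus measure) \<Rightarrow> ennreal" where
  "action \<rho> = (if \<rho> \<in> AC2 then (INF c\<in>velocity_fields \<rho>. kinetic_energy \<rho> c / 2) else \<infinity>)"

section \<open>The Fisher information functional\<close>

definition weak_gradient :: "('n::finite torus \<Rightarrow> real) \<Rightarrow> ('n torus \<Rightarrow> real^'n) \<Rightarrow> bool" where
  "weak_gradient u g \<longleftrightarrow> integrable Leb u \<and> integrable Leb g \<and>
    (\<forall>\<phi> G. C1_torus \<phi> G \<longrightarrow> (LINT x|Leb. u x *\<^sub>R G x) = - (LINT x|Leb. \<phi> x *\<^sub>R g x))"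

text \<open>\<open>u\<close> belongs to \<open>L\<^sup>2([0,1]; H\<^sup>1)\<close> with space gradient \<open>g\<close>, both given by jointly measurable representatives.\<close>

definition L2_H1 ::
  "(real \<Rightarrow> 'n::finite torus \<Rightarrow> real) \<Rightarrow> (real \<Rightarrow> 'n torus \<Rightarrow> real^'n) \<Rightarrow> bool" where
  "L2_H1 u g \<longleftrightarrow>
    (\<lambda>(t, x). u t x) \<in> borel_measurable (borel \<Otimes>\<^sub>M borel) \<and>
    (\<lambda>(t, x). g t x) \<in> borel_measurable (borel \<Otimes>\<^sub>M borel) \<and>
    (\<integral>\<^sup>+t\<in>{0..1}. (\<integral>\<^sup>+x. ennreal ((u t x)\<^sup>2) \<partial>Leb) \<partial>lborel) < \<infinity> \<and>
    (\<integral>\<^sup>+t\<in>{0..1}. (\<integral>\<^sup>+x. ennreal ((norm (g t x))\<^sup>2) \<partial>Leb) \<partial>lborel) < \<infinity> \<and>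
    (AE t in lborel. t \<in> {0..1} \<longrightarrow> weak_gradient (u t) (g t))"

definition sqrt_density ::
  "(real \<Rightarrow> 'n::finite torus measure) \<Rightarrow> (real \<Rightarrow> 'n torus \<Rightarrow> real) \<Rightarrow> bool" where
  "sqrt_density \<rho> u \<longleftrightarrow> (\<forall>t x. 0 \<le> u t x) \<and>
    (AE t in lborel. t \<in> {0..1} \<longrightarrow> \<rho> t = density Leb (\<lambda>x. ennreal ((u t x)\<^sup>2)))"

text \<open>
  The square root \<open>u\<close> of the density and its gradient \<open>g\<close> are unique up to null sets, so the infimum
  ranges over at most one value; it is \<open>\<infinity>\<close> if there are no such \<open>u\<close> and \<open>g\<close>.
\<close>

definition fisher :: "(real \<Rightarrow> 'n::finite torus measure) \<Rightarrow> ennreal" where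
  "fisher \<rho> =
    Inf {(\<integral>\<^sup>+t\<in>{0..1}. (\<integral>\<^sup>+x. ennreal ((norm (g t x))\<^sup>2) \<partial>Leb) \<partial>lborel) / 2 | u g.
          sqrt_density \<rho> u \<and> L2_H1 u g}"

section \<open>The variational problems\<close>

definition sch_functional :: "real \<Rightarrow> (real \<Rightarrow> 'n::finite torus measure) \<Rightarrow> ennreal" where
  "sch_functional \<alpha> \<rho> = action \<rho> + ennreal (\<alpha>\<^sup>2) * fisher \<rho>"

definition curves_between ::
  "'n::finite torus measure \<Rightarrow> 'n torus measure \<Rightarrow> (real \<Rightarrow> 'n torus measure) set" where
  "curves_between \<mu> \<nu> = {\<rho> \<in> AC2. \<rho> 0 = \<mu> \<and> \<rho> 1 = \<nu>}"

definition OT_solution ::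
  "'n::finite torus measure \<Rightarrow> 'n torus measure \<Rightarrow> (real \<Rightarrow> 'n torus measure) \<Rightarrow> bool" where
  "OT_solution \<mu> \<nu> \<rho> \<longleftrightarrow> is_arg_min action (\<lambda>\<sigma>. \<sigma> \<in> curves_between \<mu> \<nu>) \<rho>"

definition Sch_solution ::
  "real \<Rightarrow> 'n::finite torus measure \<Rightarrow> 'n torus measure \<Rightarrow> (real \<Rightarrow> 'n torus measure) \<Rightarrow> bool" where
  "Sch_solution \<alpha> \<mu> \<nu> \<rho> \<longleftrightarrow>
    is_arg_min (sch_functional \<alpha>) (\<lambda>\<sigma>. \<sigma> \<in> curves_between \<mu> \<nu> \<and> fisher \<sigma> < \<infinity>) \<rho>"

section \<open>Convexity of extended-real-valued functions\<close>

definition ereal_convex_on :: "real set \<Rightarrow> (real \<Rightarrow> ereal) \<Rightarrow> bool" where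
  "ereal_convex_on I f \<longleftrightarrow> convex I \<and>
    (\<forall>s\<in>I. \<forall>t\<in>I. \<forall>l\<in>{0..1}. f ((1 - l) * s + l * t) \<le> ereal (1 - l) * f s + ereal l * f t)"

end

(*
Heat up a minimizer rho slightly: replace rho_t by P_(h(t)) rho_t, where P is the heat semigroup and h is a tent
function of height eps supported on [a,b] with peak at s. If c is a velocity field of rho, then the heated curve,
with density u and P_h(rho c) = m, is driven by v = (m - h' grad u) / u, and Jensen's inequality together with the
dissipation identity d/dt H(u) = int (grad u / u) . (u v) gives
  int |v|^2 u <= int |c|^2 d rho - 2 h' d/dt H(u).
On the two affine pieces of h the last term integrates to differences of entropies. Since P also decreases the Fisher
information, the heated curve is admissible in both problems and minimality of rho yields that H(P_eps rho_s) is at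
most the convex combination of H(rho_a) and H(rho_b). Let eps tend to 0 and use lower semicontinuity of H.
The heat time h vanishes at a and b, so the energy estimate is obtained for h + delta and delta -> 0.
*)
theory Submission
  imports Defs
begin

section \<open>Topology of the torus\<close>

text \<open>Minimality yields convexity without an error term for two reasons. The part of the
  energy change that is quadratic in the slopes \<epsilon> / (s - a) and -\<epsilon> / (b - s) of
  the tent has a favourable sign and is dropped; what remains is linear in \<epsilon>, so dividing
  by \<epsilon> leaves the convexity inequality with P_\<epsilon> \<rho>_s in place of \<rho>_s.
  Inside (0, 1) the entropy may a priori be infinite: only its values at a and b enter as real
  numbers, and finiteness at s is a result of lower semicontinuity. The obstacle is regularity in
  time. The velocity field is merely square integrable, so the heated density is C1 in space, while
  its evolution is known only through the integrated continuity equation. Identities are therefore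
  obtained by testing with C1 functions of time and space, and the chain rule for the entropy from
  tangent inequalities. The minimum in the action is never attained explicitly: a velocity field
  with energy close enough to the infimum suffices. The heat flow is given by an explicit kernel,
  the periodised Gaussian, whose positivity, symmetry, unit mass and heat equation carry the whole
  argument.\<close>

lemma torus_proj_eq_iff: "torus_proj x = torus_proj y \<longleftrightarrow> (\<forall>i. x $ i - y $ i \<in> \<int>)"
  by (simp add: torus.abs_eq_iff lattice_equiv_def)

lemma torus_proj_rep [simp]: "torus_proj (torus_rep x) = x"
  using Quotient3_torus by (rule Quotient3_abs_rep)

lemma surj_torus_proj: "surj torus_proj"
  by (metis surjI torus_proj_rep)

lemma torus_proj_cases: obtains y where "x = torus_proj y"
  by (metis torus_proj_rep)

definition int_vec :: "(real^'n::finite) set" where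
  "int_vec = {k. \<forall>i. k $ i \<in> \<int>}"

lemma torus_proj_add_int_vec [simp]:
  assumes "k \<in> int_vec" shows "torus_proj (x + k) = torus_proj x"
  using assms by (simp add: torus_proj_eq_iff int_vec_def)

lemma torus_proj_eq_int_vec: "torus_proj x = torus_proj y \<longleftrightarrow> x - y \<in> int_vec"
  by (simp add: torus_proj_eq_iff int_vec_def)

lemma int_vec_uminus [simp]: "- k \<in> int_vec \<longleftrightarrow> k \<in> int_vec"
  by (simp add: int_vec_def)

text \<open>Decompositions of the covering space into lattice translates of a cell are countable for
  this reason, so measures can be summed over them.\<close>

lemma countable_int_vec: "countable (int_vec :: (real^'n::finite) set)"
proof -
  have "int_vec \<subseteq> (\<lambda>f. \<chi> i. f i) ` (UNIV \<rightarrow>\<^sub>E (\<int> :: real set) :: ('n \<Rightarrow> real) set)"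
  proof
    fix k :: "real^'n" assume "k \<in> int_vec"
    then have "(\<lambda>i. k $ i) \<in> UNIV \<rightarrow>\<^sub>E \<int>" by (auto simp: int_vec_def)
    then show "k \<in> (\<lambda>f. \<chi> i. f i) ` (UNIV \<rightarrow>\<^sub>E (\<int> :: real set))"
      by (intro image_eqI[of _ _ "\<lambda>i. k $ i"]) (simp_all add: vec_eq_iff)
  qed
  moreover have "countable ((UNIV \<rightarrow>\<^sub>E (\<int> :: real set)) :: ('n \<Rightarrow> real) set)"
    by (intro countable_PiE) (auto simp: Ints_def)
  ultimately show ?thesis by (metis countable_image countable_subset)
qed

lemma open_torus_iff: "open U \<longleftrightarrow> open (torus_proj -` U)"
  by (rule open_torus_def)

lemma vimage_torus_proj_image: "torus_proj -` (torus_proj ` U) = (\<Union>k\<in>int_vec. (\<lambda>x. x + k) ` U)"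
proof -
  have "x \<in> (\<Union>k\<in>int_vec. (\<lambda>x. x + k) ` U)" if "torus_proj x = torus_proj u" "u \<in> U" for x u
    using that by (intro UN_I[of "x - u"]) (auto simp: torus_proj_eq_int_vec)
  then show ?thesis by auto
qed

text \<open>The saturation of an open set is a union of lattice translates, hence open. Openness of
  the quotient map transports countable bases and joint continuity from the covering space to the
  torus.\<close>

lemma open_torus_proj_image:
  assumes "open U" shows "open (torus_proj ` U)"
  unfolding open_torus_iff vimage_torus_proj_image
  using assms open_translation[of U] by (auto simp: add.commute)

lemma continuous_on_torus_lift:
  fixes f :: "'n::finite torus \<Rightarrow> 'b::topological_space"
  shows "continuous_on UNIV f \<longleftrightarrow> continuous_on UNIV (\<lambda>x. f (torus_proj x))"
  by (simp add: continuous_on_open_vimage open_torus_iff vimage_def)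

text \<open>\<open>id \<times> torus_proj\<close> is an open surjection, so continuity can be tested on lifts also in the presence
  of parameters.\<close>

lemma continuous_on_param_torus_lift:
  fixes f :: "'a::topological_space \<Rightarrow> 'n::finite torus \<Rightarrow> 'b::topological_space"
  assumes "continuous_on (S \<times> UNIV) (\<lambda>(t, y). f t (torus_proj y))"
  shows "continuous_on (S \<times> UNIV) (\<lambda>(t, x). f t x)"
  unfolding continuous_on_open_invariant
proof (intro allI impI)
  fix B :: "'b set" assume "open B"
  with assms obtain A where A: "open A"
    "A \<inter> (S \<times> UNIV) = (\<lambda>(t, y). f t (torus_proj y)) -` B \<inter> (S \<times> UNIV)"
    unfolding continuous_on_open_invariant by blast
  define A' where "A' = (\<lambda>(t, y). (t, torus_proj y)) ` A"
  have "open A'"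
    unfolding open_prod_def
  proof safe
    fix t x assume "(t, x) \<in> A'"
    then obtain y where y: "(t, y) \<in> A" "x = torus_proj y" by (auto simp: A'_def)
    with A(1) obtain V W where "open V" "open W" "t \<in> V" "y \<in> W" "V \<times> W \<subseteq> A"
      by (metis open_prod_elim mem_Sigma_iff)
    with y show "\<exists>V W. open V \<and> open W \<and> (t, x) \<in> V \<times> W \<and> V \<times> W \<subseteq> A'"
      by (intro exI[of _ V] exI[of _ "torus_proj ` W"])
         (force simp: A'_def open_torus_proj_image image_iff)
  qed
  moreover have "(t, x) \<in> A' \<longleftrightarrow> f t x \<in> B" if "t \<in> S" for t x
  proof
    assume "(t, x) \<in> A'"
    then obtain y where "(t, y) \<in> A" "x = torus_proj y" by (auto simp: A'_def)
    with \<open>t \<in> S\<close> have "(t, y) \<in> (\<lambda>(t, y). f t (torus_proj y)) -` B \<inter> (S \<times> UNIV)"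
      unfolding A(2)[symmetric] by simp
    with \<open>x = torus_proj y\<close> show "f t x \<in> B" by simp
  next
    assume "f t x \<in> B"
    with that have "(t, torus_rep x) \<in> A \<inter> (S \<times> UNIV)" unfolding A(2) by simp
    then show "(t, x) \<in> A'" unfolding A'_def by (intro image_eqI[of _ _ "(t, torus_rep x)"]) auto
  qed
  then have "A' \<inter> (S \<times> UNIV) = (\<lambda>(t, x). f t x) -` B \<inter> (S \<times> UNIV)"
    by auto
  ultimately show "\<exists>A. open A \<and> A \<inter> (S \<times> UNIV) = (\<lambda>(t, x). f t x) -` B \<inter> (S \<times> UNIV)"
    by blast
qed

lemma torus_proj_cube: "torus_proj ` cbox 0 1 = UNIV"
proof -
  have "x \<in> torus_proj ` cbox 0 1" for x
  proof -
    obtain y where y: "x = torus_proj y" by (rule torus_proj_cases)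
    define z where "z = (\<chi> i. frac (y $ i))"
    have "torus_proj z = torus_proj y"
      by (simp add: z_def torus_proj_eq_iff frac_def)
    moreover have "z \<in> cbox 0 1"
      by (simp add: z_def mem_box_cart frac_lt_1 less_imp_le)
    ultimately show ?thesis using y by (metis imageI)
  qed
  then show ?thesis by auto
qed

lemma compact_torus: "compact (UNIV :: 'n::finite torus set)"
proof -
  have "compact (torus_proj ` cbox 0 (1::real^'n))"
    by (intro compact_continuous_image continuous_on_subset[OF continuous_on_torus_proj]) auto
  then show ?thesis by (simp add: torus_proj_cube)
qed

text \<open>Images of a countable base under the open quotient map form a base. The instance makes
  the Borel sets of products coincide with the product sigma-algebra (\<open>borel_prod\<close>), so
  that jointly continuous functions are measurable in the sense of the definitions.\<close>

instance torus :: (finite) second_countable_topology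
proof
  obtain B :: "(real^'a) set set" where B: "countable B" "topological_basis B"
    using ex_countable_basis by blast
  have "topological_basis ((`) torus_proj ` B)"
  proof (rule topological_basisI)
    fix U assume "U \<in> (`) torus_proj ` B"
    then show "open U" using B(2) by (auto intro: open_torus_proj_image topological_basis_open)
  next
    fix U :: "'a torus set" and x assume U: "open U" "x \<in> U"
    then have "open (torus_proj -` U)" "torus_rep x \<in> torus_proj -` U" by (auto simp: open_torus_iff)
    then obtain W where "W \<in> B" "torus_rep x \<in> W" "W \<subseteq> torus_proj -` U"
      using topological_basisE[OF B(2)] by metis
    then show "\<exists>B'\<in>(`) torus_proj ` B. x \<in> B' \<and> B' \<subseteq> U"
      by (intro bexI[of _ "torus_proj ` W"]) (force simp: image_iff)+
  qed
  moreover have "countable ((`) torus_proj ` B)" using B(1) by simp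
  ultimately show "\<exists>B::'a torus set set. countable B \<and> open = generate_topology B"
    using topological_basis_imp_subbasis by blast
qed

text \<open>The torus carries only the quotient topology here, no metric. The distance to the
  periodic lift of \<open>C\<close> is invariant under the lattice and descends to the torus; the
  resulting function takes the place of a distance when indicators of open sets are approximated by
  continuous functions.\<close>

lemma closed_torus_zero_set:
  fixes C :: "'n::finite torus set"
  assumes "closed C" "C \<noteq> {}"
  obtains d :: "'n torus \<Rightarrow> real" where "continuous_on UNIV d" "\<And>x. 0 \<le> d x" "\<And>x. d x = 0 \<longleftrightarrow> x \<in> C"
proof -
  let ?C = "torus_proj -` C"
  define d where "d x = infdist (torus_rep x) ?C" for x
  have lift: "d (torus_proj y) = infdist y ?C" for y
  proof -
    let ?k = "torus_rep (torus_proj y) - y"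
    have k: "?k \<in> int_vec" by (metis torus_proj_eq_int_vec torus_proj_rep)
    have tr: "torus_proj (?k + x) = torus_proj x" for x
      using torus_proj_add_int_vec[OF k, of x] by (simp only: add.commute)
    \<comment> \<open>The lift is invariant under the integer vector \<open>?k\<close>, so moving
      the point and the set together leaves the distance unchanged.\<close>
    have "?C = (\<lambda>x. ?k + x) ` ?C"
    proof (intro set_eqI iffI)
      fix x assume "x \<in> ?C"
      then show "x \<in> (\<lambda>x. ?k + x) ` ?C"
        using tr[of "x - ?k"] by (intro image_eqI[of _ _ "x - ?k"]) (auto simp: algebra_simps)
    next
      fix x assume "x \<in> (\<lambda>x. ?k + x) ` ?C"
      then show "x \<in> ?C" using tr by (auto simp del: diff_add_cancel)
    qed
    then have "infdist (torus_rep (torus_proj y)) ?C = infdist (?k + y) ((\<lambda>x. ?k + x) ` ?C)" by simp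
    also have "\<dots> = infdist y ?C"
      unfolding infdist_def by (simp add: image_image dist_norm del: diff_add_cancel)
    finally show ?thesis by (simp add: d_def)
  qed
  have 1: "continuous_on UNIV d"
    unfolding continuous_on_torus_lift lift by (intro continuous_intros)
  have 2: "0 \<le> d x" for x by (simp add: d_def infdist_nonneg)
  have "closed ?C" using assms(1)
    by (metis closed_def open_torus_iff vimage_Compl)
  moreover have "?C \<noteq> {}" using assms(2) surj_torus_proj by (metis (no_types) surj_image_vimage_eq image_empty)
  ultimately have 3: "d x = 0 \<longleftrightarrow> x \<in> C" for x
    using in_closed_iff_infdist_zero[of ?C "torus_rep x"] by (simp add: d_def)
  show thesis by (rule that[OF 1 2 3])
qed

section \<open>Lebesgue measure on the torus\<close>

interpretation Leb: prob_space "Leb :: 'n::finite torus measure"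
  by (rule prob_space_Leb)

lemma sets_Leb [simp, measurable_cong]: "sets Leb = sets borel"
  by (simp add: Leb_def)

lemma space_Leb [simp]: "space Leb = UNIV"
  by (simp add: Leb_def)

text \<open>Half open, so that every point has exactly one lattice translate in the cell. The closed
  cube in \<open>Leb\<close> differs from it by a null set.\<close>

definition unit_cell :: "(real^'n::finite) set" where
  "unit_cell = {x. \<forall>i. 0 \<le> x $ i \<and> x $ i < 1}"

lemma unit_cell_measurable [measurable]: "unit_cell \<in> sets borel"
proof -
  have "unit_cell = (\<Inter>i. {x. 0 \<le> x $ i} \<inter> {x. x $ i < (1::real)})"
    by (auto simp: unit_cell_def)
  also have "\<dots> \<in> sets borel" by measurable
  finally show ?thesis .
qed

lemma ex1_int_vec_unit_cell: "\<exists>!k. k \<in> int_vec \<and> x - k \<in> unit_cell"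
proof (rule ex1I)
  let ?k = "\<chi> i. of_int \<lfloor>x $ i\<rfloor>"
  have "x - ?k \<in> unit_cell" unfolding unit_cell_def
    by (auto simp: diff_less_eq) linarith+
  then show "?k \<in> int_vec \<and> x - ?k \<in> unit_cell"
    by (auto simp: int_vec_def)
  fix k assume k: "k \<in> int_vec \<and> x - k \<in> unit_cell"
  have "k $ i = of_int \<lfloor>x $ i\<rfloor>" for i
  proof -
    obtain z where z: "k $ i = of_int z" using k by (auto simp: int_vec_def elim!: Ints_cases)
    have "0 \<le> x $ i - k $ i" "x $ i - k $ i < 1" using k by (auto simp: unit_cell_def)
    then have "\<lfloor>x $ i\<rfloor> = z" unfolding z by linarith
    then show ?thesis by (simp add: z)
  qed
  then show "k = ?k" by (simp add: vec_eq_iff)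
qed

lemma emeasure_Leb_unit_cell:
  fixes A :: "'n::finite torus set"
  assumes [measurable]: "A \<in> sets borel"
  shows "emeasure Leb A = emeasure lborel (unit_cell \<inter> torus_proj -` A)"
proof -
  have m: "torus_proj -` A \<in> sets borel"
    using measurable_sets[OF torus_proj_measurable assms] by simp
  have "emeasure Leb A = emeasure lborel (cbox 0 1 \<inter> torus_proj -` A)"
    using m unfolding Leb_def
    by (subst emeasure_distr)
       (auto simp: measurable_restrict_space1 space_restrict_space emeasure_restrict_space Int_commute)
  also have "\<dots> = emeasure lborel (unit_cell \<inter> torus_proj -` A)"
  proof (rule emeasure_eq_AE)
    have "(box 0 1 :: (real^'n) set) \<subseteq> unit_cell \<and> unit_cell \<subseteq> cbox 0 (1::real^'n)"
      by (auto simp: unit_cell_def mem_box_cart less_imp_le)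
    then have "(x \<in> cbox 0 1 \<inter> torus_proj -` A) = (x \<in> unit_cell \<inter> torus_proj -` A)"
      if "x \<notin> cbox 0 (1::real^'n) - box 0 1" for x
      using that by auto
    moreover have "AE x in lborel. x \<notin> cbox 0 (1::real^'n) - box 0 1"
      by (intro AE_not_in null_setsI) (auto simp: emeasure_lborel_cbox_eq emeasure_lborel_box_eq emeasure_Diff box_subset_cbox)
    ultimately show "AE x in lborel. (x \<in> cbox 0 1 \<inter> torus_proj -` A) = (x \<in> unit_cell \<inter> torus_proj -` A)"
      by (auto elim: AE_mp)
  qed (use m in auto)
  finally show ?thesis .
qed

text \<open>Two fundamental domains of the lattice see the same mass of a periodic set: both sides
  are split into the pieces of one domain inside the translates of the other, and translation by
  \<open>k\<close> matches the pieces, with \<open>k\<close> turned into \<open>- k\<close>.\<close>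

lemma emeasure_periodic_unit_cell:
  fixes B :: "(real^'n::finite) set"
  assumes [measurable]: "B \<in> sets borel" and per: "\<And>x k. k \<in> int_vec \<Longrightarrow> x + k \<in> B \<longleftrightarrow> x \<in> B"
    and [measurable]: "Q \<in> sets borel" and Q: "\<And>x. \<exists>!k. k \<in> int_vec \<and> x - k \<in> Q"
  shows "emeasure lborel (Q \<inter> B) = emeasure lborel (unit_cell \<inter> B)"
proof -
  have split: "emeasure lborel A = (\<integral>\<^sup>+k. emeasure lborel {x. x \<in> A \<and> x - k \<in> P} \<partial>count_space int_vec)"
    if [measurable]: "A \<in> sets borel" "P \<in> sets borel" and P: "\<And>x. \<exists>!k. k \<in> int_vec \<and> x - k \<in> P"
    for A P :: "(real^'n) set"
  proof -
    have "A = (\<Union>k\<in>int_vec. {x. x \<in> A \<and> x - k \<in> P})" using P by blast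
    then have "emeasure lborel A = emeasure lborel (\<Union>k\<in>int_vec. {x. x \<in> A \<and> x - k \<in> P})" by simp
    also have "\<dots> = (\<integral>\<^sup>+k. emeasure lborel {x. x \<in> A \<and> x - k \<in> P} \<partial>count_space int_vec)"
    proof (rule emeasure_UN_countable)
      show "{x. x \<in> A \<and> x - k \<in> P} \<in> sets lborel" for k by measurable
      show "disjoint_family_on (\<lambda>k. {x. x \<in> A \<and> x - k \<in> P}) int_vec"
        using P unfolding disjoint_family_on_def by fastforce
    qed (auto intro: countable_int_vec)
    finally show ?thesis .
  qed
  have "emeasure lborel (Q \<inter> B) = (\<integral>\<^sup>+k. emeasure lborel {x. x \<in> Q \<inter> B \<and> x - k \<in> unit_cell} \<partial>count_space int_vec)"
    by (intro split ex1_int_vec_unit_cell) measurable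
  also have "\<dots> = (\<integral>\<^sup>+k. emeasure lborel {x. x \<in> unit_cell \<inter> B \<and> x + k \<in> Q} \<partial>count_space int_vec)"
  proof (rule nn_integral_cong)
    fix k :: "real^'n" assume "k \<in> space (count_space int_vec)"
    then have k: "k \<in> int_vec" by simp
    have "emeasure lborel {x. x \<in> Q \<inter> B \<and> x - k \<in> unit_cell}
        = emeasure (distr lborel borel (\<lambda>x. k + x)) {x. x \<in> Q \<inter> B \<and> x - k \<in> unit_cell}"
      by (simp add: lborel_distr_plus)
    also have "\<dots> = emeasure lborel {x. k + x \<in> Q \<inter> B \<and> (k + x) - k \<in> unit_cell}"
      by (subst emeasure_distr) (auto simp: vimage_def)
    also have "{x. k + x \<in> Q \<inter> B \<and> (k + x) - k \<in> unit_cell} = {x. x \<in> unit_cell \<inter> B \<and> x + k \<in> Q}"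
      using per[OF k] by (auto simp: add.commute)
    finally show "emeasure lborel {x. x \<in> Q \<inter> B \<and> x - k \<in> unit_cell}
        = emeasure lborel {x. x \<in> unit_cell \<inter> B \<and> x + k \<in> Q}" .
  qed
  also have "\<dots> = (\<integral>\<^sup>+k. emeasure lborel {x. x \<in> unit_cell \<inter> B \<and> x - k \<in> Q} \<partial>count_space int_vec)"
  proof -
    have "bij_betw uminus int_vec (int_vec :: (real^'n) set)"
      by (rule bij_betwI[where g=uminus]) auto
    from nn_integral_bij_count_space[OF this, of "\<lambda>k. emeasure lborel {x. x \<in> unit_cell \<inter> B \<and> x - k \<in> Q}"]
    show ?thesis by simp
  qed
  also have "\<dots> = emeasure lborel (unit_cell \<inter> B)"
    by (intro split[symmetric] Q) measurable
  finally show ?thesis .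
qed

section \<open>Translations of the torus and invariance of \<open>Leb\<close>\<close>

definition torus_shift :: "real^'n \<Rightarrow> 'n::finite torus \<Rightarrow> 'n torus" where
  "torus_shift v x = torus_proj (torus_rep x + v)"

lemma torus_shift_proj [simp]: "torus_shift v (torus_proj x) = torus_proj (x + v)"
proof -
  have "torus_rep (torus_proj x) - x \<in> int_vec"
    by (metis torus_proj_eq_int_vec torus_proj_rep)
  then show ?thesis unfolding torus_shift_def torus_proj_eq_int_vec by simp
qed

lemma continuous_on_torus_shift: "continuous_on UNIV (torus_shift v)"
  unfolding continuous_on_torus_lift torus_shift_proj
  by (intro continuous_intros continuous_on_compose2[OF continuous_on_torus_proj]) auto

lemma torus_shift_measurable [measurable]: "torus_shift v \<in> borel \<rightarrow>\<^sub>M borel"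
  by (rule borel_measurable_continuous_onI[OF continuous_on_torus_shift])

text \<open>A translated cell is again a fundamental domain, so translation invariance reduces to
  independence of the chosen cell. It is used to centre the heat kernel at the origin and to
  integrate by parts.\<close>

lemma Leb_shift: "distr Leb borel (torus_shift v) = (Leb :: 'n::finite torus measure)"
proof (rule measure_eqI)
  fix A :: "'n torus set" assume "A \<in> sets (distr Leb borel (torus_shift v))"
  then have [measurable]: "A \<in> sets borel" by simp
  have m[measurable]: "torus_proj -` A \<in> sets borel"
    using measurable_sets[OF torus_proj_measurable \<open>A \<in> sets borel\<close>] by simp
  let ?Q = "{x. x - v \<in> (unit_cell :: (real^'n) set)}"
  have "emeasure (distr Leb borel (torus_shift v)) A = emeasure Leb (torus_shift v -` A)"
    by (subst emeasure_distr) auto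
  also have "\<dots> = emeasure lborel (unit_cell \<inter> torus_proj -` (torus_shift v -` A))"
    by (rule emeasure_Leb_unit_cell) (use measurable_sets[OF torus_shift_measurable \<open>A \<in> sets borel\<close>] in simp)
  also have "\<dots> = emeasure lborel {x. v + x \<in> ?Q \<inter> torus_proj -` A}"
    by (rule arg_cong[where f="emeasure lborel"]) (auto simp: add.commute)
  also have "\<dots> = emeasure (distr lborel borel (\<lambda>x. v + x)) (?Q \<inter> torus_proj -` A)"
    by (subst emeasure_distr) (auto simp: vimage_def)
  also have "\<dots> = emeasure lborel (?Q \<inter> torus_proj -` A)"
    by (simp add: lborel_distr_plus)
  also have "\<dots> = emeasure lborel (unit_cell \<inter> torus_proj -` A)"
  proof (rule emeasure_periodic_unit_cell)
    show "\<exists>!k. k \<in> int_vec \<and> x - k \<in> ?Q" for x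
      using ex1_int_vec_unit_cell[of "x - v"] by (simp add: algebra_simps)
    show "?Q \<in> sets borel" by measurable
  qed auto
  also have "\<dots> = emeasure Leb A" by (rule emeasure_Leb_unit_cell[symmetric]) simp
  finally show "emeasure (distr Leb borel (torus_shift v)) A = emeasure Leb A" .
qed simp

lemma integral_Leb_shift:
  fixes f :: "'n::finite torus \<Rightarrow> 'b::{banach, second_countable_topology}"
  assumes "f \<in> borel_measurable borel"
  shows "(LINT x|Leb. f (torus_shift v x)) = (LINT x|Leb. f x)"
  by (subst (2) Leb_shift[of v, symmetric], subst integral_distr) (use assms in auto)

section \<open>The periodic heat kernel in one dimension\<close>

text \<open>The Gaussian of variance 2 s, the fundamental solution of the heat equation with
  generator the full second derivative. \<open>gauss1\<close> and \<open>gauss2\<close> are its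
  first two space derivatives, and \<open>gauss2\<close> is also its time derivative.\<close>

definition gauss0 :: "real \<Rightarrow> real \<Rightarrow> real" where
  "gauss0 s z = exp (- z\<^sup>2 / (4 * s)) / sqrt (4 * pi * s)"

definition gauss1 :: "real \<Rightarrow> real \<Rightarrow> real" where
  "gauss1 s z = - (z / (2 * s)) * gauss0 s z"

definition gauss2 :: "real \<Rightarrow> real \<Rightarrow> real" where
  "gauss2 s z = (z\<^sup>2 / (4 * s\<^sup>2) - 1 / (2 * s)) * gauss0 s z"

lemma gauss0_pos: "s > 0 \<Longrightarrow> 0 < gauss0 s z"
  by (simp add: gauss0_def)

lemma gauss0_normal_density: "s > 0 \<Longrightarrow> gauss0 s z = normal_density 0 (sqrt (2 * s)) z"
  by (simp add: gauss0_def normal_density_def mult.assoc)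

lemma gauss0_deriv: "s > 0 \<Longrightarrow> (gauss0 s has_real_derivative gauss1 s z) (at z)"
  unfolding gauss0_def gauss1_def
  by (auto intro!: derivative_eq_intros simp: field_simps)

lemma gauss1_deriv: "s > 0 \<Longrightarrow> (gauss1 s has_real_derivative gauss2 s z) (at z)"
  unfolding gauss1_def gauss2_def
  by (auto intro!: derivative_eq_intros gauss0_deriv simp: gauss1_def field_simps power2_eq_square)

lemma gauss0_deriv_time:
  assumes "s > 0" shows "((\<lambda>s. gauss0 s z) has_real_derivative gauss2 s z) (at s)"
proof -
  have 1: "((\<lambda>s. exp (- z\<^sup>2 / (4 * s))) has_real_derivative exp (- z\<^sup>2 / (4 * s)) * (z\<^sup>2 / (4 * s\<^sup>2))) (at s)"
    using assms by (auto intro!: derivative_eq_intros simp: field_simps power2_eq_square)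
  have 2: "((\<lambda>s. sqrt (4 * pi * s)) has_real_derivative sqrt (4 * pi * s) / (2 * s)) (at s)"
  proof -
    have "sqrt (4 * pi * s) / (2 * s) = inverse (sqrt (4 * pi * s)) / 2 * (4 * pi)"
      using assms real_sqrt_mult_self[of "4 * pi * s"] by (simp add: field_simps)
    moreover have "((\<lambda>s. sqrt (4 * pi * s)) has_real_derivative inverse (sqrt (4 * pi * s)) / 2 * (4 * pi)) (at s)"
      using assms by (intro DERIV_chain2[OF DERIV_real_sqrt]) (auto intro!: derivative_eq_intros)
    ultimately show ?thesis by simp
  qed
  have alg: "(E * A * S - E * (S / B)) / (S * S) = (A - 1 / B) * (E / S)" if "S \<noteq> 0" "B \<noteq> 0" for A B E S :: real
    using that by (simp add: field_simps)
  show ?thesis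
    unfolding gauss0_def gauss2_def using assms
    by (intro DERIV_cong[OF DERIV_divide[OF 1 2]] alg) auto
qed

section \<open>Continuity and decay of the Gaussian and its derivatives\<close>

lemma gauss_continuous:
  "continuous_on ({0<..} \<times> UNIV) (\<lambda>(s, z). gauss0 s z)"
  "continuous_on ({0<..} \<times> UNIV) (\<lambda>(s, z). gauss1 s z)"
  "continuous_on ({0<..} \<times> UNIV) (\<lambda>(s, z). gauss2 s z)"
  unfolding gauss0_def gauss1_def gauss2_def case_prod_beta
  by (auto intro!: continuous_intros)

text \<open>The class of functions that may be periodised: quadratic decay, uniform for times in a
  compact part of (0, \<infinity>), makes the sum over all integer shifts converge locally uniformly
  in time and space.\<close>

definition decaying :: "(real \<Rightarrow> real \<Rightarrow> real) \<Rightarrow> bool" where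
  "decaying f \<longleftrightarrow> continuous_on ({0<..} \<times> UNIV) (\<lambda>(s, z). f s z) \<and>
    (\<forall>\<delta>>0. \<forall>M. \<exists>C. \<forall>s\<in>{\<delta>..M}. \<forall>z. \<bar>f s z\<bar> \<le> C / (1 + z\<^sup>2))"

text \<open>Decay of order four, so that a prefactor of degree two still leaves quadratic decay. The
  source is 1 + w/2 \<le> exp (w/2) with w = z^2 / (4 s), squared.\<close>

lemma gauss0_bound:
  assumes "0 < \<delta>" "\<delta> \<le> s" "s \<le> M"
  shows "gauss0 s z \<le> ((1 + 8 * M)\<^sup>2 / sqrt (4 * pi * \<delta>)) / (1 + z\<^sup>2)\<^sup>2"
proof -
  define w where "w = z\<^sup>2 / (4 * s)"
  have M: "M > 0" using assms by linarith
  have w: "w \<ge> 0" "z\<^sup>2 = 4 * s * w" using assms by (auto simp: w_def)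
  have "1 + z\<^sup>2 \<le> (1 + 8 * M) * (1 + w / 2)"
  proof -
    have "4 * s * w \<le> 4 * M * w" using assms w by (intro mult_right_mono) auto
    then show ?thesis using M w by (simp add: algebra_simps)
  qed
  then have "(1 + z\<^sup>2)\<^sup>2 \<le> ((1 + 8 * M) * (1 + w / 2))\<^sup>2"
    by (intro power_mono) auto
  also have "\<dots> \<le> (1 + 8 * M)\<^sup>2 * (exp (w / 2))\<^sup>2"
    unfolding power_mult_distrib using exp_ge_add_one_self[of "w / 2"] w
    by (intro mult_left_mono power_mono) auto
  also have "(exp (w / 2))\<^sup>2 = exp w" by (simp add: power2_eq_square flip: exp_add)
  finally have *: "(1 + z\<^sup>2)\<^sup>2 \<le> (1 + 8 * M)\<^sup>2 * exp w" .
  have "0 < 1 + z\<^sup>2" by (simp add: add_pos_nonneg)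
  then have "0 < (1 + z\<^sup>2)\<^sup>2" by simp
  moreover have "(1 + z\<^sup>2)\<^sup>2 * exp (- w) \<le> (1 + 8 * M)\<^sup>2 * exp w * exp (- w)"
    using * by (intro mult_right_mono) auto
  ultimately have "exp (- w) \<le> (1 + 8 * M)\<^sup>2 / (1 + z\<^sup>2)\<^sup>2"
    by (simp only: mult.assoc pos_le_divide_eq mult.commute[of "exp (- w)"]) (simp flip: exp_add)
  moreover have "sqrt (4 * pi * \<delta>) \<le> sqrt (4 * pi * s)" "0 < sqrt (4 * pi * \<delta>)" using assms by auto
  ultimately have "exp (- w) / sqrt (4 * pi * s) \<le> ((1 + 8 * M)\<^sup>2 / (1 + z\<^sup>2)\<^sup>2) / sqrt (4 * pi * \<delta>)"
    by (intro frac_le) auto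
  then show ?thesis by (simp add: gauss0_def w_def mult.commute)
qed

lemma decaying_gauss: "decaying gauss0" "decaying gauss1" "decaying gauss2"
proof -
  \<comment> \<open>A prefactor growing at most like 1 + z^2 uses up one of the two powers of 1 +
    z^2 in the Gaussian bound; the other one is the decay claimed.\<close>
  have *: "decaying (\<lambda>s z. p s z * gauss0 s z)"
    if cont: "continuous_on ({0<..} \<times> UNIV) (\<lambda>(s, z). p s z * gauss0 s z)"
      and p: "\<And>\<delta> s z. 0 < \<delta> \<Longrightarrow> \<delta> \<le> s \<Longrightarrow> \<bar>p s z\<bar> \<le> A \<delta> * (1 + z\<^sup>2)" for p :: "real \<Rightarrow> real \<Rightarrow> real" and A
    unfolding decaying_def
  proof (intro conjI allI impI)
    fix \<delta> M :: real assume "\<delta> > 0"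
    have "\<bar>p s z * gauss0 s z\<bar> \<le> (A \<delta> * ((1 + 8 * M)\<^sup>2 / sqrt (4 * pi * \<delta>))) / (1 + z\<^sup>2)" if "s \<in> {\<delta>..M}" for s z
    proof -
      have s: "\<delta> \<le> s" "s \<le> M" "s > 0" using that \<open>\<delta> > 0\<close> by auto
      have "\<bar>p s z * gauss0 s z\<bar> \<le> (A \<delta> * (1 + z\<^sup>2)) * (((1 + 8 * M)\<^sup>2 / sqrt (4 * pi * \<delta>)) / (1 + z\<^sup>2)\<^sup>2)"
        unfolding abs_mult using gauss0_pos[OF s(3), of z] gauss0_bound[OF \<open>\<delta> > 0\<close> s(1,2), of z] p[OF \<open>\<delta> > 0\<close> s(1), of z]
        by (intro mult_mono) auto
      also have "\<dots> = (A \<delta> * ((1 + 8 * M)\<^sup>2 / sqrt (4 * pi * \<delta>))) / (1 + z\<^sup>2)"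
      proof -
        have "1 + z\<^sup>2 > 0" by (simp add: add_pos_nonneg)
        then show ?thesis by (simp add: power2_eq_square[of "1 + z\<^sup>2"])
      qed
      finally show ?thesis .
    qed
    then show "\<exists>C. \<forall>s\<in>{\<delta>..M}. \<forall>z. \<bar>p s z * gauss0 s z\<bar> \<le> C / (1 + z\<^sup>2)" by blast
  qed (rule cont)
  show "decaying gauss0"
    using *[of "\<lambda>s z. 1" "\<lambda>_. 1"] gauss_continuous(1) by simp
  have "\<bar>- (z / (2 * s))\<bar> \<le> (1 / (2 * \<delta>)) * (1 + z\<^sup>2)" if "0 < \<delta>" "\<delta> \<le> s" for \<delta> s z :: real
  proof -
    have "\<bar>z\<bar> \<le> 1 + z\<^sup>2" using zero_le_power2[of "\<bar>z\<bar> - 1"] zero_le_power2[of z]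
      by (simp add: power2_eq_square algebra_simps)
    then have "\<bar>z\<bar> / (2 * s) \<le> (1 + z\<^sup>2) / (2 * \<delta>)" using that by (intro frac_le) auto
    then show ?thesis using that by (simp add: abs_divide)
  qed
  then show "decaying gauss1"
    using *[of "\<lambda>s z. - (z / (2 * s))" "\<lambda>\<delta>. 1 / (2 * \<delta>)"] gauss_continuous(2) by (simp add: gauss1_def[abs_def])
  have "\<bar>z\<^sup>2 / (4 * s\<^sup>2) - 1 / (2 * s)\<bar> \<le> (1 / (4 * \<delta>\<^sup>2) + 1 / (2 * \<delta>)) * (1 + z\<^sup>2)" if "0 < \<delta>" "\<delta> \<le> s" for \<delta> s z :: real
  proof -
    have "z\<^sup>2 / (4 * s\<^sup>2) \<le> (1 + z\<^sup>2) / (4 * \<delta>\<^sup>2)" using that by (intro frac_le mult_left_mono power_mono) auto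
    moreover have "1 / (2 * s) \<le> (1 + z\<^sup>2) / (2 * \<delta>)" using that by (intro frac_le) auto
    moreover have "0 \<le> z\<^sup>2 / (4 * s\<^sup>2)" "0 \<le> 1 / (2 * s)" using that by auto
    ultimately have "\<bar>z\<^sup>2 / (4 * s\<^sup>2) - 1 / (2 * s)\<bar> \<le> (1 + z\<^sup>2) / (4 * \<delta>\<^sup>2) + (1 + z\<^sup>2) / (2 * \<delta>)" by linarith
    then show ?thesis by (simp add: algebra_simps)
  qed
  then show "decaying gauss2"
    using *[of "\<lambda>s z. z\<^sup>2 / (4 * s\<^sup>2) - 1 / (2 * s)" "\<lambda>\<delta>. 1 / (4 * \<delta>\<^sup>2) + 1 / (2 * \<delta>)"] gauss_continuous(3)
    by (simp add: gauss2_def[abs_def])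
qed

text \<open>The sum over all integer shifts as one series over the naturals: the shift by n is
  paired with the shift by -(n + 1), so that each integer occurs exactly once.\<close>

definition periodize :: "(real \<Rightarrow> real \<Rightarrow> real) \<Rightarrow> real \<Rightarrow> real \<Rightarrow> real" where
  "periodize f s x = (\<Sum>n. f s (x + real n) + f s (x - real (Suc n)))"

lemma summable_inverse_Suc_squares: "summable (\<lambda>n. 1 / (1 + (real n)\<^sup>2))"
proof (rule summable_comparison_test_ev)
  show "summable (\<lambda>n. 1 / (real n)\<^sup>2)"
    using inverse_power_summable[of 2, where 'a=real] by (simp add: inverse_eq_divide)
  show "\<forall>\<^sub>F n in sequentially. norm (1 / (1 + (real n)\<^sup>2)) \<le> 1 / (real n)\<^sup>2"
    using eventually_gt_at_top[of 0]
  proof eventually_elim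
    case (elim n)
    then show ?case by (auto intro!: divide_left_mono mult_pos_pos add_pos_nonneg)
  qed
qed

text \<open>For \<bar>x\<bar> \<le> R the shifted argument has modulus at least n - R, so quadratic
  decay in the argument becomes a bound in n that is summable and uniform in s and x. This is the
  majorant for the Weierstrass test.\<close>

lemma periodize_terms_bound:
  assumes "decaying f" "0 < \<delta>"
  obtains C where
    "\<And>s x n. s \<in> {\<delta>..M} \<Longrightarrow> x \<in> {-R..R} \<Longrightarrow> \<bar>f s (x + real n)\<bar> \<le> C * (1 / (1 + (real n)\<^sup>2))"
    "\<And>s x n. s \<in> {\<delta>..M} \<Longrightarrow> x \<in> {-R..R} \<Longrightarrow> \<bar>f s (x - real (Suc n))\<bar> \<le> C * (1 / (1 + (real n)\<^sup>2))"
proof -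
  from assms obtain C where C: "\<And>s z. s \<in> {\<delta>..M} \<Longrightarrow> \<bar>f s z\<bar> \<le> C / (1 + z\<^sup>2)"
    unfolding decaying_def by meson
  have est: "\<bar>f s z\<bar> \<le> (\<bar>C\<bar> * (2 + 2 * R\<^sup>2)) * (1 / (1 + (real n)\<^sup>2))"
    if s: "s \<in> {\<delta>..M}" and z: "real n \<le> \<bar>z\<bar> + R" and R: "0 \<le> R" for s z n
  proof -
    have "(real n)\<^sup>2 \<le> (\<bar>z\<bar> + R)\<^sup>2" using z R by (intro power_mono) auto
    also have "\<dots> \<le> 2 * z\<^sup>2 + 2 * R\<^sup>2"
      using zero_le_power2[of "\<bar>z\<bar> - R"] by (simp add: power2_eq_square algebra_simps)
    finally have "1 + (real n)\<^sup>2 \<le> (2 + 2 * R\<^sup>2) * (1 + z\<^sup>2)"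
      using mult_nonneg_nonneg[OF zero_le_power2[of R] zero_le_power2[of z]] unfolding distrib_left distrib_right by linarith
    then have "1 / (1 + z\<^sup>2) \<le> (2 + 2 * R\<^sup>2) * (1 / (1 + (real n)\<^sup>2))"
      by (simp add: divide_simps add_pos_nonneg)
    then have "\<bar>C\<bar> * (1 / (1 + z\<^sup>2)) \<le> \<bar>C\<bar> * ((2 + 2 * R\<^sup>2) * (1 / (1 + (real n)\<^sup>2)))"
      by (intro mult_left_mono) auto
    moreover have "\<bar>f s z\<bar> \<le> \<bar>C\<bar> * (1 / (1 + z\<^sup>2))"
      using C[OF s, of z] by (intro order_trans[OF C[OF s]]) (auto intro!: divide_right_mono)
    ultimately show ?thesis by (simp add: mult.assoc)
  qed
  show thesis
  proof (rule that)
    fix s x :: real and n :: nat assume "s \<in> {\<delta>..M}" "x \<in> {-R..R}"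
    then show "\<bar>f s (x + real n)\<bar> \<le> (\<bar>C\<bar> * (2 + 2 * R\<^sup>2)) * (1 / (1 + (real n)\<^sup>2))"
      "\<bar>f s (x - real (Suc n))\<bar> \<le> (\<bar>C\<bar> * (2 + 2 * R\<^sup>2)) * (1 / (1 + (real n)\<^sup>2))"
      by (intro est; auto)+
  qed
qed

lemma periodize_uniform_limit:
  assumes "decaying f" "0 < \<delta>"
  shows "uniform_limit ({\<delta>..M} \<times> {-R..R}) (\<lambda>N (s, x). \<Sum>n<N. f s (x + real n) + f s (x - real (Suc n)))
    (\<lambda>(s, x). periodize f s x) sequentially"
proof -
  obtain C where C:
    "\<And>s x n. s \<in> {\<delta>..M} \<Longrightarrow> x \<in> {-R..R} \<Longrightarrow> \<bar>f s (x + real n)\<bar> \<le> C * (1 / (1 + (real n)\<^sup>2))"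
    "\<And>s x n. s \<in> {\<delta>..M} \<Longrightarrow> x \<in> {-R..R} \<Longrightarrow> \<bar>f s (x - real (Suc n))\<bar> \<le> C * (1 / (1 + (real n)\<^sup>2))"
    using periodize_terms_bound[OF assms] by metis
  have "uniform_limit ({\<delta>..M} \<times> {-R..R}) (\<lambda>N p. \<Sum>n<N. f (fst p) (snd p + real n) + f (fst p) (snd p - real (Suc n)))
    (\<lambda>p. \<Sum>n. f (fst p) (snd p + real n) + f (fst p) (snd p - real (Suc n))) sequentially"
  proof (rule Weierstrass_m_test)
    show "norm (f (fst p) (snd p + real n) + f (fst p) (snd p - real (Suc n))) \<le> 2 * C * (1 / (1 + (real n)\<^sup>2))"
      if "p \<in> {\<delta>..M} \<times> {-R..R}" for n p
      using C(1)[of "fst p" "snd p" n] C(2)[of "fst p" "snd p" n] that by auto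
    show "summable (\<lambda>n. 2 * C * (1 / (1 + (real n)\<^sup>2)))"
      by (intro summable_mult summable_inverse_Suc_squares)
  qed
  then show ?thesis by (simp only: periodize_def case_prod_unfold)
qed

lemma periodize_summable:
  assumes "decaying f" "0 < s"
  shows "summable (\<lambda>n. f s (x + real n))" "summable (\<lambda>n. f s (x - real (Suc n)))"
proof -
  obtain C where C:
    "\<And>n. \<bar>f s (x + real n)\<bar> \<le> C * (1 / (1 + (real n)\<^sup>2))"
    "\<And>n. \<bar>f s (x - real (Suc n))\<bar> \<le> C * (1 / (1 + (real n)\<^sup>2))"
    using periodize_terms_bound[OF assms, of s "\<bar>x\<bar>"] by (metis abs_le_iff atLeastAtMost_iff minus_le_iff order_refl)
  have *: "summable (\<lambda>n. C * (1 / (1 + (real n)\<^sup>2)))"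
    by (intro summable_mult summable_inverse_Suc_squares)
  show "summable (\<lambda>n. f s (x + real n))" "summable (\<lambda>n. f s (x - real (Suc n)))"
    using C by (auto intro!: summable_comparison_test[OF _ *])
qed

lemma periodize_continuous:
  assumes f: "decaying f"
  shows "continuous_on ({0<..} \<times> UNIV) (\<lambda>(s, x). periodize f s x)"
proof -
  have cf: "continuous_on ({0<..} \<times> UNIV) (\<lambda>p. f (fst p) (snd p))"
    using f by (simp add: decaying_def case_prod_beta)
  have "isCont (\<lambda>(s, x). periodize f s x) (s, x)" if "s > 0" for s x
  proof -
    let ?A = "{s/2..s+1} \<times> {-(\<bar>x\<bar>+1)..\<bar>x\<bar>+1}"
    have "continuous_on ?A (\<lambda>(s, x). periodize f s x)"
    proof (rule uniform_limit_theorem[OF _ periodize_uniform_limit[OF f]])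
      show "\<forall>\<^sub>F N in sequentially. continuous_on ?A (\<lambda>(s, x). \<Sum>n<N. f s (x + real n) + f s (x - real (Suc n)))"
        unfolding case_prod_beta using that
        by (intro always_eventually allI continuous_intros continuous_on_compose2[OF cf, where f="\<lambda>p. (fst p, g p)" for g, simplified])
           auto
    qed (use that in auto)
    moreover have "(s, x) \<in> interior ?A"
      using that by (auto simp: interior_Times)
    ultimately show ?thesis by (rule continuous_on_interior)
  qed
  then show ?thesis by (intro continuous_at_imp_continuous_on) auto
qed

lemma periodize_deriv:
  assumes f: "decaying f" and f': "decaying f'" and s: "s > 0"
    and deriv: "\<And>z. (f s has_real_derivative f' s z) (at z)"
  shows "(periodize f s has_real_derivative periodize f' s x) (at x)"
proof -
  let ?S = "{-(\<bar>x\<bar>+1)..\<bar>x\<bar>+1}"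
  have "((\<lambda>x. \<Sum>n. f s (x + real n) + f s (x - real (Suc n))) has_field_derivative
      (\<Sum>n. f' s (x + real n) + f' s (x - real (Suc n)))) (at x)"
  proof (rule has_field_derivative_series'(2)[where S="?S" and x0=x])
    show "((\<lambda>x. f s (x + real n) + f s (x - real (Suc n))) has_real_derivative
        f' s (y + real n) + f' s (y - real (Suc n))) (at y within ?S)" for n y
    proof -
      have sh: "((\<lambda>x. f s (x + c)) has_real_derivative f' s (y + c)) (at y within ?S)" for c
        using deriv[of "y + c"] unfolding DERIV_shift by (rule has_field_derivative_at_within)
      show ?thesis
        using DERIV_add[OF sh[of "real n"] sh[of "- real (Suc n)"]] by (simp only: add_uminus_conv_diff)
    qed
    have "uniform_limit ({s..s} \<times> ?S) (\<lambda>N (s, x). \<Sum>n<N. f' s (x + real n) + f' s (x - real (Suc n)))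
        (\<lambda>(s, x). periodize f' s x) sequentially"
      by (rule periodize_uniform_limit[OF f' s])
    then have "uniform_limit ?S (\<lambda>N x. \<Sum>n<N. f' s (x + real n) + f' s (x - real (Suc n)))
        (\<lambda>x. periodize f' s x) sequentially"
      by (simp add: uniform_limit_iff)
    then show "uniformly_convergent_on ?S (\<lambda>N x. \<Sum>n<N. f' s (x + real n) + f' s (x - real (Suc n)))"
      by (auto simp: uniformly_convergent_on_def)
    show "summable (\<lambda>n. f s (x + real n) + f s (x - real (Suc n)))"
      by (intro summable_add periodize_summable[OF f s])
  qed auto
  then show ?thesis by (simp add: periodize_def[abs_def])
qed

lemma periodize_deriv_time:
  assumes f: "decaying f" and f': "decaying f'" and s: "s > 0"
    and deriv: "\<And>s z. s > 0 \<Longrightarrow> ((\<lambda>s. f s z) has_real_derivative f' s z) (at s)"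
  shows "((\<lambda>s. periodize f s x) has_real_derivative periodize f' s x) (at s)"
proof -
  let ?S = "{s/2..s+1}"
  have "((\<lambda>s. \<Sum>n. f s (x + real n) + f s (x - real (Suc n))) has_field_derivative
      (\<Sum>n. f' s (x + real n) + f' s (x - real (Suc n)))) (at s)"
  proof (rule has_field_derivative_series'(2)[where S="?S" and x0=s])
    show "((\<lambda>s. f s (x + real n) + f s (x - real (Suc n))) has_real_derivative
        f' r (x + real n) + f' r (x - real (Suc n))) (at r within ?S)" if "r \<in> ?S" for n r
    proof -
      have "r > 0" using that s by auto
      then show ?thesis
        by (intro DERIV_add has_field_derivative_at_within[OF deriv])
    qed
    have lim: "uniform_limit (?S \<times> {-\<bar>x\<bar>..\<bar>x\<bar>}) (\<lambda>N (s, x). \<Sum>n<N. f' s (x + real n) + f' s (x - real (Suc n)))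
        (\<lambda>(s, x). periodize f' s x) sequentially"
      using s by (intro periodize_uniform_limit[OF f']) auto
    have "uniform_limit ?S (\<lambda>N s. \<Sum>n<N. f' s (x + real n) + f' s (x - real (Suc n)))
        (\<lambda>s. periodize f' s x) sequentially"
    proof (rule uniform_limitI)
      fix e :: real assume "e > 0"
      from uniform_limitD[OF lim this]
      show "\<forall>\<^sub>F N in sequentially. \<forall>s\<in>?S. dist (\<Sum>n<N. f' s (x + real n) + f' s (x - real (Suc n))) (periodize f' s x) < e"
        by (rule eventually_mono) fastforce
    qed
    then show "uniformly_convergent_on ?S (\<lambda>N s. \<Sum>n<N. f' s (x + real n) + f' s (x - real (Suc n)))"
      by (auto simp: uniformly_convergent_on_def)
    show "summable (\<lambda>n. f s (x + real n) + f s (x - real (Suc n)))"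
      by (intro summable_add periodize_summable[OF f s])
  qed (use s in auto)
  then show ?thesis by (simp add: periodize_def)
qed

lemma periodize_split:
  assumes "decaying f" "0 < s"
  shows "periodize f s x = (\<Sum>n. f s (x + real n)) + (\<Sum>n. f s (x - real (Suc n)))"
  unfolding periodize_def by (rule suminf_add[OF periodize_summable[OF assms], symmetric])

text \<open>The shift by one removes the value at x from the upward half series and adds it to the
  downward one, so the two changes cancel.\<close>

lemma periodize_add1:
  assumes f: "decaying f" and s: "0 < s"
  shows "periodize f s (x + 1) = periodize f s x"
proof -
  have "(\<Sum>n. f s (x + real n)) = f s x + (\<Sum>n. f s (x + 1 + real n))"
    using suminf_split_head[OF periodize_summable(1)[OF f s, of x]] by (simp add: algebra_simps)
  moreover have "(\<Sum>n. f s (x + 1 - real (Suc n))) = f s x + (\<Sum>n. f s (x - real (Suc n)))"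
    using suminf_split_head[OF periodize_summable(2)[OF f s, of "x + 1"]] by (simp add: algebra_simps)
  ultimately show ?thesis unfolding periodize_split[OF f s] by simp
qed

lemma periodize_add_int:
  assumes f: "decaying f" and s: "0 < s" and k: "k \<in> \<int>"
  shows "periodize f s (x + k) = periodize f s x"
proof -
  have nat: "periodize f s (x + real n) = periodize f s x" for n x
  proof (induction n)
    case (Suc n)
    then show ?case using periodize_add1[OF f s, of "x + real n"] by (simp add: algebra_simps)
  qed simp
  from k obtain z where z: "k = of_int z" by (rule Ints_cases)
  show ?thesis
  proof (cases "z \<ge> 0")
    case True
    then show ?thesis using nat[of x "nat z"] z by simp
  next
    case False
    then show ?thesis using nat[of "x + k" "nat (- z)"] z by simp
  qed
qed

text \<open>Reflection exchanges the upward and the downward half series up to a shift by one, which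
  periodicity absorbs.\<close>

lemma periodize_even:
  assumes f: "decaying f" and s: "0 < s" and even: "\<And>z. f s (- z) = f s z"
  shows "periodize f s (- x) = periodize f s x"
proof -
  have 1: "f s (- x + real n) = f s ((x + 1) - real (Suc n))" for n
    using even[of "x - real n"] by (simp add: algebra_simps)
  have 2: "f s (- x - real (Suc n)) = f s ((x + 1) + real n)" for n
  proof -
    have "- x - real (Suc n) = - ((x + 1) + real n)" by simp
    then show ?thesis by (simp only: even)
  qed
  have "periodize f s (- x) = periodize f s (x + 1)"
    unfolding periodize_split[OF f s] 1 2 by simp
  then show ?thesis by (simp add: periodize_add1[OF f s])
qed

text \<open>The heat kernel of the circle of length one, followed by its first and second space
  derivatives; \<open>theta2\<close> is at the same time the time derivative of
  \<open>theta0\<close>.\<close>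

definition theta0 where "theta0 = periodize gauss0"
definition theta1 where "theta1 = periodize gauss1"
definition theta2 where "theta2 = periodize gauss2"

lemma theta_continuous:
  "continuous_on ({0<..} \<times> UNIV) (\<lambda>(s, x). theta0 s x)"
  "continuous_on ({0<..} \<times> UNIV) (\<lambda>(s, x). theta1 s x)"
  "continuous_on ({0<..} \<times> UNIV) (\<lambda>(s, x). theta2 s x)"
  unfolding theta0_def theta1_def theta2_def by (intro periodize_continuous decaying_gauss)+

lemma theta_add_int:
  assumes "s > 0" "k \<in> \<int>"
  shows "theta0 s (x + k) = theta0 s x" "theta1 s (x + k) = theta1 s x" "theta2 s (x + k) = theta2 s x"
  unfolding theta0_def theta1_def theta2_def using assms by (simp_all add: periodize_add_int decaying_gauss)

lemma theta0_even: "s > 0 \<Longrightarrow> theta0 s (- x) = theta0 s x"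
  unfolding theta0_def by (rule periodize_even) (auto simp: decaying_gauss gauss0_def)

lemma theta0_pos: "s > 0 \<Longrightarrow> 0 < theta0 s x"
  unfolding theta0_def periodize_def
  by (intro suminf_pos summable_add periodize_summable decaying_gauss add_pos_pos gauss0_pos)

lemma theta0_deriv: "s > 0 \<Longrightarrow> (theta0 s has_real_derivative theta1 s x) (at x)"
  unfolding theta0_def theta1_def by (rule periodize_deriv) (auto simp: decaying_gauss gauss0_deriv)

lemma theta1_deriv: "s > 0 \<Longrightarrow> (theta1 s has_real_derivative theta2 s x) (at x)"
  unfolding theta1_def theta2_def by (rule periodize_deriv) (auto simp: decaying_gauss gauss1_deriv)

lemma theta0_deriv_time: "s > 0 \<Longrightarrow> ((\<lambda>s. theta0 s x) has_real_derivative theta2 s x) (at s)"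
  unfolding theta0_def theta2_def
  by (rule periodize_deriv_time) (auto simp: decaying_gauss gauss0_deriv_time)

lemma theta0_measurable [measurable]: "s > 0 \<Longrightarrow> theta0 s \<in> borel_measurable borel"
  by (intro borel_measurable_continuous_onI continuous_at_imp_continuous_on ballI DERIV_isCont[OF theta0_deriv])

text \<open>Unfolding: a periodised function integrated over one period equals the original
  integrated over the line, provided the weight is periodic. Moments against the circle kernel
  thereby become Gaussian moments.\<close>

lemma nn_integral_theta0_weight:
  assumes s: "s > 0" and [measurable]: "q \<in> borel_measurable borel"
    and q: "\<And>x. 0 \<le> q x" and per: "\<And>x k. k \<in> \<int> \<Longrightarrow> q (x + k) = (q x :: real)"
  shows "(\<integral>\<^sup>+x. ennreal (theta0 s x * q x) * indicator {0..1} x \<partial>lborel) = (\<integral>\<^sup>+z. ennreal (gauss0 s z * q z) \<partial>lborel)"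
proof -
  have [measurable]: "gauss0 s \<in> borel_measurable borel" unfolding gauss0_def[abs_def] by measurable
  note sm = periodize_summable[OF decaying_gauss(1) s]
  have meas: "(\<lambda>z. ennreal (gauss0 s z * q z) * indicator {a..<b} z) \<in> borel_measurable borel" for a b by measurable
  have shift: "(\<integral>\<^sup>+x. ennreal (gauss0 s (x + k) * q x) * indicator {0..<1} x \<partial>lborel)
      = (\<integral>\<^sup>+z. ennreal (gauss0 s z * q z) * indicator {k..<k+1} z \<partial>lborel)" if k: "k \<in> \<int>" for k
  proof -
    have "(\<integral>\<^sup>+z. ennreal (gauss0 s z * q z) * indicator {k..<k+1} z \<partial>lborel)
        = (\<integral>\<^sup>+z. ennreal (gauss0 s z * q z) * indicator {k..<k+1} z \<partial>distr lborel borel ((+) k))"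
      by (simp add: lborel_distr_plus)
    also have "\<dots> = (\<integral>\<^sup>+x. ennreal (gauss0 s (k + x) * q (k + x)) * indicator {k..<k+1} (k + x) \<partial>lborel)"
      by (subst nn_integral_distr) auto
    also have "\<dots> = (\<integral>\<^sup>+x. ennreal (gauss0 s (x + k) * q x) * indicator {0..<1} x \<partial>lborel)"
      using per[OF k] by (intro nn_integral_cong) (auto simp: add.commute indicator_def)
    finally show ?thesis by simp
  qed
  have "(\<integral>\<^sup>+x. ennreal (theta0 s x * q x) * indicator {0..1} x \<partial>lborel)
      = (\<integral>\<^sup>+x. (\<Sum>n. ennreal (gauss0 s (x + real n) * q x) * indicator {0..<1} x + ennreal (gauss0 s (x - real (Suc n)) * q x) * indicator {0..<1} x) \<partial>lborel)"
  proof (rule nn_integral_cong_AE)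
    \<comment> \<open>Discarding the endpoint 1 turns the closed period into the half open one,
      whose translates tile the line.\<close>
    have "AE x in lborel. x \<noteq> (1::real)" by (rule AE_lborel_singleton)
    then show "AE x in lborel. ennreal (theta0 s x * q x) * indicator {0..1} x =
        (\<Sum>n. ennreal (gauss0 s (x + real n) * q x) * indicator {0..<1} x + ennreal (gauss0 s (x - real (Suc n)) * q x) * indicator {0..<1} x)"
    proof eventually_elim
      case (elim x)
      have "ennreal (theta0 s x * q x) = ennreal (\<Sum>n. (gauss0 s (x + real n) + gauss0 s (x - real (Suc n))) * q x)"
        unfolding theta0_def periodize_def using sm by (subst suminf_mult2) (auto intro: summable_add)
      also have "\<dots> = (\<Sum>n. ennreal ((gauss0 s (x + real n) + gauss0 s (x - real (Suc n))) * q x))"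
        using sm gauss0_pos[OF s] q
        by (intro suminf_ennreal2[symmetric] summable_mult2 summable_add mult_nonneg_nonneg) (auto simp: less_imp_le add_nonneg_nonneg)
      also have "\<dots> = (\<Sum>n. ennreal (gauss0 s (x + real n) * q x) + ennreal (gauss0 s (x - real (Suc n)) * q x))"
        using gauss0_pos[OF s] q by (intro suminf_cong) (simp add: distrib_right less_imp_le flip: ennreal_plus)
      finally show ?case using elim by (auto simp: indicator_def)
    qed
  qed
  also have "\<dots> = (\<Sum>n. (\<integral>\<^sup>+x. ennreal (gauss0 s (x + real n) * q x) * indicator {0..<1} x \<partial>lborel)
       + (\<integral>\<^sup>+x. ennreal (gauss0 s (x + - real (Suc n)) * q x) * indicator {0..<1} x \<partial>lborel))"
    by (subst nn_integral_suminf) (auto simp: nn_integral_add algebra_simps)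
  also have "\<dots> = (\<Sum>n. \<integral>\<^sup>+z. ennreal (gauss0 s z * q z) * indicator {real n..<real n + 1} z
       + ennreal (gauss0 s z * q z) * indicator {- real (Suc n)..<- real (Suc n) + 1} z \<partial>lborel)"
    by (subst (1 2) shift) (auto simp: nn_integral_add simp del: of_nat_Suc)
  also have "\<dots> = (\<integral>\<^sup>+z. (\<Sum>n. ennreal (gauss0 s z * q z) * indicator {real n..<real n + 1} z
       + ennreal (gauss0 s z * q z) * indicator {- real (Suc n)..<- real (Suc n) + 1} z) \<partial>lborel)"
    by (subst nn_integral_suminf) auto
  also have "\<dots> = (\<integral>\<^sup>+z. ennreal (gauss0 s z * q z) \<partial>lborel)"
  proof (rule nn_integral_cong)
    fix z :: real
    \<comment> \<open>The index of the unique pair of intervals that contains z: for z \<ge> 0 it is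
      the floor, and for z < 0 the interval from -(n + 1) to -n contains z when n + 1 is minus the
      floor.\<close>
    let ?m = "if z \<ge> 0 then nat \<lfloor>z\<rfloor> else nat (- \<lfloor>z\<rfloor> - 1)"
    have "z \<ge> 0 \<Longrightarrow> (z \<in> {real n..<real n + 1}) = (n = nat \<lfloor>z\<rfloor>)" for n by (auto; linarith)
    moreover have "z < 0 \<Longrightarrow> z \<notin> {real n..<real n + 1}" for n by auto
    moreover have "z < 0 \<Longrightarrow> (z \<in> {- real (Suc n)..<- real (Suc n) + 1}) = (n = nat (- \<lfloor>z\<rfloor> - 1))" for n by (auto; linarith)
    moreover have "z \<ge> 0 \<Longrightarrow> z \<notin> {- real (Suc n)..<- real (Suc n) + 1}" for n by auto
    ultimately have "ennreal (gauss0 s z * q z) * indicator {real n..<real n + 1} z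
       + ennreal (gauss0 s z * q z) * indicator {- real (Suc n)..<- real (Suc n) + 1} z
       = (if n = ?m then ennreal (gauss0 s z * q z) else 0)" for n
      by (cases "z \<ge> 0") (simp_all only: indicator_def, auto)
    then show "(\<Sum>n. ennreal (gauss0 s z * q z) * indicator {real n..<real n + 1} z
       + ennreal (gauss0 s z * q z) * indicator {- real (Suc n)..<- real (Suc n) + 1} z) = ennreal (gauss0 s z * q z)"
      by (subst suminf_finite[of "{?m}"]) auto
  qed
  finally show ?thesis .
qed

lemma nn_integral_theta0: "s > 0 \<Longrightarrow> (\<integral>\<^sup>+x. ennreal (theta0 s x) * indicator {0..1} x \<partial>lborel) = 1"
  using nn_integral_theta0_weight[of s "\<lambda>_. 1"]
  by (simp add: gauss0_normal_density nn_integral_eq_integral normal_density_nonneg)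

text \<open>The squared sine is a periodic substitute for the squared distance to the origin. On the
  line it is at most (pi z)^2, and the Gaussian has variance 2 s.\<close>

lemma nn_integral_theta0_sin:
  assumes s: "s > 0"
  shows "(\<integral>\<^sup>+x. ennreal (theta0 s x * (sin (pi * x))\<^sup>2) * indicator {0..1} x \<partial>lborel) \<le> ennreal (2 * pi\<^sup>2 * s)"
proof -
  have "(\<integral>\<^sup>+x. ennreal (theta0 s x * (sin (pi * x))\<^sup>2) * indicator {0..1} x \<partial>lborel)
      = (\<integral>\<^sup>+z. ennreal (gauss0 s z * (sin (pi * z))\<^sup>2) \<partial>lborel)"
  proof (rule nn_integral_theta0_weight[OF s])
    show "(sin (pi * (x + k)))\<^sup>2 = (sin (pi * x))\<^sup>2" if "k \<in> \<int>" for x k :: real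
    proof -
      have "sin (pi * k) = 0" using that by (auto simp: sin_zero_iff_int2 mult.commute elim!: Ints_cases)
      moreover from this have "(cos (pi * k))\<^sup>2 = 1" using sin_cos_squared_add[of "pi * k"] by simp
      ultimately show ?thesis by (simp add: distrib_left sin_add power_mult_distrib)
    qed
  qed auto
  also have "\<dots> \<le> (\<integral>\<^sup>+z. ennreal (pi\<^sup>2 * (normal_density 0 (sqrt (2 * s)) z * (z - 0) ^ (2 * 1))) \<partial>lborel)"
  proof (intro nn_integral_mono ennreal_leI)
    fix z :: real
    have "(sin (pi * z))\<^sup>2 \<le> (pi * z)\<^sup>2"
      using abs_sin_x_le_abs_x[of "pi * z"] by (simp add: abs_le_square_iff)
    then have "gauss0 s z * (sin (pi * z))\<^sup>2 \<le> gauss0 s z * (pi * z)\<^sup>2"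
      using gauss0_pos[OF s, of z] by (intro mult_left_mono) auto
    then show "gauss0 s z * (sin (pi * z))\<^sup>2 \<le> pi\<^sup>2 * (normal_density 0 (sqrt (2 * s)) z * (z - 0) ^ (2 * 1))"
      unfolding gauss0_normal_density[OF s] power_mult_distrib diff_zero mult_1_right by (simp only: ac_simps)
  qed
  also have "\<dots> = ennreal (pi\<^sup>2 * (\<integral>z. normal_density 0 (sqrt (2 * s)) z * (z - 0) ^ (2 * 1) \<partial>lborel))"
  proof -
    have "integrable lborel (\<lambda>z. normal_density 0 (sqrt (2 * s)) z * (z - 0) ^ (2 * 1))"
      using normal_moment_even[of "sqrt (2 * s)" 0 1] s by (auto intro: integrable.intros)
    then show ?thesis
      by (subst nn_integral_eq_integral) (auto simp: normal_density_nonneg)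
  qed
  also have "\<dots> = ennreal (2 * pi\<^sup>2 * s)"
    using s by (subst integral_normal_moment_even) (auto simp: fact_numeral)
  finally show ?thesis .
qed

section \<open>The heat kernel on the torus\<close>

text \<open>On the torus the heat kernel factorises over the coordinates. \<open>heatDG\<close> is
  its gradient, \<open>heatGs\<close> its time derivative, equal to its Laplacian, and
  \<open>heatG_part\<close> the product with one coordinate left out. All of them are kept as
  periodic functions on the covering space, where calculus is available.\<close>

definition heatG :: "real \<Rightarrow> real^'n::finite \<Rightarrow> real" where
  "heatG s x = (\<Prod>i\<in>UNIV. theta0 s (x $ i))"

definition heatG_part :: "real \<Rightarrow> real^'n::finite \<Rightarrow> 'n \<Rightarrow> real" where
  "heatG_part s x i = (\<Prod>j\<in>UNIV - {i}. theta0 s (x $ j))"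

definition heatDG :: "real \<Rightarrow> real^'n::finite \<Rightarrow> real^'n" where
  "heatDG s x = (\<chi> i. theta1 s (x $ i) * heatG_part s x i)"

definition heatGs :: "real \<Rightarrow> real^'n::finite \<Rightarrow> real" where
  "heatGs s x = (\<Sum>i\<in>UNIV. theta2 s (x $ i) * heatG_part s x i)"

lemma heatG_pos: "s > 0 \<Longrightarrow> 0 < heatG s x"
  unfolding heatG_def by (intro prod_pos theta0_pos)

lemma heatG_even: "s > 0 \<Longrightarrow> heatG s (- x) = heatG s x"
  by (simp add: heatG_def theta0_even)

lemma heat_periodic:
  assumes "s > 0" "k \<in> int_vec"
  shows "heatG s (x + k) = heatG s x" "heatDG s (x + k) = heatDG s x" "heatGs s (x + k) = heatGs s x"
    "heatG_part s (x + k) = heatG_part s x"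
  using assms by (simp_all add: heatG_def heatDG_def heatGs_def heatG_part_def[abs_def] theta_add_int int_vec_def)

text \<open>Partial derivatives, the one in space jointly continuous, give a total derivative. Joint
  differentiability is what permits heat times that depend on the time of the curve.\<close>

lemma theta0_joint_deriv:
  assumes s: "s > 0"
  shows "((\<lambda>(s, x). theta0 s x) has_derivative (\<lambda>(\<sigma>, h). \<sigma> * theta2 s x + theta1 s x * h)) (at (s, x))"
proof -
  have "((\<lambda>(s, x). theta0 s x) has_derivative (\<lambda>(\<sigma>, h). \<sigma> * theta2 s x + blinfun_apply (blinfun_mult_right (theta1 s x)) h))
      (at (s, x) within {0<..} \<times> UNIV)"
  proof (rule has_derivative_partialsI[where fy="\<lambda>s x. blinfun_mult_right (theta1 s x)"])
    show "((\<lambda>s. theta0 s x) has_derivative (\<lambda>\<sigma>. \<sigma> * theta2 s x)) (at s within {0<..})"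
      using has_derivative_at_withinI[OF theta0_deriv_time[OF s, of x, unfolded has_field_derivative_def]]
      by (simp add: mult_commute_abs)
    show "(theta0 s has_derivative blinfun_apply (blinfun_mult_right (theta1 s x))) (at x within UNIV)"
      if "s \<in> {0<..}" for s x
      using theta0_deriv[of s x] that unfolding has_field_derivative_def by simp
    have "continuous_on ({0<..} \<times> UNIV) (\<lambda>p. blinfun_mult_right (case p of (s, x) \<Rightarrow> theta1 s x))"
      by (rule bounded_linear.continuous_on[OF bounded_linear_blinfun_mult_right theta_continuous(2)])
    then show "continuous (at (s, x) within {0<..} \<times> UNIV) (\<lambda>(x, y). blinfun_mult_right (theta1 x y))"
      using s by (auto simp: continuous_on_eq_continuous_within case_prod_unfold)
  qed auto
  moreover have "open ({0::real<..} \<times> (UNIV :: real set))" by (intro open_Times) auto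
  ultimately show ?thesis
    using s by (subst (asm) at_within_open) auto
qed

lemma heatG_deriv:
  fixes x :: "real^'n::finite"
  assumes s: "s > 0"
  shows "((\<lambda>(s, x). heatG s x) has_derivative (\<lambda>(\<sigma>, h). heatGs s x * \<sigma> + heatDG s x \<bullet> h)) (at (s, x))"
proof -
  have comp: "((\<lambda>p. theta0 (fst p) (snd p $ i)) has_derivative
      (\<lambda>q. fst q * theta2 s (x $ i) + theta1 s (x $ i) * (snd q $ i))) (at (s, x))" for i
  proof -
    have "bounded_linear (\<lambda>q :: real \<times> (real^'n). (fst q, snd q $ i))"
      by (intro bounded_linear_Pair bounded_linear_fst bounded_linear_compose[OF bounded_linear_vec_nth bounded_linear_snd, unfolded o_def])
    then have "((\<lambda>p :: real \<times> (real^'n). (fst p, snd p $ i)) has_derivative (\<lambda>q. (fst q, snd q $ i))) (at (s, x))"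
      by (rule bounded_linear_imp_has_derivative)
    from has_derivative_compose[OF this, of "\<lambda>(s, x). theta0 s x", simplified, OF theta0_joint_deriv[OF s]]
    show ?thesis by simp
  qed
  have "((\<lambda>p. \<Prod>i\<in>UNIV. theta0 (fst p) (snd p $ i)) has_derivative
      (\<lambda>q. \<Sum>i\<in>UNIV. (fst q * theta2 s (x $ i) + theta1 s (x $ i) * (snd q $ i)) * (\<Prod>j\<in>UNIV - {i}. theta0 (fst (s, x)) (snd (s, x) $ j)))) (at (s, x))"
    by (rule has_derivative_prod) (rule comp)
  moreover have "(\<Sum>i\<in>UNIV. (fst q * theta2 s (x $ i) + theta1 s (x $ i) * (snd q $ i)) * (\<Prod>j\<in>UNIV - {i}. theta0 (fst (s, x)) (snd (s, x) $ j)))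
      = heatGs s x * fst q + heatDG s x \<bullet> snd q" for q
    by (simp add: heatGs_def heatDG_def heatG_part_def inner_vec_def sum_distrib_left distrib_right sum.distrib algebra_simps)
  ultimately show ?thesis
    by (simp add: heatG_def case_prod_unfold)
qed

text \<open>The right-hand side is the i-th summand of \<open>heatGs\<close>. Hence
  \<open>heatGs\<close>, which arises as the time derivative, is the divergence of
  \<open>heatDG\<close>: this is the heat equation in the form used for integration by
  parts.\<close>

lemma heatDG_deriv:
  fixes x :: "real^'n::finite"
  assumes s: "s > 0"
  shows "((\<lambda>\<tau>. heatDG s (x + \<tau> *\<^sub>R axis i 1) $ i) has_real_derivative theta2 s (x $ i) * heatG_part s x i) (at 0)"
proof -
  have "(x + \<tau> *\<^sub>R axis i 1) $ j = (if j = i then x $ i + \<tau> else x $ j)" for \<tau> j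
    by (simp add: axis_def)
  then have eq: "heatDG s (x + \<tau> *\<^sub>R axis i 1) $ i = theta1 s (x $ i + \<tau>) * heatG_part s x i" for \<tau>
    by (simp add: heatDG_def heatG_part_def)
  have "(theta1 s has_real_derivative theta2 s (x $ i)) (at (x $ i + 0))"
    using theta1_deriv[OF s] by simp
  then have "((\<lambda>\<tau>. theta1 s (x $ i + \<tau>)) has_real_derivative theta2 s (x $ i)) (at 0)"
    using DERIV_shift[of "theta1 s" "theta2 s (x $ i)" 0 "x $ i"] by (simp add: add.commute)
  then show ?thesis unfolding eq by (rule DERIV_cmult_right)
qed

lemma heat_continuous:
  fixes X :: "'a::topological_space \<Rightarrow> real^'n::finite"
  assumes [continuous_intros]: "continuous_on S \<sigma>" "continuous_on S X" and pos: "\<And>\<xi>. \<xi> \<in> S \<Longrightarrow> \<sigma> \<xi> > 0"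
  shows "continuous_on S (\<lambda>\<xi>. heatG (\<sigma> \<xi>) (X \<xi>))" "continuous_on S (\<lambda>\<xi>. heatDG (\<sigma> \<xi>) (X \<xi>))"
    "continuous_on S (\<lambda>\<xi>. heatGs (\<sigma> \<xi>) (X \<xi>))" "continuous_on S (\<lambda>\<xi>. heatG_part (\<sigma> \<xi>) (X \<xi>) i)"
    "continuous_on S (\<lambda>\<xi>. theta2 (\<sigma> \<xi>) (X \<xi> $ i))"
proof -
  have *: "continuous_on S (\<lambda>\<xi>. f (\<sigma> \<xi>) (X \<xi> $ i))"
    if "continuous_on ({0<..} \<times> UNIV) (\<lambda>(s, x). f s x)" for f :: "real \<Rightarrow> real \<Rightarrow> real" and i
    using continuous_on_compose2[OF that, of S "\<lambda>\<xi>. (\<sigma> \<xi>, X \<xi> $ i)"] pos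
      continuous_on_Pair[OF assms(1) continuous_on_component[OF assms(2), of i]]
    by (auto simp: image_subset_iff)
  note [continuous_intros] = *[OF theta_continuous(1)] *[OF theta_continuous(2)] *[OF theta_continuous(3)]
  show "continuous_on S (\<lambda>\<xi>. heatG (\<sigma> \<xi>) (X \<xi>))" "continuous_on S (\<lambda>\<xi>. heatDG (\<sigma> \<xi>) (X \<xi>))"
    "continuous_on S (\<lambda>\<xi>. heatGs (\<sigma> \<xi>) (X \<xi>))" "continuous_on S (\<lambda>\<xi>. heatG_part (\<sigma> \<xi>) (X \<xi>) i)"
    "continuous_on S (\<lambda>\<xi>. theta2 (\<sigma> \<xi>) (X \<xi> $ i))"
    unfolding heatG_def heatDG_def heatGs_def heatG_part_def by (intro continuous_intros)+
qed

text \<open>\<open>hk\<close> is the heat kernel of the equation \<open>\<partial>\<^sub>s u = \<Delta> u\<close>, \<open>hkD\<close> its gradient in the first point and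
  \<open>hkS\<close> its time derivative.\<close>

definition hk :: "real \<Rightarrow> 'n::finite torus \<Rightarrow> 'n torus \<Rightarrow> real" where
  "hk s x y = heatG s (torus_rep x - torus_rep y)"

definition hkD :: "real \<Rightarrow> 'n::finite torus \<Rightarrow> 'n torus \<Rightarrow> real^'n" where
  "hkD s x y = heatDG s (torus_rep x - torus_rep y)"

definition hkS :: "real \<Rightarrow> 'n::finite torus \<Rightarrow> 'n torus \<Rightarrow> real" where
  "hkS s x y = heatGs s (torus_rep x - torus_rep y)"

lemma torus_rep_proj_diff: "torus_rep (torus_proj x) - x \<in> int_vec"
  by (metis torus_proj_eq_int_vec torus_proj_rep)

text \<open>\<open>torus_rep\<close> chooses arbitrary representatives without any continuity;
  expressions in it become regular only because a periodic \<open>F\<close> does not see the choice.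
  The chosen representative is exchanged for any convenient lift.\<close>

lemma periodic_torus_rep_proj:
  assumes per: "\<And>z k. k \<in> int_vec \<Longrightarrow> F (z + k) = F z"
  shows "F (torus_rep (torus_proj a) - c) = F (a - c)" "F (c - torus_rep (torus_proj a)) = F (c - a)"
proof -
  have "torus_rep (torus_proj a) - c = (a - c) + (torus_rep (torus_proj a) - a)"
    and 2: "c - torus_rep (torus_proj a) = (c - a) + - (torus_rep (torus_proj a) - a)" by simp_all
  then show "F (torus_rep (torus_proj a) - c) = F (a - c)"
    using per[OF torus_rep_proj_diff] by metis
  show "F (c - torus_rep (torus_proj a)) = F (c - a)"
    unfolding 2 by (intro per) (simp only: int_vec_uminus torus_rep_proj_diff)
qed

lemma hk_proj:
  assumes "s > 0"
  shows "hk s (torus_proj a) (torus_proj b) = heatG s (a - b)"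
    "hkD s (torus_proj a) (torus_proj b) = heatDG s (a - b)"
    "hkS s (torus_proj a) (torus_proj b) = heatGs s (a - b)"
  unfolding hk_def hkD_def hkS_def using assms
  by (simp_all add: periodic_torus_rep_proj[where F="heatG s"] periodic_torus_rep_proj[where F="heatDG s"]
      periodic_torus_rep_proj[where F="heatGs s"] heat_periodic)

text \<open>The arbitrary representatives are replaced by lifts one variable at a time: each use of
  \<open>continuous_on_param_torus_lift\<close> treats one torus variable while the time and the
  other point are parameters.\<close>

lemma continuous_on_torus_diff:
  fixes F :: "real \<Rightarrow> real^'n::finite \<Rightarrow> 'b::topological_space"
  assumes F: "continuous_on ({0<..} \<times> UNIV) (\<lambda>(s, z). F s z)"
    and per: "\<And>s z k. s > 0 \<Longrightarrow> k \<in> int_vec \<Longrightarrow> F s (z + k) = F s z"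
    and \<sigma>: "continuous_on S \<sigma>" "continuous_on S a" "continuous_on S b" "\<And>\<xi>. \<xi> \<in> S \<Longrightarrow> \<sigma> \<xi> > 0"
  shows "continuous_on S (\<lambda>\<xi>. F (\<sigma> \<xi>) (torus_rep (a \<xi>) - torus_rep (b \<xi>)))"
proof -
  note per' = periodic_torus_rep_proj[where F="F s" for s, OF per]
  have 1: "continuous_on (({0<..} \<times> UNIV) \<times> UNIV) (\<lambda>(sb, x). F (fst sb) (torus_rep x - snd sb))"
  proof (rule continuous_on_param_torus_lift)
    have "continuous_on (({0<..} \<times> UNIV) \<times> UNIV) (\<lambda>p :: (real \<times> (real^'n)) \<times> (real^'n). F (fst (fst p)) (snd p - snd (fst p)))"
      by (rule continuous_on_compose2[OF F, where f="\<lambda>p. (fst (fst p), snd p - snd (fst p))", simplified])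
         (auto intro!: continuous_intros simp: image_subset_iff)
    then show "continuous_on (({0<..} \<times> UNIV) \<times> UNIV) (\<lambda>(sb, y). F (fst sb) (torus_rep (torus_proj y) - snd sb))"
      by (rule continuous_on_eq) (auto simp: per')
  qed
  have 2: "continuous_on (({0<..} \<times> UNIV) \<times> UNIV) (\<lambda>(sx, y). F (fst sx) (torus_rep (snd sx) - torus_rep y))"
  proof (rule continuous_on_param_torus_lift)
    have "continuous_on (({0<..} \<times> UNIV) \<times> UNIV) (\<lambda>p :: (real \<times> 'n torus) \<times> (real^'n). F (fst (fst p)) (torus_rep (snd (fst p)) - snd p))"
      by (rule continuous_on_compose2[OF 1, where f="\<lambda>p. ((fst (fst p), snd p), snd (fst p))", simplified])
         (auto intro!: continuous_intros simp: image_subset_iff)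
    then show "continuous_on (({0<..} \<times> UNIV) \<times> UNIV) (\<lambda>(sx, y). F (fst sx) (torus_rep (snd sx) - torus_rep (torus_proj y)))"
      by (rule continuous_on_eq) (auto simp: per')
  qed
  show ?thesis
    by (rule continuous_on_compose2[OF 2, where f="\<lambda>\<xi>. ((\<sigma> \<xi>, a \<xi>), b \<xi>)", simplified])
       (use \<sigma> in \<open>auto intro!: continuous_intros simp: image_subset_iff\<close>)
qed

lemma continuous_on_hk [continuous_intros]:
  fixes a b :: "'a::topological_space \<Rightarrow> 'n::finite torus"
  assumes "continuous_on S \<sigma>" "continuous_on S a" "continuous_on S b" "\<And>\<xi>. \<xi> \<in> S \<Longrightarrow> \<sigma> \<xi> > 0"
  shows "continuous_on S (\<lambda>\<xi>. hk (\<sigma> \<xi>) (a \<xi>) (b \<xi>))" "continuous_on S (\<lambda>\<xi>. hkD (\<sigma> \<xi>) (a \<xi>) (b \<xi>))"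
    "continuous_on S (\<lambda>\<xi>. hkS (\<sigma> \<xi>) (a \<xi>) (b \<xi>))"
  unfolding hk_def hkD_def hkS_def case_prod_unfold
  by (rule continuous_on_torus_diff; use assms in \<open>auto simp: case_prod_unfold heat_periodic intro!: heat_continuous continuous_intros\<close>)+

lemma hk_pos: "s > 0 \<Longrightarrow> 0 < hk s x y"
  by (simp add: hk_def heatG_pos)

lemma hk_nonneg: "s > 0 \<Longrightarrow> 0 \<le> hk s x y"
  using hk_pos less_imp_le by blast

lemma hk_sym: "s > 0 \<Longrightarrow> hk s x y = hk s y x"
  unfolding hk_def using heatG_even[of s "torus_rep x - torus_rep y"] by simp

section \<open>Integrals against the heat kernel: unit mass and concentration at the
  diagonal\<close>

lemma nn_integral_Leb:
  fixes f :: "'n::finite torus \<Rightarrow> ennreal"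
  assumes [measurable]: "f \<in> borel_measurable borel"
  shows "(\<integral>\<^sup>+x. f x \<partial>Leb) = (\<integral>\<^sup>+x\<in>cbox 0 1. f (torus_proj x) \<partial>lborel)"
  unfolding Leb_def
  by (subst nn_integral_distr) (auto simp: measurable_restrict_space1 nn_integral_restrict_space)

lemma nn_integral_Leb_shift:
  fixes f :: "'n::finite torus \<Rightarrow> ennreal"
  assumes [measurable]: "f \<in> borel_measurable borel"
  shows "(\<integral>\<^sup>+x. f (torus_shift v x) \<partial>Leb) = (\<integral>\<^sup>+x. f x \<partial>Leb)"
  by (subst (2) Leb_shift[of v, symmetric], subst nn_integral_distr) auto

lemma nn_integral_cube_prod:
  fixes g :: "'n::finite \<Rightarrow> real \<Rightarrow> ennreal"
  assumes [measurable]: "\<And>i. g i \<in> borel_measurable borel"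
  shows "(\<integral>\<^sup>+x\<in>cbox 0 1. (\<Prod>i\<in>UNIV. g i (x $ i)) \<partial>lborel) = (\<Prod>i\<in>UNIV. (\<integral>\<^sup>+z\<in>{0..1}. g i z \<partial>lborel))"
proof -
  define f where "f b z = g (axis_index b) z * indicator {0..1} z" for b :: "real^'n" and z
  have bij: "bij_betw (\<lambda>i. axis i 1) UNIV (Basis :: (real^'n) set)"
    by (auto simp: bij_betw_def inj_on_def axis_eq_axis Basis_vec_def)
  have ind: "indicator (cbox 0 1) x = (\<Prod>i\<in>UNIV. indicator {0..1} (x $ i) :: ennreal)" for x :: "real^'n"
  proof (cases "x \<in> cbox 0 1")
    case True
    then show ?thesis by (simp add: mem_box_cart)
  next
    case False
    then obtain i where "x $ i \<notin> {0..1}" by (auto simp: mem_box_cart)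
    then have "(\<Prod>i\<in>UNIV. indicator {0..1} (x $ i) :: ennreal) = 0"
      by (intro prod_zero bexI[of _ i]) (auto simp: indicator_def)
    with False show ?thesis by simp
  qed
  have "(\<integral>\<^sup>+x\<in>cbox 0 1. (\<Prod>i\<in>UNIV. g i (x $ i)) \<partial>lborel) = (\<integral>\<^sup>+x. (\<Prod>b\<in>Basis. f b (x \<bullet> b)) \<partial>lborel)"
    by (intro nn_integral_cong, subst prod.reindex_bij_betw[OF bij, symmetric])
       (simp add: f_def ind inner_axis prod.distrib)
  also have "\<dots> = (\<Prod>b\<in>Basis. (\<integral>\<^sup>+z. f b z \<partial>lborel))"
    by (rule nn_integral_lborel_prod) (auto simp: f_def)
  also have "\<dots> = (\<Prod>i\<in>UNIV. (\<integral>\<^sup>+z\<in>{0..1}. g i z \<partial>lborel))"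
    by (subst prod.reindex_bij_betw[OF bij, symmetric]) (simp add: f_def[abs_def])
  finally show ?thesis .
qed

lemma torus_gap_periodic:
  assumes "k \<in> int_vec" shows "(sin (pi * ((z + k) $ i)))\<^sup>2 = (sin (pi * (z $ i)))\<^sup>2"
proof -
  have "sin (pi * (k $ i)) = 0"
    using assms by (auto simp: int_vec_def sin_zero_iff_int2 mult.commute elim!: allE[of _ i] Ints_cases)
  moreover from this have "(cos (pi * (k $ i)))\<^sup>2 = 1" using sin_cos_squared_add[of "pi * (k $ i)"] by simp
  ultimately show ?thesis by (simp add: distrib_left sin_add power_mult_distrib)
qed

text \<open>A periodic surrogate for the squared distance. It vanishes exactly on the diagonal, and
  being a sum over coordinates it can be averaged against the product kernel one coordinate at a
  time.\<close>

definition torus_gap :: "'n::finite torus \<Rightarrow> 'n torus \<Rightarrow> real" where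
  "torus_gap x y = (\<Sum>i\<in>UNIV. (sin (pi * ((torus_rep x - torus_rep y) $ i)))\<^sup>2)"

lemma torus_gap_eq_0: "torus_gap x y = 0 \<longleftrightarrow> x = y"
proof -
  have z: "sin (pi * r) = 0 \<longleftrightarrow> r \<in> \<int>" for r :: real
    unfolding sin_zero_iff_int2 by (auto simp: Ints_def mult.commute)
  have "torus_gap x y = 0 \<longleftrightarrow> (\<forall>i\<in>UNIV. (sin (pi * ((torus_rep x - torus_rep y) $ i)))\<^sup>2 = 0)"
    unfolding torus_gap_def by (rule sum_nonneg_eq_0_iff) auto
  also have "\<dots> \<longleftrightarrow> torus_proj (torus_rep x) = torus_proj (torus_rep y)"
    unfolding torus_proj_eq_iff power_eq_0_iff z vector_minus_component by simp
  finally show ?thesis by simp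
qed

lemma torus_gap_nonneg: "0 \<le> torus_gap x y"
  unfolding torus_gap_def by (intro sum_nonneg) auto

lemma continuous_on_torus_gap [continuous_intros]:
  assumes "continuous_on S a" "continuous_on S b"
  shows "continuous_on S (\<lambda>\<xi>. torus_gap (a \<xi>) (b \<xi>))"
  unfolding torus_gap_def
proof (rule continuous_on_torus_diff[where \<sigma>="\<lambda>_. 1" and F="\<lambda>_ z. \<Sum>i\<in>UNIV. (sin (pi * (z $ i)))\<^sup>2"])
  show "continuous_on ({0::real<..} \<times> UNIV) (\<lambda>(s, z). \<Sum>i\<in>UNIV. (sin (pi * (z $ i)))\<^sup>2)"
    unfolding case_prod_unfold
    by (intro continuous_on_sum continuous_on_power continuous_on_sin continuous_on_mult_left continuous_on_component continuous_on_snd continuous_on_id)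
  show "(\<Sum>i\<in>UNIV. (sin (pi * ((z + k) $ i)))\<^sup>2) = (\<Sum>i\<in>UNIV. (sin (pi * (z $ i)))\<^sup>2)" if "k \<in> int_vec" for z k :: "real^'b"
    by (intro sum.cong refl torus_gap_periodic that)
qed (use assms in auto)

lemma hk_measurable1 [measurable]: "s > 0 \<Longrightarrow> (\<lambda>x. hk s x y) \<in> borel_measurable borel"
  by (intro borel_measurable_continuous_onI continuous_intros) auto

text \<open>Translation invariance moves y to the origin; there kernel and weight are products over
  the coordinates, and the integral over the unit cube factorises.\<close>

lemma nn_integral_heat_weight:
  fixes y :: "'n::finite torus"
  assumes s: "s > 0" and cont: "\<And>i. continuous_on UNIV (q i)" and q: "\<And>i z. 0 \<le> q i z"
    and per: "\<And>i z k. k \<in> \<int> \<Longrightarrow> q i (z + k) = (q i z :: real)"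
  shows "(\<integral>\<^sup>+x. ennreal (hk s x y * (\<Prod>i\<in>UNIV. q i ((torus_rep x - torus_rep y) $ i))) \<partial>Leb)
    = (\<Prod>i\<in>UNIV. \<integral>\<^sup>+z\<in>{0..1}. ennreal (theta0 s z * q i z) \<partial>lborel)"
proof -
  define F where "F z = heatG s z * (\<Prod>i\<in>UNIV. q i (z $ i))" for z :: "real^'n"
  have perF: "F (z + k) = F z" if "k \<in> int_vec" for z k
    using that per by (simp add: F_def heat_periodic[OF s] int_vec_def)
  define f where "f x = F (torus_rep x - torus_rep y)" for x
  have lift: "f (torus_proj x) = F (x - torus_rep y)" for x
    unfolding f_def by (rule periodic_torus_rep_proj[where F=F, OF perF])
  have "continuous_on UNIV F"
    unfolding F_def using s
    by (intro continuous_intros heat_continuous continuous_on_compose2[OF cont] continuous_on_component) auto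
  then have "continuous_on UNIV f"
    unfolding continuous_on_torus_lift lift by (rule continuous_on_compose2) (auto intro!: continuous_intros)
  then have [measurable]: "f \<in> borel_measurable borel" by (rule borel_measurable_continuous_onI)
  have [measurable]: "q i \<in> borel_measurable borel" for i by (rule borel_measurable_continuous_onI[OF cont])
  have "(\<integral>\<^sup>+x. ennreal (hk s x y * (\<Prod>i\<in>UNIV. q i ((torus_rep x - torus_rep y) $ i))) \<partial>Leb) = (\<integral>\<^sup>+x. ennreal (f x) \<partial>Leb)"
    by (simp add: f_def F_def hk_def)
  also have "\<dots> = (\<integral>\<^sup>+x. ennreal (f (torus_shift (torus_rep y) x)) \<partial>Leb)"
    by (rule nn_integral_Leb_shift[symmetric]) measurable
  also have "\<dots> = (\<integral>\<^sup>+x\<in>cbox 0 1. ennreal (f (torus_shift (torus_rep y) (torus_proj x))) \<partial>lborel)"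
    by (rule nn_integral_Leb) measurable
  also have "\<dots> = (\<integral>\<^sup>+x\<in>cbox 0 1. (\<Prod>i\<in>UNIV. ennreal (theta0 s (x $ i) * q i (x $ i))) \<partial>lborel)"
    using theta0_pos[OF s] q
    by (intro nn_integral_cong) (simp add: lift F_def heatG_def prod_ennreal less_imp_le flip: prod.distrib)
  also have "\<dots> = (\<Prod>i\<in>UNIV. \<integral>\<^sup>+z\<in>{0..1}. ennreal (theta0 s z * q i z) \<partial>lborel)"
    using s by (intro nn_integral_cube_prod) measurable
  finally show ?thesis .
qed

lemma nn_integral_hk: "s > 0 \<Longrightarrow> (\<integral>\<^sup>+x. ennreal (hk s x y) \<partial>Leb) = 1"
  using nn_integral_heat_weight[of s "\<lambda>_ _. 1" y] by (simp add: nn_integral_theta0)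

lemma integrable_hk: "s > 0 \<Longrightarrow> integrable Leb (\<lambda>x. hk s x y)"
  by (rule integrableI_nonneg) (auto simp: nn_integral_hk hk_nonneg)

lemma integral_hk: "s > 0 \<Longrightarrow> (LINT x|Leb. hk s x y) = 1"
  by (subst integral_eq_nn_integral) (auto simp: nn_integral_hk hk_nonneg)

lemma continuous_torus_measurable: "continuous_on UNIV f \<Longrightarrow> f \<in> borel_measurable borel"
  for f :: "'n::finite torus \<Rightarrow> 'b::topological_space"
  by (rule borel_measurable_continuous_onI)

text \<open>For the summand of coordinate j the weight is the squared sine in that coordinate and 1
  in the others, whose factors integrate to 1. Each coordinate thus contributes at most 2 pi^2 s,
  and the bound tends to 0 with s.\<close>

lemma nn_integral_hk_gap:
  fixes y :: "'n::finite torus"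
  assumes s: "s > 0"
  shows "(\<integral>\<^sup>+x. ennreal (hk s x y * torus_gap x y) \<partial>Leb) \<le> ennreal (real CARD('n) * (2 * pi\<^sup>2 * s))"
proof -
  let ?g = "\<lambda>j x. (sin (pi * ((torus_rep x - torus_rep y) $ j)))\<^sup>2"
  have [measurable]: "?g j \<in> borel_measurable borel" for j
  proof (rule continuous_torus_measurable, rule continuous_on_torus_diff[where \<sigma>="\<lambda>_. 1" and F="\<lambda>_ z. (sin (pi * (z $ j)))\<^sup>2" and a="\<lambda>x. x" and b="\<lambda>_. y"])
    show "continuous_on ({0::real<..} \<times> UNIV) (\<lambda>(s, z). (sin (pi * (z $ j)))\<^sup>2)"
      unfolding case_prod_unfold
      by (intro continuous_on_power continuous_on_sin continuous_on_mult_left continuous_on_component continuous_on_snd continuous_on_id)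
    show "(sin (pi * ((z + k) $ j)))\<^sup>2 = (sin (pi * (z $ j)))\<^sup>2" if "k \<in> int_vec" for z k :: "real^'n"
      by (rule torus_gap_periodic[OF that])
  qed auto
  have one: "(\<integral>\<^sup>+x. ennreal (hk s x y * ?g j x) \<partial>Leb) \<le> ennreal (2 * pi\<^sup>2 * s)" for j
  proof -
    let ?q = "\<lambda>i z. if i = j then (sin (pi * z))\<^sup>2 else 1"
    have "(\<integral>\<^sup>+x. ennreal (hk s x y * ?g j x) \<partial>Leb)
        = (\<integral>\<^sup>+x. ennreal (hk s x y * (\<Prod>i\<in>UNIV. ?q i ((torus_rep x - torus_rep y) $ i))) \<partial>Leb)"
      by simp
    also have "\<dots> = (\<Prod>i\<in>UNIV. \<integral>\<^sup>+z\<in>{0..1}. ennreal (theta0 s z * ?q i z) \<partial>lborel)"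
    proof (rule nn_integral_heat_weight[OF s])
      show "continuous_on UNIV (?q i)" for i by (cases "i = j") (auto intro!: continuous_intros)
      show "?q i (z + k) = ?q i z" if "k \<in> \<int>" for i z k
        using torus_gap_periodic[of "axis i k" "axis i z" i] that by (auto simp: int_vec_def axis_def)
    qed auto
    also have "\<dots> = (\<Prod>i\<in>UNIV. if i = j then (\<integral>\<^sup>+z\<in>{0..1}. ennreal (theta0 s z * (sin (pi * z))\<^sup>2) \<partial>lborel) else 1)"
      by (intro prod.cong) (auto simp: nn_integral_theta0[OF s])
    also have "\<dots> \<le> ennreal (2 * pi\<^sup>2 * s)"
      using nn_integral_theta0_sin[OF s] by simp
    finally show ?thesis .
  qed
  have "(\<integral>\<^sup>+x. ennreal (hk s x y * torus_gap x y) \<partial>Leb) = (\<integral>\<^sup>+x. (\<Sum>j\<in>UNIV. ennreal (hk s x y * ?g j x)) \<partial>Leb)"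
    by (intro nn_integral_cong) (simp add: torus_gap_def sum_distrib_left hk_nonneg[OF s] sum_ennreal)
  also have "\<dots> = (\<Sum>j\<in>UNIV. \<integral>\<^sup>+x. ennreal (hk s x y * ?g j x) \<partial>Leb)"
    using s by (intro nn_integral_sum) measurable
  also have "\<dots> \<le> (\<Sum>j\<in>(UNIV::'n set). ennreal (2 * pi\<^sup>2 * s))"
    by (intro sum_mono one)
  also have "\<dots> = ennreal (real CARD('n) * (2 * pi\<^sup>2 * s))"
    using s by (simp add: ennreal_of_nat_eq_real_of_nat flip: ennreal_mult)
  finally show ?thesis .
qed

section \<open>Integrals of continuous kernels\<close>

lemma continuous_torus_bounded:
  fixes f :: "'n::finite torus \<Rightarrow> 'b::real_normed_vector"
  assumes "continuous_on UNIV f"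
  obtains B where "0 < B" "\<And>x. norm (f x) \<le> B"
proof -
  have "bounded (f ` UNIV)"
    by (intro compact_imp_bounded compact_continuous_image assms compact_torus)
  then obtain B where "\<And>x. norm (f x) \<le> B" unfolding bounded_iff by auto
  then show thesis using that[of "max B 1"] by (force simp: le_max_iff_disj)
qed

lemma continuous_torus_pair_bounded:
  fixes f :: "'n::finite torus \<Rightarrow> 'n torus \<Rightarrow> 'b::real_normed_vector"
  assumes "continuous_on UNIV (\<lambda>(x, y). f x y)"
  obtains B where "0 < B" "\<And>x y. norm (f x y) \<le> B"
proof -
  have "compact (UNIV :: ('n torus \<times> 'n torus) set)"
    using compact_Times[OF compact_torus compact_torus] by simp
  then have "bounded ((\<lambda>(x, y). f x y) ` UNIV)"
    by (intro compact_imp_bounded compact_continuous_image assms)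
  then obtain B where "\<And>x y. norm (f x y) \<le> B" unfolding bounded_iff by auto
  then show thesis using that[of "max B 1"] by (force simp: le_max_iff_disj)
qed

lemma bilinear_measurable:
  fixes B :: "'b::{banach, second_countable_topology} \<Rightarrow> 'c::{banach, second_countable_topology} \<Rightarrow> 'd::{banach, second_countable_topology}"
  assumes "bounded_bilinear B" "f \<in> borel_measurable M" "g \<in> borel_measurable M"
  shows "(\<lambda>x. B (f x) (g x)) \<in> borel_measurable M"
  using assms(2,3)
  by (rule borel_measurable_continuous_Pair)
     (intro bounded_bilinear.continuous_on[OF assms(1)] continuous_intros)

lemma integrable_bilinear_continuous:
  fixes B :: "'b::{banach, second_countable_topology} \<Rightarrow> 'c::{banach, second_countable_topology} \<Rightarrow> 'd::{banach, second_countable_topology}"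
    and \<mu> :: "'n::finite torus measure"
  assumes B: "bounded_bilinear B" and \<mu>: "sets \<mu> = sets borel" and f: "integrable \<mu> f" and g: "continuous_on UNIV g"
  shows "integrable \<mu> (\<lambda>y. B (g y) (f y))"
proof -
  obtain K where K: "0 < K" "\<And>a b. norm (B a b) \<le> norm a * norm b * K"
    using bounded_bilinear.pos_bounded[OF B] by blast
  obtain C where C: "0 < C" "\<And>x. norm (g x) \<le> C" using continuous_torus_bounded[OF g] by blast
  have [measurable]: "g \<in> borel_measurable \<mu>"
    using continuous_torus_measurable[OF g] \<mu> by (simp cong: measurable_cong_sets)
  show ?thesis
  proof (rule Bochner_Integration.integrable_bound)
    show "integrable \<mu> (\<lambda>y. C * K * norm (f y))" using f by auto
    show "(\<lambda>y. B (g y) (f y)) \<in> borel_measurable \<mu>"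
      using f by (intro bilinear_measurable[OF B]) auto
    show "AE y in \<mu>. norm (B (g y) (f y)) \<le> norm (C * K * norm (f y))"
    proof (rule AE_I2)
      fix y
      have "norm (B (g y) (f y)) \<le> norm (g y) * norm (f y) * K" by (rule K)
      also have "\<dots> \<le> C * norm (f y) * K" using C K by (intro mult_right_mono) auto
      finally show "norm (B (g y) (f y)) \<le> norm (C * K * norm (f y))" using C K by (simp add: ac_simps)
    qed
  qed
qed

lemma continuous_slice:
  assumes "continuous_on (S \<times> UNIV) (\<lambda>(p, y). k p y)" "p \<in> S"
  shows "continuous_on UNIV (k p)"
  by (rule continuous_on_compose2[OF assms(1), where f="\<lambda>y. (p, y)", simplified])
     (use assms(2) in \<open>auto intro!: continuous_intros\<close>)

lemma norm_integral_le:
  fixes f :: "'a \<Rightarrow> 'b::{banach, second_countable_topology}"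
  assumes "integrable M f" "integrable M g" "\<And>x. norm (f x) \<le> g x"
  shows "norm (LINT x|M. f x) \<le> (LINT x|M. g x)"
  using assms by (intro order_trans[OF integral_norm_bound] integral_mono) auto

text \<open>Compactness of the torus makes \<open>k p\<close> close to \<open>k p0\<close> uniformly
  in y, so integrability of \<open>f\<close> is enough. The bilinear map covers products of scalars,
  scalar multiples of vectors and inner products at once.\<close>

lemma continuous_on_integral_kernel:
  fixes B :: "'b::{banach, second_countable_topology} \<Rightarrow> 'c::{banach, second_countable_topology} \<Rightarrow> 'd::{banach, second_countable_topology}"
    and \<mu> :: "'n::finite torus measure" and k :: "'a::topological_space \<Rightarrow> 'n torus \<Rightarrow> 'b"
  assumes B: "bounded_bilinear B" and \<mu>: "sets \<mu> = sets borel" and f: "integrable \<mu> f"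
    and k: "continuous_on (S \<times> UNIV) (\<lambda>(p, y). k p y)"
  shows "continuous_on S (\<lambda>p. LINT y|\<mu>. B (k p y) (f y))"
  unfolding continuous_on_def
proof (intro ballI tendstoI)
  fix p0 and e :: real assume p0: "p0 \<in> S" and e: "0 < e"
  obtain K where K: "0 < K" "\<And>a b. norm (B a b) \<le> norm a * norm b * K"
    using bounded_bilinear.pos_bounded[OF B] by blast
  define I where "I = (LINT y|\<mu>. norm (f y)) + 1"
  have I: "I > 0" unfolding I_def by (intro add_nonneg_pos integral_nonneg) auto
  define e' where "e' = e / (2 * K * I)"
  have e': "e' > 0" using e K I by (simp add: e'_def)
  obtain X where X: "p0 \<in> X" "open X" "\<And>p y. p \<in> X \<inter> S \<Longrightarrow> dist (k p y) (k p0 y) \<le> e'"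
    using continuous_on_prod_compactE[OF k compact_torus p0 e'] by (metis (no_types, lifting) UNIV_I case_prod_conv)
  note int = integrable_bilinear_continuous[OF B \<mu> f continuous_slice[OF k]]
  have "dist (LINT y|\<mu>. B (k p y) (f y)) (LINT y|\<mu>. B (k p0 y) (f y)) < e" if p: "p \<in> X \<inter> S" for p
  proof -
    have "(LINT y|\<mu>. B (k p y) (f y)) - (LINT y|\<mu>. B (k p0 y) (f y)) = (LINT y|\<mu>. B (k p y - k p0 y) (f y))"
      using p p0 by (simp add: int bounded_bilinear.diff_left[OF B])
    also have "norm \<dots> \<le> (LINT y|\<mu>. e' * K * norm (f y))"
    proof (rule norm_integral_le)
      show "integrable \<mu> (\<lambda>y. B (k p y - k p0 y) (f y))"
        using p p0 by (simp add: int bounded_bilinear.diff_left[OF B])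
      show "integrable \<mu> (\<lambda>y. e' * K * norm (f y))" using f by auto
      fix y
      have "norm (B (k p y - k p0 y) (f y)) \<le> norm (k p y - k p0 y) * norm (f y) * K" by (rule K)
      also have "\<dots> \<le> e' * norm (f y) * K"
        using X(3)[OF p, of y] K by (intro mult_right_mono) (auto simp: dist_norm)
      finally show "norm (B (k p y - k p0 y) (f y)) \<le> e' * K * norm (f y)" by (simp add: ac_simps)
    qed
    also have "\<dots> \<le> e' * K * I" using e' K by (simp add: I_def)
    also have "\<dots> < e" using e K I by (simp add: e'_def)
    finally show ?thesis by (simp add: dist_norm)
  qed
  then show "\<forall>\<^sub>F p in at p0 within S. dist (LINT y|\<mu>. B (k p y) (f y)) (LINT y|\<mu>. B (k p0 y) (f y)) < e"
    unfolding eventually_at_topological using X by blast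
qed

text \<open>Differentiation under the integral: by compactness \<open>Dk p y\<close> is within e' of
  \<open>Dk p0 y\<close> for all y once p is near \<open>p0\<close>, and the mean value estimate
  makes the linearisation error of \<open>k\<close> uniform in y.\<close>

lemma has_derivative_integral_kernel:
  fixes \<mu> :: "'n::finite torus measure" and k :: "'p::euclidean_space \<Rightarrow> 'n torus \<Rightarrow> real"
  assumes \<mu>: "sets \<mu> = sets borel" and f: "integrable \<mu> f" and U: "open U" "p0 \<in> U"
    and deriv: "\<And>p y. p \<in> U \<Longrightarrow> ((\<lambda>p. k p y) has_derivative (\<lambda>h. Dk p y \<bullet> h)) (at p)"
    and k: "continuous_on (U \<times> UNIV) (\<lambda>(p, y). k p y)" and Dk: "continuous_on (U \<times> UNIV) (\<lambda>(p, y). Dk p y)"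
  shows "((\<lambda>p. LINT y|\<mu>. k p y * f y) has_derivative (\<lambda>h. (LINT y|\<mu>. f y *\<^sub>R Dk p0 y) \<bullet> h)) (at p0)"
  unfolding has_derivative_at_alt
proof (intro conjI allI impI)
  show "bounded_linear ((\<bullet>) (LINT y|\<mu>. f y *\<^sub>R Dk p0 y))"
    by (rule bounded_linear_inner_right)
  fix e :: real assume e: "0 < e"
  define I where "I = (LINT y|\<mu>. norm (f y)) + 1"
  have I: "I > 0" unfolding I_def by (intro add_nonneg_pos integral_nonneg) auto
  define e' where "e' = e / I"
  have e': "e' > 0" using e I by (simp add: e'_def)
  obtain X where X: "p0 \<in> X" "open X" "\<And>p y. p \<in> X \<inter> U \<Longrightarrow> dist (Dk p y) (Dk p0 y) \<le> e'"
    using continuous_on_prod_compactE[OF Dk compact_torus U(2) e'] by (metis (no_types, lifting) UNIV_I case_prod_conv)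
  then obtain d where d: "d > 0" "ball p0 d \<subseteq> X \<inter> U"
    using U open_contains_ball[of "X \<inter> U"] by blast
  note intk = integrable_bilinear_continuous[OF bounded_bilinear_mult \<mu> f continuous_slice[OF k]]
  note intD = integrable_bilinear_continuous[OF bounded_bilinear.flip[OF bounded_bilinear_scaleR] \<mu> f continuous_slice[OF Dk]]
  have "norm ((LINT y|\<mu>. k q y * f y) - (LINT y|\<mu>. k p0 y * f y) - (LINT y|\<mu>. f y *\<^sub>R Dk p0 y) \<bullet> (q - p0)) \<le> e * norm (q - p0)"
    if q: "norm (q - p0) < d" for q
  proof -
    have qb: "q \<in> ball p0 d" "q \<in> U" using q d by (auto simp: dist_norm norm_minus_commute)
    \<comment> \<open>Mean value inequality on a ball, which is convex, so the segment from
      \<open>p0\<close> to \<open>q\<close> stays where the derivative varies by at most e'.\<close>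
    have pt: "norm (k q y - k p0 y - Dk p0 y \<bullet> (q - p0)) \<le> norm (q - p0) * e'" for y
    proof (rule differentiable_bound_linearization[where S="ball p0 d" and f'="\<lambda>p h. Dk p y \<bullet> h"])
      show "p0 + t *\<^sub>R (q - p0) \<in> ball p0 d" if "t \<in> {0..1}" for t
      proof -
        have "norm (t *\<^sub>R (q - p0)) \<le> 1 * norm (q - p0)" using that unfolding norm_scaleR by (intro mult_right_mono) auto
        then show ?thesis using q by (simp add: dist_norm)
      qed
      show "((\<lambda>p. k p y) has_derivative (\<bullet>) (Dk p y)) (at p within ball p0 d)" if "p \<in> ball p0 d" for p
      proof -
        from that d(2) have "p \<in> U" by blast
        then show ?thesis by (rule has_derivative_at_withinI[OF deriv])
      qed
      show "onorm ((\<bullet>) (Dk p y) - (\<bullet>) (Dk p0 y)) \<le> e'" if "p \<in> ball p0 d" for p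
      proof (rule onorm_bound)
        from that d(2) have "p \<in> X \<inter> U" by blast
        then have "norm (Dk p y - Dk p0 y) \<le> e'" using X(3)[of p y] by (simp add: dist_norm)
        then show "norm (((\<bullet>) (Dk p y) - (\<bullet>) (Dk p0 y)) h) \<le> e' * norm h" for h
          using Cauchy_Schwarz_ineq2[of "Dk p y - Dk p0 y" h]
          by (simp add: inner_diff_left) (meson mult_right_mono norm_ge_zero order_trans)
      qed (use e' in simp)
    qed (use d in auto)
    have i1: "integrable \<mu> (\<lambda>y. (Dk p0 y \<bullet> (q - p0)) * f y)"
    proof -
      have "integrable \<mu> (\<lambda>y. (f y *\<^sub>R Dk p0 y) \<bullet> (q - p0))"
        by (intro integrable_inner_left intD U)
      then show ?thesis by (simp add: mult.commute)
    qed
    have "(LINT y|\<mu>. k q y * f y) - (LINT y|\<mu>. k p0 y * f y) - (LINT y|\<mu>. f y *\<^sub>R Dk p0 y) \<bullet> (q - p0)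
        = (LINT y|\<mu>. (k q y - k p0 y - Dk p0 y \<bullet> (q - p0)) * f y)"
      using intk[OF qb(2)] intk[OF U(2)] intD[OF U(2)] i1
      by (simp add: integral_inner_left[symmetric] left_diff_distrib mult.commute[of "f _"])
    also have "norm \<dots> \<le> (LINT y|\<mu>. (norm (q - p0) * e') * norm (f y))"
    proof (rule norm_integral_le)
      show "integrable \<mu> (\<lambda>y. (k q y - k p0 y - Dk p0 y \<bullet> (q - p0)) * f y)"
        using intk[OF qb(2)] intk[OF U(2)] i1 by (simp add: left_diff_distrib)
      show "integrable \<mu> (\<lambda>y. (norm (q - p0) * e') * norm (f y))" using f by auto
      show "norm ((k q y - k p0 y - Dk p0 y \<bullet> (q - p0)) * f y) \<le> (norm (q - p0) * e') * norm (f y)" for y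
        using mult_right_mono[OF pt[of y], of "norm (f y)"] by (simp add: abs_mult)
    qed
    also have "\<dots> \<le> norm (q - p0) * e' * I" using e' by (simp add: I_def mult_left_mono)
    also have "\<dots> = e * norm (q - p0)" using I by (simp add: e'_def)
    finally show ?thesis .
  qed
  then show "\<exists>d>0. \<forall>q. norm (q - p0) < d \<longrightarrow> norm ((LINT y|\<mu>. k q y * f y) - (LINT y|\<mu>. k p0 y * f y) - (LINT y|\<mu>. f y *\<^sub>R Dk p0 y) \<bullet> (q - p0)) \<le> e * norm (q - p0)"
    using d(1) by blast
qed

lemma borel_pair_continuous:
  fixes f :: "'a::second_countable_topology \<Rightarrow> 'c::second_countable_topology \<Rightarrow> 'b::topological_space"
  assumes "continuous_on UNIV (\<lambda>(x, y). f x y)"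
  shows "(\<lambda>(x, y). f x y) \<in> borel_measurable (borel \<Otimes>\<^sub>M borel)"
  unfolding borel_prod by (rule borel_measurable_continuous_onI[OF assms])

text \<open>The double integrals it serves have a bounded kernel against an integrable function of
  each variable, so a product majorant is the natural criterion for exchanging the order.\<close>

lemma Fubini_torus:
  fixes \<mu> \<nu> :: "'n::finite torus measure" and F :: "'n torus \<Rightarrow> 'n torus \<Rightarrow> real"
  assumes "finite_measure \<mu>" "finite_measure \<nu>" and [measurable_cong]: "sets \<mu> = sets borel" "sets \<nu> = sets borel"
    and F[measurable]: "(\<lambda>(x, y). F x y) \<in> borel_measurable (borel \<Otimes>\<^sub>M borel)"
    and A: "integrable \<mu> A" and B: "integrable \<nu> B" and bound: "\<And>x y. \<bar>F x y\<bar> \<le> A x * B y"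
  shows "(LINT x|\<mu>. LINT y|\<nu>. F x y) = (LINT y|\<nu>. LINT x|\<mu>. F x y)"
    and "integrable \<mu> (\<lambda>x. LINT y|\<nu>. F x y)" and "integrable \<nu> (\<lambda>y. LINT x|\<mu>. F x y)"
proof -
  interpret \<mu>: finite_measure \<mu> by fact
  interpret \<nu>: finite_measure \<nu> by fact
  interpret pair_sigma_finite \<mu> \<nu> ..
  have AB: "integrable (\<mu> \<Otimes>\<^sub>M \<nu>) (\<lambda>(x, y). A x * B y)"
  proof (rule Fubini_integrable)
    show "(\<lambda>(x, y). A x * B y) \<in> borel_measurable (\<mu> \<Otimes>\<^sub>M \<nu>)" using A B by measurable
    have "(\<lambda>x. LINT y|\<nu>. norm (case (x, y) of (x, y) \<Rightarrow> A x * B y)) = (\<lambda>x. \<bar>A x\<bar> * (LINT y|\<nu>. \<bar>B y\<bar>))"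
      by (simp add: abs_mult)
    then show "integrable \<mu> (\<lambda>x. LINT y|\<nu>. norm (case (x, y) of (x, y) \<Rightarrow> A x * B y))" using A by simp
    show "AE x in \<mu>. integrable \<nu> (\<lambda>y. case (x, y) of (x, y) \<Rightarrow> A x * B y)" using B by simp
  qed
  have int: "integrable (\<mu> \<Otimes>\<^sub>M \<nu>) (\<lambda>(x, y). F x y)"
  proof (rule Bochner_Integration.integrable_bound[OF AB])
    show "AE p in \<mu> \<Otimes>\<^sub>M \<nu>. norm (case p of (x, y) \<Rightarrow> F x y) \<le> norm (case p of (x, y) \<Rightarrow> A x * B y)"
      using order_trans[OF bound abs_ge_self] by (intro AE_I2) (auto simp: case_prod_unfold)
  qed measurable
  show "(LINT x|\<mu>. LINT y|\<nu>. F x y) = (LINT y|\<nu>. LINT x|\<mu>. F x y)"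
    using Fubini_integral[OF int] by simp
  show "integrable \<mu> (\<lambda>x. LINT y|\<nu>. F x y)" "integrable \<nu> (\<lambda>y. LINT x|\<mu>. F x y)"
    using integrable_fst[OF int] integrable_snd[OF int] by simp_all
qed

section \<open>Integration by parts\<close>

text \<open>Integrating \<open>f'\<close> along a closed loop gives zero, and every translate of the loop has the same
  average.\<close>

lemma integral_directional_derivative:
  fixes f f' :: "'n::finite torus \<Rightarrow> real"
  assumes f': "continuous_on UNIV f'"
    and deriv: "\<And>x. ((\<lambda>\<tau>. f (torus_proj (x + \<tau> *\<^sub>R axis i 1))) has_real_derivative f' (torus_proj x)) (at 0)"
  shows "(LINT x|Leb. f' x) = 0"
proof -
  have cont: "continuous_on UNIV (\<lambda>(\<tau>::real, x). f' (torus_shift (\<tau> *\<^sub>R axis i 1) x))"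
  proof (rule continuous_on_param_torus_lift[where S=UNIV, simplified])
    show "continuous_on UNIV (\<lambda>(\<tau>::real, y). f' (torus_shift (\<tau> *\<^sub>R axis i 1) (torus_proj y)))"
      unfolding torus_shift_proj case_prod_unfold
      by (intro continuous_on_compose2[OF f'] continuous_on_compose2[OF continuous_on_torus_proj] continuous_intros) auto
  qed
  have loop: "(LINT \<tau>:{0..1}|lborel. f' (torus_shift (\<tau> *\<^sub>R axis i 1) x)) = 0" for x
  proof -
    obtain y where x: "x = torus_proj y" by (rule torus_proj_cases)
    have d: "((\<lambda>\<tau>. f (torus_proj (y + \<tau> *\<^sub>R axis i 1))) has_real_derivative f' (torus_proj (y + \<tau>0 *\<^sub>R axis i 1))) (at \<tau>0)" for \<tau>0
    proof -
      have "((\<lambda>\<tau>. f (torus_proj ((y + \<tau>0 *\<^sub>R axis i 1) + \<tau> *\<^sub>R axis i 1))) has_real_derivative f' (torus_proj (y + \<tau>0 *\<^sub>R axis i 1))) (at (\<tau>0 + - \<tau>0))"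
        using deriv[of "y + \<tau>0 *\<^sub>R axis i 1"] by simp
      then have "((\<lambda>\<tau>. f (torus_proj ((y + \<tau>0 *\<^sub>R axis i 1) + (\<tau> + - \<tau>0) *\<^sub>R axis i 1))) has_real_derivative f' (torus_proj (y + \<tau>0 *\<^sub>R axis i 1))) (at \<tau>0)"
        unfolding DERIV_shift .
      then show ?thesis by (simp add: algebra_simps)
    qed
    have c: "continuous_on {0..1} (\<lambda>\<tau>. f' (torus_proj (y + \<tau> *\<^sub>R axis i 1)))"
      by (intro continuous_on_compose2[OF f'] continuous_on_compose2[OF continuous_on_torus_proj] continuous_intros) auto
    have "(LINT \<tau>:{0..1}|lborel. f' (torus_proj (y + \<tau> *\<^sub>R axis i 1)))
        = f (torus_proj (y + 1 *\<^sub>R axis i 1)) - f (torus_proj (y + 0 *\<^sub>R axis i 1))"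
      unfolding set_lebesgue_integral_def
      using c d by (intro integral_FTC_atLeastAtMost) (auto simp: has_real_derivative_iff_has_vector_derivative[symmetric] intro: has_field_derivative_at_within)
    also have "torus_proj (y + 1 *\<^sub>R axis i 1) = torus_proj y"
      using torus_proj_add_int_vec[of "axis i 1" y] by (simp add: int_vec_def axis_def)
    finally show ?thesis by (simp add: x)
  qed
  obtain C where C: "C > 0" "\<And>x. norm (f' x) \<le> C" using continuous_torus_bounded[OF f'] by blast
  have [measurable]: "f' \<in> borel_measurable borel" by (rule continuous_torus_measurable[OF f'])
  have [measurable]: "(\<lambda>(\<tau>, x). f' (torus_shift (\<tau> *\<^sub>R axis i 1) x)) \<in> borel_measurable (borel \<Otimes>\<^sub>M borel)"
    by (rule borel_pair_continuous[OF cont])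
  interpret pair_sigma_finite lborel "Leb :: 'n torus measure"
    by (intro pair_sigma_finite.intro) (unfold_locales)
  have int: "integrable (lborel \<Otimes>\<^sub>M Leb) (\<lambda>(\<tau>, x). indicator {0..1} \<tau> * f' (torus_shift (\<tau> *\<^sub>R axis i 1) x))"
  proof (rule Bochner_Integration.integrable_bound)
    show "integrable (lborel \<Otimes>\<^sub>M (Leb :: 'n torus measure)) (\<lambda>(\<tau>, x). C * indicator ({0..1::real} \<times> UNIV) (\<tau>, x))"
      unfolding case_prod_unfold prod.collapse
      by (intro integrable_mult_right integrable_real_indicator pair_measureI)
         (simp_all add: Leb.emeasure_pair_measure_Times less_top[symmetric] Leb.emeasure_finite)
    show "AE p in lborel \<Otimes>\<^sub>M Leb. norm (case p of (\<tau>, x) \<Rightarrow> indicator {0..1} \<tau> * f' (torus_shift (\<tau> *\<^sub>R axis i 1) x))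
        \<le> norm (case p of (\<tau>, x) \<Rightarrow> C * indicator ({0..1} \<times> UNIV) (\<tau>, x))"
      using C by (intro AE_I2) (auto simp: indicator_def)
  qed measurable
  have "0 = (LINT x|Leb. (LINT \<tau>:{0..1}|lborel. f' (torus_shift (\<tau> *\<^sub>R axis i 1) x)))" by (simp add: loop)
  also have "\<dots> = (LINT \<tau>|lborel. (LINT x|Leb. indicator {0..1} \<tau> * f' (torus_shift (\<tau> *\<^sub>R axis i 1) x)))"
    using Fubini_integral[OF int] by (simp add: set_lebesgue_integral_def)
  also have "\<dots> = (LINT \<tau>:{0..1::real}|lborel. (LINT x|Leb. f' x))"
    unfolding set_lebesgue_integral_def by (simp add: integral_Leb_shift)
  also have "\<dots> = (LINT x|Leb. f' x)" by (simp add: set_lebesgue_integral_def)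
  finally show ?thesis by simp
qed

section \<open>C1 functions on the torus and their weak gradients\<close>

lemma C1_torus_continuous:
  assumes "C1_torus \<phi> G" shows "continuous_on UNIV \<phi>" "continuous_on UNIV G"
proof -
  show "continuous_on UNIV \<phi>"
    unfolding continuous_on_torus_lift
    using assms by (intro continuous_at_imp_continuous_on ballI) (auto simp: C1_torus_def intro: has_derivative_continuous)
qed (use assms in \<open>simp add: C1_torus_def\<close>)

lemma C1_torus_directional:
  assumes "C1_torus \<phi> G"
  shows "((\<lambda>\<tau>. \<phi> (torus_proj (x + \<tau> *\<^sub>R v))) has_real_derivative G (torus_proj x) \<bullet> v) (at 0)"
proof -
  have "((\<lambda>\<tau>. x + \<tau> *\<^sub>R v) has_derivative (\<lambda>\<tau>. \<tau> *\<^sub>R v)) (at (0::real))"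
    by (auto intro!: derivative_eq_intros)
  from has_derivative_compose[OF this, of "\<lambda>y. \<phi> (torus_proj y)" "\<lambda>h. G (torus_proj x) \<bullet> h"]
  show ?thesis using assms by (simp add: C1_torus_def has_field_derivative_def mult_commute_abs)
qed

lemma C1_torus_mult:
  assumes a: "C1_torus \<phi> G" and b: "C1_torus \<psi> H"
  shows "C1_torus (\<lambda>x. \<phi> x * \<psi> x) (\<lambda>x. \<psi> x *\<^sub>R G x + \<phi> x *\<^sub>R H x)"
  unfolding C1_torus_def
proof (intro conjI allI)
  show "continuous_on UNIV (\<lambda>x. \<psi> x *\<^sub>R G x + \<phi> x *\<^sub>R H x)"
    using C1_torus_continuous[OF a] C1_torus_continuous[OF b] by (intro continuous_intros)
  show "((\<lambda>y. \<phi> (torus_proj y) * \<psi> (torus_proj y)) has_derivative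
      (\<lambda>h. (\<psi> (torus_proj x) *\<^sub>R G (torus_proj x) + \<phi> (torus_proj x) *\<^sub>R H (torus_proj x)) \<bullet> h)) (at x)" for x
    using a b unfolding C1_torus_def
    by (intro has_derivative_eq_rhs[OF has_derivative_mult]) (auto simp: algebra_simps fun_eq_iff)
qed

lemma continuous_Leb_integrable:
  fixes f :: "'n::finite torus \<Rightarrow> 'b::{banach, second_countable_topology}"
  assumes "finite_measure \<mu>" "sets \<mu> = sets borel" "continuous_on UNIV f"
  shows "integrable \<mu> f"
proof -
  obtain C where C: "0 < C" "\<And>x. norm (f x) \<le> C" using continuous_torus_bounded[OF assms(3)] by blast
  interpret finite_measure \<mu> by fact
  show ?thesis
    using C continuous_torus_measurable[OF assms(3)] assms(2)
    by (intro integrable_const_bound[where B=C]) (auto cong: measurable_cong_sets)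
qed

lemmas continuous_integrable_Leb = continuous_Leb_integrable[OF Leb.finite_measure_axioms sets_Leb]

lemma integral_C1_torus_gradient:
  assumes "C1_torus \<phi> G" shows "(LINT x|Leb. G x) = 0"
proof -
  have G: "continuous_on UNIV G" by (rule C1_torus_continuous[OF assms])
  have "(LINT x|Leb. G x) $ i = 0" for i
  proof -
    have "(LINT x|Leb. G x) $ i = (LINT x|Leb. G x $ i)"
      using integral_bounded_linear[OF bounded_linear_vec_nth[of i] continuous_integrable_Leb[OF G]] by simp
    also have "\<dots> = 0"
    proof (rule integral_directional_derivative[where f=\<phi> and i=i])
      show "continuous_on UNIV (\<lambda>x. G x $ i)" by (intro continuous_on_component G)
      show "((\<lambda>\<tau>. \<phi> (torus_proj (x + \<tau> *\<^sub>R axis i 1))) has_real_derivative G (torus_proj x) $ i) (at 0)" for x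
        using C1_torus_directional[OF assms, of x "axis i 1"] by (simp add: inner_axis)
    qed
    finally show ?thesis .
  qed
  then show ?thesis by (simp add: vec_eq_iff)
qed

text \<open>Integration by parts: the gradient of a product of two C1 functions integrates to 0. The
  lemma links classical and weak gradients, so that heated densities and heated test functions fit
  definitions phrased with \<open>weak_gradient\<close>.\<close>

lemma C1_weak_gradient:
  fixes \<phi> :: "'n::finite torus \<Rightarrow> real"
  assumes a: "C1_torus \<phi> G" shows "weak_gradient \<phi> G"
  unfolding weak_gradient_def
proof (intro conjI allI impI)
  note c = C1_torus_continuous[OF a]
  show "integrable Leb \<phi>" "integrable Leb G" by (intro continuous_integrable_Leb c)+
  fix \<psi> :: "'n torus \<Rightarrow> real" and H assume b: "C1_torus \<psi> H"
  note c' = C1_torus_continuous[OF b]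
  have "(LINT x|Leb. \<psi> x *\<^sub>R G x + \<phi> x *\<^sub>R H x) = 0"
    by (rule integral_C1_torus_gradient[OF C1_torus_mult[OF a b]])
  moreover have "(LINT x|Leb. \<psi> x *\<^sub>R G x + \<phi> x *\<^sub>R H x) = (LINT x|Leb. \<psi> x *\<^sub>R G x) + (LINT x|Leb. \<phi> x *\<^sub>R H x)"
    using c c' by (intro Bochner_Integration.integral_add continuous_integrable_Leb continuous_intros)
  ultimately show "(LINT x|Leb. \<phi> x *\<^sub>R H x) = - (LINT x|Leb. \<psi> x *\<^sub>R G x)"
    unfolding eq_neg_iff_add_eq_0 by (simp only: add.commute)
qed

text \<open>The heat equation tested against \<phi>. The i-th summand of \<open>hkS\<close> is the
  i-th derivative of the i-th component of \<open>hkD\<close>; multiplied by \<phi>, this component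
  has a directional derivative of integral 0. Only one derivative reaches \<phi>.\<close>

lemma integral_hkS:
  assumes s: "s > 0" and \<phi>: "C1_torus \<phi> G"
  shows "(LINT x|Leb. \<phi> x * hkS s x y) = - (LINT x|Leb. G x \<bullet> hkD s x y)"
proof -
  note c = C1_torus_continuous[OF \<phi>]
  define part where "part i x = theta2 s ((torus_rep x - torus_rep y) $ i) * heatG_part s (torus_rep x - torus_rep y) i" for i and x :: "'a torus"
  obtain b where y: "y = torus_proj b" by (rule torus_proj_cases)
  have part_lift: "part i (torus_proj x) = theta2 s ((x - b) $ i) * heatG_part s (x - b) i" for i x
  proof -
    have per: "theta2 s ((z + k) $ i) * heatG_part s (z + k) i = theta2 s (z $ i) * heatG_part s z i" if "k \<in> int_vec" for z k :: "real^'a"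
      using that s by (simp add: heat_periodic theta_add_int int_vec_def)
    show ?thesis
      unfolding part_def y
      using periodic_torus_rep_proj(1)[where F="\<lambda>z. theta2 s (z $ i) * heatG_part s z i", OF per, of x "torus_rep (torus_proj b)"]
        periodic_torus_rep_proj(2)[where F="\<lambda>z. theta2 s (z $ i) * heatG_part s z i", OF per, of x b] by simp
  qed
  have cont_part: "continuous_on UNIV (part i)" for i
    unfolding continuous_on_torus_lift part_lift using s by (intro continuous_intros heat_continuous) auto
  have cD: "continuous_on UNIV (\<lambda>x. hkD s x y)" using s by (intro continuous_intros) auto
  have zero: "(LINT x|Leb. G x $ i * hkD s x y $ i + \<phi> x * part i x) = 0" for i
  proof (rule integral_directional_derivative[where i=i and f="\<lambda>x. \<phi> x * hkD s x y $ i"])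
    show "continuous_on UNIV (\<lambda>x. G x $ i * hkD s x y $ i + \<phi> x * part i x)"
      by (intro continuous_on_add continuous_on_mult continuous_on_component c cont_part cD)
    fix x
    have 1: "((\<lambda>\<tau>. \<phi> (torus_proj (x + \<tau> *\<^sub>R axis i 1))) has_real_derivative G (torus_proj x) $ i) (at 0)"
      using C1_torus_directional[OF \<phi>, of x "axis i 1"] by (simp add: inner_axis)
    have 2: "((\<lambda>\<tau>. hkD s (torus_proj (x + \<tau> *\<^sub>R axis i 1)) y $ i) has_real_derivative part i (torus_proj x)) (at 0)"
      using heatDG_deriv[OF s, of "x - b" i] by (simp add: y hk_proj[OF s] part_lift algebra_simps)
    show "((\<lambda>\<tau>. \<phi> (torus_proj (x + \<tau> *\<^sub>R axis i 1)) * hkD s (torus_proj (x + \<tau> *\<^sub>R axis i 1)) y $ i) has_real_derivative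
        G (torus_proj x) $ i * hkD s (torus_proj x) y $ i + \<phi> (torus_proj x) * part i (torus_proj x)) (at 0)"
      using DERIV_mult[OF 1 2] by (simp add: mult.commute)
  qed
  have "(LINT x|Leb. G x \<bullet> hkD s x y + \<phi> x * hkS s x y) = (LINT x|Leb. (\<Sum>i\<in>UNIV. G x $ i * hkD s x y $ i + \<phi> x * part i x))"
    by (simp add: inner_vec_def sum.distrib hkS_def heatGs_def part_def sum_distrib_left)
  also have "\<dots> = 0"
    by (subst Bochner_Integration.integral_sum)
       (simp_all add: zero continuous_integrable_Leb continuous_on_add continuous_on_mult continuous_on_component c cont_part cD)
  also have "(LINT x|Leb. G x \<bullet> hkD s x y + \<phi> x * hkS s x y) = (LINT x|Leb. G x \<bullet> hkD s x y) + (LINT x|Leb. \<phi> x * hkS s x y)"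
    using c cD s by (intro Bochner_Integration.integral_add continuous_integrable_Leb continuous_intros) auto
  finally show ?thesis by simp
qed

section \<open>Heat regularisation of measures\<close>

lemma theta2_even: "s > 0 \<Longrightarrow> theta2 s (- x) = theta2 s x"
  unfolding theta2_def by (rule periodize_even) (auto simp: decaying_gauss gauss2_def gauss0_def)

lemma hkS_sym: "s > 0 \<Longrightarrow> hkS s x y = hkS s y x"
proof -
  assume s: "s > 0"
  have "heatGs s (- z) = heatGs s z" for z :: "real^'a"
    using s by (simp add: heatGs_def heatG_part_def theta0_even theta2_even)
  from this[of "torus_rep x - torus_rep y"] show ?thesis by (simp add: hkS_def)
qed

text \<open>The heat flow applied to the measure with density f relative to \<mu>, evaluated
  pointwise. One operator covers the density of a heated measure (f = 1), a smoothed momentum (f a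
  velocity field) and a mollified function (\<mu> = \<open>Leb\<close>).\<close>

definition hconv :: "real \<Rightarrow> 'n::finite torus measure \<Rightarrow> ('n torus \<Rightarrow> 'b::{banach, second_countable_topology}) \<Rightarrow> 'n torus \<Rightarrow> 'b" where
  "hconv s \<mu> f x = (LINT y|\<mu>. hk s x y *\<^sub>R f y)"

definition hgrad :: "real \<Rightarrow> 'n::finite torus measure \<Rightarrow> ('n torus \<Rightarrow> real) \<Rightarrow> 'n torus \<Rightarrow> real^'n" where
  "hgrad s \<mu> f x = (LINT y|\<mu>. f y *\<^sub>R hkD s x y)"

lemma hk_continuous_pair:
  assumes "s > 0"
  shows "continuous_on UNIV (\<lambda>(x, y). hk s x y)" "continuous_on UNIV (\<lambda>(x, y). hkD s x y)"
  unfolding case_prod_unfold using assms by (intro continuous_intros; simp)+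

lemma hk_continuous1:
  assumes "s > 0"
  shows "continuous_on UNIV (\<lambda>x. hk s x y)" "continuous_on UNIV (\<lambda>x. hkD s x y)" "continuous_on UNIV (\<lambda>x. hkS s x y)"
    "continuous_on UNIV (\<lambda>y. hk s x y)" "continuous_on UNIV (\<lambda>y. hkD s x y)" "continuous_on UNIV (\<lambda>y. hkS s x y)"
  using assms by (intro continuous_intros; simp)+

lemma integrable_hk_scaleR:
  fixes f :: "'n::finite torus \<Rightarrow> 'b::{banach, second_countable_topology}"
  assumes "s > 0" "sets \<mu> = sets borel" "integrable \<mu> f"
  shows "integrable \<mu> (\<lambda>y. hk s x y *\<^sub>R f y)"
  by (rule integrable_bilinear_continuous[OF bounded_bilinear_scaleR assms(2,3) hk_continuous1(4)[OF assms(1)]])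

lemma hconv_continuous_time:
  fixes f :: "'n::finite torus \<Rightarrow> 'b::{banach, second_countable_topology}"
  assumes \<mu>: "sets \<mu> = sets borel" "integrable \<mu> f"
    and c: "continuous_on S \<sigma>" "continuous_on S a" "\<And>\<xi>. \<xi> \<in> S \<Longrightarrow> \<sigma> \<xi> > 0"
  shows "continuous_on S (\<lambda>\<xi>. hconv (\<sigma> \<xi>) \<mu> f (a \<xi>))"
  unfolding hconv_def
proof (rule continuous_on_integral_kernel[OF bounded_bilinear_scaleR \<mu>])
  show "continuous_on (S \<times> UNIV) (\<lambda>(\<xi>, y). hk (\<sigma> \<xi>) (a \<xi>) y)"
    unfolding case_prod_unfold
    by (intro continuous_on_hk continuous_on_compose2[OF c(1)] continuous_on_compose2[OF c(2)] continuous_intros)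
       (auto intro: c)
qed

lemma hgrad_continuous_time:
  assumes \<mu>: "sets \<mu> = sets borel" "integrable \<mu> f"
    and c: "continuous_on S \<sigma>" "continuous_on S a" "\<And>\<xi>. \<xi> \<in> S \<Longrightarrow> \<sigma> \<xi> > 0"
  shows "continuous_on S (\<lambda>\<xi>. hgrad (\<sigma> \<xi>) \<mu> f (a \<xi>))"
  unfolding hgrad_def
proof (rule continuous_on_integral_kernel[OF bounded_bilinear.flip[OF bounded_bilinear_scaleR] \<mu>])
  show "continuous_on (S \<times> UNIV) (\<lambda>(\<xi>, y). hkD (\<sigma> \<xi>) (a \<xi>) y)"
    unfolding case_prod_unfold
    by (intro continuous_on_hk continuous_on_compose2[OF c(1)] continuous_on_compose2[OF c(2)] continuous_intros)
       (auto intro: c)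
qed

lemma hconv_continuous:
  assumes "s > 0" "sets \<mu> = sets borel" "integrable \<mu> f"
  shows "continuous_on UNIV (hconv s \<mu> f)"
  using hconv_continuous_time[OF assms(2,3), of UNIV "\<lambda>_. s" "\<lambda>x. x"] assms(1) by simp

lemma hgrad_continuous:
  assumes "s > 0" "sets \<mu> = sets borel" "integrable \<mu> f"
  shows "continuous_on UNIV (hgrad s \<mu> f)"
  using hgrad_continuous_time[OF assms(2,3), of UNIV "\<lambda>_. s" "\<lambda>x. x"] assms(1) by simp

lemma heatG_deriv_compose:
  fixes b :: "real^'n::finite"
  assumes "\<gamma> + \<beta> * t > 0"
  shows "((\<lambda>(t, x). heatG (\<gamma> + \<beta> * t) (x - b)) has_derivative
    (\<lambda>(\<sigma>, h). \<beta> * heatGs (\<gamma> + \<beta> * t) (x - b) * \<sigma> + heatDG (\<gamma> + \<beta> * t) (x - b) \<bullet> h)) (at (t, x))"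
proof -
  have 1: "((\<lambda>p. (\<gamma> + \<beta> * fst p, snd p - b)) has_derivative (\<lambda>q. (\<beta> * fst q, snd q))) (at (t, x))"
    by (auto intro!: derivative_eq_intros)
  have 2: "((\<lambda>(s, x). heatG s x) has_derivative (\<lambda>(\<sigma>, h). heatGs (\<gamma> + \<beta> * t) (x - b) * \<sigma> + heatDG (\<gamma> + \<beta> * t) (x - b) \<bullet> h))
      (at (\<gamma> + \<beta> * fst (t, x), snd (t, x) - b))"
    using heatG_deriv[OF assms, of "x - b"] by simp
  show ?thesis
    using has_derivative_compose[OF 1 2] by (simp add: case_prod_unfold ac_simps)
qed

lemma heatG_deriv_space:
  fixes b :: "real^'n::finite"
  assumes "s > 0"
  shows "((\<lambda>x. heatG s (x - b)) has_derivative (\<lambda>h. heatDG s (x - b) \<bullet> h)) (at x)"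
proof -
  have 1: "((\<lambda>x. (0::real, x)) has_derivative (\<lambda>h. (0, h))) (at x)"
    by (auto intro!: derivative_eq_intros)
  show ?thesis
    using has_derivative_compose[OF 1 heatG_deriv_compose[of s 0 0 b x, simplified, OF assms]] by simp
qed

lemma hk_C1:
  assumes s: "s > 0"
  shows "C1_torus (\<lambda>x. hk s x y) (\<lambda>x. hkD s x y)"
proof -
  obtain b where y: "y = torus_proj b" by (rule torus_proj_cases)
  show ?thesis
    unfolding C1_torus_def y hk_proj[OF s]
    using hk_continuous1(2)[OF s] heatG_deriv_space[OF s] by auto
qed

lemma hk_C1':
  assumes s: "s > 0"
  shows "C1_torus (\<lambda>y. hk s x y) (\<lambda>y. - hkD s x y)"
proof -
  obtain a where x: "x = torus_proj a" by (rule torus_proj_cases)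
  have "((\<lambda>y. heatG s (a - y)) has_derivative (\<lambda>h. - heatDG s (a - b) \<bullet> h)) (at b)" for b
  proof -
    have 1: "((\<lambda>y. a - y) has_derivative (\<lambda>h. - h)) (at b)" by (auto intro!: derivative_eq_intros)
    show ?thesis
      using has_derivative_compose[OF 1, of "heatG s" "\<lambda>h. heatDG s (a - b) \<bullet> h"] heatG_deriv_space[OF s, of 0 "a - b"] by simp
  qed
  then show ?thesis
    unfolding C1_torus_def x hk_proj[OF s]
    by (intro conjI allI continuous_on_minus hk_continuous1(5)[OF s])
qed

lemma hconv_C1:
  fixes f :: "'n::finite torus \<Rightarrow> real"
  assumes s: "s > 0" and \<mu>: "sets \<mu> = sets borel" "integrable \<mu> f"
  shows "C1_torus (hconv s \<mu> f) (hgrad s \<mu> f)"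
  unfolding C1_torus_def
proof (intro conjI allI)
  show "continuous_on UNIV (hgrad s \<mu> f)" by (rule hgrad_continuous[OF s \<mu>])
  fix x
  have cp: "continuous_on (UNIV :: ((real^'n) \<times> 'n torus) set) (\<lambda>p. torus_proj (fst p))"
    by (intro continuous_on_compose2[OF continuous_on_torus_proj] continuous_intros) auto
  have "((\<lambda>p. LINT y|\<mu>. hk s (torus_proj p) y * f y) has_derivative
      (\<lambda>h. (LINT y|\<mu>. f y *\<^sub>R hkD s (torus_proj x) y) \<bullet> h)) (at x)"
  proof (rule has_derivative_integral_kernel[OF \<mu>, where U=UNIV])
    show "((\<lambda>p. hk s (torus_proj p) y) has_derivative (\<bullet>) (hkD s (torus_proj p) y)) (at p)" for p y
      using hk_C1[OF s, of y] by (simp add: C1_torus_def)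
    show "continuous_on (UNIV \<times> UNIV) (\<lambda>(p, y :: 'n torus). hk s (torus_proj p) y)"
      unfolding case_prod_unfold UNIV_Times_UNIV
      by (rule continuous_on_hk(1)[OF continuous_on_const cp continuous_on_snd[OF continuous_on_id] s])
    show "continuous_on (UNIV \<times> UNIV) (\<lambda>(p, y :: 'n torus). hkD s (torus_proj p) y)"
      unfolding case_prod_unfold UNIV_Times_UNIV
      by (rule continuous_on_hk(2)[OF continuous_on_const cp continuous_on_snd[OF continuous_on_id] s])
  qed auto
  then show "((\<lambda>y. hconv s \<mu> f (torus_proj y)) has_derivative (\<bullet>) (hgrad s \<mu> f (torus_proj x))) (at x)"
    by (simp add: hconv_def hgrad_def)
qed

lemma hk_bound:
  assumes "s > 0"
  obtains C where "0 < C" "\<And>x y :: 'n::finite torus. hk s x y \<le> C" "\<And>x y :: 'n torus. norm (hkD s x y) \<le> C"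
proof -
  obtain C1 where C1: "0 < C1" "\<And>x y :: 'n torus. norm (hk s x y) \<le> C1"
    using continuous_torus_pair_bounded[OF hk_continuous_pair(1)[OF assms]] by blast
  obtain C2 where C2: "0 < C2" "\<And>x y :: 'n torus. norm (hkD s x y) \<le> C2"
    using continuous_torus_pair_bounded[OF hk_continuous_pair(2)[OF assms]] by blast
  show thesis
  proof (rule that[of "max C1 C2"])
    show "hk s x y \<le> max C1 C2" for x y :: "'n torus" using C1(2)[of x y] by auto
    show "norm (hkD s x y) \<le> max C1 C2" for x y :: "'n torus" using C2(2)[of x y] by auto
  qed (use C1 in auto)
qed

section \<open>Duality, positivity and Cauchy-Schwarz for the heat flow\<close>

lemma measurable_hk_pair:
  assumes "s > 0"
  shows "(\<lambda>(x, y). hk s x y) \<in> borel_measurable (borel \<Otimes>\<^sub>M borel)"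
    "(\<lambda>(x, y). hkD s x y) \<in> borel_measurable (borel \<Otimes>\<^sub>M borel)"
  using hk_continuous_pair[OF assms] by (auto intro!: borel_pair_continuous)

text \<open>Symmetry of the kernel and Fubini. Heating the measure and heating the test function
  amount to the same, which is how tests of the heated curve are reduced to tests of the original
  one.\<close>

lemma hconv_adjoint:
  fixes f \<phi> :: "'n::finite torus \<Rightarrow> 'b::euclidean_space"
  assumes s: "s > 0" and \<mu>: "finite_measure \<mu>" "sets \<mu> = sets borel" and f: "integrable \<mu> f" and \<phi>: "integrable Leb \<phi>"
  shows "(LINT x|Leb. \<phi> x \<bullet> hconv s \<mu> f x) = (LINT y|\<mu>. hconv s Leb \<phi> y \<bullet> f y)"
    and "integrable Leb (\<lambda>x. \<phi> x \<bullet> hconv s \<mu> f x)" "integrable \<mu> (\<lambda>y. hconv s Leb \<phi> y \<bullet> f y)"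
proof -
  obtain C where C: "0 < C" "\<And>x y :: 'n torus. hk s x y \<le> C" "\<And>x y :: 'n torus. norm (hkD s x y) \<le> C"
    by (rule hk_bound[OF s]) (rule that)
  note [measurable_cong] = \<mu>(2)
  have [measurable]: "f \<in> borel_measurable borel" "\<phi> \<in> borel_measurable borel"
    using borel_measurable_integrable[OF f] borel_measurable_integrable[OF \<phi>] \<mu> by (simp_all cong: measurable_cong_sets)
  have F: "(\<lambda>(x, y). hk s x y * (\<phi> x \<bullet> f y)) \<in> borel_measurable (borel \<Otimes>\<^sub>M borel)"
    using measurable_hk_pair(1)[OF s] unfolding case_prod_unfold
    by (intro borel_measurable_times borel_measurable_inner measurable_compose[OF measurable_fst] measurable_compose[OF measurable_snd]) auto
  have bound: "\<bar>hk s x y * (\<phi> x \<bullet> f y)\<bar> \<le> (C * norm (\<phi> x)) * norm (f y)" for x y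
  proof -
    have "\<bar>hk s x y * (\<phi> x \<bullet> f y)\<bar> \<le> hk s x y * (norm (\<phi> x) * norm (f y))"
      unfolding abs_mult using hk_nonneg[OF s, of x y] Cauchy_Schwarz_ineq2[of "\<phi> x" "f y"] by (simp add: mult_left_mono)
    also have "\<dots> \<le> C * (norm (\<phi> x) * norm (f y))" using C(2)[of x y] by (intro mult_right_mono) auto
    finally show ?thesis by (simp add: ac_simps)
  qed
  have i1: "integrable Leb (\<lambda>x. C * norm (\<phi> x))" using \<phi> by auto
  have i2: "integrable \<mu> (\<lambda>y. norm (f y))" using f by auto
  have e1: "(LINT y|\<mu>. hk s x y * (\<phi> x \<bullet> f y)) = \<phi> x \<bullet> hconv s \<mu> f x" for x
    unfolding hconv_def using integrable_hk_scaleR[OF s \<mu>(2) f, of x]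
    by (simp add: integral_inner_right[symmetric])
  have e2: "(LINT x|Leb. hk s x y * (\<phi> x \<bullet> f y)) = hconv s Leb \<phi> y \<bullet> f y" for y
    unfolding hconv_def using integrable_hk_scaleR[OF s sets_Leb \<phi>, of y]
    by (simp add: integral_inner_left[symmetric] hk_sym[OF s, of y])
  note F = Fubini_torus[OF Leb.finite_measure_axioms \<mu>(1) sets_Leb \<mu>(2) F i1 i2 bound, unfolded e1 e2]
  show "(LINT x|Leb. \<phi> x \<bullet> hconv s \<mu> f x) = (LINT y|\<mu>. hconv s Leb \<phi> y \<bullet> f y)"
    "integrable Leb (\<lambda>x. \<phi> x \<bullet> hconv s \<mu> f x)" "integrable \<mu> (\<lambda>y. hconv s Leb \<phi> y \<bullet> f y)"
    using F by auto
qed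

lemma hgrad_adjoint:
  fixes f :: "'n::finite torus \<Rightarrow> real"
  assumes s: "s > 0" and \<mu>: "finite_measure \<mu>" "sets \<mu> = sets borel" and f: "integrable \<mu> f" and \<Phi>: "integrable Leb \<Phi>"
  shows "(LINT x|Leb. \<Phi> x \<bullet> hgrad s \<mu> f x) = (LINT y|\<mu>. f y * (LINT x|Leb. \<Phi> x \<bullet> hkD s x y))"
proof -
  obtain C where C: "0 < C" "\<And>x y :: 'n torus. hk s x y \<le> C" "\<And>x y :: 'n torus. norm (hkD s x y) \<le> C"
    by (rule hk_bound[OF s]) (rule that)
  note [measurable_cong] = \<mu>(2)
  have [measurable]: "f \<in> borel_measurable borel" "\<Phi> \<in> borel_measurable borel"
    using borel_measurable_integrable[OF f] borel_measurable_integrable[OF \<Phi>] \<mu> by (simp_all cong: measurable_cong_sets)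
  have F: "(\<lambda>(x, y). f y * (\<Phi> x \<bullet> hkD s x y)) \<in> borel_measurable (borel \<Otimes>\<^sub>M borel)"
    using measurable_hk_pair(2)[OF s] unfolding case_prod_unfold
    by (intro borel_measurable_times borel_measurable_inner measurable_compose[OF measurable_fst] measurable_compose[OF measurable_snd]) auto
  have bound: "\<bar>f y * (\<Phi> x \<bullet> hkD s x y)\<bar> \<le> (C * norm (\<Phi> x)) * norm (f y)" for x y
  proof -
    have "\<bar>\<Phi> x \<bullet> hkD s x y\<bar> \<le> norm (\<Phi> x) * norm (hkD s x y)" by (rule Cauchy_Schwarz_ineq2)
    also have "\<dots> \<le> norm (\<Phi> x) * C" using C(3)[of x y] by (intro mult_left_mono) auto
    finally have "\<bar>f y\<bar> * \<bar>\<Phi> x \<bullet> hkD s x y\<bar> \<le> \<bar>f y\<bar> * (norm (\<Phi> x) * C)" by (intro mult_left_mono) auto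
    then show ?thesis by (simp add: abs_mult ac_simps)
  qed
  have i1: "integrable Leb (\<lambda>x. C * norm (\<Phi> x))" using \<Phi> by auto
  have i2: "integrable \<mu> (\<lambda>y. norm (f y))" using f by auto
  have e1: "(LINT y|\<mu>. f y * (\<Phi> x \<bullet> hkD s x y)) = \<Phi> x \<bullet> hgrad s \<mu> f x" for x
    unfolding hgrad_def
    using integrable_bilinear_continuous[OF bounded_bilinear.flip[OF bounded_bilinear_scaleR] \<mu>(2) f hk_continuous1(5)[OF s, of x]]
    by (simp add: integral_inner_right[symmetric])
  show ?thesis
    using Fubini_torus(1)[OF Leb.finite_measure_axioms \<mu>(1) sets_Leb \<mu>(2) F i1 i2 bound, unfolded e1] by simp
qed

text \<open>As a function of its second point the kernel is a C1 test function with gradient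
  -\<open>hkD\<close>. Testing the weak gradient with it says that gradient and heat flow
  commute.\<close>

lemma hgrad_weak_gradient:
  assumes s: "s > 0" and "weak_gradient u g"
  shows "hgrad s Leb u = hconv s Leb g"
proof
  fix x
  have "(LINT y|Leb. u y *\<^sub>R - hkD s x y) = - (LINT y|Leb. hk s x y *\<^sub>R g y)"
    using assms(2) hk_C1'[OF s, of x] unfolding weak_gradient_def by blast
  then show "hgrad s Leb u x = hconv s Leb g x" by (simp add: hgrad_def hconv_def)
qed

lemma hconv_C1_weak_gradient:
  assumes s: "s > 0" and w: "weak_gradient u g"
  shows "C1_torus (hconv s Leb u) (hconv s Leb g)"
  using hconv_C1[OF s sets_Leb, of u] w unfolding hgrad_weak_gradient[OF s w] by (simp add: weak_gradient_def)

lemma hconv_const: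
  fixes v :: "'b::{banach, second_countable_topology}"
  assumes "s > 0" shows "hconv s Leb (\<lambda>_. v) x = v"
proof -
  have "(LINT y|Leb. hk s x y) = 1" using integral_hk[OF assms, of x] by (simp add: hk_sym[OF assms, of x])
  moreover have "integrable Leb (\<lambda>y. hk s x y)" using integrable_hk[OF assms, of x] by (simp add: hk_sym[OF assms, of x])
  ultimately show ?thesis unfolding hconv_def by simp
qed

lemma integral_hconv:
  fixes f :: "'n::finite torus \<Rightarrow> real"
  assumes s: "s > 0" and \<mu>: "finite_measure \<mu>" "sets \<mu> = sets borel" and f: "integrable \<mu> f"
  shows "(LINT x|Leb. hconv s \<mu> f x) = (LINT y|\<mu>. f y)"
  using hconv_adjoint(1)[OF s \<mu> f, of "\<lambda>_. 1"] by (simp add: hconv_const[OF s])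

text \<open>By compactness the kernel has a positive minimum in y, a lower bound for its average
  over any probability measure. Strict positivity makes quotients by the heated density and its
  logarithm continuous.\<close>

lemma hconv_pos:
  assumes s: "s > 0" and \<mu>: "prob_space \<mu>" "sets \<mu> = sets borel"
  shows "0 < hconv s \<mu> (\<lambda>_. 1 :: real) x"
proof -
  interpret prob_space \<mu> by fact
  have c: "continuous_on UNIV (hk s x)" by (rule hk_continuous1(4)[OF s])
  obtain y0 where y0: "\<And>y. hk s x y0 \<le> hk s x y"
    using continuous_attains_inf[OF compact_torus _ c] by auto
  have "hk s x y0 = (LINT y|\<mu>. hk s x y0)" by (simp add: prob_space)
  also have "\<dots> \<le> (LINT y|\<mu>. hk s x y)"
    by (intro integral_mono continuous_Leb_integrable[OF finite_measure_axioms \<mu>(2)] c y0) auto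
  finally show ?thesis using hk_pos[OF s, of x y0] by (simp add: hconv_def)
qed

lemma quadratic_nonneg_discriminant:
  fixes A B I :: real
  assumes "\<And>l. 0 \<le> A - 2 * l * I + l\<^sup>2 * B"
  shows "I\<^sup>2 \<le> A * B"
proof (cases "B = 0")
  case True
  have "I = 0"
  proof (rule ccontr)
    assume "I \<noteq> 0"
    \<comment> \<open>With this l the expression equals A - (A + 1) = -1.\<close>
    then show False using assms[of "(A + 1) / (2 * I)"] True by simp
  qed
  then show ?thesis using True by simp
next
  case False
  have "B > 0"
  proof (rule ccontr)
    assume "\<not> B > 0"
    with False have B: "B < 0" by simp
    \<comment> \<open>Chosen so that l \<ge> 1 and l (- B) \<ge> \<bar>A\<bar> + 1. The inequalities
      for l and for -l are then incompatible, because adding them cancels the linear term.\<close>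
    define l where "l = (\<bar>A\<bar> + 1) / (- B) + 1"
    have "l * (- B) = \<bar>A\<bar> + 1 - B" using B by (simp add: l_def field_simps)
    moreover have "(\<bar>A\<bar> + 1) / (- B) \<ge> 0" using B by (intro divide_nonneg_pos) auto
    ultimately have *: "l * (- B) \<ge> \<bar>A\<bar> + 1" "l \<ge> 1" using B by (simp_all add: l_def)
    have "0 \<le> l * (- B)" using *(1) by linarith
    from mult_right_mono[OF *(2) this] have "l\<^sup>2 * (- B) \<ge> \<bar>A\<bar> + 1"
      using *(1) unfolding power2_eq_square mult.assoc by linarith
    moreover have "0 \<le> A - 2 * l * I + l\<^sup>2 * B" "0 \<le> A - 2 * (- l) * I + (- l)\<^sup>2 * B" by (rule assms)+
    ultimately show False by simp
  qed
  moreover have "0 \<le> A - 2 * (I / B) * I + (I / B)\<^sup>2 * B" by (rule assms)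
  ultimately have "I * I / B \<le> A" by (simp add: power2_eq_square)
  with \<open>B > 0\<close> show ?thesis by (simp add: power2_eq_square pos_divide_le_eq)
qed

text \<open>Two instances matter. With w = 1 it is Jensen's inequality for the kinetic energy,
  bounding the smoothed momentum by the smoothed density; with w a square root of the density it
  controls the Fisher information. The proof is the discriminant argument for the measure with
  density \<open>hk s x\<close>.\<close>

lemma hconv_Cauchy_Schwarz:
  fixes c :: "'n::finite torus \<Rightarrow> 'b::euclidean_space" and w :: "'n torus \<Rightarrow> real"
  assumes s: "s > 0" and \<mu>: "finite_measure \<mu>" "sets \<mu> = sets borel"
    and c: "integrable \<mu> (\<lambda>y. (norm (c y))\<^sup>2)" "c \<in> borel_measurable borel"
    and w: "integrable \<mu> (\<lambda>y. (w y)\<^sup>2)" "w \<in> borel_measurable borel"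
  shows "(norm (hconv s \<mu> (\<lambda>y. w y *\<^sub>R c y) x))\<^sup>2 \<le> hconv s \<mu> (\<lambda>y. (w y)\<^sup>2) x * hconv s \<mu> (\<lambda>y. (norm (c y))\<^sup>2) x"
proof -
  note [measurable_cong] = \<mu>(2)
  note [measurable] = c(2) w(2)
  have i0: "integrable \<mu> (\<lambda>y. \<bar>w y\<bar> * norm (c y))"
  proof (rule Bochner_Integration.integrable_bound)
    show "integrable \<mu> (\<lambda>y. (w y)\<^sup>2 + (norm (c y))\<^sup>2)" using c w by auto
    have "\<bar>w y\<bar> * norm (c y) \<le> (w y)\<^sup>2 + (norm (c y))\<^sup>2" for y
    proof -
      have "2 * (\<bar>w y\<bar> * norm (c y)) \<le> (w y)\<^sup>2 + (norm (c y))\<^sup>2"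
        using sum_squares_bound[of "\<bar>w y\<bar>" "norm (c y)"] by (simp add: mult.assoc)
      moreover have "0 \<le> \<bar>w y\<bar> * norm (c y)" by simp
      ultimately show ?thesis by linarith
    qed
    then show "AE y in \<mu>. norm (\<bar>w y\<bar> * norm (c y)) \<le> norm ((w y)\<^sup>2 + (norm (c y))\<^sup>2)"
      by (intro AE_I2) (simp add: abs_mult)
  qed measurable
  note int = integrable_hk_scaleR[OF s \<mu>(2), of _ x]
  define I where "I = hconv s \<mu> (\<lambda>y. \<bar>w y\<bar> * norm (c y)) x"
  have "I\<^sup>2 \<le> hconv s \<mu> (\<lambda>y. (w y)\<^sup>2) x * hconv s \<mu> (\<lambda>y. (norm (c y))\<^sup>2) x"
  proof (rule quadratic_nonneg_discriminant)
    fix l :: real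
    have "0 \<le> (LINT y|\<mu>. hk s x y * (\<bar>w y\<bar> - l * norm (c y))\<^sup>2)"
      by (intro Bochner_Integration.integral_nonneg mult_nonneg_nonneg hk_nonneg[OF s] zero_le_power2)
    also have "\<dots> = (LINT y|\<mu>. hk s x y * (w y)\<^sup>2 - 2 * l * (hk s x y * (\<bar>w y\<bar> * norm (c y))) + l\<^sup>2 * (hk s x y * (norm (c y))\<^sup>2))"
      by (intro Bochner_Integration.integral_cong) (auto simp: power2_eq_square algebra_simps)
    also have "\<dots> = hconv s \<mu> (\<lambda>y. (w y)\<^sup>2) x - 2 * l * I + l\<^sup>2 * hconv s \<mu> (\<lambda>y. (norm (c y))\<^sup>2) x"
      using int[OF w(1)] int[OF c(1)] int[OF i0] by (simp add: hconv_def I_def)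
    finally show "0 \<le> hconv s \<mu> (\<lambda>y. (w y)\<^sup>2) x - 2 * l * I + l\<^sup>2 * hconv s \<mu> (\<lambda>y. (norm (c y))\<^sup>2) x" .
  qed
  moreover have "norm (hconv s \<mu> (\<lambda>y. w y *\<^sub>R c y) x) \<le> I"
    unfolding hconv_def I_def
  proof (rule norm_integral_le)
    have "integrable \<mu> (\<lambda>y. w y *\<^sub>R c y)"
      by (rule Bochner_Integration.integrable_bound[OF i0]) auto
    then show "integrable \<mu> (\<lambda>y. hk s x y *\<^sub>R w y *\<^sub>R c y)" by (rule integrable_hk_scaleR[OF s \<mu>(2)])
    show "integrable \<mu> (\<lambda>y. hk s x y *\<^sub>R (\<bar>w y\<bar> * norm (c y)))" by (rule int[OF i0])
    show "norm (hk s x y *\<^sub>R w y *\<^sub>R c y) \<le> hk s x y *\<^sub>R (\<bar>w y\<bar> * norm (c y))" for y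
      using hk_nonneg[OF s, of x y] by (simp add: abs_mult)
  qed
  ultimately show ?thesis
    by (meson norm_ge_zero order_trans power_mono)
qed

text \<open>\<open>hconv s Leb \<phi> \<longrightarrow> \<phi>\<close> uniformly: away from the diagonal \<open>torus_gap\<close> is bounded below, and
  its average against the heat kernel is of order \<open>s\<close>.\<close>

lemma hconv_uniform_approx:
  fixes \<phi> :: "'n::finite torus \<Rightarrow> 'b::{banach, second_countable_topology}"
  assumes \<phi>: "continuous_on UNIV \<phi>" and e: "\<epsilon> > 0"
  obtains s0 where "s0 > 0" "\<And>s y. 0 < s \<Longrightarrow> s < s0 \<Longrightarrow> norm (hconv s Leb \<phi> y - \<phi> y) \<le> \<epsilon>"
proof -
  obtain M where M: "0 < M" "\<And>x. norm (\<phi> x) \<le> M" using continuous_torus_bounded[OF \<phi>] by blast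
  have cf: "continuous_on UNIV (\<lambda>p. \<phi> (fst p))" "continuous_on UNIV (\<lambda>p. \<phi> (snd p))"
    by (auto intro!: continuous_on_compose2[OF \<phi>] continuous_intros)
  \<comment> \<open>The pairs at which \<phi> oscillates by at least half of \<epsilon>. This
    compact set misses the diagonal, so the gap has a positive lower bound \<open>c\<close> on
    it.\<close>
  define S where "S = {p :: 'n torus \<times> 'n torus. \<epsilon>/2 \<le> norm (\<phi> (fst p) - \<phi> (snd p))}"
  have "closed S" unfolding S_def by (intro closed_Collect_le continuous_intros cf)
  then have S: "compact S"
    using compact_Int_closed[OF compact_Times[OF compact_torus compact_torus], of S] by simp
  obtain c where c: "c > 0" "\<And>p. p \<in> S \<Longrightarrow> c \<le> torus_gap (fst p) (snd p)"
  proof (cases "S = {}")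
    case False
    have "continuous_on S (\<lambda>p. torus_gap (fst p) (snd p))" by (intro continuous_intros)
    from continuous_attains_inf[OF S False this] obtain p0 where
      p0: "p0 \<in> S" "\<And>p. p \<in> S \<Longrightarrow> torus_gap (fst p0) (snd p0) \<le> torus_gap (fst p) (snd p)" by blast
    have "fst p0 \<noteq> snd p0" using p0(1) e by (auto simp: S_def)
    then have "0 < torus_gap (fst p0) (snd p0)"
      using torus_gap_nonneg[of "fst p0" "snd p0"] torus_gap_eq_0[of "fst p0" "snd p0"] by linarith
    then show thesis using p0 that by blast
  qed (use that[of 1] in auto)
  \<comment> \<open>Off \<open>S\<close> the first term suffices; on \<open>S\<close> the
    oscillation is at most 2 M and the gap divided by \<open>c\<close> is at least 1.\<close>
  have est: "norm (\<phi> x - \<phi> y) \<le> \<epsilon>/2 + (2 * M / c) * torus_gap x y" for x y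
  proof (cases "(x, y) \<in> S")
    case True
    have "norm (\<phi> x - \<phi> y) \<le> 2 * M" using norm_triangle_ineq4[of "\<phi> x" "\<phi> y"] M(2)[of x] M(2)[of y] by linarith
    also have "2 * M \<le> 2 * M * (torus_gap x y / c)"
      using c(2)[OF True] c(1) M(1) by (simp add: pos_le_divide_eq)
    also have "\<dots> = (2 * M / c) * torus_gap x y" by simp
    finally show ?thesis using e by linarith
  next
    case False
    then show ?thesis using torus_gap_nonneg[of x y] M(1) c(1) by (simp add: S_def add_increasing2 not_le less_imp_le)
  qed
  \<comment> \<open>\<open>L * s\<close> bounds the average of the second term of
    \<open>est\<close>, which explains the threshold \<epsilon> / (2 L).\<close>
  define L where "L = 2 * M / c * (real CARD('n) * (2 * pi\<^sup>2))"
  have L: "L > 0" using M c by (simp add: L_def)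
  show thesis
  proof (rule that[of "\<epsilon> / (2 * L)"])
    show "\<epsilon> / (2 * L) > 0" using e L by simp
    fix s and y :: "'n torus" assume s: "0 < s" "s < \<epsilon> / (2 * L)"
    have gap_int: "integrable Leb (\<lambda>x. hk s x y * torus_gap x y)"
      using s by (intro continuous_integrable_Leb continuous_intros) auto
    have gap: "(LINT x|Leb. hk s x y * torus_gap x y) \<le> real CARD('n) * (2 * pi\<^sup>2 * s)"
    proof -
      have "ennreal (LINT x|Leb. hk s x y * torus_gap x y) = (\<integral>\<^sup>+x. ennreal (hk s x y * torus_gap x y) \<partial>Leb)"
        using hk_nonneg[OF s(1)] torus_gap_nonneg
        by (intro nn_integral_eq_integral[symmetric] gap_int) (auto intro!: AE_I2 mult_nonneg_nonneg)
      also have "\<dots> \<le> ennreal (real CARD('n) * (2 * pi\<^sup>2 * s))" by (rule nn_integral_hk_gap[OF s(1)])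
      finally show ?thesis using s by (subst (asm) ennreal_le_iff) auto
    qed
    have i\<phi>: "integrable Leb \<phi>" by (rule continuous_integrable_Leb[OF \<phi>])
    have "hconv s Leb \<phi> y - \<phi> y = hconv s Leb \<phi> y - hconv s Leb (\<lambda>_. \<phi> y) y" by (simp add: hconv_const[OF s(1)])
    also have "\<dots> = (LINT x|Leb. hk s x y *\<^sub>R (\<phi> x - \<phi> y))"
      unfolding hconv_def scaleR_diff_right hk_sym[OF s(1), of _ y]
      using integrable_hk_scaleR[OF s(1) sets_Leb i\<phi>, of y] integrable_hk_scaleR[OF s(1) sets_Leb, of "\<lambda>_. \<phi> y" y]
      by (intro Bochner_Integration.integral_diff[symmetric]) auto
    also have "norm \<dots> \<le> (LINT x|Leb. hk s x y * (\<epsilon>/2) + (2 * M / c) * (hk s x y * torus_gap x y))"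
    proof (rule norm_integral_le)
      show "integrable Leb (\<lambda>x. hk s x y *\<^sub>R (\<phi> x - \<phi> y))"
        using s by (intro continuous_integrable_Leb continuous_intros \<phi>) auto
      show "integrable Leb (\<lambda>x. hk s x y * (\<epsilon>/2) + (2 * M / c) * (hk s x y * torus_gap x y))"
        by (intro Bochner_Integration.integrable_add integrable_mult_left integrable_mult_right integrable_hk[OF s(1)] gap_int)
      show "norm (hk s x y *\<^sub>R (\<phi> x - \<phi> y)) \<le> hk s x y * (\<epsilon>/2) + (2 * M / c) * (hk s x y * torus_gap x y)" for x
        using mult_left_mono[OF est[of x y] hk_nonneg[OF s(1), of x y]] hk_nonneg[OF s(1), of x y]
        by (simp add: distrib_left ac_simps)
    qed
    also have "\<dots> = \<epsilon>/2 + (2 * M / c) * (LINT x|Leb. hk s x y * torus_gap x y)"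
      by (subst Bochner_Integration.integral_add)
         (simp_all only: integrable_mult_left integrable_mult_right integrable_hk[OF s(1)] gap_int
           integral_mult_left_zero integral_mult_right_zero integral_hk[OF s(1)] mult_1_left)
    also have "\<dots> \<le> \<epsilon>/2 + (2 * M / c) * (real CARD('n) * (2 * pi\<^sup>2 * s))"
      using gap M c by (intro add_left_mono mult_left_mono) auto
    also have "\<dots> = \<epsilon>/2 + L * s" by (simp add: L_def)
    also have "\<dots> \<le> \<epsilon>" using s L by (simp add: field_simps)
    finally show "norm (hconv s Leb \<phi> y - \<phi> y) \<le> \<epsilon>" .
  qed
qed

section \<open>Density of continuous functions\<close>

text \<open>Density of the continuous functions in L1, stated for one function at a time so that the
  class can be shown stable under the steps of the standard induction over integrable
  functions.\<close>

definition L1_approximable :: "'n::finite torus measure \<Rightarrow> ('n torus \<Rightarrow> real) \<Rightarrow> bool" where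
  "L1_approximable \<mu> f \<longleftrightarrow> (\<forall>e>0. \<exists>\<phi>. continuous_on UNIV \<phi> \<and> (LINT x|\<mu>. \<bar>f x - \<phi> x\<bar>) < e)"

context
  fixes \<mu> :: "'n::finite torus measure"
  assumes \<mu>: "finite_measure \<mu>" "sets \<mu> = sets borel"
begin

lemma L1_approximable_closure:
  assumes f: "integrable \<mu> f" and g: "\<And>e. e > 0 \<Longrightarrow> \<exists>g. integrable \<mu> g \<and> L1_approximable \<mu> g \<and> (LINT x|\<mu>. \<bar>f x - g x\<bar>) < e"
  shows "L1_approximable \<mu> f"
  unfolding L1_approximable_def
proof (intro allI impI)
  fix e :: real assume "e > 0"
  then have e2: "e / 2 > 0" by simp
  then obtain g where g: "integrable \<mu> g" "L1_approximable \<mu> g" "(LINT x|\<mu>. \<bar>f x - g x\<bar>) < e / 2"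
    using assms(2) by blast
  then obtain \<phi> where \<phi>: "continuous_on UNIV \<phi>" "(LINT x|\<mu>. \<bar>g x - \<phi> x\<bar>) < e / 2"
    unfolding L1_approximable_def using e2 by blast
  have i: "integrable \<mu> \<phi>" by (rule continuous_Leb_integrable[OF \<mu> \<phi>(1)])
  have "(LINT x|\<mu>. \<bar>f x - \<phi> x\<bar>) \<le> (LINT x|\<mu>. \<bar>f x - g x\<bar> + \<bar>g x - \<phi> x\<bar>)"
    using f g(1) i by (intro integral_mono) auto
  also have "\<dots> = (LINT x|\<mu>. \<bar>f x - g x\<bar>) + (LINT x|\<mu>. \<bar>g x - \<phi> x\<bar>)"
    using f g(1) i by (intro Bochner_Integration.integral_add) auto
  also have "\<dots> < e" using g \<phi> by linarith
  finally show "\<exists>\<phi>. continuous_on UNIV \<phi> \<and> (LINT x|\<mu>. \<bar>f x - \<phi> x\<bar>) < e" using \<phi>(1) by blast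
qed

lemma L1_approximable_continuous: "continuous_on UNIV \<phi> \<Longrightarrow> L1_approximable \<mu> \<phi>"
  unfolding L1_approximable_def by (auto intro!: exI[of _ \<phi>])

lemma L1_approximable_add:
  assumes f: "integrable \<mu> f" "L1_approximable \<mu> f" and g: "integrable \<mu> g" "L1_approximable \<mu> g"
  shows "L1_approximable \<mu> (\<lambda>x. f x + g x)"
  unfolding L1_approximable_def
proof (intro allI impI)
  fix e :: real assume "e > 0"
  then have e2: "e / 2 > 0" by simp
  obtain \<phi> where \<phi>: "continuous_on UNIV \<phi>" "(LINT x|\<mu>. \<bar>f x - \<phi> x\<bar>) < e / 2"
    using f(2) e2 unfolding L1_approximable_def by blast
  obtain \<psi> where \<psi>: "continuous_on UNIV \<psi>" "(LINT x|\<mu>. \<bar>g x - \<psi> x\<bar>) < e / 2"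
    using g(2) e2 unfolding L1_approximable_def by blast
  note i = continuous_Leb_integrable[OF \<mu> \<phi>(1)] continuous_Leb_integrable[OF \<mu> \<psi>(1)]
  have "(LINT x|\<mu>. \<bar>f x + g x - (\<phi> x + \<psi> x)\<bar>) \<le> (LINT x|\<mu>. \<bar>f x - \<phi> x\<bar> + \<bar>g x - \<psi> x\<bar>)"
    using f g i by (intro integral_mono) auto
  also have "\<dots> = (LINT x|\<mu>. \<bar>f x - \<phi> x\<bar>) + (LINT x|\<mu>. \<bar>g x - \<psi> x\<bar>)"
    using f g i by (intro Bochner_Integration.integral_add) auto
  also have "\<dots> < e" using \<phi> \<psi> by linarith
  finally show "\<exists>\<phi>. continuous_on UNIV \<phi> \<and> (LINT x|\<mu>. \<bar>f x + g x - \<phi> x\<bar>) < e"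
    using \<phi>(1) \<psi>(1) by (intro exI[of _ "\<lambda>x. \<phi> x + \<psi> x"]) (auto intro: continuous_intros)
qed

lemma L1_approximable_cmult:
  assumes f: "L1_approximable \<mu> f" shows "L1_approximable \<mu> (\<lambda>x. c * f x)"
  unfolding L1_approximable_def
proof (intro allI impI)
  fix e :: real assume "e > 0"
  then have "e / (\<bar>c\<bar> + 1) > 0" by simp
  then obtain \<phi> where \<phi>: "continuous_on UNIV \<phi>" "(LINT x|\<mu>. \<bar>f x - \<phi> x\<bar>) < e / (\<bar>c\<bar> + 1)"
    using f unfolding L1_approximable_def by blast
  have "(LINT x|\<mu>. \<bar>c * f x - c * \<phi> x\<bar>) = \<bar>c\<bar> * (LINT x|\<mu>. \<bar>f x - \<phi> x\<bar>)"
    by (simp add: abs_mult flip: right_diff_distrib)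
  also have "\<dots> \<le> (\<bar>c\<bar> + 1) * (LINT x|\<mu>. \<bar>f x - \<phi> x\<bar>)" by (intro mult_right_mono) auto
  also have "\<dots> < e" using \<phi>(2) by (simp add: pos_less_divide_eq mult.commute)
  finally show "\<exists>\<phi>. continuous_on UNIV \<phi> \<and> (LINT x|\<mu>. \<bar>c * f x - \<phi> x\<bar>) < e"
    using \<phi>(1) by (intro exI[of _ "\<lambda>x. c * \<phi> x"]) (auto intro: continuous_intros)
qed

lemma L1_approximable_dominated:
  assumes s: "\<And>i. integrable \<mu> (s i)" "\<And>i::nat. L1_approximable \<mu> (s i)" and f: "integrable \<mu> f" and w: "integrable \<mu> w"
    and lim: "\<And>x. (\<lambda>i. s i x) \<longlonglongrightarrow> f x" and bound: "\<And>i x. \<bar>s i x\<bar> \<le> w x"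
  shows "L1_approximable \<mu> f"
proof (rule L1_approximable_closure[OF f])
  fix e :: real assume e: "e > 0"
  have "(\<lambda>i. LINT x|\<mu>. \<bar>f x - s i x\<bar>) \<longlonglongrightarrow> (LINT x|\<mu>. 0)"
  proof (rule integral_dominated_convergence[where w="\<lambda>x. \<bar>f x\<bar> + w x"])
    show "AE x in \<mu>. (\<lambda>i. \<bar>f x - s i x\<bar>) \<longlonglongrightarrow> 0"
      using lim by (intro AE_I2) (auto intro!: tendsto_eq_intros)
    show "AE x in \<mu>. norm \<bar>f x - s i x\<bar> \<le> \<bar>f x\<bar> + w x" for i
    proof (rule AE_I2)
      fix x show "norm \<bar>f x - s i x\<bar> \<le> \<bar>f x\<bar> + w x" using bound[of i x] by simp
    qed
  qed (use s f w in auto)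
  then have "(\<lambda>i. LINT x|\<mu>. \<bar>f x - s i x\<bar>) \<longlonglongrightarrow> 0" by simp
  from order_tendstoD(2)[OF this e] obtain i where "(LINT x|\<mu>. \<bar>f x - s i x\<bar>) < e"
    by (auto simp: eventually_sequentially)
  then show "\<exists>g. integrable \<mu> g \<and> L1_approximable \<mu> g \<and> (LINT x|\<mu>. \<bar>f x - g x\<bar>) < e" using s by blast
qed

text \<open>Induction from the open sets, a generator stable under intersections. For open U, n
  times a continuous function that vanishes exactly off U, truncated at 1, converges to the
  indicator; complements and disjoint unions follow by linearity and dominated convergence.\<close>

lemma L1_approximable_indicator:
  assumes "A \<in> sets borel" shows "L1_approximable \<mu> (indicator A)"
proof -
  interpret finite_measure \<mu> by (rule \<mu>)
  have ind: "integrable \<mu> (indicator A :: _ \<Rightarrow> real)" if "A \<in> sets borel" for A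
    using that \<mu>(2) by (intro integrable_real_indicator) (auto simp: less_top[symmetric] emeasure_finite)
  have "A \<in> sigma_sets UNIV {S. open S}" using assms by (simp add: borel_def)
  moreover have sig: "sigma_sets UNIV {S. open S} = sets (borel :: 'n torus measure)" by (simp add: borel_def)
  moreover have "Int_stable {S :: 'n torus set. open S}" by (auto simp: Int_stable_def)
  moreover have "{S :: 'n torus set. open S} \<subseteq> Pow UNIV" by auto
  ultimately have "Int_stable {S :: 'n torus set. open S}" "{S :: 'n torus set. open S} \<subseteq> Pow UNIV"
    "A \<in> sigma_sets UNIV {S. open S}" by blast+
  then show ?thesis
  proof (induction rule: sigma_sets_induct_disjoint)
    case (basic U)
    then have U: "open U" by simp
    show ?case
    proof (cases "U = UNIV")
      case True
      then show ?thesis by (intro L1_approximable_continuous) (auto simp: indicator_def)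
    next
      case False
      with U obtain d :: "'n torus \<Rightarrow> real" where d: "continuous_on UNIV d" "\<And>x. 0 \<le> d x" "\<And>x. d x = 0 \<longleftrightarrow> x \<in> - U"
        using closed_torus_zero_set[of "- U"] by (metis Compl_UNIV_eq Compl_eq_Compl_iff closed_Compl)
      define s where "s n x = min 1 (real n * d x)" for n :: nat and x
      have sc: "continuous_on UNIV (s n)" for n
        unfolding s_def by (intro continuous_intros d)
      show ?thesis
      proof (rule L1_approximable_dominated[of s _ "\<lambda>_. 1"])
        show "integrable \<mu> (s n)" for n by (rule continuous_Leb_integrable[OF \<mu> sc])
        show "L1_approximable \<mu> (s n)" for n by (rule L1_approximable_continuous[OF sc])
        show "integrable \<mu> (indicator U :: _ \<Rightarrow> real)" using U by (intro ind) auto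
        show "\<bar>s n x\<bar> \<le> 1" for n x using d(2)[of x] by (simp add: s_def)
        show "(\<lambda>n. s n x) \<longlonglongrightarrow> indicator U x" for x
        proof (cases "x \<in> U")
          case True
          then have dx: "d x > 0" using d(2,3)[of x] by (metis ComplD order_le_less)
          have "\<forall>\<^sub>F n in sequentially. s n x = 1"
          proof -
            obtain N :: nat where N: "1 / d x < real N" using reals_Archimedean2 by blast
            have "s n x = 1" if "n \<ge> N" for n
            proof -
              have "1 / d x < real n" using N that by linarith
              then have "1 < real n * d x" using dx by (simp add: pos_divide_less_eq)
              then show ?thesis by (simp add: s_def)
            qed
            then show ?thesis by (auto simp: eventually_sequentially)
          qed
          then show ?thesis using True by (simp add: tendsto_eventually)
        next
          case False
          then have "d x = 0" using d(3) by simp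
          then show ?thesis using False by (simp add: s_def)
        qed
      qed simp
    qed
  next
    case empty
    then show ?case using L1_approximable_continuous[of "\<lambda>_. 0"] by (simp add: indicator_def[abs_def])
  next
    case (compl A)
    then have A: "A \<in> sets borel" by (simp add: sig)
    have eq: "indicator (UNIV - A) = (\<lambda>x. 1 + (-1) * indicator A x :: real)" by (auto simp: indicator_def)
    have "integrable \<mu> (\<lambda>x. (-1) * indicator A x :: real)" using ind[OF A] by (intro integrable_mult_right) auto
    then show ?case
      unfolding eq
      by (intro L1_approximable_add L1_approximable_cmult compl(2) L1_approximable_continuous ind A) auto
  next
    case (union A)
    then have A: "A i \<in> sets borel" for i by (auto simp: sig)
    define s where "s n x = (\<Sum>i<n. indicator (A i) x :: real)" for n x
    have s: "integrable \<mu> (s n) \<and> L1_approximable \<mu> (s n)" for n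
    proof (induction n)
      case 0
      then show ?case using L1_approximable_continuous[of "\<lambda>_. 0"] by (simp add: s_def[abs_def])
    next
      case (Suc n)
      have "s (Suc n) = (\<lambda>x. s n x + indicator (A n) x)" by (simp add: s_def fun_eq_iff)
      then show ?case using Suc union.IH[of n] ind[OF A[of n]] by (auto intro: L1_approximable_add)
    qed
    have eq: "s n x = indicator (\<Union>i<n. A i) x" for n x
      unfolding s_def using union(1)
      by (subst indicator_UN_disjoint) (auto simp: disjoint_family_on_def)
    show ?case
    proof (rule L1_approximable_dominated[of s _ "\<lambda>_. 1"])
      show "integrable \<mu> (indicator (\<Union>i. A i) :: _ \<Rightarrow> real)" using A by (intro ind) auto
      show "\<bar>s n x\<bar> \<le> 1" for n x unfolding eq by (simp add: indicator_def)
      show "(\<lambda>n. s n x) \<longlonglongrightarrow> indicator (\<Union>i. A i) x" for x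
        unfolding eq by (rule LIMSEQ_indicator_UN)
    qed (use s in auto)
  qed
qed

lemma integrable_L1_approximable:
  assumes f: "integrable \<mu> (f :: 'n torus \<Rightarrow> real)" shows "L1_approximable \<mu> f"
  using f
proof (induction rule: integrable_induct)
  case (base A c)
  then show ?case using L1_approximable_cmult[OF L1_approximable_indicator, of A c] \<mu>(2) by (simp add: mult.commute)
next
  case (add f g)
  then show ?case by (intro L1_approximable_add)
next
  case (lim f s)
  have sp: "space \<mu> = UNIV" using sets_eq_imp_space_eq[OF \<mu>(2)] by simp
  show ?case
    by (rule L1_approximable_dominated[of s f "\<lambda>x. 2 * norm (f x)"]) (use lim sp in auto)
qed

text \<open>Clamping an approximant to the range from -B to B only brings it closer to f. The
  uniform bound keeps exponentials of the approximants under control in the entropy duality.\<close>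

lemma bounded_continuous_approx:
  fixes B :: real
  assumes f: "f \<in> borel_measurable borel" and B: "\<And>x. \<bar>f x\<bar> \<le> B" and e: "e > 0"
  obtains \<phi> where "continuous_on UNIV \<phi>" "\<And>x. \<bar>\<phi> x\<bar> \<le> B" "(LINT x|\<mu>. \<bar>f x - \<phi> x\<bar>) < e"
proof -
  interpret finite_measure \<mu> by (rule \<mu>)
  have f': "f \<in> borel_measurable \<mu>" using f \<mu>(2) by (simp cong: measurable_cong_sets)
  then have fi: "integrable \<mu> f" using B by (intro integrable_const_bound[of _ B]) auto
  from integrable_L1_approximable[OF this] e
  obtain \<psi> where \<psi>: "continuous_on UNIV \<psi>" "(LINT x|\<mu>. \<bar>f x - \<psi> x\<bar>) < e" unfolding L1_approximable_def by blast
  define \<phi> where "\<phi> x = max (- B) (min B (\<psi> x))" for x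
  have c: "continuous_on UNIV \<phi>" unfolding \<phi>_def by (intro continuous_intros \<psi>)
  have Bn: "0 \<le> B" using B[of undefined] by linarith
  have "(LINT x|\<mu>. \<bar>f x - \<phi> x\<bar>) \<le> (LINT x|\<mu>. \<bar>f x - \<psi> x\<bar>)"
  proof (rule integral_mono)
    show "integrable \<mu> (\<lambda>x. \<bar>f x - \<phi> x\<bar>)" "integrable \<mu> (\<lambda>x. \<bar>f x - \<psi> x\<bar>)"
      using fi continuous_Leb_integrable[OF \<mu> c] continuous_Leb_integrable[OF \<mu> \<psi>(1)] by auto
    show "\<bar>f x - \<phi> x\<bar> \<le> \<bar>f x - \<psi> x\<bar>" for x using B[of x] by (auto simp: \<phi>_def max_def min_def abs_if split: if_splits)
  qed
  with \<psi> have "(LINT x|\<mu>. \<bar>f x - \<phi> x\<bar>) < e" by linarith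
  moreover have "\<bar>\<phi> x\<bar> \<le> B" for x using Bn by (auto simp: \<phi>_def)
  ultimately show thesis using that c by blast
qed

end

section \<open>Entropy\<close>

lemma measure_Leb_UNIV [simp]: "measure (Leb :: 'n::finite torus measure) UNIV = 1"
  using Leb.prob_space by simp

definition ent :: "('n::finite torus \<Rightarrow> real) \<Rightarrow> real" where
  "ent u = (LINT x|Leb. u x * ln (u x))"

text \<open>Tangent line of the convex function s ln s at b, valid up to a = 0 by the convention 0 *
  ln 0 = 0. Jensen's inequality, the duality bound and the time increments of the entropy are all
  read off from it.\<close>

lemma xlnx_tangent:
  fixes a b :: real
  assumes "0 \<le> a" "0 < b"
  shows "b * ln b + (1 + ln b) * (a - b) \<le> a * ln a"
proof (cases "a = 0")
  case False
  with assms have a: "a > 0" by simp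
  have "ln (b / a) \<le> b / a - 1" using a assms by (intro ln_le_minus_one) auto
  then have "a * ln (b / a) \<le> a * (b / a - 1)" using a by (intro mult_left_mono) auto
  then have "a * ln b - a * ln a \<le> b - a" using a assms by (simp add: ln_div algebra_simps)
  then show ?thesis by (simp add: algebra_simps)
qed (use assms in \<open>simp add: algebra_simps\<close>)

lemma xlnx_ge: "0 \<le> a \<Longrightarrow> - 1 \<le> a * ln a" for a :: real
  using xlnx_tangent[of a 1] by simp

text \<open>The tangent at b = exp (p - 1), the point where the slope 1 + ln b equals p.\<close>

lemma young_entropy: "0 \<le> a \<Longrightarrow> p * a \<le> a * ln a + exp (p - 1)" for a p :: real
  using xlnx_tangent[of a "exp (p - 1)"] by (simp add: algebra_simps)

lemma ent_integrable:
  fixes u :: "'n::finite torus \<Rightarrow> real"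
  assumes "continuous_on UNIV u" "\<And>x. 0 < u x"
  shows "continuous_on UNIV (\<lambda>x. ln (u x))" "continuous_on UNIV (\<lambda>x. u x * ln (u x))" "integrable Leb (\<lambda>x. u x * ln (u x))"
proof -
  have nz: "\<forall>x\<in>UNIV. u x \<noteq> 0"
  proof
    fix x show "u x \<noteq> 0" using assms(2)[of x] by simp
  qed
  show 1: "continuous_on UNIV (\<lambda>x. ln (u x))" by (rule continuous_on_ln[OF assms(1) nz])
  show 2: "continuous_on UNIV (\<lambda>x. u x * ln (u x))" by (intro continuous_intros assms 1)
  show "integrable Leb (\<lambda>x. u x * ln (u x))" by (rule continuous_integrable_Leb[OF 2])
qed

section \<open>Entropy of a measure and of its heat regularisation\<close>

lemma entropy_H_density:
  assumes [measurable]: "u \<in> borel_measurable borel" and u: "\<And>x. 0 \<le> u x" and int: "integrable Leb (\<lambda>x. u x * ln (u x))"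
  shows "entropy_H (density Leb (\<lambda>x. ennreal (u x))) = ereal (ent u)"
proof -
  let ?\<mu> = "density Leb (\<lambda>x. ennreal (u x))"
  have ae: "AE x in Leb. ennreal (u x) = RN_deriv Leb ?\<mu> x"
    by (rule Leb.RN_deriv_unique) auto
  have ae': "AE x in Leb. enn2real (RN_deriv Leb ?\<mu> x) * ln (enn2real (RN_deriv Leb ?\<mu> x)) = u x * ln (u x)"
    using ae by eventually_elim (metis enn2real_ennreal u)
  have "absolutely_continuous Leb ?\<mu>" by (rule absolutely_continuousI_density) simp
  moreover have "integrable Leb (\<lambda>x. enn2real (RN_deriv Leb ?\<mu> x) * ln (enn2real (RN_deriv Leb ?\<mu> x)))"
    using int integrable_cong_AE[OF _ _ ae'] by simp
  moreover have "(LINT x|Leb. enn2real (RN_deriv Leb ?\<mu> x) * ln (enn2real (RN_deriv Leb ?\<mu> x))) = ent u"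
    unfolding ent_def by (rule integral_cong_AE[OF _ _ ae']) auto
  ultimately show ?thesis unfolding entropy_H_def Let_def by simp
qed

lemma absolutely_continuous_torus_density:
  assumes \<mu>: "\<mu> \<in> prob_measures" and ac: "absolutely_continuous Leb \<mu>"
  obtains f where "f \<in> borel_measurable borel" "\<And>x. 0 \<le> f x" "\<mu> = density Leb (\<lambda>x. ennreal (f x))"
    "integrable Leb f" "(LINT x|Leb. f x) = 1" "f = (\<lambda>x. enn2real (RN_deriv Leb \<mu> x))"
proof -
  have s: "sets \<mu> = sets borel" and "prob_space \<mu>" using \<mu> by (auto simp: prob_measures_def)
  then interpret prob_space \<mu> by simp
  define f where "f x = enn2real (RN_deriv Leb \<mu> x)" for x
  have [measurable]: "f \<in> borel_measurable borel" unfolding f_def by measurable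
  have fin: "AE x in Leb. RN_deriv Leb \<mu> x \<noteq> \<infinity>"
    by (rule Leb.RN_deriv_finite) (use ac s in \<open>auto intro: sigma_finite_measure_axioms\<close>)
  have "density Leb (\<lambda>x. ennreal (f x)) = density Leb (RN_deriv Leb \<mu>)"
    by (rule density_cong) (use fin in \<open>auto simp: f_def less_top elim!: AE_mp\<close>)
  also have "\<dots> = \<mu>" using ac s by (intro Leb.density_RN_deriv) auto
  finally have eq: "\<mu> = density Leb (\<lambda>x. ennreal (f x))" by simp
  have "(\<integral>\<^sup>+x. ennreal (f x) \<partial>Leb) = emeasure \<mu> UNIV"
    by (subst eq, subst emeasure_density) auto
  also have "\<dots> = 1" using emeasure_space_1 sets_eq_imp_space_eq[OF s] by simp
  finally have n: "(\<integral>\<^sup>+x. ennreal (f x) \<partial>Leb) = 1" .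
  have nn: "0 \<le> f x" for x by (simp add: f_def)
  have i: "integrable Leb f" by (rule integrableI_nonneg) (use n nn in auto)
  have "(LINT x|Leb. f x) = 1" by (subst integral_eq_nn_integral) (use n nn in auto)
  moreover have "f = (\<lambda>x. enn2real (RN_deriv Leb \<mu> x))" by (simp add: f_def[abs_def])
  moreover have "f \<in> borel_measurable borel" by simp
  ultimately show thesis using that[OF _ nn eq i] by blast
qed

lemma entropy_H_finiteE:
  assumes \<mu>: "\<mu> \<in> prob_measures" and H: "entropy_H \<mu> < \<infinity>"
  obtains f where "f \<in> borel_measurable borel" "\<And>x. 0 \<le> f x" "\<mu> = density Leb (\<lambda>x. ennreal (f x))"
    "integrable Leb f" "integrable Leb (\<lambda>x. f x * ln (f x))" "entropy_H \<mu> = ereal (ent f)"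
proof -
  let ?f = "\<lambda>x. enn2real (RN_deriv Leb \<mu> x)"
  have ac: "absolutely_continuous Leb \<mu>" and int: "integrable Leb (\<lambda>x. ?f x * ln (?f x))"
    using H by (auto simp: entropy_H_def Let_def split: if_splits)
  obtain f where f: "f \<in> borel_measurable borel" "\<And>x. 0 \<le> f x" "\<mu> = density Leb (\<lambda>x. ennreal (f x))"
    "integrable Leb f" "(LINT x|Leb. f x) = 1" "f = (\<lambda>x. enn2real (RN_deriv Leb \<mu> x))"
    by (rule absolutely_continuous_torus_density[OF \<mu> ac]) (rule that)
  from int have i: "integrable Leb (\<lambda>x. f x * ln (f x))" unfolding f(6) .
  have "entropy_H \<mu> = ereal (ent f)" unfolding f(3) by (rule entropy_H_density[OF f(1,2) i])
  then show thesis by (rule that[OF f(1-4) i])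
qed

lemma entropy_H_not_minf: "- \<infinity> < entropy_H \<mu>"
  by (auto simp: entropy_H_def Let_def)

abbreviation hdens :: "real \<Rightarrow> 'n::finite torus measure \<Rightarrow> 'n torus \<Rightarrow> real" where
  "hdens s \<mu> \<equiv> hconv s \<mu> (\<lambda>_. 1)"

lemma hdens_props:
  assumes s: "s > 0" and \<mu>: "\<mu> \<in> prob_measures"
  shows "0 < hdens s \<mu> x" "continuous_on UNIV (hdens s \<mu>)" "C1_torus (hdens s \<mu>) (hgrad s \<mu> (\<lambda>_. 1))"
    "(LINT x|Leb. hdens s \<mu> x) = 1" "integrable Leb (hdens s \<mu>)" "integrable Leb (\<lambda>x. hdens s \<mu> x * ln (hdens s \<mu> x))"
    "density Leb (\<lambda>x. ennreal (hdens s \<mu> x)) \<in> prob_measures"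
    "entropy_H (density Leb (\<lambda>x. ennreal (hdens s \<mu> x))) = ereal (ent (hdens s \<mu>))"
proof -
  have p: "prob_space \<mu>" "sets \<mu> = sets borel" using \<mu> by (auto simp: prob_measures_def)
  interpret prob_space \<mu> by (rule p)
  have i1: "integrable \<mu> (\<lambda>_. 1 :: real)" by simp
  have pos: "0 < hdens s \<mu> x" for x by (rule hconv_pos[OF s p])
  show "0 < hdens s \<mu> x" by (rule pos)
  show c: "continuous_on UNIV (hdens s \<mu>)" by (rule hconv_continuous[OF s p(2) i1])
  show "C1_torus (hdens s \<mu>) (hgrad s \<mu> (\<lambda>_. 1))" by (rule hconv_C1[OF s p(2) i1])
  show one: "(LINT x|Leb. hdens s \<mu> x) = 1"
    using integral_hconv[OF s finite_measure_axioms p(2) i1] by (simp add: prob_space)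
  show int: "integrable Leb (hdens s \<mu>)" by (rule continuous_integrable_Leb[OF c])
  show int2: "integrable Leb (\<lambda>x. hdens s \<mu> x * ln (hdens s \<mu> x))" by (rule ent_integrable(3)[OF c pos])
  have m[measurable]: "hdens s \<mu> \<in> borel_measurable borel" by (rule continuous_torus_measurable[OF c])
  have "emeasure (density Leb (\<lambda>x. ennreal (hdens s \<mu> x))) UNIV = 1"
    by (subst emeasure_density)
       (use one int pos in \<open>auto simp: nn_integral_eq_integral less_imp_le\<close>)
  then show "density Leb (\<lambda>x. ennreal (hdens s \<mu> x)) \<in> prob_measures"
    by (auto simp: prob_measures_def intro!: prob_spaceI)
  show "entropy_H (density Leb (\<lambda>x. ennreal (hdens s \<mu> x))) = ereal (ent (hdens s \<mu>))"
    by (rule entropy_H_density[OF m less_imp_le[OF pos] int2])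
qed

lemma hconv_density:
  fixes g :: "'n::finite torus \<Rightarrow> 'b::{banach, second_countable_topology}"
  assumes f: "f \<in> borel_measurable borel" "\<And>x. 0 \<le> f x" and g: "g \<in> borel_measurable borel" and s: "s > 0"
  shows "hconv s (density Leb (\<lambda>x. ennreal (f x))) g x = hconv s Leb (\<lambda>y. f y *\<^sub>R g y) x"
proof -
  have m: "(\<lambda>y. hk s x y *\<^sub>R g y) \<in> borel_measurable borel"
    using g continuous_torus_measurable[OF hk_continuous1(4)[OF s, of x]] by auto
  show ?thesis
    unfolding hconv_def using m f by (subst integral_density) (auto simp: ac_simps)
qed

text \<open>Jensen with the probability density \<open>hk s x\<close>: the tangent at the averaged
  value b has a linear part that integrates to 0. Integrating over x afterwards costs nothing since
  the heat flow preserves integrals.\<close>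

lemma hdens_entropy_le:
  assumes s: "s > 0" and \<mu>: "\<mu> \<in> prob_measures"
  shows "ereal (ent (hdens s \<mu>)) \<le> entropy_H \<mu>"
proof (cases "entropy_H \<mu> < \<infinity>")
  case True
  obtain f where f: "f \<in> borel_measurable borel" "\<And>x. 0 \<le> f x" "\<mu> = density Leb (\<lambda>x. ennreal (f x))"
    "integrable Leb f" "integrable Leb (\<lambda>x. f x * ln (f x))" "entropy_H \<mu> = ereal (ent f)"
    using entropy_H_finiteE[OF \<mu> True] by metis
  note p = hdens_props[OF s \<mu>]
  have u: "hdens s \<mu> x = hconv s Leb f x" for x
    unfolding f(3) by (subst hconv_density[OF f(1,2) _ s]) auto
  have pt: "hdens s \<mu> x * ln (hdens s \<mu> x) \<le> hconv s Leb (\<lambda>y. f y * ln (f y)) x" for x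
  proof -
    define b where "b = hdens s \<mu> x"
    have bp: "0 < b" by (simp add: b_def p(1))
    note int = integrable_hk_scaleR[OF s sets_Leb, of _ x]
    have i1: "integrable Leb (\<lambda>y. hk s x y * b)" using int[of "\<lambda>_. b"] by simp
    have "hconv s Leb (\<lambda>y. f y * ln (f y)) x \<ge> (LINT y|Leb. hk s x y * (b * ln b + (1 + ln b) * (f y - b)))"
      unfolding hconv_def
    proof (rule integral_mono)
      show "integrable Leb (\<lambda>y. hk s x y *\<^sub>R (f y * ln (f y)))" by (rule int[OF f(5)])
      have "integrable Leb (\<lambda>y. b * ln b + (1 + ln b) * (f y - b))" using f(4) by simp
      from int[OF this] show "integrable Leb (\<lambda>y. hk s x y * (b * ln b + (1 + ln b) * (f y - b)))" by simp
      show "hk s x y * (b * ln b + (1 + ln b) * (f y - b)) \<le> hk s x y *\<^sub>R (f y * ln (f y))" for y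
        using mult_left_mono[OF xlnx_tangent[OF f(2) bp] hk_nonneg[OF s]] by simp
    qed
    moreover have "(LINT y|Leb. hk s x y * (b * ln b + (1 + ln b) * (f y - b)))
        = (LINT y|Leb. (b * ln b - (1 + ln b) * b) * hk s x y + (1 + ln b) * (hk s x y * f y))"
      by (intro Bochner_Integration.integral_cong) (auto simp: algebra_simps)
    moreover have bL: "b = (LINT y|Leb. hk s x y * f y)" by (simp only: b_def u) (simp add: hconv_def)
    moreover have "(LINT y|Leb. (b * ln b - (1 + ln b) * b) * hk s x y + (1 + ln b) * (hk s x y * f y))
        = (b * ln b - (1 + ln b) * b) * (LINT y|Leb. hk s x y) + (1 + ln b) * (LINT y|Leb. hk s x y * f y)"
      using int[of "\<lambda>_. 1::real"] int[OF f(4)] by simp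
    moreover have "(LINT y|Leb. hk s x y) = 1" using hconv_const[OF s, of "1::real" x] by (simp add: hconv_def)
    ultimately show ?thesis unfolding b_def[symmetric] bL[symmetric] by simp
  qed
  have "ent (hdens s \<mu>) \<le> (LINT x|Leb. hconv s Leb (\<lambda>y. f y * ln (f y)) x)"
    unfolding ent_def
    by (intro integral_mono p pt continuous_integrable_Leb hconv_continuous[OF s sets_Leb f(5)])
  also have "\<dots> = ent f"
    unfolding ent_def by (rule integral_hconv[OF s Leb.finite_measure_axioms sets_Leb f(5)])
  finally show ?thesis by (simp add: f(6))
qed auto

text \<open>The sum of the two measures. A continuous approximation in L1 of the sum is good for
  \<mu> and for \<open>Leb\<close> simultaneously, at a stage where \<mu> is not yet known to have a
  density.\<close>

lemma sum_measure_exists: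
  fixes \<mu> \<nu> :: "'n::finite torus measure"
  assumes \<mu>: "finite_measure \<mu>" "sets \<mu> = sets borel" and \<nu>: "finite_measure \<nu>" "sets \<nu> = sets borel"
  obtains \<kappa> where "finite_measure \<kappa>" "sets \<kappa> = sets borel"
    "\<And>f :: 'n torus \<Rightarrow> real. f \<in> borel_measurable borel \<Longrightarrow> (\<And>x. 0 \<le> f x) \<Longrightarrow> integrable \<kappa> f \<Longrightarrow>
      (LINT x|\<mu>. f x) \<le> (LINT x|\<kappa>. f x) \<and> (LINT x|\<nu>. f x) \<le> (LINT x|\<kappa>. f x)"
proof -
  define \<kappa> where "\<kappa> = measure_of UNIV (sets (borel :: 'n torus measure)) (\<lambda>A. emeasure \<mu> A + emeasure \<nu> A)"
  have sa: "sigma_algebra UNIV (sets (borel :: 'n torus measure))"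
    using sets.sigma_algebra_axioms[of "borel :: 'n torus measure"] by simp
  have sets: "sets \<kappa> = sets borel"
    unfolding \<kappa>_def using sigma_algebra.sigma_sets_eq[OF sa] by (subst sets_measure_of) auto
  have em: "emeasure \<kappa> A = emeasure \<mu> A + emeasure \<nu> A" if "A \<in> sets borel" for A
    unfolding \<kappa>_def
  proof (rule emeasure_measure_of_sigma[OF sa _ _ that])
    show "positive (sets borel) (\<lambda>A. emeasure \<mu> A + emeasure \<nu> A)" by (simp add: positive_def)
    show "countably_additive (sets borel) (\<lambda>A. emeasure \<mu> A + emeasure \<nu> A)"
    proof (rule countably_additiveI)
      fix A :: "nat \<Rightarrow> 'n torus set" assume A: "range A \<subseteq> sets borel" "disjoint_family A"
      show "(\<Sum>i. emeasure \<mu> (A i) + emeasure \<nu> (A i)) = emeasure \<mu> (\<Union> (range A)) + emeasure \<nu> (\<Union> (range A))"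
        using A \<mu> \<nu> by (simp add: suminf_add[symmetric] suminf_emeasure)
    qed
  qed
  interpret \<mu>: finite_measure \<mu> by fact
  interpret \<nu>: finite_measure \<nu> by fact
  have fin: "finite_measure \<kappa>"
    by (rule finite_measureI) (use em[of UNIV] in \<open>simp add: sets_eq_imp_space_eq[OF sets] \<mu>.emeasure_finite \<nu>.emeasure_finite\<close>)
  have "\<mu> \<le> \<kappa>" "\<nu> \<le> \<kappa>"
    using em \<mu>(2) \<nu>(2) sets by (simp_all add: le_measure)
  have le: "(LINT x|m. f x) \<le> (LINT x|\<kappa>. f x)"
    if m: "m \<le> \<kappa>" "sets m = sets borel" and f: "f \<in> borel_measurable borel" "\<And>x. 0 \<le> f x" "integrable \<kappa> f"
    for m and f :: "'n torus \<Rightarrow> real"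
  proof -
    have "(\<integral>\<^sup>+x. ennreal (f x) \<partial>m) \<le> (\<integral>\<^sup>+x. ennreal (f x) \<partial>\<kappa>)"
      using m sets by (intro nn_integral_mono_measure) auto
    moreover have "(\<integral>\<^sup>+x. ennreal (f x) \<partial>\<kappa>) = ennreal (LINT x|\<kappa>. f x)"
      using f by (intro nn_integral_eq_integral) auto
    moreover have "(LINT x|m. f x) = enn2real (\<integral>\<^sup>+x. ennreal (f x) \<partial>m)"
      using f m by (intro integral_eq_nn_integral) (auto cong: measurable_cong_sets)
    ultimately show ?thesis
      using f(2) by (metis enn2real_leI integral_nonneg_AE AE_I2)
  qed
  show thesis
    using le \<open>\<mu> \<le> \<kappa>\<close> \<open>\<nu> \<le> \<kappa>\<close> \<mu>(2) \<nu>(2) by (intro that[OF fin sets]) blast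
qed

text \<open>The entropy is the convex conjugate of \<open>\<phi> \<mapsto> \<integral> exp (\<phi> - 1)\<close>; lower semicontinuity along the heat
  flow follows by testing with bounded functions.\<close>

lemma entropy_H_le_heat_limit:
  fixes \<mu> :: "'n::finite torus measure"
  assumes \<mu>: "\<mu> \<in> prob_measures" and s1: "s1 > 0" and C: "\<And>s. 0 < s \<Longrightarrow> s < s1 \<Longrightarrow> ent (hdens s \<mu>) \<le> C"
  shows "entropy_H \<mu> \<le> ereal C"
proof -
  have p: "prob_space \<mu>" and s\<mu>[measurable_cong]: "sets \<mu> = sets borel" using \<mu> by (auto simp: prob_measures_def)
  interpret prob_space \<mu> by (rule p)
  have sp: "space \<mu> = UNIV" using sets_eq_imp_space_eq[OF s\<mu>] by simp
  \<comment> \<open>Young's inequality for the heated density, followed by small s. By duality the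
    smoothing falls on \<phi>, where it converges uniformly.\<close>
  have cont: "(LINT x|\<mu>. \<phi> x) \<le> C + (LINT x|Leb. exp (\<phi> x - 1))" if \<phi>: "continuous_on UNIV \<phi>" for \<phi>
  proof (rule field_le_epsilon)
    fix e :: real assume "e > 0"
    then obtain s0 where s0: "s0 > 0" "\<And>s y. 0 < s \<Longrightarrow> s < s0 \<Longrightarrow> norm (hconv s Leb \<phi> y - \<phi> y) \<le> e"
      using hconv_uniform_approx[OF \<phi>] by blast
    define s where "s = min s0 s1 / 2"
    have s: "0 < s" "s < s0" "s < s1" using s0 s1 by (auto simp: s_def)
    note u = hdens_props[OF s(1) \<mu>]
    have i\<phi>: "integrable Leb \<phi>" "integrable \<mu> \<phi>"
      by (rule continuous_integrable_Leb[OF \<phi>], rule continuous_Leb_integrable[OF finite_measure_axioms s\<mu> \<phi>])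
    have ie: "integrable Leb (\<lambda>x. exp (\<phi> x - 1))" by (intro continuous_integrable_Leb continuous_intros \<phi>)
    have ih: "integrable \<mu> (hconv s Leb \<phi>)"
      by (intro continuous_Leb_integrable[OF finite_measure_axioms s\<mu>] hconv_continuous s sets_Leb i\<phi>)
    have "(LINT x|\<mu>. \<phi> x) \<le> (LINT x|\<mu>. hconv s Leb \<phi> x + e)"
    proof (rule integral_mono)
      show "\<phi> x \<le> hconv s Leb \<phi> x + e" for x using s0(2)[OF s(1,2), of x] by (simp add: abs_le_iff)
    qed (use i\<phi> ih in auto)
    also have "\<dots> = (LINT x|\<mu>. hconv s Leb \<phi> x) + e" using ih by (simp add: prob_space)
    also have "(LINT x|\<mu>. hconv s Leb \<phi> x) = (LINT x|Leb. \<phi> x * hdens s \<mu> x)"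
      using hconv_adjoint(1)[OF s(1) finite_measure_axioms s\<mu> _ i\<phi>(1), of "\<lambda>_. 1"] by simp
    also have "\<dots> \<le> (LINT x|Leb. hdens s \<mu> x * ln (hdens s \<mu> x) + exp (\<phi> x - 1))"
    proof (rule integral_mono)
      show "integrable Leb (\<lambda>x. \<phi> x * hdens s \<mu> x)" by (intro continuous_integrable_Leb continuous_intros \<phi> u)
      show "\<phi> x * hdens s \<mu> x \<le> hdens s \<mu> x * ln (hdens s \<mu> x) + exp (\<phi> x - 1)" for x
        by (rule young_entropy[OF less_imp_le[OF u(1)]])
    qed (use u(6) ie in auto)
    also have "\<dots> = ent (hdens s \<mu>) + (LINT x|Leb. exp (\<phi> x - 1))" using u(6) ie by (simp add: ent_def)
    also have "\<dots> \<le> C + (LINT x|Leb. exp (\<phi> x - 1))" using C[OF s(1,3)] by simp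
    finally show "(LINT x|\<mu>. \<phi> x) \<le> C + (LINT x|Leb. exp (\<phi> x - 1)) + e" by simp
  qed
  obtain \<kappa> where \<kappa>: "finite_measure \<kappa>" "sets \<kappa> = sets borel"
    "\<And>f :: 'n torus \<Rightarrow> real. f \<in> borel_measurable borel \<Longrightarrow> (\<And>x. 0 \<le> f x) \<Longrightarrow> integrable \<kappa> f \<Longrightarrow>
      (LINT x|\<mu>. f x) \<le> (LINT x|\<kappa>. f x) \<and> (LINT x|Leb. f x) \<le> (LINT x|\<kappa>. f x)"
    by (rule sum_measure_exists[OF finite_measure_axioms s\<mu> Leb.finite_measure_axioms sets_Leb])
       (rule that, assumption, assumption, blast)
  \<comment> \<open>Continuous test functions cannot single out null sets or logarithms of a
    measurable density, so the bound is extended to bounded Borel functions.\<close>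
  have bdd: "(LINT x|\<mu>. \<phi> x) \<le> C + (LINT x|Leb. exp (\<phi> x - 1))"
    if \<phi>[measurable]: "\<phi> \<in> borel_measurable borel" and B: "\<And>x. \<bar>\<phi> x\<bar> \<le> B" for \<phi> B
  proof (rule field_le_epsilon)
    fix e :: real assume e: "e > 0"
    \<comment> \<open>The approximation error enters once for \<mu> and exp (B - 1) times for
      \<open>Leb\<close>; dividing e by the sum of these weights makes the total exactly e.\<close>
    define L where "L = exp (B - 1) + 1"
    have L: "L > 0" unfolding L_def by (intro add_pos_pos) auto
    obtain \<psi> where \<psi>: "continuous_on UNIV \<psi>" "\<And>x. \<bar>\<psi> x\<bar> \<le> B" "(LINT x|\<kappa>. \<bar>\<phi> x - \<psi> x\<bar>) < e / L"
      using bounded_continuous_approx[OF \<kappa>(1,2) \<phi> B, of "e / L"] e L by (metis divide_pos_pos)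
    have \<psi>m[measurable]: "\<psi> \<in> borel_measurable borel" by (rule continuous_torus_measurable[OF \<psi>(1)])
    have bi: "integrable m f" if "finite_measure m" "sets m = sets borel" "f \<in> borel_measurable borel" "\<And>x. \<bar>f x\<bar> \<le> K"
      for m and f :: "'n torus \<Rightarrow> real" and K
      using that by (intro finite_measure.integrable_const_bound[of m f K]) (auto cong: measurable_cong_sets)
    have db: "\<bar>\<bar>\<phi> x - \<psi> x\<bar>\<bar> \<le> 2 * B" for x using B[of x] \<psi>(2)[of x] by linarith
    have d: "(LINT x|\<mu>. \<bar>\<phi> x - \<psi> x\<bar>) < e / L" "(LINT x|Leb. \<bar>\<phi> x - \<psi> x\<bar>) < e / L"
    proof -
      have "integrable \<kappa> (\<lambda>x. \<bar>\<phi> x - \<psi> x\<bar>)" by (rule bi[OF \<kappa>(1,2) _ db]) measurable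
      from \<kappa>(3)[OF _ _ this] \<psi>(3)
      show "(LINT x|\<mu>. \<bar>\<phi> x - \<psi> x\<bar>) < e / L" "(LINT x|Leb. \<bar>\<phi> x - \<psi> x\<bar>) < e / L"
        by (simp_all add: order_le_less_trans)
    qed
    have i: "integrable m \<phi>" "integrable m \<psi>" "integrable m (\<lambda>x. \<bar>\<phi> x - \<psi> x\<bar>)"
      "integrable m (\<lambda>x. exp (\<phi> x - 1))" "integrable m (\<lambda>x. exp (\<psi> x - 1))"
      if m: "finite_measure m" "sets m = sets borel" for m
    proof -
      have "exp (r - 1) \<le> exp (B - 1)" if "\<bar>r\<bar> \<le> B" for r using that by simp
      then have "\<bar>exp (\<phi> x - 1)\<bar> \<le> exp (B - 1)" "\<bar>exp (\<psi> x - 1)\<bar> \<le> exp (B - 1)" for x using B \<psi>(2) by auto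
      note eb = this
      show "integrable m \<phi>" by (rule bi[OF m \<phi> B])
      show "integrable m \<psi>" by (rule bi[OF m \<psi>m \<psi>(2)])
      show "integrable m (\<lambda>x. \<bar>\<phi> x - \<psi> x\<bar>)" by (rule bi[OF m _ db]) measurable
      show "integrable m (\<lambda>x. exp (\<phi> x - 1))" by (rule bi[OF m _ eb(1)]) measurable
      show "integrable m (\<lambda>x. exp (\<psi> x - 1))" by (rule bi[OF m _ eb(2)]) measurable
    qed
    note i\<mu> = i[OF finite_measure_axioms s\<mu>] and iL = i[OF Leb.finite_measure_axioms sets_Leb]
    have "(LINT x|\<mu>. \<phi> x) \<le> (LINT x|\<mu>. \<psi> x + \<bar>\<phi> x - \<psi> x\<bar>)"
      using i\<mu> by (intro integral_mono) auto
    also have "\<dots> = (LINT x|\<mu>. \<psi> x) + (LINT x|\<mu>. \<bar>\<phi> x - \<psi> x\<bar>)" using i\<mu> by simp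
    also have "(LINT x|\<mu>. \<psi> x) \<le> C + (LINT x|Leb. exp (\<psi> x - 1))" by (rule cont[OF \<psi>(1)])
    also have "(LINT x|Leb. exp (\<psi> x - 1)) \<le> (LINT x|Leb. exp (\<phi> x - 1) + exp (B - 1) * \<bar>\<phi> x - \<psi> x\<bar>)"
    proof (rule integral_mono)
      fix x
      have "exp (\<psi> x - 1) * (1 + (\<phi> x - \<psi> x)) \<le> exp (\<psi> x - 1) * exp (\<phi> x - \<psi> x)"
        by (intro mult_left_mono exp_ge_add_one_self) auto
      also have "\<dots> = exp (\<phi> x - 1)" by (simp flip: exp_add)
      finally have "exp (\<psi> x - 1) \<le> exp (\<phi> x - 1) + exp (\<psi> x - 1) * (\<psi> x - \<phi> x)" by (simp add: algebra_simps)
      also have "exp (\<psi> x - 1) * (\<psi> x - \<phi> x) \<le> exp (B - 1) * \<bar>\<phi> x - \<psi> x\<bar>"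
        using \<psi>(2)[of x] by (intro order_trans[OF mult_left_mono mult_right_mono]) auto
      finally show "exp (\<psi> x - 1) \<le> exp (\<phi> x - 1) + exp (B - 1) * \<bar>\<phi> x - \<psi> x\<bar>" by simp
    qed (use iL in auto)
    also have "\<dots> = (LINT x|Leb. exp (\<phi> x - 1)) + exp (B - 1) * (LINT x|Leb. \<bar>\<phi> x - \<psi> x\<bar>)" using iL by simp
    also have "\<dots> \<le> (LINT x|Leb. exp (\<phi> x - 1)) + exp (B - 1) * (e / L)" using d by (intro add_left_mono mult_left_mono) auto
    finally have "(LINT x|\<mu>. \<phi> x) \<le> C + (LINT x|Leb. exp (\<phi> x - 1)) + (exp (B - 1) * (e / L) + e / L)"
      using d(1) by simp
    also have "exp (B - 1) * (e / L) + e / L = (exp (B - 1) + 1) * (e / L)" by (simp add: distrib_right add_divide_distrib)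
    also have "\<dots> = e" using L unfolding L_def[symmetric] by simp
    finally show "(LINT x|\<mu>. \<phi> x) \<le> C + (LINT x|Leb. exp (\<phi> x - 1)) + e" .
  qed
  have ac: "absolutely_continuous Leb \<mu>"
    unfolding absolutely_continuous_def
  proof
    fix N :: "'n torus set" assume "N \<in> null_sets Leb"
    then have N[measurable]: "N \<in> sets borel" and N0: "emeasure Leb N = 0" by auto
    \<comment> \<open>The test function is n on \<open>N\<close> and 0 elsewhere. It vanishes almost
      everywhere for \<open>Leb\<close>, so the right-hand side does not grow with n.\<close>
    have "real n * measure \<mu> N \<le> C + exp (- 1)" for n :: nat
    proof -
      have "(LINT x|\<mu>. real n * indicator N x) \<le> C + (LINT x|Leb. exp (real n * indicator N x - 1))"
        by (rule bdd[of _ "real n"]) (auto simp: indicator_def)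
      moreover have "(LINT x|Leb. exp (real n * indicator N x - 1)) = (LINT x|(Leb :: 'n torus measure). exp (- 1))"
      proof (rule integral_cong_AE)
        have "AE x in Leb. x \<notin> N" using \<open>N \<in> null_sets Leb\<close> by (rule AE_not_in)
        then show "AE x in Leb. exp (real n * indicator N x - 1) = exp (- 1 :: real)" by eventually_elim simp
      qed auto
      ultimately show ?thesis by (simp add: measure_Leb_UNIV)
    qed
    then have "measure \<mu> N \<le> 0"
    proof (intro leI notI)
      assume "0 < measure \<mu> N"
      obtain n :: nat where "(C + exp (- 1)) / measure \<mu> N < real n" using reals_Archimedean2 by blast
      then have "C + exp (- 1) < real n * measure \<mu> N" using \<open>0 < measure \<mu> N\<close> by (simp add: pos_divide_less_eq)
      moreover assume "\<And>n. real n * measure \<mu> N \<le> C + exp (- 1)"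
      ultimately show False by (metis not_le)
    qed
    then show "N \<in> null_sets \<mu>" using s\<mu> by (simp add: null_sets_def emeasure_eq_measure measure_le_0_iff)
  qed
  obtain f where f[measurable]: "f \<in> borel_measurable borel" and f0: "\<And>x. 0 \<le> f x" and eq: "\<mu> = density Leb (\<lambda>x. ennreal (f x))"
    and fi: "integrable Leb f" and f1: "(LINT x|Leb. f x) = 1" and "f = (\<lambda>x. enn2real (RN_deriv Leb \<mu> x))"
    by (rule absolutely_continuous_torus_density[OF \<mu> ac]) (rule that)
  \<comment> \<open>The density clamped between 1 / (n + 1) and n + 1. The test function 1 + ln
    (\<open>cl n x\<close>) is the optimal one of the duality, made bounded.\<close>
  define cl where "cl n x = max (1 / (real n + 1)) (min (real n + 1) (f x))" for n :: nat and x
  have cl[measurable]: "cl n \<in> borel_measurable borel" for n unfolding cl_def by measurable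
  have clp: "0 < cl n x" for n x unfolding cl_def by (simp add: less_max_iff_disj)
  have in1: "1 / (real n + 1) \<le> 1" for n by simp
  have clb: "1 / (real n + 1) \<le> cl n x" for n x by (simp add: cl_def)
  have clb2: "cl n x \<le> real n + 1" for n x
    unfolding cl_def using in1[of n] by (intro max.boundedI min.coboundedI1) linarith+
  have lncl: "\<bar>ln (cl n x)\<bar> \<le> ln (real n + 1)" for n x
  proof -
    have "ln (cl n x) \<le> ln (real n + 1)" by (intro ln_mono clb2 clp)
    moreover have "ln (1 / (real n + 1)) \<le> ln (cl n x)" by (intro ln_mono clb) auto
    ultimately show ?thesis by (simp add: ln_div abs_le_iff)
  qed
  have clf: "cl n x \<le> f x + 1" for n x
    unfolding cl_def using f0[of x] in1[of n] by (intro max.boundedI min.coboundedI2) linarith+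
  have lim: "(\<lambda>n. cl n x) \<longlonglongrightarrow> f x" for x
  proof -
    have a: "(\<lambda>n. min (real n + 1) (f x)) \<longlonglongrightarrow> f x"
    proof (rule tendsto_eventually)
      obtain N :: nat where "f x < real N" using reals_Archimedean2 by blast
      then show "\<forall>\<^sub>F n in sequentially. min (real n + 1) (f x) = f x"
        unfolding eventually_sequentially by (intro exI[of _ N]) (auto simp: min_def)
    qed
    have b: "(\<lambda>n. 1 / (real n + 1)) \<longlonglongrightarrow> 0"
      using LIMSEQ_inverse_real_of_nat by (simp add: inverse_eq_divide add.commute)
    show ?thesis unfolding cl_def using tendsto_max[OF b a] f0[of x] by (simp add: max_def)
  qed
  have icl: "integrable Leb (cl n)" for n
    using clb2 clp by (intro Leb.integrable_const_bound[of _ "real n + 1"]) (auto simp: abs_of_pos)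
  have ifl: "integrable Leb (\<lambda>x. f x * ln (cl n x))" for n
  proof (rule Bochner_Integration.integrable_bound)
    show "integrable Leb (\<lambda>x. ln (real n + 1) * f x)" using fi by simp
    show "AE x in Leb. norm (f x * ln (cl n x)) \<le> norm (ln (real n + 1) * f x)"
      using lncl f0 by (intro AE_I2) (auto simp: abs_mult mult.commute mult_left_mono)
  qed measurable
  have main: "(LINT x|Leb. f x * ln (cl n x)) \<le> C + (LINT x|Leb. cl n x) - 1" for n
  proof -
    have "(LINT x|\<mu>. 1 + ln (cl n x)) \<le> C + (LINT x|Leb. exp ((1 + ln (cl n x)) - 1))"
    proof (rule bdd[of _ "1 + ln (real n + 1)"])
      show "\<bar>1 + ln (cl n x)\<bar> \<le> 1 + ln (real n + 1)" for x using lncl[of n x] by linarith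
    qed measurable
    also have "(LINT x|\<mu>. 1 + ln (cl n x)) = (LINT x|Leb. f x * (1 + ln (cl n x)))"
      unfolding eq using f0 by (subst integral_density) auto
    also have "\<dots> = (LINT x|Leb. f x + f x * ln (cl n x))" by (simp add: distrib_left)
    also have "\<dots> = 1 + (LINT x|Leb. f x * ln (cl n x))" using fi ifl f1 by simp
    finally show ?thesis using clp by simp
  qed
  have limc: "(\<lambda>n. LINT x|Leb. cl n x) \<longlonglongrightarrow> (LINT x|Leb. f x)"
  proof (rule integral_dominated_convergence[where w="\<lambda>x. f x + 1"])
    show "AE x in Leb. norm (cl n x) \<le> f x + 1" for n
      using clf clp by (intro AE_I2) (simp add: abs_of_pos)
  qed (use fi lim in auto)
  \<comment> \<open>The uniform lower bound for Fatou's lemma. Either \<open>cl n x\<close> is at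
    least the density, and f ln f \<ge> -1 applies, or it is the upper clamp n + 1, whose logarithm
    is nonnegative.\<close>
  have lower: "- 1 \<le> f x * ln (cl n x)" for n x
  proof (cases "f x \<le> cl n x")
    case True
    have "f x * ln (f x) \<le> f x * ln (cl n x)"
    proof (cases "f x = 0")
      case False
      then show ?thesis using True f0[of x] clp[of n x] by (intro mult_left_mono ln_mono) auto
    qed simp
    then show ?thesis using xlnx_ge[OF f0, of x] by linarith
  next
    case False
    moreover have "1 / (real n + 1) \<le> real n + 1" using in1[of n] by linarith
    ultimately have "cl n x = real n + 1" unfolding cl_def max_def min_def by (smt (verit))
    then have "0 \<le> f x * ln (cl n x)" using f0[of x] by simp
    then show ?thesis by linarith
  qed
  have limf: "(\<lambda>n. f x * ln (cl n x)) \<longlonglongrightarrow> f x * ln (f x)" for x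
  proof (cases "f x = 0")
    case False
    then show ?thesis by (intro tendsto_intros lim)
  qed simp
  have "(\<integral>\<^sup>+x. ennreal (f x * ln (f x) + 1) \<partial>Leb) \<le> liminf (\<lambda>n. \<integral>\<^sup>+x. ennreal (f x * ln (cl n x) + 1) \<partial>Leb)"
  proof -
    have "(\<integral>\<^sup>+x. ennreal (f x * ln (f x) + 1) \<partial>Leb) = (\<integral>\<^sup>+x. liminf (\<lambda>n. ennreal (f x * ln (cl n x) + 1)) \<partial>Leb)"
    proof (rule nn_integral_cong)
      fix x
      have "(\<lambda>n. ennreal (f x * ln (cl n x) + 1)) \<longlonglongrightarrow> ennreal (f x * ln (f x) + 1)"
        by (intro tendsto_ennrealI tendsto_intros limf)
      then show "ennreal (f x * ln (f x) + 1) = liminf (\<lambda>n. ennreal (f x * ln (cl n x) + 1))"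
        by (simp add: lim_imp_Liminf)
    qed
    also have "\<dots> \<le> liminf (\<lambda>n. \<integral>\<^sup>+x. ennreal (f x * ln (cl n x) + 1) \<partial>Leb)"
      by (rule nn_integral_liminf) auto
    finally show ?thesis .
  qed
  also have "\<dots> \<le> liminf (\<lambda>n. ennreal (C + (LINT x|Leb. cl n x)))"
  proof (intro Liminf_mono always_eventually allI)
    fix n
    have "(\<integral>\<^sup>+x. ennreal (f x * ln (cl n x) + 1) \<partial>Leb) = ennreal (LINT x|Leb. f x * ln (cl n x) + 1)"
    proof (rule nn_integral_eq_integral)
      show "integrable Leb (\<lambda>x. f x * ln (cl n x) + 1)" using ifl[of n] by simp
      show "AE x in Leb. 0 \<le> f x * ln (cl n x) + 1"
      proof (rule AE_I2)
        fix x show "0 \<le> f x * ln (cl n x) + 1" using lower[of x n] by linarith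
      qed
    qed
    also have "(LINT x|Leb. f x * ln (cl n x) + 1) = (LINT x|Leb. f x * ln (cl n x)) + 1"
      using ifl[of n] by (simp add: measure_Leb_UNIV)
    also have "\<dots> \<le> C + (LINT x|Leb. cl n x)" using main[of n] by simp
    finally show "(\<integral>\<^sup>+x. ennreal (f x * ln (cl n x) + 1) \<partial>Leb) \<le> ennreal (C + (LINT x|Leb. cl n x))"
      by (simp add: ennreal_leI)
  qed
  also have "\<dots> = ennreal (C + 1)"
    using limc f1 by (intro lim_imp_Liminf tendsto_ennrealI tendsto_intros) auto
  finally have fin: "(\<integral>\<^sup>+x. ennreal (f x * ln (f x) + 1) \<partial>Leb) \<le> ennreal (C + 1)" .
  have nn: "0 \<le> f x * ln (f x) + 1" for x using xlnx_ge[OF f0, of x] by linarith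
  have i1: "integrable Leb (\<lambda>x. f x * ln (f x) + 1)"
    using fin nn by (intro integrableI_nonneg) (auto simp: less_top[symmetric] top_unique)
  have int: "integrable Leb (\<lambda>x. f x * ln (f x))"
    using Bochner_Integration.integrable_diff[OF i1, of "\<lambda>_. 1"] by simp
  have "ennreal (LINT x|Leb. f x * ln (f x) + 1) \<le> ennreal (C + 1)"
    using fin nn_integral_eq_integral[OF i1] nn by simp
  moreover have "(LINT x|Leb. f x * ln (f x) + 1) = ent f + 1" using int by (simp add: ent_def measure_Leb_UNIV)
  moreover have "-1 \<le> ent f"
  proof -
    have "(LINT x|(Leb :: 'n torus measure). -1) \<le> ent f" unfolding ent_def using int xlnx_ge[OF f0] by (intro integral_mono) auto
    then show ?thesis by (simp add: measure_Leb_UNIV)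
  qed
  \<comment> \<open>Both sides increased by 1 must be nonnegative before the comparison in
    \<open>ennreal\<close> can be read as one of reals.\<close>
  moreover have "-1 \<le> C"
  proof -
    have u: "-1 \<le> ent (hdens (s1/2) \<mu>)"
    proof -
      note u = hdens_props[of "s1/2", OF _ \<mu>]
      have "(LINT x|(Leb :: 'n torus measure). -1) \<le> ent (hdens (s1/2) \<mu>)"
        unfolding ent_def using u(6) u(1) s1 xlnx_ge[OF less_imp_le[OF u(1)]] by (intro integral_mono) auto
      then show ?thesis by (simp add: measure_Leb_UNIV)
    qed
    then show ?thesis using C[of "s1/2"] s1 by simp
  qed
  ultimately have "ent f \<le> C" by (simp add: ennreal_le_iff)
  then show ?thesis unfolding eq using entropy_H_density[OF f f0 int] by simp
qed

section \<open>Fisher information along the heat flow\<close>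

lemma integrable_mult_squares:
  fixes f g :: "'a \<Rightarrow> real"
  assumes "f \<in> borel_measurable M" "g \<in> borel_measurable M" "integrable M (\<lambda>x. (f x)\<^sup>2)" "integrable M (\<lambda>x. (g x)\<^sup>2)"
  shows "integrable M (\<lambda>x. f x * g x)"
proof (rule Bochner_Integration.integrable_bound)
  show "integrable M (\<lambda>x. (f x)\<^sup>2 + (g x)\<^sup>2)" using assms by auto
  have "\<bar>f x * g x\<bar> \<le> (f x)\<^sup>2 + (g x)\<^sup>2" for x
  proof -
    have "0 \<le> \<bar>f x\<bar> * \<bar>g x\<bar>" by simp
    moreover have "2 * (\<bar>f x\<bar> * \<bar>g x\<bar>) \<le> (f x)\<^sup>2 + (g x)\<^sup>2"
      using sum_squares_bound[of "\<bar>f x\<bar>" "\<bar>g x\<bar>"] by (simp add: mult.assoc)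
    ultimately show ?thesis unfolding abs_mult by linarith
  qed
  then show "AE x in M. norm (f x * g x) \<le> norm ((f x)\<^sup>2 + (g x)\<^sup>2)" by (intro AE_I2) simp
qed (use assms in auto)

lemma integrable_of_square:
  fixes f :: "'n::finite torus \<Rightarrow> real"
  assumes "finite_measure \<mu>" "f \<in> borel_measurable \<mu>" "integrable \<mu> (\<lambda>x. (f x)\<^sup>2)"
  shows "integrable \<mu> f"
proof -
  interpret finite_measure \<mu> by fact
  show ?thesis using integrable_mult_squares[of f \<mu> "\<lambda>_. 1"] assms by simp
qed

text \<open>Young's inequality with a free weight \<eta> in the role of Cauchy-Schwarz: choosing
  \<eta> small and then g small makes both terms small without square roots of integrals.\<close>

lemma integral_mult_AMGM:
  fixes f g :: "'a \<Rightarrow> real"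
  assumes "f \<in> borel_measurable M" "g \<in> borel_measurable M" "integrable M (\<lambda>x. (f x)\<^sup>2)" "integrable M (\<lambda>x. (g x)\<^sup>2)"
    and \<eta>: "\<eta> > 0"
  shows "\<bar>LINT x|M. f x * g x\<bar> \<le> \<eta> * (LINT x|M. (f x)\<^sup>2) + (1 / \<eta>) * (LINT x|M. (g x)\<^sup>2)"
proof -
  have "\<bar>LINT x|M. f x * g x\<bar> = norm (LINT x|M. f x * g x)" by simp
  also have "\<dots> \<le> (LINT x|M. \<eta> * (f x)\<^sup>2 + (1 / \<eta>) * (g x)\<^sup>2)"
  proof (rule norm_integral_le)
    show "integrable M (\<lambda>x. f x * g x)" by (rule integrable_mult_squares) (use assms in auto)
    show "integrable M (\<lambda>x. \<eta> * (f x)\<^sup>2 + (1 / \<eta>) * (g x)\<^sup>2)" using assms by auto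
    fix x
    have "0 \<le> (1 / \<eta>) * (\<eta> * \<bar>f x\<bar> - \<bar>g x\<bar>)\<^sup>2" using \<eta> by simp
    also have "\<dots> = \<eta> * (f x)\<^sup>2 + (1 / \<eta>) * (g x)\<^sup>2 - 2 * (\<bar>f x\<bar> * \<bar>g x\<bar>)"
      using \<eta> by (simp add: power2_eq_square algebra_simps)
    finally have "2 * (\<bar>f x\<bar> * \<bar>g x\<bar>) \<le> \<eta> * (f x)\<^sup>2 + (1 / \<eta>) * (g x)\<^sup>2" by simp
    moreover have "0 \<le> \<bar>f x\<bar> * \<bar>g x\<bar>" by simp
    ultimately show "norm (f x * g x) \<le> \<eta> * (f x)\<^sup>2 + (1 / \<eta>) * (g x)\<^sup>2"
      unfolding real_norm_def abs_mult by linarith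
  qed
  also have "\<dots> = \<eta> * (LINT x|M. (f x)\<^sup>2) + (1 / \<eta>) * (LINT x|M. (g x)\<^sup>2)" using assms by simp
  finally show ?thesis .
qed

lemma hconv_square_le:
  fixes r :: "'n::finite torus \<Rightarrow> real"
  assumes s: "s > 0" and r: "r \<in> borel_measurable borel" "integrable Leb (\<lambda>x. (r x)\<^sup>2)"
  shows "(LINT x|Leb. (hconv s Leb r x)\<^sup>2) \<le> (LINT x|Leb. (r x)\<^sup>2)" and "integrable Leb (\<lambda>x. (hconv s Leb r x)\<^sup>2)"
proof -
  have ri: "integrable Leb r" by (rule integrable_of_square[OF Leb.finite_measure_axioms]) (use r in auto)
  have pt: "(hconv s Leb r x)\<^sup>2 \<le> hconv s Leb (\<lambda>y. (r y)\<^sup>2) x" for x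
    using hconv_Cauchy_Schwarz[OF s Leb.finite_measure_axioms sets_Leb, of r "\<lambda>_. 1" x] r
    by (simp add: hconv_const[OF s])
  show i: "integrable Leb (\<lambda>x. (hconv s Leb r x)\<^sup>2)"
    by (intro continuous_integrable_Leb continuous_intros hconv_continuous[OF s sets_Leb ri])
  have "(LINT x|Leb. (hconv s Leb r x)\<^sup>2) \<le> (LINT x|Leb. hconv s Leb (\<lambda>y. (r y)\<^sup>2) x)"
    by (rule integral_mono[OF i continuous_integrable_Leb[OF hconv_continuous[OF s sets_Leb r(2)]] pt])
  also have "\<dots> = (LINT x|Leb. (r x)\<^sup>2)" by (rule integral_hconv[OF s Leb.finite_measure_axioms sets_Leb r(2)])
  finally show "(LINT x|Leb. (hconv s Leb r x)\<^sup>2) \<le> (LINT x|Leb. (r x)\<^sup>2)" .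
qed

text \<open>Truncation reduces to a function bounded by B. There the square of the error is at most
  2 B times the error itself, so approximation in L1 by functions with the same bound is
  enough.\<close>

lemma L2_continuous_approx:
  fixes w :: "'n::finite torus \<Rightarrow> real"
  assumes w[measurable]: "w \<in> borel_measurable borel" and int: "integrable Leb (\<lambda>x. (w x)\<^sup>2)" and e: "e > 0"
  obtains \<phi> where "continuous_on UNIV \<phi>" "(LINT x|Leb. (w x - \<phi> x)\<^sup>2) < e"
proof -
  define cl where "cl n x = max (- real n) (min (real n) (w x))" for n :: nat and x
  have [measurable]: "cl n \<in> borel_measurable borel" for n unfolding cl_def by measurable
  have "(\<lambda>n. LINT x|Leb. (w x - cl n x)\<^sup>2) \<longlonglongrightarrow> (LINT x|(Leb :: 'n torus measure). 0 :: real)"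
  proof (rule integral_dominated_convergence[where w="\<lambda>x. (w x)\<^sup>2"])
    show "AE x in Leb. (\<lambda>n. (w x - cl n x)\<^sup>2) \<longlonglongrightarrow> 0"
    proof (rule AE_I2, rule tendsto_eventually)
      fix x
      obtain N :: nat where N: "\<bar>w x\<bar> < real N" using reals_Archimedean2 by blast
      have "cl n x = w x" if "n \<ge> N" for n using N that by (auto simp: cl_def min_def max_def)
      then show "\<forall>\<^sub>F n in sequentially. (w x - cl n x)\<^sup>2 = 0"
        unfolding eventually_sequentially by (intro exI[of _ N]) simp
    qed
    show "AE x in Leb. norm ((w x - cl n x)\<^sup>2) \<le> (w x)\<^sup>2" for n
    proof (rule AE_I2)
      fix x
      have "\<bar>w x - cl n x\<bar> \<le> \<bar>w x\<bar>" by (auto simp: cl_def min_def max_def)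
      then show "norm ((w x - cl n x)\<^sup>2) \<le> (w x)\<^sup>2" by (simp add: abs_le_square_iff)
    qed
  qed (use int in auto)
  then have "(\<lambda>n. LINT x|Leb. (w x - cl n x)\<^sup>2) \<longlonglongrightarrow> 0" by simp
  from order_tendstoD(2)[OF this, of "e / 4"] e
  obtain n where n: "(LINT x|Leb. (w x - cl n x)\<^sup>2) < e / 4" by (auto simp: eventually_sequentially)
  define B where "B = real n"
  have B: "\<bar>cl n x\<bar> \<le> B" for x by (auto simp: cl_def B_def)
  \<comment> \<open>This error is later multiplied by 4 B, so it contributes at most e / 2; the
    truncation error, doubled, contributes less than the other half.\<close>
  obtain \<phi> where \<phi>: "continuous_on UNIV \<phi>" "\<And>x. \<bar>\<phi> x\<bar> \<le> B" "(LINT x|Leb. \<bar>cl n x - \<phi> x\<bar>) < e / (8 * (B + 1))"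
  proof (rule bounded_continuous_approx[OF Leb.finite_measure_axioms sets_Leb, of "cl n" B "e / (8 * (B + 1))"])
    show "0 < e / (8 * (B + 1))" using e by (simp add: B_def)
  qed (use B in auto)
  have [measurable]: "\<phi> \<in> borel_measurable borel" by (rule continuous_torus_measurable[OF \<phi>(1)])
  have i1: "integrable Leb (\<lambda>x. (w x - cl n x)\<^sup>2)"
  proof (rule Bochner_Integration.integrable_bound[OF int])
    show "AE x in Leb. norm ((w x - cl n x)\<^sup>2) \<le> norm ((w x)\<^sup>2)"
    proof (rule AE_I2)
      fix x
      have "\<bar>w x - cl n x\<bar> \<le> \<bar>w x\<bar>" by (auto simp: cl_def min_def max_def)
      then show "norm ((w x - cl n x)\<^sup>2) \<le> norm ((w x)\<^sup>2)" by (simp add: abs_le_square_iff)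
    qed
  qed measurable
  have i2: "integrable Leb (\<lambda>x. \<bar>cl n x - \<phi> x\<bar>)"
  proof (rule Leb.integrable_const_bound[of _ "2 * B"])
    show "AE x in Leb. norm \<bar>cl n x - \<phi> x\<bar> \<le> 2 * B"
    proof (rule AE_I2)
      fix x show "norm \<bar>cl n x - \<phi> x\<bar> \<le> 2 * B" using B[of x] \<phi>(2)[of x] by simp
    qed
  qed measurable
  have pt: "(w x - \<phi> x)\<^sup>2 \<le> 2 * (w x - cl n x)\<^sup>2 + (4 * B) * \<bar>cl n x - \<phi> x\<bar>" for x
  proof -
    have "(w x - \<phi> x)\<^sup>2 \<le> 2 * (w x - cl n x)\<^sup>2 + 2 * (cl n x - \<phi> x)\<^sup>2"
      using zero_le_power2[of "(w x - cl n x) - (cl n x - \<phi> x)"] by (simp add: power2_eq_square algebra_simps)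
    moreover have "(cl n x - \<phi> x)\<^sup>2 = \<bar>cl n x - \<phi> x\<bar> * \<bar>cl n x - \<phi> x\<bar>" by (simp add: power2_eq_square)
    moreover have "\<dots> \<le> (2 * B) * \<bar>cl n x - \<phi> x\<bar>"
      using B[of x] \<phi>(2)[of x] by (intro mult_right_mono) auto
    ultimately show ?thesis by linarith
  qed
  have "(LINT x|Leb. (w x - \<phi> x)\<^sup>2) \<le> (LINT x|Leb. 2 * (w x - cl n x)\<^sup>2 + (4 * B) * \<bar>cl n x - \<phi> x\<bar>)"
  proof (rule integral_mono_AE)
    show i3: "integrable Leb (\<lambda>x. 2 * (w x - cl n x)\<^sup>2 + (4 * B) * \<bar>cl n x - \<phi> x\<bar>)"
      using i1 i2 by (intro Bochner_Integration.integrable_add integrable_mult_right)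
    show "integrable Leb (\<lambda>x. (w x - \<phi> x)\<^sup>2)"
      by (rule Bochner_Integration.integrable_bound[OF i3])
         (use pt in \<open>auto intro!: AE_I2 order_trans[OF pt]\<close>)
  qed (use pt in auto)
  also have "\<dots> = 2 * (LINT x|Leb. (w x - cl n x)\<^sup>2) + (4 * B) * (LINT x|Leb. \<bar>cl n x - \<phi> x\<bar>)"
    using i1 i2 by (subst Bochner_Integration.integral_add) auto
  also have "\<dots> \<le> 2 * (LINT x|Leb. (w x - cl n x)\<^sup>2) + (4 * B) * (e / (8 * (B + 1)))"
    using \<phi>(3) by (intro add_left_mono mult_left_mono) (auto simp: B_def)
  also have "\<dots> < e"
  proof -
    have "(4 * B) * (e / (8 * (B + 1))) \<le> e / 2"
      using e by (simp add: B_def field_simps)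
    then show ?thesis using n by linarith
  qed
  finally show thesis by (rule that[OF \<phi>(1)])
qed

text \<open>A fixed sequence of positive heat times tending to 0, so that small-time limits are
  sequential and fit Fatou's lemma and limits of sequences of integrals.\<close>

definition heat_time :: "nat \<Rightarrow> real" where "heat_time n = 1 / (real n + 1)"

lemma heat_time_pos: "heat_time n > 0"
  by (simp add: heat_time_def)

lemma heat_time_lim: "heat_time \<longlonglongrightarrow> 0"
  using LIMSEQ_inverse_real_of_nat by (simp add: heat_time_def[abs_def] inverse_eq_divide add.commute)

text \<open>w is split into a continuous part, on which the heat flow converges uniformly, and a
  remainder small in L2, on which the heat flow is a contraction. Convergence against a fixed L2
  function is what the passage to the limit in \<open>weak_gradient_square\<close> uses.\<close>

lemma hconv_L2_weak:
  fixes f w :: "'n::finite torus \<Rightarrow> real"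
  assumes f[measurable]: "f \<in> borel_measurable borel" and fi: "integrable Leb (\<lambda>x. (f x)\<^sup>2)"
    and w[measurable]: "w \<in> borel_measurable borel" and wi: "integrable Leb (\<lambda>x. (w x)\<^sup>2)"
  shows "(\<lambda>n. LINT x|Leb. f x * hconv (heat_time n) Leb w x) \<longlonglongrightarrow> (LINT x|Leb. f x * w x)"
proof (rule tendstoI)
  fix e :: real assume e: "e > 0"
  define F where "F = (LINT x|Leb. (f x)\<^sup>2)"
  have F: "0 \<le> F" unfolding F_def by (intro Bochner_Integration.integral_nonneg) auto
  \<comment> \<open>Makes \<eta> F at most e / 8. The remainder is then taken with squared norm
    below \<eta> (e / 8), so that division by \<eta> again leaves e / 8.\<close>
  define \<eta> where "\<eta> = e / 8 / (F + 1)"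
  have \<eta>: "\<eta> > 0" using e F by (simp add: \<eta>_def)
  obtain w' where w': "continuous_on UNIV w'" "(LINT x|Leb. (w x - w' x)\<^sup>2) < \<eta> * (e / 8)"
    using L2_continuous_approx[OF w wi, of "\<eta> * (e / 8)"] e \<eta> by auto
  have w'm[measurable]: "w' \<in> borel_measurable borel" by (rule continuous_torus_measurable[OF w'(1)])
  have w'i: "integrable Leb w'" "integrable Leb (\<lambda>x. (w' x)\<^sup>2)"
    by (intro continuous_integrable_Leb continuous_intros w'(1))+
  have wi1: "integrable Leb w" by (rule integrable_of_square[OF Leb.finite_measure_axioms]) (use wi in auto)
  have fi1: "integrable Leb f" by (rule integrable_of_square[OF Leb.finite_measure_axioms]) (use fi in auto)
  define r where "r x = w x - w' x" for x
  have [measurable]: "r \<in> borel_measurable borel" unfolding r_def by measurable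
  have ri: "integrable Leb (\<lambda>x. (r x)\<^sup>2)"
  proof -
    have "integrable Leb (\<lambda>x. (w x)\<^sup>2 + (w' x)\<^sup>2 - 2 * (w x * w' x))"
      using wi w'i integrable_mult_squares[of w Leb w'] by auto
    then show ?thesis by (simp add: r_def power2_diff algebra_simps)
  qed
  have ri1: "integrable Leb r" by (rule integrable_of_square[OF Leb.finite_measure_axioms]) (use ri in auto)
  define A where "A = (LINT x|Leb. \<bar>f x\<bar>)"
  have A: "0 \<le> A" unfolding A_def by (intro Bochner_Integration.integral_nonneg) auto
  have "e / (4 * (A + 1)) > 0" using e A by simp
  then obtain s0 where s0: "s0 > 0" "\<And>s y. 0 < s \<Longrightarrow> s < s0 \<Longrightarrow> norm (hconv s Leb w' y - w' y) \<le> e / (4 * (A + 1))"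
    using hconv_uniform_approx[OF w'(1)] by metis
  have "\<forall>\<^sub>F n in sequentially. heat_time n < s0" by (rule order_tendstoD(2)[OF heat_time_lim s0(1)])
  then show "\<forall>\<^sub>F n in sequentially. dist (LINT x|Leb. f x * hconv (heat_time n) Leb w x) (LINT x|Leb. f x * w x) < e"
  proof eventually_elim
    case (elim n)
    define s where "s = heat_time n"
    have s: "0 < s" "s < s0" using elim heat_time_pos[of n] by (auto simp: s_def)
    have cr: "continuous_on UNIV (hconv s Leb r)" by (rule hconv_continuous[OF s(1) sets_Leb ri1])
    have [measurable]: "hconv s Leb r \<in> borel_measurable borel" by (rule continuous_torus_measurable[OF cr])
    have cw: "continuous_on UNIV (hconv s Leb w')" by (rule hconv_continuous[OF s(1) sets_Leb w'i(1)])
    have [measurable]: "hconv s Leb w' \<in> borel_measurable borel" by (rule continuous_torus_measurable[OF cw])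
    have split: "hconv s Leb w x = hconv s Leb r x + hconv s Leb w' x" for x
    proof -
      have "hconv s Leb r x + hconv s Leb w' x = (LINT y|Leb. hk s x y *\<^sub>R r y + hk s x y *\<^sub>R w' y)"
        unfolding hconv_def using integrable_hk_scaleR[OF s(1) sets_Leb ri1, of x] integrable_hk_scaleR[OF s(1) sets_Leb w'i(1), of x]
        by (intro Bochner_Integration.integral_add[symmetric])
      also have "\<dots> = hconv s Leb w x"
        unfolding hconv_def by (intro Bochner_Integration.integral_cong) (auto simp: r_def algebra_simps)
      finally show ?thesis by simp
    qed
    note sq = hconv_square_le[OF s(1) _ ri]
    have i1: "integrable Leb (\<lambda>x. f x * hconv s Leb r x)" by (rule integrable_mult_squares) (use fi sq in auto)
    have i3: "integrable Leb (\<lambda>x. f x * r x)" by (rule integrable_mult_squares) (use fi ri in auto)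
    have ib: "integrable Leb (\<lambda>x. f x * g x)" if "continuous_on UNIV g" for g :: "'n torus \<Rightarrow> real"
      using integrable_bilinear_continuous[OF bounded_bilinear_mult sets_Leb fi1 that] by (simp add: mult.commute)
    have i2: "integrable Leb (\<lambda>x. f x * (hconv s Leb w' x - w' x))" by (intro ib continuous_intros cw w')
    have "(LINT x|Leb. f x * hconv s Leb w x) - (LINT x|Leb. f x * w x)
        = (LINT x|Leb. f x * hconv s Leb r x) + (LINT x|Leb. f x * (hconv s Leb w' x - w' x)) - (LINT x|Leb. f x * r x)"
    proof -
      have "(LINT x|Leb. f x * hconv s Leb w x) = (LINT x|Leb. f x * hconv s Leb r x + f x * (hconv s Leb w' x - w' x) + f x * w' x)"
        by (intro Bochner_Integration.integral_cong) (auto simp: split algebra_simps)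
      also have "\<dots> = (LINT x|Leb. f x * hconv s Leb r x) + (LINT x|Leb. f x * (hconv s Leb w' x - w' x)) + (LINT x|Leb. f x * w' x)"
        using i1 i2 ib[OF w'(1)] by simp
      moreover have "(LINT x|Leb. f x * w x) = (LINT x|Leb. f x * r x + f x * w' x)"
        by (intro Bochner_Integration.integral_cong) (auto simp: r_def algebra_simps)
      moreover have "\<dots> = (LINT x|Leb. f x * r x) + (LINT x|Leb. f x * w' x)" using i3 ib[OF w'(1)] by simp
      ultimately show ?thesis by linarith
    qed
    moreover have "\<bar>LINT x|Leb. f x * hconv s Leb r x\<bar> \<le> \<eta> * F + (1 / \<eta>) * (LINT x|Leb. (r x)\<^sup>2)"
    proof -
      have "\<bar>LINT x|Leb. f x * hconv s Leb r x\<bar> \<le> \<eta> * F + (1 / \<eta>) * (LINT x|Leb. (hconv s Leb r x)\<^sup>2)"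
        unfolding F_def by (rule integral_mult_AMGM) (use fi sq \<eta> in auto)
      also have "\<dots> \<le> \<eta> * F + (1 / \<eta>) * (LINT x|Leb. (r x)\<^sup>2)"
        using \<eta> sq(1) by (intro add_left_mono mult_left_mono) auto
      finally show ?thesis .
    qed
    moreover have "\<bar>LINT x|Leb. f x * r x\<bar> \<le> \<eta> * F + (1 / \<eta>) * (LINT x|Leb. (r x)\<^sup>2)"
      unfolding F_def by (rule integral_mult_AMGM) (use fi ri \<eta> in auto)
    moreover have "\<eta> * F + (1 / \<eta>) * (LINT x|Leb. (r x)\<^sup>2) \<le> e / 4"
    proof -
      have "\<eta> * F \<le> \<eta> * (F + 1)" using \<eta> by simp
      also have "\<eta> * (F + 1) = e / 8"
      proof -
        have "F + 1 \<noteq> 0" using F by simp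
        then show ?thesis by (rule nonzero_divide_eq_eq[THEN iffD1, OF _ \<eta>_def[symmetric], symmetric])
      qed
      finally have "\<eta> * F \<le> e / 8" .
      moreover have "(1 / \<eta>) * (LINT x|Leb. (r x)\<^sup>2) \<le> e / 8"
      proof -
        have "(1 / \<eta>) * (LINT x|Leb. (r x)\<^sup>2) \<le> (1 / \<eta>) * (\<eta> * (e / 8))"
          using w'(2) \<eta> by (intro mult_left_mono) (auto simp: r_def)
        also have "\<dots> = e / 8" using \<eta> by simp
        finally show ?thesis .
      qed
      ultimately show ?thesis by linarith
    qed
    moreover have "\<bar>LINT x|Leb. f x * (hconv s Leb w' x - w' x)\<bar> \<le> e / 4"
    proof -
      have "norm (LINT x|Leb. f x * (hconv s Leb w' x - w' x)) \<le> (LINT x|Leb. e / (4 * (A + 1)) * \<bar>f x\<bar>)"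
      proof (rule norm_integral_le[OF i2])
        show "norm (f x * (hconv s Leb w' x - w' x)) \<le> e / (4 * (A + 1)) * \<bar>f x\<bar>" for x
          using mult_right_mono[OF s0(2)[OF s, of x], of "\<bar>f x\<bar>"] by (simp add: abs_mult mult.commute)
      qed (use fi1 in auto)
      also have "\<dots> = e / (4 * (A + 1)) * A" by (simp add: A_def)
      also have "\<dots> \<le> e / 4" using A e by (simp add: field_simps)
      finally show ?thesis by simp
    qed
    ultimately have "\<bar>(LINT x|Leb. f x * hconv s Leb w x) - (LINT x|Leb. f x * w x)\<bar> \<le> e / 4 + e / 4 + e / 4" by linarith
    then show ?case using e by (simp add: dist_real_def s_def)
  qed
qed

section \<open>The weak gradient of a square and the decrease of the Fisher information\<close>

lemma LINT_vec_nth: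
  fixes f :: "'a \<Rightarrow> real^'n::finite"
  shows "integrable M f \<Longrightarrow> (LINT x|M. f x) $ i = (LINT x|M. f x $ i)"
  using integral_bounded_linear[OF bounded_linear_vec_nth[of i], of M f] by simp

lemma integrable_vec_nth: "integrable M f \<Longrightarrow> integrable M (\<lambda>x. (f x :: real^'n::finite) $ i)"
  using integrable_bounded_linear[OF bounded_linear_vec_nth[of i], of M f] by simp

lemma hconv_vec_nth:
  fixes g :: "'n::finite torus \<Rightarrow> real^'m::finite"
  assumes "s > 0" "sets \<mu> = sets borel" "integrable \<mu> g"
  shows "hconv s \<mu> g x $ i = hconv s \<mu> (\<lambda>y. g y $ i) x"
  unfolding hconv_def by (subst LINT_vec_nth[OF integrable_hk_scaleR[OF assms]]) simp

text \<open>Obtained by testing the weak gradient of \<open>w\<close> with \<open>\<phi>\<close> times a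
  mollification of \<open>w\<close>.\<close>

lemma weak_gradient_square:
  fixes w :: "'n::finite torus \<Rightarrow> real"
  assumes wg: "weak_gradient w g" and w[measurable]: "w \<in> borel_measurable borel" and g[measurable]: "g \<in> borel_measurable borel"
    and wi: "integrable Leb (\<lambda>x. (w x)\<^sup>2)" and gi: "integrable Leb (\<lambda>x. (norm (g x))\<^sup>2)"
    and \<phi>: "C1_torus \<phi> G"
  shows "(LINT x|Leb. (w x)\<^sup>2 *\<^sub>R G x) = - (LINT x|Leb. \<phi> x *\<^sub>R (2 * w x) *\<^sub>R g x)"
proof -
  note c = C1_torus_continuous[OF \<phi>]
  have [measurable]: "\<phi> \<in> borel_measurable borel" "G \<in> borel_measurable borel" using c by (auto intro: continuous_torus_measurable)
  have w1: "integrable Leb w" and g1: "integrable Leb g" using wg by (auto simp: weak_gradient_def)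
  have [measurable]: "(\<lambda>x. g x $ i) \<in> borel_measurable borel" for i
    by (rule measurable_compose[OF g borel_measurable_continuous_onI[OF continuous_on_component[OF continuous_on_id]]])
  have gci: "integrable Leb (\<lambda>x. (g x $ i)\<^sup>2)" for i
    by (rule Bochner_Integration.integrable_bound[OF gi])
       (auto intro!: AE_I2 power_mono component_le_norm_cart simp: abs_le_square_iff[symmetric])
  obtain C1 where C1: "0 < C1" "\<And>x. norm (G x) \<le> C1" using continuous_torus_bounded[OF c(2)] by blast
  obtain C2 where C2: "0 < C2" "\<And>x. norm (\<phi> x) \<le> C2" using continuous_torus_bounded[OF c(1)] by blast
  have bi: "integrable Leb (\<lambda>x. (p x * f x)\<^sup>2)"
    if "integrable Leb (\<lambda>x. (f x)\<^sup>2)" "continuous_on UNIV p" for p f :: "'n torus \<Rightarrow> real"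
    using integrable_bilinear_continuous[OF bounded_bilinear_mult sets_Leb that(1), of "\<lambda>x. (p x)\<^sup>2"] that(2)
    by (simp add: power_mult_distrib continuous_on_power)
  have wgi: "integrable Leb (\<lambda>x. w x * g x $ i)" for i by (rule integrable_mult_squares) (use wi gci in auto)
  have wgv: "integrable Leb (\<lambda>x. w x *\<^sub>R g x)"
  proof (rule Bochner_Integration.integrable_bound)
    show "integrable Leb (\<lambda>x. w x * norm (g x))" by (rule integrable_mult_squares) (use wi gi in auto)
  qed auto
  have "(LINT x|Leb. (w x)\<^sup>2 *\<^sub>R G x) $ i = (- (LINT x|Leb. \<phi> x *\<^sub>R (2 * w x) *\<^sub>R g x)) $ i" for i
  proof -
    have Gi: "continuous_on UNIV (\<lambda>x. G x $ i)" by (intro continuous_on_component c)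
    have [measurable]: "(\<lambda>x. G x $ i) \<in> borel_measurable borel" by (rule continuous_torus_measurable[OF Gi])
    have eq: "(LINT x|Leb. (G x $ i * w x) * hconv (heat_time n) Leb w x) + (LINT x|Leb. (\<phi> x * w x) * hconv (heat_time n) Leb (\<lambda>y. g y $ i) x)
        = - (LINT x|Leb. (\<phi> x * g x $ i) * hconv (heat_time n) Leb w x)" for n
    proof -
      let ?s = "heat_time n"
      note s = heat_time_pos[of n]
      have C: "C1_torus (hconv ?s Leb w) (hconv ?s Leb g)" by (rule hconv_C1_weak_gradient[OF s wg])
      note cc = C1_torus_continuous[OF C]
      note P = C1_torus_mult[OF \<phi> C]
      have "(LINT x|Leb. w x *\<^sub>R (hconv ?s Leb w x *\<^sub>R G x + \<phi> x *\<^sub>R hconv ?s Leb g x)) = - (LINT x|Leb. (\<phi> x * hconv ?s Leb w x) *\<^sub>R g x)"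
        using wg P unfolding weak_gradient_def by blast
      then have "(LINT x|Leb. w x *\<^sub>R (hconv ?s Leb w x *\<^sub>R G x + \<phi> x *\<^sub>R hconv ?s Leb g x)) $ i = - (LINT x|Leb. (\<phi> x * hconv ?s Leb w x) *\<^sub>R g x) $ i"
        by simp
      moreover have "(LINT x|Leb. w x *\<^sub>R (hconv ?s Leb w x *\<^sub>R G x + \<phi> x *\<^sub>R hconv ?s Leb g x)) $ i
        = (LINT x|Leb. (G x $ i * w x) * hconv ?s Leb w x) + (LINT x|Leb. (\<phi> x * w x) * hconv ?s Leb (\<lambda>y. g y $ i) x)"
      proof -
        have a: "integrable Leb (\<lambda>x. w x *\<^sub>R (hconv ?s Leb w x *\<^sub>R G x + \<phi> x *\<^sub>R hconv ?s Leb g x))"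
          using integrable_bilinear_continuous[OF bounded_bilinear.flip[OF bounded_bilinear_scaleR] sets_Leb w1]
            C1_torus_continuous(2)[OF P] by blast
        have b: "integrable Leb (\<lambda>x. (G x $ i * w x) * hconv ?s Leb w x)"
          using integrable_bilinear_continuous[OF bounded_bilinear_mult sets_Leb w1 continuous_on_mult[OF Gi cc(1)]]
          by (simp add: ac_simps)
        have d: "continuous_on UNIV (hconv ?s Leb (\<lambda>y. g y $ i))"
          by (intro hconv_continuous s sets_Leb integrable_vec_nth g1)
        have e: "integrable Leb (\<lambda>x. (\<phi> x * w x) * hconv ?s Leb (\<lambda>y. g y $ i) x)"
          using integrable_bilinear_continuous[OF bounded_bilinear_mult sets_Leb w1 continuous_on_mult[OF c(1) d]]
          by (simp add: ac_simps)
        show ?thesis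
          unfolding LINT_vec_nth[OF a] Bochner_Integration.integral_add[OF b e, symmetric]
          by (intro Bochner_Integration.integral_cong) (auto simp: hconv_vec_nth[OF s sets_Leb g1] algebra_simps)
      qed
      moreover have "(LINT x|Leb. (\<phi> x * hconv ?s Leb w x) *\<^sub>R g x) $ i = (LINT x|Leb. (\<phi> x * g x $ i) * hconv ?s Leb w x)"
      proof -
        have a: "integrable Leb (\<lambda>x. (\<phi> x * hconv ?s Leb w x) *\<^sub>R g x)"
          by (rule integrable_bilinear_continuous[OF bounded_bilinear_scaleR sets_Leb g1 continuous_on_mult[OF c(1) cc(1)]])
        show ?thesis unfolding LINT_vec_nth[OF a] by (intro Bochner_Integration.integral_cong) (auto simp: ac_simps)
      qed
      ultimately show ?thesis by simp
    qed
    have l1: "(\<lambda>n. LINT x|Leb. (G x $ i * w x) * hconv (heat_time n) Leb w x) \<longlonglongrightarrow> (LINT x|Leb. (G x $ i * w x) * w x)"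
      by (rule hconv_L2_weak) (use wi bi[OF wi Gi] in auto)
    have l2: "(\<lambda>n. LINT x|Leb. (\<phi> x * w x) * hconv (heat_time n) Leb (\<lambda>y. g y $ i) x) \<longlonglongrightarrow> (LINT x|Leb. (\<phi> x * w x) * g x $ i)"
      by (rule hconv_L2_weak) (use gci bi[OF wi c(1)] in auto)
    have l3: "(\<lambda>n. LINT x|Leb. (\<phi> x * g x $ i) * hconv (heat_time n) Leb w x) \<longlonglongrightarrow> (LINT x|Leb. (\<phi> x * g x $ i) * w x)"
      by (rule hconv_L2_weak) (use wi bi[OF gci c(1)] in auto)
    \<comment> \<open>After the limit, the term with the mollified gradient coincides with the term
      on the right up to sign; this produces the factor 2 of the chain rule.\<close>
    have "(LINT x|Leb. (G x $ i * w x) * w x) + (LINT x|Leb. (\<phi> x * w x) * g x $ i) = - (LINT x|Leb. (\<phi> x * g x $ i) * w x)"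
      by (rule LIMSEQ_unique[OF tendsto_add[OF l1 l2]]) (unfold eq, rule tendsto_minus[OF l3])
    moreover have "(LINT x|Leb. (\<phi> x * g x $ i) * w x) = (LINT x|Leb. (\<phi> x * w x) * g x $ i)"
      by (intro Bochner_Integration.integral_cong) (auto simp: ac_simps)
    ultimately have "(LINT x|Leb. (G x $ i * w x) * w x) = - (2 * (LINT x|Leb. (\<phi> x * w x) * g x $ i))" by linarith
    moreover have "(LINT x|Leb. (w x)\<^sup>2 *\<^sub>R G x) $ i = (LINT x|Leb. (G x $ i * w x) * w x)"
    proof -
      have a: "integrable Leb (\<lambda>x. (w x)\<^sup>2 *\<^sub>R G x)"
        by (rule integrable_bilinear_continuous[OF bounded_bilinear.flip[OF bounded_bilinear_scaleR] sets_Leb wi c(2)])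
      show ?thesis unfolding LINT_vec_nth[OF a]
        by (intro Bochner_Integration.integral_cong) (auto simp: power2_eq_square ac_simps)
    qed
    moreover have "(LINT x|Leb. \<phi> x *\<^sub>R (2 * w x) *\<^sub>R g x) $ i = 2 * (LINT x|Leb. (\<phi> x * w x) * g x $ i)"
    proof -
      have "integrable Leb (\<lambda>x. 2 *\<^sub>R \<phi> x *\<^sub>R w x *\<^sub>R g x)"
        using integrable_bilinear_continuous[OF bounded_bilinear_scaleR sets_Leb wgv c(1)] by (rule integrable_scaleR_right)
      then have a: "integrable Leb (\<lambda>x. \<phi> x *\<^sub>R (2 * w x) *\<^sub>R g x)" by (simp add: ac_simps)
      have "(LINT x|Leb. \<phi> x *\<^sub>R (2 * w x) *\<^sub>R g x) $ i = (LINT x|Leb. 2 * ((\<phi> x * w x) * g x $ i))"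
        unfolding LINT_vec_nth[OF a] by (intro Bochner_Integration.integral_cong) (auto simp: ac_simps)
      then show ?thesis by simp
    qed
    ultimately show ?thesis by simp
  qed
  then show ?thesis by (intro vec_eq_iff[THEN iffD2] allI)
qed

text \<open>With P the heat flow, the heated density is P (w^2) and its gradient is 2 P (w g). Hence
  the squared gradient of its root is \<bar>P (w g)\<bar>^2 / P (w^2), at most P (\<bar>g\<bar>^2)
  by Cauchy-Schwarz for the kernel, and P preserves integrals. Working with the root avoids division
  by the original density, which may vanish.\<close>

lemma heat_fisher_le:
  fixes w :: "'n::finite torus \<Rightarrow> real"
  assumes wg: "weak_gradient w g" and w[measurable]: "w \<in> borel_measurable borel" and g[measurable]: "g \<in> borel_measurable borel"
    and wi: "integrable Leb (\<lambda>x. (w x)\<^sup>2)" and gi: "integrable Leb (\<lambda>x. (norm (g x))\<^sup>2)"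
    and \<mu>: "\<mu> \<in> prob_measures" "\<mu> = density Leb (\<lambda>x. ennreal ((w x)\<^sup>2))" and s: "s > 0"
  shows "(\<integral>\<^sup>+x. ennreal ((norm ((1 / (2 * sqrt (hdens s \<mu> x))) *\<^sub>R hgrad s \<mu> (\<lambda>_. 1) x))\<^sup>2) \<partial>Leb)
    \<le> (\<integral>\<^sup>+x. ennreal ((norm (g x))\<^sup>2) \<partial>Leb)"
proof -
  note u = hdens_props[OF s \<mu>(1)]
  have ueq: "hdens s \<mu> x = hconv s Leb (\<lambda>y. (w y)\<^sup>2) x" for x
    unfolding \<mu>(2) by (subst hconv_density[OF _ _ _ s]) auto
  have grad: "hgrad s \<mu> (\<lambda>_. 1) x = 2 *\<^sub>R hconv s Leb (\<lambda>y. w y *\<^sub>R g y) x" for x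
  proof -
    have [measurable]: "hkD s x \<in> borel_measurable borel" by (rule continuous_torus_measurable[OF hk_continuous1(5)[OF s]])
    have "hgrad s \<mu> (\<lambda>_. 1) x = (LINT y|Leb. (w y)\<^sup>2 *\<^sub>R hkD s x y)"
      unfolding hgrad_def \<mu>(2) by (subst integral_density) auto
    also have "\<dots> = - (LINT y|Leb. (w y)\<^sup>2 *\<^sub>R - hkD s x y)" by simp
    also have "\<dots> = (LINT y|Leb. hk s x y *\<^sub>R (2 * w y) *\<^sub>R g y)"
      unfolding weak_gradient_square[OF wg w g wi gi hk_C1'[OF s, of x]] by simp
    also have "\<dots> = (LINT y|Leb. 2 *\<^sub>R hk s x y *\<^sub>R w y *\<^sub>R g y)"
      by (intro Bochner_Integration.integral_cong) (auto simp: ac_simps)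
    finally show ?thesis by (simp only: hconv_def integral_scaleR_right)
  qed
  have cg: "continuous_on UNIV (hconv s Leb (\<lambda>y. (norm (g y))\<^sup>2))" by (rule hconv_continuous[OF s sets_Leb gi])
  have pt: "(norm ((1 / (2 * sqrt (hdens s \<mu> x))) *\<^sub>R hgrad s \<mu> (\<lambda>_. 1) x))\<^sup>2 \<le> hconv s Leb (\<lambda>y. (norm (g y))\<^sup>2) x" for x
  proof -
    have "(norm ((1 / (2 * sqrt (hdens s \<mu> x))) *\<^sub>R hgrad s \<mu> (\<lambda>_. 1) x))\<^sup>2
        = (norm (hconv s Leb (\<lambda>y. w y *\<^sub>R g y) x))\<^sup>2 / hdens s \<mu> x"
      using u(1)[of x] unfolding grad by (simp add: power_mult_distrib power_divide)
    also have "\<dots> \<le> (hconv s Leb (\<lambda>y. (w y)\<^sup>2) x * hconv s Leb (\<lambda>y. (norm (g y))\<^sup>2) x) / hdens s \<mu> x"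
      using u(1)[of x]
      by (intro divide_right_mono hconv_Cauchy_Schwarz[OF s Leb.finite_measure_axioms sets_Leb gi g wi w]) auto
    also have "\<dots> = hconv s Leb (\<lambda>y. (norm (g y))\<^sup>2) x" using u(1)[of x] by (simp add: ueq)
    finally show ?thesis .
  qed
  have pos: "0 \<le> hconv s Leb (\<lambda>y. (norm (g y))\<^sup>2) x" for x
    unfolding hconv_def real_scaleR_def
    by (intro Bochner_Integration.integral_nonneg mult_nonneg_nonneg hk_nonneg[OF s] zero_le_power2)
  have "(\<integral>\<^sup>+x. ennreal ((norm ((1 / (2 * sqrt (hdens s \<mu> x))) *\<^sub>R hgrad s \<mu> (\<lambda>_. 1) x))\<^sup>2) \<partial>Leb)
      \<le> (\<integral>\<^sup>+x. ennreal (hconv s Leb (\<lambda>y. (norm (g y))\<^sup>2) x) \<partial>Leb)"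
    by (intro nn_integral_mono ennreal_leI pt)
  also have "\<dots> = ennreal (LINT x|Leb. hconv s Leb (\<lambda>y. (norm (g y))\<^sup>2) x)"
    by (intro nn_integral_eq_integral continuous_integrable_Leb cg) (auto simp: pos)
  also have "\<dots> = ennreal (LINT x|Leb. (norm (g x))\<^sup>2)"
    by (simp only: integral_hconv[OF s Leb.finite_measure_axioms sets_Leb gi])
  also have "\<dots> = (\<integral>\<^sup>+x. ennreal ((norm (g x))\<^sup>2) \<partial>Leb)"
    by (intro nn_integral_eq_integral[symmetric] gi) auto
  finally show ?thesis .
qed

section \<open>Square root and logarithm of a positive C1 density\<close>

lemma C1_torus_sqrt:
  fixes u :: "'n::finite torus \<Rightarrow> real"
  assumes "C1_torus u G" "\<And>x. 0 < u x"
  shows "C1_torus (\<lambda>x. sqrt (u x)) (\<lambda>x. (1 / (2 * sqrt (u x))) *\<^sub>R G x)"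
  unfolding C1_torus_def
proof (intro conjI allI)
  note c = C1_torus_continuous[OF assms(1)]
  show "continuous_on UNIV (\<lambda>x. (1 / (2 * sqrt (u x))) *\<^sub>R G x)"
  proof (intro continuous_intros c ballI)
    fix x show "2 * sqrt (u x) \<noteq> 0" using assms(2)[of x] by simp
  qed
  fix x
  have "((\<lambda>y. u (torus_proj y)) has_derivative (\<lambda>h. G (torus_proj x) \<bullet> h)) (at x)" using assms(1) by (simp add: C1_torus_def)
  note D = has_derivative_real_sqrt[where g="\<lambda>y. u (torus_proj y)" and x=x, OF assms(2) this]
  have "(\<lambda>h. ((1 / (2 * sqrt (u (torus_proj x)))) *\<^sub>R G (torus_proj x)) \<bullet> h) = (\<lambda>h. G (torus_proj x) \<bullet> h * (inverse (sqrt (u (torus_proj x))) / 2))"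
    by (rule ext) (simp add: inverse_eq_divide)
  with D show "((\<lambda>y. sqrt (u (torus_proj y))) has_derivative (\<lambda>h. ((1 / (2 * sqrt (u (torus_proj x)))) *\<^sub>R G (torus_proj x)) \<bullet> h)) (at x)"
    by simp
qed

lemma C1_torus_ln:
  fixes u :: "'n::finite torus \<Rightarrow> real"
  assumes "C1_torus u G" "\<And>x. 0 < u x"
  shows "C1_torus (\<lambda>x. ln (u x)) (\<lambda>x. (1 / u x) *\<^sub>R G x)"
  unfolding C1_torus_def
proof (intro conjI allI)
  note c = C1_torus_continuous[OF assms(1)]
  show "continuous_on UNIV (\<lambda>x. (1 / u x) *\<^sub>R G x)"
  proof (intro continuous_intros c ballI)
    fix x show "u x \<noteq> 0" using assms(2)[of x] by simp
  qed
  fix x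
  have "((\<lambda>y. u (torus_proj y)) has_derivative (\<lambda>h. G (torus_proj x) \<bullet> h)) (at x)" using assms(1) by (simp add: C1_torus_def)
  note D = has_derivative_ln[where g="\<lambda>y. u (torus_proj y)" and x=x, OF assms(2) this]
  have "(\<lambda>h. ((1 / u (torus_proj x)) *\<^sub>R G (torus_proj x)) \<bullet> h) = (\<lambda>h. G (torus_proj x) \<bullet> h * inverse (u (torus_proj x)))"
    by (rule ext) (simp add: inverse_eq_divide)
  with D show "((\<lambda>y. ln (u (torus_proj y))) has_derivative (\<lambda>h. ((1 / u (torus_proj x)) *\<^sub>R G (torus_proj x)) \<bullet> h)) (at x)"
    by simp
qed

section \<open>The fundamental lemma of the calculus of variations\<close>

text \<open>A C1 transition from 0 to 1, piecewise quadratic: 2 r^2 up to r = 1/2, then 1 - 2 (1 -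
  r)^2 up to r = 1. Its derivative is a triangular bump of mass one. C1 is precisely the regularity
  demanded of test functions.\<close>

definition sstep :: "real \<Rightarrow> real" where
  "sstep r = 2 * (max 0 r)\<^sup>2 - 4 * (max 0 (r - 1 / 2))\<^sup>2 + 2 * (max 0 (r - 1))\<^sup>2"

definition sstep' :: "real \<Rightarrow> real" where
  "sstep' r = 4 * max 0 r - 8 * max 0 (r - 1 / 2) + 4 * max 0 (r - 1)"

lemma deriv_max_0_square: "((\<lambda>r. (max 0 r)\<^sup>2) has_real_derivative 2 * max 0 r) (at (r :: real))"
proof -
  consider "r > 0" | "r < 0" | "r = 0" by linarith
  then show ?thesis
  proof cases
    case 1
    have "((\<lambda>r. r\<^sup>2) has_real_derivative 2 * r) (at r)" by (auto intro!: derivative_eq_intros)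
    then have "((\<lambda>r. (max 0 r)\<^sup>2) has_real_derivative 2 * r) (at r)"
      by (rule has_field_derivative_transform_within_open[where S="{0<..}"]) (use 1 in auto)
    then show ?thesis using 1 by simp
  next
    case 2
    have "((\<lambda>r. 0) has_real_derivative 0) (at r)" by simp
    then have "((\<lambda>r. (max 0 r)\<^sup>2) has_real_derivative 0) (at r)"
      by (rule has_field_derivative_transform_within_open[where S="{..<0}"]) (use 2 in auto)
    then show ?thesis using 2 by simp
  next
    case 3
    have "(\<lambda>h. (max 0 h)\<^sup>2 / h) = (\<lambda>h::real. max 0 h)"
      by (auto simp: fun_eq_iff max_def power2_eq_square)
    moreover have "((\<lambda>h::real. max 0 h) \<longlongrightarrow> max 0 0) (at 0)" by (intro tendsto_intros)
    ultimately show ?thesis using 3 by (simp add: DERIV_def)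
  qed
qed

lemma sstep_deriv: "(sstep has_real_derivative sstep' r) (at r)"
proof -
  have d: "((\<lambda>r. (max 0 (r - a))\<^sup>2) has_real_derivative 2 * max 0 (r - a)) (at r)" for a :: real
  proof -
    have "((\<lambda>r. r - a) has_real_derivative 1) (at r)" by (auto intro!: derivative_eq_intros)
    from DERIV_chain2[OF deriv_max_0_square this] show ?thesis by simp
  qed
  show ?thesis
    unfolding sstep_def[abs_def] sstep'_def
    by (rule DERIV_cong[OF DERIV_add[OF DERIV_diff[OF
          DERIV_cmult[OF deriv_max_0_square] DERIV_cmult[OF d[of "1/2"]]] DERIV_cmult[OF d[of 1]]]]) simp
qed

lemma sstep'_nonneg: "0 \<le> sstep' r"
  by (auto simp: sstep'_def max_def)

lemma sstep'_eq_0: "r \<notin> {0..1} \<Longrightarrow> sstep' r = 0"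
  by (auto simp: sstep'_def max_def)

lemma sstep_eq_0: "r \<le> 0 \<Longrightarrow> sstep r = 0"
  by (simp add: sstep_def)

lemma sstep_eq_1: "1 \<le> r \<Longrightarrow> sstep r = 1"
  by (simp add: sstep_def power2_eq_square algebra_simps)

lemma sstep_mono: "x \<le> y \<Longrightarrow> sstep x \<le> sstep y"
  using sstep_deriv sstep'_nonneg by (metis DERIV_nonneg_imp_nondecreasing)

lemma sstep_bounds: "0 \<le> sstep r" "sstep r \<le> 1"
  using sstep_mono[of "min r 0" r] sstep_mono[of r "max r 1"] sstep_eq_0[of "min r 0"] sstep_eq_1[of "max r 1"] by auto

lemma sstep'_continuous: "continuous_on UNIV sstep'"
  unfolding sstep'_def by (intro continuous_intros)

lemma sstep_scaled_deriv: "((\<lambda>t. sstep (n * (t - a) + b)) has_real_derivative n * sstep' (n * (t - a) + b)) (at t)"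
proof -
  have "((\<lambda>t. n * (t - a) + b) has_real_derivative n) (at t)" by (auto intro!: derivative_eq_intros)
  from DERIV_chain2[OF sstep_deriv this] show ?thesis by (simp add: mult.commute)
qed

lemma average_close:
  fixes E k :: "real \<Rightarrow> real"
  assumes E: "continuous_on {p..q} E" and k: "continuous_on {p..q} k" "\<And>t. 0 \<le> k t" "(LINT t:{p..q}|lborel. k t) = 1"
    and close: "\<And>t. t \<in> {p..q} \<Longrightarrow> k t \<noteq> 0 \<Longrightarrow> \<bar>E t - v\<bar> \<le> e"
  shows "\<bar>(LINT t:{p..q}|lborel. k t * E t) - v\<bar> \<le> e"
proof -
  have i1: "set_integrable lborel {p..q} k" by (rule borel_integrable_atLeastAtMost'[OF k(1)])
  have i2: "set_integrable lborel {p..q} (\<lambda>t. k t * E t)"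
    by (intro borel_integrable_atLeastAtMost' continuous_intros k E)
  have i3: "set_integrable lborel {p..q} (\<lambda>t. k t * v)"
    by (intro borel_integrable_atLeastAtMost' continuous_intros k)
  have "(LINT t:{p..q}|lborel. k t * E t) - v = (LINT t:{p..q}|lborel. k t * E t) - (LINT t:{p..q}|lborel. k t * v)"
    using k(3) by simp
  also have "\<dots> = (LINT t:{p..q}|lborel. k t * E t - k t * v)"
    using i1 i2 by (intro set_integral_diff(2)[symmetric]) auto
  finally have "\<bar>(LINT t:{p..q}|lborel. k t * E t) - v\<bar> = norm (LINT t|lborel. indicator {p..q} t *\<^sub>R (k t * E t - k t * v))"
    by (simp add: set_lebesgue_integral_def)
  also have "\<dots> \<le> (LINT t|lborel. e * (indicator {p..q} t *\<^sub>R k t))"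
  proof (rule norm_integral_le)
    show "integrable lborel (\<lambda>t. indicator {p..q} t *\<^sub>R (k t * E t - k t * v))"
      using set_integral_diff(1)[OF i2 i3] by (simp add: set_integrable_def)
    show "integrable lborel (\<lambda>t. e * (indicator {p..q} t *\<^sub>R k t))" using i1 by (simp add: set_integrable_def)
    show "norm (indicator {p..q} t *\<^sub>R (k t * E t - k t * v)) \<le> e * (indicator {p..q} t *\<^sub>R k t)" for t
    proof (cases "t \<in> {p..q} \<and> k t \<noteq> 0")
      case True
      have "\<bar>k t * E t - k t * v\<bar> = k t * \<bar>E t - v\<bar>" using k(2)[of t] by (simp add: abs_mult flip: right_diff_distrib)
      also have "\<dots> \<le> k t * e" using close True k(2)[of t] by (intro mult_left_mono) auto
      finally show ?thesis using True by (simp add: mult.commute)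
    qed (auto simp: indicator_def)
  qed
  also have "\<dots> = e" using k(3) by (simp add: set_lebesgue_integral_def)
  finally show ?thesis .
qed

text \<open>The weak equation E' = D with E continuous is integrated up to the end points. The tests
  are differences of two smooth steps, rising just after p and falling just before q; they tend to 1
  inside, while their derivatives average E near p and near q.\<close>

lemma du_bois_reymond:
  fixes E D :: "real \<Rightarrow> real"
  assumes pq: "p < q" and E: "continuous_on {p..q} E" and D: "set_integrable lborel {p..q} D"
    and test: "\<And>\<zeta> \<zeta>' a b. p < a \<Longrightarrow> a < b \<Longrightarrow> b < q \<Longrightarrow> (\<And>t. (\<zeta> has_real_derivative \<zeta>' t) (at t)) \<Longrightarrow>
      continuous_on UNIV \<zeta>' \<Longrightarrow> (\<And>t. t \<notin> {a..b} \<Longrightarrow> \<zeta> t = 0) \<Longrightarrow> (LINT t:{p..q}|lborel. \<zeta>' t * E t + \<zeta> t * D t) = 0"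
  shows "(LINT t:{p..q}|lborel. D t) = E q - E p"
proof -
  \<comment> \<open>The offsets place the rise of \<open>f\<close> between p + 1/n and p + 2/n and
    that of \<open>g\<close> between q - 2/n and q - 1/n, so that \<open>f - g\<close> is supported
    strictly inside the interval once n (q - p) > 4.\<close>
  define f where "f n t = sstep (real n * (t - p) + (-1))" for n t
  define g where "g n t = sstep (real n * (t - q) + 2)" for n t
  define f' where "f' n t = real n * sstep' (real n * (t - p) + (-1))" for n t
  define g' where "g' n t = real n * sstep' (real n * (t - q) + 2)" for n t
  have df: "(f n has_real_derivative f' n t) (at t)" "(g n has_real_derivative g' n t) (at t)" for n t
    unfolding f_def[abs_def] g_def[abs_def] f'_def g'_def by (rule sstep_scaled_deriv)+
  have cf': "continuous_on S (f' n)" "continuous_on S (g' n)" for n S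
    unfolding f'_def g'_def by (intro continuous_intros continuous_on_compose2[OF sstep'_continuous]; simp)+
  have nn: "0 \<le> f' n t" "0 \<le> g' n t" for n t unfolding f'_def g'_def using sstep'_nonneg by auto
  obtain N0 :: nat where N0: "4 / (q - p) < real N0" using reals_Archimedean2 by blast
  have big: "4 < real n * (q - p)" "n > 0" if "n \<ge> N0" for n
  proof -
    have "4 / (q - p) < real n" using N0 that by linarith
    then show *: "4 < real n * (q - p)" using pq by (simp add: pos_divide_less_eq)
    then show "n > 0" by (cases n) auto
  qed
  have supp_f: "t \<le> p + 2 / real n" "p + 1 / real n \<le> t" if "f' n t \<noteq> 0" "n > 0" for n t
  proof -
    have "real n * (t - p) + (-1) \<in> {0..1}" using that(1) sstep'_eq_0 unfolding f'_def by fastforce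
    then have "1 \<le> real n * (t - p)" "real n * (t - p) \<le> 2" by auto
    then show "t \<le> p + 2 / real n" "p + 1 / real n \<le> t" using that(2) by (simp_all add: field_simps)
  qed
  have supp_g: "t \<le> q - 1 / real n" "q - 2 / real n \<le> t" if "g' n t \<noteq> 0" "n > 0" for n t
  proof -
    have "real n * (t - q) + 2 \<in> {0..1}" using that(1) sstep'_eq_0 unfolding g'_def by fastforce
    then have "- 2 \<le> real n * (t - q)" "real n * (t - q) \<le> - 1" by auto
    then show "t \<le> q - 1 / real n" "q - 2 / real n \<le> t" using that(2) by (simp_all add: field_simps)
  qed
  have one: "(LINT t:{p..q}|lborel. f' n t) = 1" "(LINT t:{p..q}|lborel. g' n t) = 1" if n: "n \<ge> N0" for n
  proof -
    note b = big[OF n]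
    have "(LINT t:{p..q}|lborel. f' n t) = f n q - f n p"
      unfolding set_lebesgue_integral_def using pq df cf'
      by (intro integral_FTC_atLeastAtMost) (auto simp: has_real_derivative_iff_has_vector_derivative[symmetric] intro: has_field_derivative_at_within)
    also have "\<dots> = 1" using b by (simp add: f_def sstep_eq_0 sstep_eq_1)
    finally show "(LINT t:{p..q}|lborel. f' n t) = 1" .
    have "(LINT t:{p..q}|lborel. g' n t) = g n q - g n p"
      unfolding set_lebesgue_integral_def using pq df cf'
      by (intro integral_FTC_atLeastAtMost) (auto simp: has_real_derivative_iff_has_vector_derivative[symmetric] intro: has_field_derivative_at_within)
    also have "\<dots> = 1" using b by (simp add: g_def sstep_eq_0 sstep_eq_1 algebra_simps)
    finally show "(LINT t:{p..q}|lborel. g' n t) = 1" .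
  qed
  have i: "set_integrable lborel {p..q} (\<lambda>t. f' n t * E t)" "set_integrable lborel {p..q} (\<lambda>t. g' n t * E t)" for n
    by (intro borel_integrable_atLeastAtMost' continuous_intros cf' E)+
  have [measurable]: "f n \<in> borel_measurable borel" "g n \<in> borel_measurable borel" for n
    by (intro borel_measurable_continuous_onI continuous_at_imp_continuous_on ballI DERIV_isCont[OF df(1)] DERIV_isCont[OF df(2)])+
  have bd: "\<bar>f n t - g n t\<bar> \<le> 1" for n t
    using sstep_bounds[of "real n * (t - p) + (-1)"] sstep_bounds[of "real n * (t - q) + 2"]
    unfolding f_def g_def by linarith
  have iD: "set_integrable lborel {p..q} (\<lambda>t. (f n t - g n t) * D t)" for n
  proof (rule set_integrable_bound[OF D])
    show "set_borel_measurable lborel {p..q} (\<lambda>t. (f n t - g n t) * D t)"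
    proof -
      have "(\<lambda>t. indicator {p..q} t *\<^sub>R ((f n t - g n t) * D t)) = (\<lambda>t. (f n t - g n t) * (indicator {p..q} t *\<^sub>R D t))" by (simp add: ac_simps)
      moreover have "(\<lambda>t. indicator {p..q} t *\<^sub>R D t) \<in> borel_measurable lborel" using D unfolding set_integrable_def by (rule borel_measurable_integrable)
      ultimately show ?thesis unfolding set_borel_measurable_def by simp
    qed
    show "AE t in lborel. t \<in> {p..q} \<longrightarrow> norm ((f n t - g n t) * D t) \<le> norm (D t)"
      using mult_right_mono[OF bd] by (intro AE_I2) (auto simp: abs_mult)
  qed
  have eq: "(LINT t:{p..q}|lborel. (f n t - g n t) * D t) = (LINT t:{p..q}|lborel. g' n t * E t) - (LINT t:{p..q}|lborel. f' n t * E t)"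
    if n: "n \<ge> N0" for n
  proof -
    note b = big[OF n]
    have "(LINT t:{p..q}|lborel. (f' n t - g' n t) * E t + (f n t - g n t) * D t) = 0"
    proof (rule test[of "p + 1 / real n" "q - 1 / real n"])
      show "p < p + 1 / real n" "q - 1 / real n < q" using b by auto
      have "2 / real n < q - p" using b by (simp add: pos_divide_less_eq mult.commute)
      moreover have "2 / real n = 1 / real n + 1 / real n" by simp
      ultimately show "p + 1 / real n < q - 1 / real n" by linarith
      show "((\<lambda>t. f n t - g n t) has_real_derivative f' n t - g' n t) (at t)" for t by (intro DERIV_diff df)
      show "continuous_on UNIV (\<lambda>t. f' n t - g' n t)" by (intro continuous_intros cf')
      show "f n t - g n t = 0" if "t \<notin> {p + 1 / real n..q - 1 / real n}" for t
      proof (cases "t < p + 1 / real n")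
        case True
        then have *: "real n * (t - p) < 1" using b by (simp add: field_simps)
        moreover have "real n * (t - q) + 2 \<le> 0"
          using * b by (simp add: algebra_simps)
        ultimately show ?thesis by (simp add: f_def g_def sstep_eq_0)
      next
        case False
        with that have "q - 1 / real n < t" by auto
        then have *: "- 1 < real n * (t - q)" using b by (simp add: field_simps)
        moreover have "1 \<le> real n * (t - p) + (- 1)" using * b by (simp add: algebra_simps)
        ultimately show ?thesis by (simp add: f_def g_def sstep_eq_1)
      qed
    qed
    also have "(LINT t:{p..q}|lborel. (f' n t - g' n t) * E t + (f n t - g n t) * D t)
        = (LINT t:{p..q}|lborel. (f' n t * E t - g' n t * E t) + (f n t - g n t) * D t)"
      by (simp add: left_diff_distrib)
    also have "\<dots> = (LINT t:{p..q}|lborel. f' n t * E t) - (LINT t:{p..q}|lborel. g' n t * E t) + (LINT t:{p..q}|lborel. (f n t - g n t) * D t)"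
      by (subst set_integral_add(2)[OF set_integral_diff(1)[OF i] iD], subst set_integral_diff(2)[OF i]) simp
    finally show ?thesis by simp
  qed
  have "(\<lambda>n. LINT t:{p..q}|lborel. (f n t - g n t) * D t) \<longlonglongrightarrow> (LINT t:{p..q}|lborel. D t)"
    unfolding set_lebesgue_integral_def
  proof (rule integral_dominated_convergence[where w="\<lambda>t. norm (indicator {p..q} t *\<^sub>R D t)"])
    show "integrable lborel (\<lambda>t. norm (indicator {p..q} t *\<^sub>R D t))" using D unfolding set_integrable_def by auto
    show "(\<lambda>t. indicator {p..q} t *\<^sub>R D t) \<in> borel_measurable lborel" using D unfolding set_integrable_def by auto
    show "(\<lambda>t. indicator {p..q} t *\<^sub>R ((f n t - g n t) * D t)) \<in> borel_measurable lborel" for n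
      using iD[of n] unfolding set_integrable_def by auto
    show "AE t in lborel. norm (indicator {p..q} t *\<^sub>R ((f n t - g n t) * D t)) \<le> norm (indicator {p..q} t *\<^sub>R D t)" for n
      using mult_right_mono[OF bd] by (intro AE_I2) (auto simp: abs_mult indicator_def)
    have "AE t in lborel. t \<noteq> p" "AE t in lborel. t \<noteq> q" by (rule AE_lborel_singleton)+
    then show "AE t in lborel. (\<lambda>n. indicator {p..q} t *\<^sub>R ((f n t - g n t) * D t)) \<longlonglongrightarrow> indicator {p..q} t *\<^sub>R D t"
    proof eventually_elim
      case (elim t)
      show ?case
      proof (cases "t \<in> {p..q}")
        case True
        with elim have t: "0 < t - p" "0 < q - t" by auto
        obtain N1 :: nat where N1: "2 / (t - p) < real N1" using reals_Archimedean2 by blast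
        obtain N2 :: nat where N2: "2 / (q - t) < real N2" using reals_Archimedean2 by blast
        have "f n t - g n t = 1" if "n \<ge> max N1 N2" for n
        proof -
          have "2 / (t - p) < real n" "2 / (q - t) < real n" using N1 N2 that by (auto simp: max_def split: if_splits)
          then have "2 < real n * (t - p)" "2 < real n * (q - t)" using t by (simp_all add: pos_divide_less_eq)
          then show ?thesis by (simp add: f_def g_def sstep_eq_1 sstep_eq_0 algebra_simps)
        qed
        then have "\<forall>\<^sub>F n in sequentially. indicator {p..q} t *\<^sub>R ((f n t - g n t) * D t) = indicator {p..q} t *\<^sub>R D t"
          unfolding eventually_sequentially by (intro exI[of _ "max N1 N2"]) simp
        then show ?thesis by (rule tendsto_eventually)
      qed simp
    qed
  qed
  moreover have "(\<lambda>n. LINT t:{p..q}|lborel. (f n t - g n t) * D t) \<longlonglongrightarrow> E q - E p"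
  proof (rule tendstoI)
    fix e :: real assume e: "e > 0"
    have "uniformly_continuous_on {p..q} E" by (rule compact_uniformly_continuous[OF E]) simp
    then obtain d where d: "d > 0" "\<And>s t. s \<in> {p..q} \<Longrightarrow> t \<in> {p..q} \<Longrightarrow> dist s t < d \<Longrightarrow> dist (E s) (E t) < e / 3"
      unfolding uniformly_continuous_on_def using e by (metis divide_pos_pos zero_less_numeral)
    obtain N1 :: nat where N1: "2 / d < real N1" using reals_Archimedean2 by blast
    have "dist (LINT t:{p..q}|lborel. (f n t - g n t) * D t) (E q - E p) < e" if n: "n \<ge> max N0 N1" for n
    proof -
      have n0: "n \<ge> N0" "n > 0" using n big by auto
      have "2 / d < real n" using N1 n by auto
      then have nd: "2 / real n < d" using d n0 by (simp add: field_simps)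
      have "\<bar>(LINT t:{p..q}|lborel. f' n t * E t) - E p\<bar> \<le> e / 3"
      proof (rule average_close[OF E cf'(1) nn(1) one(1)[OF n0(1)]])
        fix t assume t: "t \<in> {p..q}" "f' n t \<noteq> 0"
        have "dist t p < d" using supp_f[OF t(2) n0(2)] nd t(1) by (simp add: dist_real_def)
        then show "\<bar>E t - E p\<bar> \<le> e / 3" using d(2)[of t p] t(1) pq by (simp add: dist_real_def)
      qed
      moreover have "\<bar>(LINT t:{p..q}|lborel. g' n t * E t) - E q\<bar> \<le> e / 3"
      proof (rule average_close[OF E cf'(2) nn(2) one(2)[OF n0(1)]])
        fix t assume t: "t \<in> {p..q}" "g' n t \<noteq> 0"
        have "dist t q < d" using supp_g[OF t(2) n0(2)] nd t(1) by (simp add: dist_real_def)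
        then show "\<bar>E t - E q\<bar> \<le> e / 3" using d(2)[of t q] t(1) pq by (simp add: dist_real_def)
      qed
      ultimately show ?thesis unfolding eq[OF n0(1)] dist_real_def using e by linarith
    qed
    then show "\<forall>\<^sub>F n in sequentially. dist (LINT t:{p..q}|lborel. (f n t - g n t) * D t) (E q - E p) < e"
      unfolding eventually_sequentially by blast
  qed
  ultimately show ?thesis by (rule LIMSEQ_unique)
qed

section \<open>Measurability of narrowly continuous curves\<close>

text \<open>Measure and integrand both depend on x. Pushing \<open>L x\<close> forward under y
  \<mapsto> (x, y) gives a kernel into the product space, against which the integrand is
  fixed.\<close>

lemma integral_measurable_kernel:
  fixes f :: "'a \<Rightarrow> 'b \<Rightarrow> 'c::{banach, second_countable_topology}"
  assumes f[measurable]: "(\<lambda>(x, y). f x y) \<in> borel_measurable (M \<Otimes>\<^sub>M N)"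
    and N[measurable]: "L \<in> measurable M (subprob_algebra N)"
  shows "(\<lambda>x. integral\<^sup>L (L x) (f x)) \<in> borel_measurable M"
proof -
  note integral_measurable_subprob_algebra[measurable]
  note measurable_distr2[measurable]
  have "(\<lambda>x. integral\<^sup>L (distr (L x) (M \<Otimes>\<^sub>M N) (\<lambda>y. (x, y))) (\<lambda>(x, y). f x y)) \<in> borel_measurable M"
    by measurable
  then show ?thesis
    by (rule measurable_cong[THEN iffD1, rotated]) (simp add: integral_distr)
qed

text \<open>The open sets generate the Borel sets, and the mass of an open set is a limit of
  integrals of continuous functions, hence a pointwise limit of continuous functions of t.
  Measurability in time of the slice integrals rests on this.\<close>

lemma narrow_continuous_kernel:
  fixes \<kappa> :: "real \<Rightarrow> 'n::finite torus measure"
  assumes prob: "\<And>t. \<kappa> t \<in> prob_measures"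
    and narrow: "\<And>\<phi> :: 'n torus \<Rightarrow> real. continuous_on UNIV \<phi> \<Longrightarrow> continuous_on UNIV (\<lambda>t. LINT x|\<kappa> t. \<phi> x)"
  shows "\<kappa> \<in> borel \<rightarrow>\<^sub>M prob_algebra borel"
proof (rule measurable_prob_algebra_generated[where \<Omega>=UNIV and G="{S. open S}"])
  show "sets borel = sigma_sets UNIV {S :: 'n torus set. open S}" by (simp add: borel_def)
  show "Int_stable {S :: 'n torus set. open S}" by (auto simp: Int_stable_def)
  show "prob_space (\<kappa> t)" "sets (\<kappa> t) = sets borel" for t using prob by (auto simp: prob_measures_def)
  then have sp: "space (\<kappa> t) = UNIV" for t using sets_eq_imp_space_eq[of "\<kappa> t" borel] by simp
  fix U :: "'n torus set" assume "U \<in> {S. open S}"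
  then have U: "open U" by simp
  show "(\<lambda>t. emeasure (\<kappa> t) U) \<in> borel_measurable borel"
  proof (cases "U = UNIV")
    case True
    have "emeasure (\<kappa> t) U = 1" for t
      using prob_space.emeasure_space_1[OF \<open>prob_space (\<kappa> t)\<close>] sp[of t] True by simp
    then show ?thesis by simp
  next
    case False
    with U obtain d :: "'n torus \<Rightarrow> real" where d: "continuous_on UNIV d" "\<And>x. 0 \<le> d x" "\<And>x. d x = 0 \<longleftrightarrow> x \<in> - U"
      using closed_torus_zero_set[of "- U"] by (metis Compl_UNIV_eq Compl_eq_Compl_iff closed_Compl)
    define s where "s n x = min 1 (real n * d x)" for n :: nat and x
    have sc: "continuous_on UNIV (s n)" for n
      unfolding s_def by (intro continuous_intros d)
    have sl: "(\<lambda>n. s n x) \<longlonglongrightarrow> indicator U x" for x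
    proof (cases "x \<in> U")
      case True
      then have dx: "d x > 0" using d(2,3)[of x] by (metis ComplD order_le_less)
      obtain N :: nat where N: "1 / d x < real N" using reals_Archimedean2 by blast
      have "s n x = 1" if "n \<ge> N" for n
      proof -
        have "1 / d x < real n" using N that by linarith
        then have "1 < real n * d x" using dx by (simp add: pos_divide_less_eq)
        then show ?thesis by (simp add: s_def)
      qed
      then have "\<forall>\<^sub>F n in sequentially. s n x = 1" by (auto simp: eventually_sequentially)
      then show ?thesis using True by (simp add: tendsto_eventually)
    next
      case False
      then have "d x = 0" using d(3) by simp
      then show ?thesis using False by (simp add: s_def)
    qed
    have lim: "(\<lambda>n. LINT x|\<kappa> t. s n x) \<longlonglongrightarrow> measure (\<kappa> t) U" for t
    proof -
      interpret prob_space "\<kappa> t" by fact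
      have Ut: "U \<in> sets (\<kappa> t)" using U \<open>sets (\<kappa> t) = sets borel\<close> by auto
      have "(\<lambda>n. LINT x|\<kappa> t. s n x) \<longlonglongrightarrow> (LINT x|\<kappa> t. indicator U x)"
      proof (rule integral_dominated_convergence[where w="\<lambda>_. 1"])
        show "s n \<in> borel_measurable (\<kappa> t)" for n
          using continuous_torus_measurable[OF sc] \<open>sets (\<kappa> t) = sets borel\<close> by (simp cong: measurable_cong_sets)
        show "AE x in \<kappa> t. norm (s n x) \<le> 1" for n using d(2) by (intro AE_I2) (simp add: s_def)
      qed (use Ut sl in auto)
      then show ?thesis using Ut by simp
    qed
    have "(\<lambda>t. measure (\<kappa> t) U) \<in> borel_measurable borel"
      by (rule borel_measurable_LIMSEQ_real[OF lim]) (intro borel_measurable_continuous_onI narrow sc)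
    moreover have "emeasure (\<kappa> t) U = ennreal (measure (\<kappa> t) U)" for t
    proof -
      interpret prob_space "\<kappa> t" by fact
      show ?thesis by (rule emeasure_eq_measure)
    qed
    ultimately show ?thesis by simp
  qed
qed auto

text \<open>Measure and integrand vary together. By compactness the integrands are uniformly close
  to the one at \<open>p0\<close>, and for that fixed integrand narrow continuity applies.\<close>

lemma continuous_on_narrow_integral:
  fixes \<kappa> :: "real \<Rightarrow> 'n::finite torus measure" and k :: "'a::topological_space \<Rightarrow> 'n torus \<Rightarrow> real"
  assumes prob: "\<And>t. \<kappa> t \<in> prob_measures"
    and narrow: "\<And>\<phi> :: 'n torus \<Rightarrow> real. continuous_on UNIV \<phi> \<Longrightarrow> continuous_on UNIV (\<lambda>t. LINT x|\<kappa> t. \<phi> x)"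
    and k: "continuous_on (S \<times> UNIV) (\<lambda>(p, y). k p y)" and \<theta>: "continuous_on S \<theta>"
  shows "continuous_on S (\<lambda>p. LINT y|\<kappa> (\<theta> p). k p y)"
  unfolding continuous_on_def
proof (intro ballI tendstoI)
  fix p0 and e :: real assume p0: "p0 \<in> S" and e: "0 < e"
  then have e3: "e / 3 > 0" by simp
  obtain X where X: "p0 \<in> X" "open X" "\<And>p y. p \<in> X \<inter> S \<Longrightarrow> dist (k p y) (k p0 y) \<le> e / 3"
    using continuous_on_prod_compactE[OF k compact_torus p0 e3] by (metis (no_types, lifting) UNIV_I case_prod_conv)
  note ck = continuous_slice[OF k]
  have "continuous_on S (\<lambda>p. LINT y|\<kappa> (\<theta> p). k p0 y)"
    by (rule continuous_on_compose2[OF narrow[OF ck[OF p0]] \<theta>]) auto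
  then have "((\<lambda>p. LINT y|\<kappa> (\<theta> p). k p0 y) \<longlongrightarrow> (LINT y|\<kappa> (\<theta> p0). k p0 y)) (at p0 within S)"
    using p0 by (simp add: continuous_on_def)
  from tendstoD[OF this e3]
  have ev: "\<forall>\<^sub>F p in at p0 within S. dist (LINT y|\<kappa> (\<theta> p). k p0 y) (LINT y|\<kappa> (\<theta> p0). k p0 y) < e / 3" .
  have ev2: "\<forall>\<^sub>F p in at p0 within S. p \<in> X \<inter> S"
    unfolding eventually_at_topological using X by blast
  show "\<forall>\<^sub>F p in at p0 within S. dist (LINT y|\<kappa> (\<theta> p). k p y) (LINT y|\<kappa> (\<theta> p0). k p0 y) < e"
    using ev ev2
  proof eventually_elim
    case (elim p)
    have pr: "prob_space (\<kappa> (\<theta> p))" and s: "sets (\<kappa> (\<theta> p)) = sets borel" using prob by (auto simp: prob_measures_def)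
    interpret prob_space "\<kappa> (\<theta> p)" by (rule pr)
    note int = continuous_Leb_integrable[OF finite_measure_axioms s ck]
    have "norm ((LINT y|\<kappa> (\<theta> p). k p y) - (LINT y|\<kappa> (\<theta> p). k p0 y)) = norm (LINT y|\<kappa> (\<theta> p). k p y - k p0 y)"
      using int p0 elim by simp
    also have "\<dots> \<le> (LINT y|\<kappa> (\<theta> p). e / 3)"
    proof (rule norm_integral_le)
      show "norm (k p y - k p0 y) \<le> e / 3" for y using X(3)[OF elim(2), of y] by (simp add: dist_norm)
    qed (use int p0 elim in auto)
    also have "\<dots> = e / 3" by (simp add: prob_space)
    finally show ?case using elim(1) unfolding dist_real_def real_norm_def by linarith
  qed
qed

section \<open>Continuously differentiable functions of time and space\<close>

text \<open>A variant of \<open>spacetime_test\<close> on an open set of times and without compact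
  support in time: heated test functions exist only where the heat time is positive, and the
  integrated continuity equation retains their values at the end points.\<close>

definition C1_spacetime ::
  "real set \<Rightarrow> (real \<Rightarrow> 'n::finite torus \<Rightarrow> real) \<Rightarrow> (real \<Rightarrow> 'n torus \<Rightarrow> real) \<Rightarrow> (real \<Rightarrow> 'n torus \<Rightarrow> real^'n) \<Rightarrow> bool"
  where
  "C1_spacetime J \<psi> \<psi>t \<psi>x \<longleftrightarrow> open J \<and>
    continuous_on (J \<times> UNIV) (\<lambda>(t, x). \<psi>t t x) \<and> continuous_on (J \<times> UNIV) (\<lambda>(t, x). \<psi>x t x) \<and>
    (\<forall>t\<in>J. \<forall>x. ((\<lambda>(s, y). \<psi> s (torus_proj y)) has_derivative
             (\<lambda>(s, h). \<psi>t t (torus_proj x) * s + \<psi>x t (torus_proj x) \<bullet> h)) (at (t, x)))"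

lemma C1_spacetimeD:
  assumes "C1_spacetime J \<psi> \<psi>t \<psi>x"
  shows "open J" "continuous_on (J \<times> UNIV) (\<lambda>(t, x). \<psi>t t x)" "continuous_on (J \<times> UNIV) (\<lambda>(t, x). \<psi>x t x)"
    "t \<in> J \<Longrightarrow> ((\<lambda>(s, y). \<psi> s (torus_proj y)) has_derivative
             (\<lambda>(s, h). \<psi>t t (torus_proj x) * s + \<psi>x t (torus_proj x) \<bullet> h)) (at (t, x))"
  using assms by (auto simp: C1_spacetime_def)

lemma C1_spacetime_continuous:
  assumes "C1_spacetime J \<psi> \<psi>t \<psi>x"
  shows "continuous_on (J \<times> UNIV) (\<lambda>(t, x). \<psi> t x)"
proof (rule continuous_on_param_torus_lift)
  show "continuous_on (J \<times> UNIV) (\<lambda>(t, y). \<psi> t (torus_proj y))"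
  proof (intro continuous_at_imp_continuous_on ballI)
    fix p :: "real \<times> (real^'a)" assume "p \<in> J \<times> UNIV"
    then have "fst p \<in> J" by auto
    from has_derivative_continuous[OF C1_spacetimeD(4)[OF assms this, of "snd p"]]
    show "isCont (\<lambda>(t, y). \<psi> t (torus_proj y)) p" by simp
  qed
qed

lemma C1_spacetime_time_deriv:
  assumes "C1_spacetime J \<psi> \<psi>t \<psi>x" "t \<in> J"
  shows "((\<lambda>s. \<psi> s x) has_real_derivative \<psi>t t x) (at t)"
proof -
  obtain y where x: "x = torus_proj y" by (rule torus_proj_cases)
  have 1: "((\<lambda>s. (s, y)) has_derivative (\<lambda>s. (s, 0))) (at t)" by (auto intro!: derivative_eq_intros)
  from has_derivative_compose[OF 1 C1_spacetimeD(4)[OF assms, of y]]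
  show ?thesis by (simp add: x has_field_derivative_def mult.commute mult_commute_abs)
qed

lemma C1_spacetime_slice:
  fixes \<psi> :: "real \<Rightarrow> 'n::finite torus \<Rightarrow> real"
  assumes "C1_spacetime J \<psi> \<psi>t \<psi>x" "t \<in> J"
  shows "C1_torus (\<psi> t) (\<psi>x t)"
  unfolding C1_torus_def
proof (intro conjI allI)
  show "continuous_on UNIV (\<psi>x t)" by (rule continuous_slice[OF C1_spacetimeD(3)[OF assms(1)] assms(2)])
  fix y :: "real^'n"
  have 1: "((\<lambda>y. (t, y)) has_derivative (\<lambda>h. (0, h))) (at y)" by (auto intro!: derivative_eq_intros)
  from has_derivative_compose[OF 1 C1_spacetimeD(4)[OF assms, of y]]
  show "((\<lambda>y. \<psi> t (torus_proj y)) has_derivative (\<lambda>h. \<psi>x t (torus_proj y) \<bullet> h)) (at y)" by simp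
qed

lemma spacetime_test_C1: "spacetime_test \<psi> \<psi>t \<psi>x \<Longrightarrow> C1_spacetime UNIV \<psi> \<psi>t \<psi>x"
  by (simp add: spacetime_test_def C1_spacetime_def)

lemma C1_torus_spacetime:
  fixes \<phi> :: "'n::finite torus \<Rightarrow> real"
  assumes "C1_torus \<phi> G" shows "C1_spacetime UNIV (\<lambda>_. \<phi>) (\<lambda>_ _. 0) (\<lambda>_. G)"
  unfolding C1_spacetime_def
proof (intro conjI ballI allI)
  show "continuous_on (UNIV \<times> UNIV) (\<lambda>(t::real, x). G x)"
    unfolding case_prod_unfold by (rule continuous_on_compose2[OF C1_torus_continuous(2)[OF assms]]) (auto intro!: continuous_intros)
  fix t :: real and x :: "real^'n"
  have "((\<lambda>p. \<phi> (torus_proj (snd p))) has_derivative (\<lambda>h. G (torus_proj x) \<bullet> snd h)) (at (t, x))"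
    by (rule has_derivative_compose[of snd snd "(t, x)" UNIV "\<lambda>y. \<phi> (torus_proj y)"])
       (use assms in \<open>auto simp: C1_torus_def intro!: derivative_eq_intros\<close>)
  then show "((\<lambda>(s, y). \<phi> (torus_proj y)) has_derivative (\<lambda>(s, h). 0 * s + G (torus_proj x) \<bullet> h)) (at (t, x))"
    by (simp add: case_prod_unfold)
qed auto

text \<open>A cutoff in time supported inside J yields an admissible test: off the support the
  product is identically 0, whatever the values of \<psi> outside J, and the two open pieces are
  glued.\<close>

lemma C1_spacetime_cutoff:
  assumes \<psi>: "C1_spacetime J \<psi> \<psi>t \<psi>x" and J: "{a..b} \<subseteq> J"
    and w: "\<And>t. (w has_real_derivative w' t) (at t)" "continuous_on UNIV w'" "\<And>t. t \<notin> {a..b} \<Longrightarrow> w t = 0"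
    and ab: "0 < a" "a < b" "b < 1"
  shows "spacetime_test (\<lambda>t x. w t * \<psi> t x) (\<lambda>t x. w' t * \<psi> t x + w t * \<psi>t t x) (\<lambda>t x. w t *\<^sub>R \<psi>x t x)"
proof -
  note D = C1_spacetimeD[OF \<psi>]
  have w'0: "w' t = 0" if "t \<notin> {a..b}" for t
  proof -
    have "((\<lambda>_. 0) has_real_derivative w' t) (at t)"
      by (rule has_field_derivative_transform_within_open[OF w(1), of "- {a..b}"]) (use that w(3) in auto)
    then show ?thesis by (rule DERIV_unique[OF _ DERIV_const])
  qed
  have cw: "continuous_on S w" for S
    by (intro continuous_at_imp_continuous_on ballI DERIV_isCont[OF w(1)])
  have UJ: "UNIV = J \<times> UNIV \<union> (- {a..b}) \<times> (UNIV :: 'a torus set)" using J by auto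
  have oJ: "open (J \<times> (UNIV :: 'a torus set))" "open ((- {a..b}) \<times> (UNIV :: 'a torus set))"
    using D(1) by (auto intro!: open_Times)
  have cfst: "continuous_on (S :: (real \<times> 'a torus) set) (\<lambda>p. w (fst p))" "continuous_on S (\<lambda>p. w' (fst p))" for S
    by (auto intro!: continuous_on_compose2[OF cw[of UNIV]] continuous_on_compose2[OF w(2)] continuous_intros)
  have glue: "continuous_on UNIV (\<lambda>(t, x). F t x)"
    if "continuous_on (J \<times> UNIV) (\<lambda>(t, x). F t x)" "\<And>t x. t \<notin> {a..b} \<Longrightarrow> F t x = 0"
    for F :: "real \<Rightarrow> 'a torus \<Rightarrow> 'c::real_normed_vector"
  proof -
    have "continuous_on ((- {a..b}) \<times> UNIV) (\<lambda>(t, x). F t x)"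
      by (rule continuous_on_eq[of _ "\<lambda>_. 0"]) (use that(2) in auto)
    then show ?thesis unfolding UJ by (intro continuous_on_open_Un oJ that(1))
  qed
  have c1: "continuous_on UNIV (\<lambda>(t, x). w' t * \<psi> t x + w t * \<psi>t t x)"
    using C1_spacetime_continuous[OF \<psi>] D(2) cfst w(3) w'0
    by (intro glue) (auto simp: case_prod_unfold intro!: continuous_intros)
  have c2: "continuous_on UNIV (\<lambda>(t, x). w t *\<^sub>R \<psi>x t x)"
    using D(3) cfst w(3) by (intro glue) (auto simp: case_prod_unfold intro!: continuous_intros)
  have d: "((\<lambda>(s, y). w s * \<psi> s (torus_proj y)) has_derivative
      (\<lambda>(s, h). (w' t * \<psi> t (torus_proj x) + w t * \<psi>t t (torus_proj x)) * s + (w t *\<^sub>R \<psi>x t (torus_proj x)) \<bullet> h)) (at (t, x))" for t x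
  proof (cases "t \<in> J")
    case True
    have 1: "((\<lambda>p. w (fst p)) has_derivative (\<lambda>h. fst h * w' t)) (at (t, x))"
      using has_derivative_compose[of fst fst "(t, x)" UNIV w "\<lambda>h. h * w' t"] w(1)[of t]
      by (simp add: has_field_derivative_def mult_commute_abs has_derivative_fst)
    have 2: "((\<lambda>p. \<psi> (fst p) (torus_proj (snd p))) has_derivative (\<lambda>h. \<psi>t t (torus_proj x) * fst h + \<psi>x t (torus_proj x) \<bullet> snd h)) (at (t, x))"
      using D(4)[OF True, of x] by (simp add: case_prod_unfold)
    have "(\<lambda>h. w (fst (t, x)) * (\<psi>t t (torus_proj x) * fst h + \<psi>x t (torus_proj x) \<bullet> snd h) + fst h * w' t * \<psi> (fst (t, x)) (torus_proj (snd (t, x))))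
      = (\<lambda>(s, h). (w' t * \<psi> t (torus_proj x) + w t * \<psi>t t (torus_proj x)) * s + (w t *\<^sub>R \<psi>x t (torus_proj x)) \<bullet> h)"
      by (rule ext) (simp add: case_prod_unfold algebra_simps)
    with has_derivative_mult[OF 1 2] show ?thesis by (simp add: case_prod_unfold)
  next
    case False
    then have t: "t \<notin> {a..b}" using J by auto
    have "((\<lambda>_. 0) has_derivative (\<lambda>_. 0)) (at (t, x))" by simp
    then have "((\<lambda>(s, y). w s * \<psi> s (torus_proj y)) has_derivative (\<lambda>_. 0)) (at (t, x))"
      by (rule has_derivative_transform_within_open[where s="(- {a..b}) \<times> UNIV"]) (use t w(3) in \<open>auto intro: open_Times\<close>)
    then show ?thesis using w(3)[OF t] w'0[OF t] by (simp add: case_prod_unfold)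
  qed
  show ?thesis
    unfolding spacetime_test_def by (intro conjI allI c1 c2 d exI[of _ a] exI[of _ b]) (use ab w(3) in auto)
qed

section \<open>Curves of finite energy\<close>

text \<open>The curve lives on the whole real line and its velocity has finite energy on every
  slice, which removes almost-everywhere clauses; \<open>AC2_torus_curve\<close> brings any curve of
  \<open>AC2\<close> into this form. The continuity equation is kept apart because the competitor
  must be known to have integrable tests before its equation is proved.\<close>

locale torus_field =
  fixes \<kappa> :: "real \<Rightarrow> 'n::finite torus measure" and c :: "real \<Rightarrow> 'n torus \<Rightarrow> real^'n"
  assumes prob: "\<And>t. \<kappa> t \<in> prob_measures"
    and narrow: "\<And>\<phi> :: 'n torus \<Rightarrow> real. continuous_on UNIV \<phi> \<Longrightarrow> continuous_on UNIV (\<lambda>t. LINT x|\<kappa> t. \<phi> x)"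
    and c_measurable: "(\<lambda>(t, x). c t x) \<in> borel_measurable (borel \<Otimes>\<^sub>M borel)"
    and c_finite: "\<And>t. (\<integral>\<^sup>+x. ennreal ((norm (c t x))\<^sup>2) \<partial>\<kappa> t) < \<infinity>"
    and c_energy: "kinetic_energy \<kappa> c < \<infinity>"
begin

lemma prob_space_\<kappa>: "prob_space (\<kappa> t)" and finite_\<kappa>: "finite_measure (\<kappa> t)" and sets_\<kappa> [measurable_cong, simp]: "sets (\<kappa> t) = sets borel"
  using prob[of t] by (auto simp: prob_measures_def prob_space.finite_measure)

lemma kernel_\<kappa> [measurable]: "\<kappa> \<in> borel \<rightarrow>\<^sub>M subprob_algebra borel"
  by (rule measurable_prob_algebraD[OF narrow_continuous_kernel[OF prob narrow]])

lemma c_slice_measurable [measurable]: "c t \<in> borel_measurable borel"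
  using measurable_compose[OF measurable_Pair1' c_measurable, of t] by simp

lemma c_integrable: "integrable (\<kappa> t) (\<lambda>x. (norm (c t x))\<^sup>2)" "integrable (\<kappa> t) (\<lambda>x. norm (c t x))" "integrable (\<kappa> t) (c t)"
proof -
  interpret prob_space "\<kappa> t" by (rule prob_space_\<kappa>)
  show 1: "integrable (\<kappa> t) (\<lambda>x. (norm (c t x))\<^sup>2)"
    by (rule integrableI_nonneg) (use c_finite[of t] in auto)
  show 2: "integrable (\<kappa> t) (\<lambda>x. norm (c t x))"
    by (rule integrable_of_square[OF finite_measure_axioms _ 1]) simp
  show "integrable (\<kappa> t) (c t)" by (rule integrable_norm_cancel[OF 2]) simp
qed

definition en :: "real \<Rightarrow> real" where
  "en t = (LINT x|\<kappa> t. (norm (c t x))\<^sup>2)"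

lemma en_nonneg: "0 \<le> en t"
  unfolding en_def by (intro Bochner_Integration.integral_nonneg) auto

lemma en_nn: "(\<integral>\<^sup>+x. ennreal ((norm (c t x))\<^sup>2) \<partial>\<kappa> t) = ennreal (en t)"
  unfolding en_def by (intro nn_integral_eq_integral c_integrable) auto

lemma en_measurable [measurable]: "en \<in> borel_measurable borel"
proof -
  have "(\<lambda>t. \<integral>\<^sup>+x. ennreal ((norm (c t x))\<^sup>2) \<partial>\<kappa> t) \<in> borel_measurable borel"
    by (rule nn_integral_measurable_subprob_algebra2[OF _ kernel_\<kappa>])
       (use c_measurable in \<open>simp add: case_prod_unfold\<close>)
  then have "(\<lambda>t. enn2real (ennreal (en t))) \<in> borel_measurable borel"
    unfolding en_nn by measurable
  then show ?thesis using en_nonneg by simp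
qed

lemma kinetic_energy_en: "kinetic_energy \<kappa> c = (\<integral>\<^sup>+t\<in>{0..1}. ennreal (en t) \<partial>lborel)"
  by (simp add: kinetic_energy_def en_nn)

lemma en_integrable:
  assumes "0 \<le> p" "q \<le> 1" shows "set_integrable lborel {p..q} en"
proof -
  have "integrable lborel (\<lambda>t. indicator {0..1} t * en t)"
  proof (rule integrableI_nonneg)
    show "AE t in lborel. 0 \<le> indicator {0..1} t * en t" using en_nonneg by (intro AE_I2) auto
    have "(\<integral>\<^sup>+t. ennreal (indicator {0..1} t * en t) \<partial>lborel) = kinetic_energy \<kappa> c"
      unfolding kinetic_energy_en by (intro nn_integral_cong) (auto simp: indicator_def)
    then show "(\<integral>\<^sup>+t. ennreal (indicator {0..1} t * en t) \<partial>lborel) < \<infinity>" using c_energy by simp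
  qed measurable
  then have "set_integrable lborel {0..1} en" by (simp add: set_integrable_def)
  then show ?thesis by (rule set_integrable_subset) (use assms in auto)
qed

lemma norm_integral_le_en: "(LINT x|\<kappa> t. norm (c t x)) \<le> 1 + en t"
proof -
  interpret prob_space "\<kappa> t" by (rule prob_space_\<kappa>)
  have "norm (c t x) \<le> 1 + (norm (c t x))\<^sup>2" for x
  proof -
    have "0 \<le> (norm (c t x) - 1)\<^sup>2" by simp
    also have "\<dots> = 1 + (norm (c t x))\<^sup>2 - 2 * norm (c t x)" by (simp add: power2_eq_square algebra_simps)
    finally show ?thesis using norm_ge_zero[of "c t x"] by linarith
  qed
  then have "(LINT x|\<kappa> t. norm (c t x)) \<le> (LINT x|\<kappa> t. 1 + (norm (c t x))\<^sup>2)"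
    using c_integrable[of t] by (intro integral_mono) auto
  also have "\<dots> = 1 + en t" using c_integrable[of t] by (simp add: en_def prob_space)
  finally show ?thesis .
qed

lemma compact_product_bounded:
  fixes F :: "real \<Rightarrow> 'n torus \<Rightarrow> 'b::real_normed_vector"
  assumes "continuous_on ({p..q} \<times> UNIV) (\<lambda>(t, x). F t x)"
  obtains C where "0 < C" "\<And>t x. t \<in> {p..q} \<Longrightarrow> norm (F t x) \<le> C"
proof -
  have "bounded ((\<lambda>(t, x). F t x) ` ({p..q} \<times> UNIV))"
    by (intro compact_imp_bounded compact_continuous_image assms compact_Times compact_torus compact_Icc)
  then obtain C where "\<forall>z\<in>(\<lambda>(t, x). F t x) ` ({p..q} \<times> UNIV). norm z \<le> C" unfolding bounded_iff by blast
  then have C: "norm (F t x) \<le> C" if "t \<in> {p..q}" for t x using that by auto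
  show thesis
    by (rule that[of "max C 1"]) (auto intro: order_trans[OF C])
qed

lemma indicator_continuous_measurable:
  fixes F :: "real \<Rightarrow> 'n torus \<Rightarrow> 'b::{real_normed_vector, second_countable_topology}"
  assumes "continuous_on ({p..q} \<times> UNIV) (\<lambda>(t, x). F t x)"
  shows "(\<lambda>(t, x). indicator {p..q} t *\<^sub>R F t x) \<in> borel_measurable (borel \<Otimes>\<^sub>M borel)"
proof -
  have "{p..q} \<times> (UNIV :: 'n torus set) \<in> sets (borel \<Otimes>\<^sub>M borel)" by (intro pair_measureI) auto
  then have "{p..q} \<times> (UNIV :: 'n torus set) \<in> sets borel" by (simp only: borel_prod)
  from borel_measurable_continuous_on_indicator[OF this assms]
  have "(\<lambda>z. indicator ({p..q} \<times> (UNIV :: 'n torus set)) z *\<^sub>R (case z of (t, x) \<Rightarrow> F t x)) \<in> borel_measurable (borel \<Otimes>\<^sub>M borel)"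
    by (simp only: borel_prod)
  then show ?thesis by (simp add: case_prod_unfold indicator_times)
qed

text \<open>Since \<bar>c\<bar> \<le> 1 + \<bar>c\<bar>^2, the slice integrals are dominated by an
  affine function of \<open>en t\<close>, which is integrable in time.\<close>

lemma D_integrable:
  assumes pq: "0 \<le> p" "q \<le> 1"
    and a: "continuous_on ({p..q} \<times> UNIV) (\<lambda>(t, x). a t x)" and b: "continuous_on ({p..q} \<times> UNIV) (\<lambda>(t, x). b t x)"
  shows "set_integrable lborel {p..q} (\<lambda>t. LINT x|\<kappa> t. a t x + b t x \<bullet> c t x)"
    and "t \<in> {p..q} \<Longrightarrow> integrable (\<kappa> t) (a t)" "t \<in> {p..q} \<Longrightarrow> integrable (\<kappa> t) (\<lambda>x. b t x \<bullet> c t x)"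
proof -
  obtain A where A: "0 < A" "\<And>t x. t \<in> {p..q} \<Longrightarrow> norm (a t x) \<le> A" by (rule compact_product_bounded[OF a]) (rule that)
  obtain B where B: "0 < B" "\<And>t x. t \<in> {p..q} \<Longrightarrow> norm (b t x) \<le> B" by (rule compact_product_bounded[OF b]) (rule that)
  show ia: "integrable (\<kappa> t) (a t)" if "t \<in> {p..q}" for t
    by (rule continuous_Leb_integrable[OF finite_\<kappa> sets_\<kappa> continuous_slice[OF a that]])
  show ib: "integrable (\<kappa> t) (\<lambda>x. b t x \<bullet> c t x)" if "t \<in> {p..q}" for t
    by (rule integrable_bilinear_continuous[OF bounded_bilinear_inner sets_\<kappa> c_integrable(3) continuous_slice[OF b that]])
  have m: "(\<lambda>(t, x). indicator {p..q} t * a t x + (indicator {p..q} t *\<^sub>R b t x) \<bullet> c t x) \<in> borel_measurable (borel \<Otimes>\<^sub>M borel)"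
    using indicator_continuous_measurable[OF a] indicator_continuous_measurable[OF b] c_measurable
    unfolding case_prod_unfold real_scaleR_def by (intro borel_measurable_add borel_measurable_inner)
  have "(\<lambda>t. LINT x|\<kappa> t. indicator {p..q} t * a t x + (indicator {p..q} t *\<^sub>R b t x) \<bullet> c t x) \<in> borel_measurable borel"
    by (rule integral_measurable_kernel[OF m kernel_\<kappa>])
  also have "(\<lambda>t. LINT x|\<kappa> t. indicator {p..q} t * a t x + (indicator {p..q} t *\<^sub>R b t x) \<bullet> c t x)
      = (\<lambda>t. indicator {p..q} t *\<^sub>R (LINT x|\<kappa> t. a t x + b t x \<bullet> c t x))"
    by (auto simp: fun_eq_iff indicator_def)
  finally have meas: "(\<lambda>t. indicator {p..q} t *\<^sub>R (LINT x|\<kappa> t. a t x + b t x \<bullet> c t x)) \<in> borel_measurable borel" .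
  have bound: "\<bar>LINT x|\<kappa> t. a t x + b t x \<bullet> c t x\<bar> \<le> (A + B) + B * en t" if t: "t \<in> {p..q}" for t
  proof -
    interpret prob_space "\<kappa> t" by (rule prob_space_\<kappa>)
    have "norm (LINT x|\<kappa> t. a t x + b t x \<bullet> c t x) \<le> (LINT x|\<kappa> t. A + B * norm (c t x))"
    proof (rule norm_integral_le)
      show "integrable (\<kappa> t) (\<lambda>x. a t x + b t x \<bullet> c t x)" using ia[OF t] ib[OF t] by simp
      show "integrable (\<kappa> t) (\<lambda>x. A + B * norm (c t x))" using c_integrable[of t] by auto
      show "norm (a t x + b t x \<bullet> c t x) \<le> A + B * norm (c t x)" for x
      proof -
        have "\<bar>b t x \<bullet> c t x\<bar> \<le> norm (b t x) * norm (c t x)" by (rule Cauchy_Schwarz_ineq2)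
        also have "\<dots> \<le> B * norm (c t x)" using B(2)[OF t] by (intro mult_right_mono) auto
        finally show ?thesis using A(2)[OF t, of x] by simp
      qed
    qed
    also have "\<dots> = A + B * (LINT x|\<kappa> t. norm (c t x))" using c_integrable[of t] by (simp add: prob_space)
    also have "\<dots> \<le> A + B * (1 + en t)" using B(1) norm_integral_le_en by (intro add_left_mono mult_left_mono) auto
    finally show ?thesis by (simp add: algebra_simps)
  qed
  have "set_integrable lborel {p..q} (\<lambda>t. (A + B) + B * en t)"
    by (intro set_integral_add(1) set_integrable_mult_right en_integrable pq borel_integrable_atLeastAtMost' continuous_intros)
  then show "set_integrable lborel {p..q} (\<lambda>t. LINT x|\<kappa> t. a t x + b t x \<bullet> c t x)"
  proof (rule set_integrable_bound)
    show "set_borel_measurable lborel {p..q} (\<lambda>t. LINT x|\<kappa> t. a t x + b t x \<bullet> c t x)"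
      unfolding set_borel_measurable_def using meas by simp
    show "AE t in lborel. t \<in> {p..q} \<longrightarrow> norm (LINT x|\<kappa> t. a t x + b t x \<bullet> c t x) \<le> norm ((A + B) + B * en t)"
      using order_trans[OF bound abs_ge_self] by (intro AE_I2) auto
  qed
qed

end

locale torus_curve = torus_field \<kappa> c
  for \<kappa> :: "real \<Rightarrow> 'n::finite torus measure" and c :: "real \<Rightarrow> 'n torus \<Rightarrow> real^'n" +
  assumes c_eq: "continuity_eq \<kappa> c"
begin

text \<open>For a cutoff w in time the test function w \<psi> produces w' E + w D, with E the slice
  integral of \<psi> and D that of its transport derivative; \<open>du_bois_reymond\<close> recovers
  the increment of E. Equations on adjacent intervals can be added in this form.\<close>

lemma integrated_CE:
  assumes pq: "0 \<le> p" "p < q" "q \<le> 1" and \<psi>: "C1_spacetime J \<psi> \<psi>t \<psi>x" and J: "{p..q} \<subseteq> J"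
  shows "set_integrable lborel {p..q} (\<lambda>t. LINT x|\<kappa> t. \<psi>t t x + \<psi>x t x \<bullet> c t x)"
    and "(LINT t:{p..q}|lborel. (LINT x|\<kappa> t. \<psi>t t x + \<psi>x t x \<bullet> c t x)) = (LINT x|\<kappa> q. \<psi> q x) - (LINT x|\<kappa> p. \<psi> p x)"
proof -
  have sub: "{p..q} \<times> UNIV \<subseteq> J \<times> (UNIV :: 'n torus set)" using J by auto
  note D = C1_spacetimeD[OF \<psi>]
  note ct = continuous_on_subset[OF D(2) sub] and cx = continuous_on_subset[OF D(3) sub]
    and c\<psi> = continuous_on_subset[OF C1_spacetime_continuous[OF \<psi>] sub]
  note I = D_integrable[OF pq(1,3) ct cx]
  show "set_integrable lborel {p..q} (\<lambda>t. LINT x|\<kappa> t. \<psi>t t x + \<psi>x t x \<bullet> c t x)" by (rule I)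
  show "(LINT t:{p..q}|lborel. (LINT x|\<kappa> t. \<psi>t t x + \<psi>x t x \<bullet> c t x)) = (LINT x|\<kappa> q. \<psi> q x) - (LINT x|\<kappa> p. \<psi> p x)"
  proof (rule du_bois_reymond[OF pq(2) _ I(1)])
    show "continuous_on {p..q} (\<lambda>t. LINT x|\<kappa> t. \<psi> t x)"
      by (rule continuous_on_narrow_integral[OF prob narrow c\<psi>]) (auto intro: continuous_intros)
    fix w w' :: "real \<Rightarrow> real" and a b
    assume ab: "p < a" "a < b" "b < q" and w: "\<And>t. (w has_real_derivative w' t) (at t)" "continuous_on UNIV w'" "\<And>t. t \<notin> {a..b} \<Longrightarrow> w t = 0"
    have abJ: "{a..b} \<subseteq> J" using ab J by auto
    have w'0: "w' t = 0" if "t \<notin> {a..b}" for t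
    proof -
      have "((\<lambda>_. 0) has_real_derivative w' t) (at t)"
        by (rule has_field_derivative_transform_within_open[OF w(1), of "- {a..b}"]) (use that w(3) in auto)
      then show ?thesis by (rule DERIV_unique[OF _ DERIV_const])
    qed
    have st: "spacetime_test (\<lambda>t x. w t * \<psi> t x) (\<lambda>t x. w' t * \<psi> t x + w t * \<psi>t t x) (\<lambda>t x. w t *\<^sub>R \<psi>x t x)"
      using ab pq by (intro C1_spacetime_cutoff[OF \<psi> abJ w]) auto
    have "0 = (LINT t:{0..1}|lborel. (LINT x|\<kappa> t. (w' t * \<psi> t x + w t * \<psi>t t x) + (w t *\<^sub>R \<psi>x t x) \<bullet> c t x))"
      using c_eq[unfolded continuity_eq_def, rule_format, OF st] by (rule sym)
    also have "\<dots> = (LINT t:{p..q}|lborel. w' t * (LINT x|\<kappa> t. \<psi> t x) + w t * (LINT x|\<kappa> t. \<psi>t t x + \<psi>x t x \<bullet> c t x))"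
      unfolding set_lebesgue_integral_def
    proof (rule Bochner_Integration.integral_cong)
      fix t
      show "indicator {0..1} t *\<^sub>R (LINT x|\<kappa> t. (w' t * \<psi> t x + w t * \<psi>t t x) + (w t *\<^sub>R \<psi>x t x) \<bullet> c t x)
        = indicator {p..q} t *\<^sub>R (w' t * (LINT x|\<kappa> t. \<psi> t x) + w t * (LINT x|\<kappa> t. \<psi>t t x + \<psi>x t x \<bullet> c t x))"
      proof (cases "t \<in> {p..q}")
        case True
        have i\<psi>: "integrable (\<kappa> t) (\<psi> t)"
          by (rule continuous_Leb_integrable[OF finite_\<kappa> sets_\<kappa> continuous_slice[OF c\<psi> True]])
        have "(LINT x|\<kappa> t. (w' t * \<psi> t x + w t * \<psi>t t x) + (w t *\<^sub>R \<psi>x t x) \<bullet> c t x)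
          = (LINT x|\<kappa> t. w' t * \<psi> t x + w t * (\<psi>t t x + \<psi>x t x \<bullet> c t x))"
          by (simp add: algebra_simps)
        also have "\<dots> = w' t * (LINT x|\<kappa> t. \<psi> t x) + w t * (LINT x|\<kappa> t. \<psi>t t x + \<psi>x t x \<bullet> c t x)"
          using i\<psi> I(2,3)[OF True] by simp
        finally show ?thesis using True pq by simp
      next
        case False
        then have "t \<notin> {a..b}" using ab by auto
        then show ?thesis using False w(3) w'0 by simp
      qed
    qed simp
    finally show "(LINT t:{p..q}|lborel. w' t * (LINT x|\<kappa> t. \<psi> t x) + w t * (LINT x|\<kappa> t. \<psi>t t x + \<psi>x t x \<bullet> c t x)) = 0" by simp
  qed
qed

end

text \<open>Both factors of the integrand depend on time; the space derivative falls on the kernel and is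
  then moved to \<open>\<psi>\<close>.\<close>

lemma hconv_C1_spacetime:
  fixes \<psi> :: "real \<Rightarrow> 'n::finite torus \<Rightarrow> real"
  assumes \<psi>: "C1_spacetime UNIV \<psi> \<psi>t \<psi>x"
  shows "C1_spacetime {t. 0 < \<gamma> + \<beta> * t} (\<lambda>t. hconv (\<gamma> + \<beta> * t) Leb (\<psi> t))
    (\<lambda>t y. \<beta> * (LINT x|Leb. hkS (\<gamma> + \<beta> * t) y x * \<psi> t x) + hconv (\<gamma> + \<beta> * t) Leb (\<psi>t t) y)
    (\<lambda>t. hconv (\<gamma> + \<beta> * t) Leb (\<psi>x t))"
proof -
  let ?J = "{t. 0 < \<gamma> + \<beta> * t}"
  note D = C1_spacetimeD[OF \<psi>, simplified] and c\<psi> = C1_spacetime_continuous[OF \<psi>, simplified]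
  have op: "open ?J" by (intro open_Collect_less continuous_intros)
  have cp: "continuous_on S (\<lambda>p. F (f p) (g p))"
    if "continuous_on UNIV (\<lambda>(t, x). F t x)" "continuous_on S f" "continuous_on S g"
    for F :: "real \<Rightarrow> 'n torus \<Rightarrow> 'b::topological_space" and S :: "'c::topological_space set" and f g
    by (rule continuous_on_compose2[OF that(1), where f="\<lambda>p. (f p, g p)", simplified]) (use that in \<open>auto intro: continuous_intros\<close>)
  have one: "integrable (Leb :: 'n torus measure) (\<lambda>_. 1::real)" by simp
  have cS: "continuous_on (?J \<times> UNIV) (\<lambda>(t, y). LINT x|Leb. hkS (\<gamma> + \<beta> * t) y x * \<psi> t x)"
  proof -
    have "continuous_on ((?J \<times> UNIV) \<times> UNIV) (\<lambda>(p, x). hkS (\<gamma> + \<beta> * fst p) (snd p) x * \<psi> (fst p) x)"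
      unfolding case_prod_unfold
      by (intro continuous_on_mult continuous_on_hk cp[OF c\<psi>] continuous_intros) auto
    from continuous_on_integral_kernel[OF bounded_bilinear_mult sets_Leb one this]
    show ?thesis by (simp add: case_prod_unfold)
  qed
  have ch: "continuous_on (?J \<times> UNIV) (\<lambda>(t, y). hconv (\<gamma> + \<beta> * t) Leb (F t) y)"
    if F: "continuous_on UNIV (\<lambda>(t, x). F t x)" for F :: "real \<Rightarrow> 'n torus \<Rightarrow> 'b::{banach, second_countable_topology}"
  proof -
    have "continuous_on ((?J \<times> UNIV) \<times> UNIV) (\<lambda>(p, x). hk (\<gamma> + \<beta> * fst p) (snd p) x *\<^sub>R F (fst p) x)"
      unfolding case_prod_unfold
      by (intro continuous_on_scaleR continuous_on_hk cp[OF F] continuous_intros) auto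
    from continuous_on_integral_kernel[OF bounded_bilinear.flip[OF bounded_bilinear_scaleR] sets_Leb one this]
    show ?thesis by (simp add: case_prod_unfold hconv_def)
  qed
  have deriv: "((\<lambda>(s, y). hconv (\<gamma> + \<beta> * s) Leb (\<psi> s) (torus_proj y)) has_derivative
      (\<lambda>(\<sigma>, h). (\<beta> * (LINT x|Leb. hkS (\<gamma> + \<beta> * t) (torus_proj y) x * \<psi> t x) + hconv (\<gamma> + \<beta> * t) Leb (\<psi>t t) (torus_proj y)) * \<sigma>
        + hconv (\<gamma> + \<beta> * t) Leb (\<psi>x t) (torus_proj y) \<bullet> h)) (at (t, y))" if t: "t \<in> ?J" for t y
  proof -
    define k where "k p x = hk (\<gamma> + \<beta> * fst p) (torus_proj (snd p)) x * \<psi> (fst p) x" for p :: "real \<times> (real^'n)" and x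
    define Dk where "Dk p x = (\<beta> * hkS (\<gamma> + \<beta> * fst p) (torus_proj (snd p)) x * \<psi> (fst p) x + hk (\<gamma> + \<beta> * fst p) (torus_proj (snd p)) x * \<psi>t (fst p) x,
      \<psi> (fst p) x *\<^sub>R hkD (\<gamma> + \<beta> * fst p) (torus_proj (snd p)) x)" for p :: "real \<times> (real^'n)" and x
    let ?U = "{p :: real \<times> (real^'n). 0 < \<gamma> + \<beta> * fst p}"
    have ctp: "continuous_on S (\<lambda>q. torus_proj (snd (fst q)))" for S :: "((real \<times> (real^'n)) \<times> 'n torus) set"
      by (intro continuous_on_compose2[OF continuous_on_torus_proj] continuous_intros) auto
    have s: "0 < \<gamma> + \<beta> * t" using t by simp
    have "((\<lambda>p. LINT x|Leb. k p x * 1) has_derivative (\<lambda>h. (LINT x|Leb. 1 *\<^sub>R Dk (t, y) x) \<bullet> h)) (at (t, y))"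
    proof (rule has_derivative_integral_kernel[OF sets_Leb one, where U="?U"])
      show "open ?U" by (intro open_Collect_less continuous_intros)
      show "(t, y) \<in> ?U" using t by simp
      show "continuous_on (?U \<times> UNIV) (\<lambda>(p, x). k p x)"
        unfolding k_def case_prod_unfold
        by (intro continuous_on_mult continuous_on_hk cp[OF c\<psi>] ctp continuous_intros) auto
      show "continuous_on (?U \<times> UNIV) (\<lambda>(p, x). Dk p x)"
        unfolding Dk_def case_prod_unfold
        by (intro continuous_on_Pair continuous_on_add continuous_on_scaleR continuous_on_mult continuous_on_hk cp[OF c\<psi>] cp[OF D(2)] ctp continuous_intros) auto
      fix p :: "real \<times> (real^'n)" and x :: "'n torus" assume p: "p \<in> ?U"
      obtain b where x: "x = torus_proj b" by (rule torus_proj_cases)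
      obtain r z where pz: "p = (r, z)" by (cases p)
      have r: "0 < \<gamma> + \<beta> * r" using p pz by simp
      have 1: "((\<lambda>p. heatG (\<gamma> + \<beta> * fst p) (snd p - b)) has_derivative
          (\<lambda>h. \<beta> * heatGs (\<gamma> + \<beta> * r) (z - b) * fst h + heatDG (\<gamma> + \<beta> * r) (z - b) \<bullet> snd h)) (at (r, z))"
        using heatG_deriv_compose[OF r, of b z] by (simp add: case_prod_unfold)
      have 2: "((\<lambda>p. \<psi> (fst p) x) has_derivative (\<lambda>h. fst h * \<psi>t r x)) (at (r, z))"
        using has_derivative_compose[of fst fst "(r, z)" UNIV "\<lambda>s. \<psi> s x" "\<lambda>h. h * \<psi>t r x"] C1_spacetime_time_deriv[OF \<psi>, of r x]
        by (simp add: has_field_derivative_def mult_commute_abs has_derivative_fst)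
      have 3: "((\<lambda>p. heatG (\<gamma> + \<beta> * fst p) (snd p - b) * \<psi> (fst p) x) has_derivative (\<lambda>h. Dk (r, z) x \<bullet> h)) (at (r, z))"
      proof (rule has_derivative_eq_rhs[OF has_derivative_mult[OF 1 2]])
        show "(\<lambda>h. heatG (\<gamma> + \<beta> * fst (r, z)) (snd (r, z) - b) * (fst h * \<psi>t r x) +
            (\<beta> * heatGs (\<gamma> + \<beta> * r) (z - b) * fst h + heatDG (\<gamma> + \<beta> * r) (z - b) \<bullet> snd h) * \<psi> (fst (r, z)) x) = (\<lambda>h. Dk (r, z) x \<bullet> h)"
          by (rule ext) (simp add: Dk_def x hk_proj[OF r] inner_prod_def algebra_simps)
      qed
      have "((\<lambda>p. k p x) has_derivative (\<lambda>h. Dk (r, z) x \<bullet> h)) (at (r, z))"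
        by (rule has_derivative_transform_within_open[OF 3, of ?U])
           (use p pz in \<open>auto simp: k_def x hk_proj intro!: open_Collect_less continuous_intros\<close>)
      then show "((\<lambda>p. k p x) has_derivative (\<bullet>) (Dk p x)) (at p)" by (simp add: pz)
    qed
    moreover have eqv: "(LINT x|Leb. 1 *\<^sub>R Dk (t, y) x) \<bullet> (\<sigma>, h) = (\<beta> * (LINT x|Leb. hkS (\<gamma> + \<beta> * t) (torus_proj y) x * \<psi> t x) + hconv (\<gamma> + \<beta> * t) Leb (\<psi>t t) (torus_proj y)) * \<sigma>
        + hconv (\<gamma> + \<beta> * t) Leb (\<psi>x t) (torus_proj y) \<bullet> h" for \<sigma> h
    proof -
      note cc = continuous_slice[OF c\<psi>[unfolded UNIV_Times_UNIV[symmetric]], OF UNIV_I, of t]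
      note ct = continuous_slice[OF D(2)[unfolded UNIV_Times_UNIV[symmetric]], OF UNIV_I, of t]
      note hc = hk_continuous1(4-6)[OF s, of "torus_proj y"]
      have i1: "integrable Leb (\<lambda>x. hkS (\<gamma> + \<beta> * t) (torus_proj y) x * \<psi> t x)"
        "integrable Leb (\<lambda>x. hk (\<gamma> + \<beta> * t) (torus_proj y) x * \<psi>t t x)"
        "integrable Leb (\<lambda>x. \<psi> t x *\<^sub>R hkD (\<gamma> + \<beta> * t) (torus_proj y) x)"
        by (intro continuous_integrable_Leb continuous_on_mult continuous_on_scaleR hc cc ct)+
      have iD: "integrable Leb (Dk (t, y))"
        unfolding Dk_def fst_conv snd_conv
        by (intro continuous_integrable_Leb continuous_on_Pair continuous_on_add continuous_on_mult continuous_on_scaleR continuous_on_const hc cc ct)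
      have "(LINT x|Leb. 1 *\<^sub>R Dk (t, y) x) \<bullet> (\<sigma>, h) = (LINT x|Leb. Dk (t, y) x \<bullet> (\<sigma>, h))"
        using iD by simp
      also have "\<dots> = (LINT x|Leb. (\<beta> * (hkS (\<gamma> + \<beta> * t) (torus_proj y) x * \<psi> t x) + hk (\<gamma> + \<beta> * t) (torus_proj y) x * \<psi>t t x) * \<sigma>
          + (\<psi> t x *\<^sub>R hkD (\<gamma> + \<beta> * t) (torus_proj y) x) \<bullet> h)"
        by (simp add: Dk_def inner_prod_def ac_simps)
      also have "\<dots> = (LINT x|Leb. (\<beta> * (hkS (\<gamma> + \<beta> * t) (torus_proj y) x * \<psi> t x) + hk (\<gamma> + \<beta> * t) (torus_proj y) x * \<psi>t t x) * \<sigma>)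
          + (LINT x|Leb. (\<psi> t x *\<^sub>R hkD (\<gamma> + \<beta> * t) (torus_proj y) x) \<bullet> h)"
        by (intro Bochner_Integration.integral_add integrable_inner_left integrable_mult_left Bochner_Integration.integrable_add integrable_mult_right i1)
      also have "(LINT x|Leb. (\<psi> t x *\<^sub>R hkD (\<gamma> + \<beta> * t) (torus_proj y) x) \<bullet> h) = hgrad (\<gamma> + \<beta> * t) Leb (\<psi> t) (torus_proj y) \<bullet> h"
        unfolding hgrad_def by (rule integral_inner_left) (rule i1(3))
      also have "(LINT x|Leb. (\<beta> * (hkS (\<gamma> + \<beta> * t) (torus_proj y) x * \<psi> t x) + hk (\<gamma> + \<beta> * t) (torus_proj y) x * \<psi>t t x) * \<sigma>)
        = (\<beta> * (LINT x|Leb. hkS (\<gamma> + \<beta> * t) (torus_proj y) x * \<psi> t x) + hconv (\<gamma> + \<beta> * t) Leb (\<psi>t t) (torus_proj y)) * \<sigma>"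
        using i1 by (simp add: hconv_def)
      also have "hgrad (\<gamma> + \<beta> * t) Leb (\<psi> t) = hconv (\<gamma> + \<beta> * t) Leb (\<psi>x t)"
        by (rule hgrad_weak_gradient[OF s C1_weak_gradient[OF C1_spacetime_slice[OF \<psi>]]]) simp
      finally show ?thesis .
    qed
    moreover have "(\<lambda>q. (LINT x|Leb. 1 *\<^sub>R Dk (t, y) x) \<bullet> q) = (\<lambda>(\<sigma>, h). (\<beta> * (LINT x|Leb. hkS (\<gamma> + \<beta> * t) (torus_proj y) x * \<psi> t x) + hconv (\<gamma> + \<beta> * t) Leb (\<psi>t t) (torus_proj y)) * \<sigma>
        + hconv (\<gamma> + \<beta> * t) Leb (\<psi>x t) (torus_proj y) \<bullet> h)"
    proof
      fix q :: "real \<times> (real^'n)"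
      obtain \<sigma> h where q: "q = (\<sigma>, h)" by (cases q)
      show "(LINT x|Leb. 1 *\<^sub>R Dk (t, y) x) \<bullet> q = ((\<lambda>(\<sigma>, h). (\<beta> * (LINT x|Leb. hkS (\<gamma> + \<beta> * t) (torus_proj y) x * \<psi> t x) + hconv (\<gamma> + \<beta> * t) Leb (\<psi>t t) (torus_proj y)) * \<sigma>
        + hconv (\<gamma> + \<beta> * t) Leb (\<psi>x t) (torus_proj y) \<bullet> h)) q" unfolding q eqv by simp
    qed
    ultimately have "((\<lambda>p. LINT x|Leb. k p x * 1) has_derivative (\<lambda>(\<sigma>, h). (\<beta> * (LINT x|Leb. hkS (\<gamma> + \<beta> * t) (torus_proj y) x * \<psi> t x) + hconv (\<gamma> + \<beta> * t) Leb (\<psi>t t) (torus_proj y)) * \<sigma>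
        + hconv (\<gamma> + \<beta> * t) Leb (\<psi>x t) (torus_proj y) \<bullet> h)) (at (t, y))"
      by (simp only:)
    then show ?thesis by (simp add: k_def hconv_def case_prod_unfold)
  qed
  show ?thesis
    unfolding C1_spacetime_def
  proof (intro conjI ballI allI)
    show "continuous_on (?J \<times> UNIV) (\<lambda>(t, y). \<beta> * (LINT x|Leb. hkS (\<gamma> + \<beta> * t) y x * \<psi> t x) + hconv (\<gamma> + \<beta> * t) Leb (\<psi>t t) y)"
      using cS ch[OF D(2)] unfolding case_prod_unfold by (intro continuous_intros)
  qed (use op ch[OF D(3)] deriv in auto)
qed

section \<open>From increments on short intervals to increments on long ones\<close>

lemma set_integral_split:
  fixes f :: "real \<Rightarrow> real"
  assumes "p \<le> a" "a \<le> b" "set_integrable lborel {p..b} f"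
  shows "(LINT t:{p..b}|lborel. f t) = (LINT t:{p..a}|lborel. f t) + (LINT t:{a..b}|lborel. f t)"
proof -
  have i: "set_integrable lborel {p..a} f" "set_integrable lborel {a..b} f"
    by (rule set_integrable_subset[OF assms(3)]; use assms in auto)+

  have "(LINT t|lborel. indicator {p..b} t *\<^sub>R f t) = (LINT t|lborel. indicator {p..a} t *\<^sub>R f t + indicator {a..b} t *\<^sub>R f t)"
  proof (rule integral_cong_AE)
    show "AE t in lborel. indicator {p..b} t *\<^sub>R f t = indicator {p..a} t *\<^sub>R f t + indicator {a..b} t *\<^sub>R f t"
      using AE_lborel_singleton[of a] by eventually_elim (use assms(1,2) in \<open>auto simp: indicator_def\<close>)
  qed (use i assms(3) in \<open>simp_all add: set_integrable_def borel_measurable_integrable del: real_scaleR_def\<close>)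
  then show ?thesis using i unfolding set_lebesgue_integral_def set_integrable_def by simp
qed

text \<open>Along a fine uniform partition the increments add up to at most \<epsilon> times the
  whole integral of W. The criterion bypasses differentiability of \<Phi> and only compares nearby
  times.\<close>

lemma small_increments_constant:
  fixes \<Phi> W :: "real \<Rightarrow> real"
  assumes pq: "p < q" and W: "set_integrable lborel {p..q} W" "\<And>t. t \<in> {p..q} \<Longrightarrow> 0 \<le> W t"
    and small: "\<And>\<epsilon>. \<epsilon> > 0 \<Longrightarrow> \<exists>\<delta>>0. \<forall>t1 t2. p \<le> t1 \<longrightarrow> t1 < t2 \<longrightarrow> t2 \<le> q \<longrightarrow> t2 - t1 < \<delta> \<longrightarrow>
      \<bar>\<Phi> t2 - \<Phi> t1\<bar> \<le> \<epsilon> * (LINT t:{t1..t2}|lborel. W t)"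
  shows "\<Phi> q = \<Phi> p"
proof -
  define I where "I = (LINT t:{p..q}|lborel. W t)"
  have I: "0 \<le> I" unfolding I_def set_lebesgue_integral_def
    using W(2) by (intro Bochner_Integration.integral_nonneg) (auto simp: indicator_def)
  have "\<bar>\<Phi> q - \<Phi> p\<bar> \<le> e" if e: "e > 0" for e
  proof -
    define \<epsilon> where "\<epsilon> = e / (I + 1)"
    have \<epsilon>: "\<epsilon> > 0" using e I by (simp add: \<epsilon>_def)
    obtain \<delta> where \<delta>: "\<delta> > 0" "\<And>t1 t2. p \<le> t1 \<Longrightarrow> t1 < t2 \<Longrightarrow> t2 \<le> q \<Longrightarrow> t2 - t1 < \<delta> \<Longrightarrow> \<bar>\<Phi> t2 - \<Phi> t1\<bar> \<le> \<epsilon> * (LINT t:{t1..t2}|lborel. W t)"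
      using small[OF \<epsilon>] by blast
    obtain n :: nat where n: "(q - p) / \<delta> < real n" using reals_Archimedean2 by blast
    have n0: "n > 0" using n pq \<delta>(1) by (cases n) (auto simp: divide_less_0_iff)
    define h where "h = (q - p) / real n"
    have h: "0 < h" "h < \<delta>" using n n0 pq \<delta>(1) by (auto simp: h_def field_simps)
    have nh: "real n * h = q - p" using n0 by (simp add: h_def)
    have "\<bar>\<Phi> (p + real k * h) - \<Phi> p\<bar> \<le> \<epsilon> * (LINT t:{p..p + real k * h}|lborel. W t)" if "k \<le> n" for k
      using that
    proof (induction k)
      case 0
      have "0 \<le> (LINT t:{p..p}|lborel. W t)" unfolding set_lebesgue_integral_def
        using W(2) pq by (intro Bochner_Integration.integral_nonneg) (auto simp: indicator_def)
      then show ?case using \<epsilon> by simp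
    next
      case (Suc k)
      let ?a = "p + real k * h" and ?b = "p + real (Suc k) * h"
      have "real (Suc k) * h \<le> real n * h" using Suc.prems h by (intro mult_right_mono) auto
      then have bq: "?b \<le> q" unfolding nh by simp
      have ab: "p \<le> ?a" "?a < ?b" "?b - ?a < \<delta>" using h by (auto simp: algebra_simps)
      have ib: "set_integrable lborel {p..?b} W" by (rule set_integrable_subset[OF W(1)]) (use bq in auto)
      have "\<bar>\<Phi> ?b - \<Phi> p\<bar> \<le> \<bar>\<Phi> ?b - \<Phi> ?a\<bar> + \<bar>\<Phi> ?a - \<Phi> p\<bar>" by linarith
      also have "\<dots> \<le> \<epsilon> * (LINT t:{?a..?b}|lborel. W t) + \<epsilon> * (LINT t:{p..?a}|lborel. W t)"
        using \<delta>(2)[OF ab(1,2) bq ab(3)] Suc by (intro add_mono) auto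
      also have "\<dots> = \<epsilon> * (LINT t:{p..?b}|lborel. W t)"
        using set_integral_split[OF ab(1) less_imp_le[OF ab(2)] ib] by (simp add: distrib_left)
      finally show ?case .
    qed
    from this[of n] have "\<bar>\<Phi> q - \<Phi> p\<bar> \<le> \<epsilon> * I" by (simp add: nh I_def)
    also have "\<dots> \<le> \<epsilon> * (I + 1)" using \<epsilon> by simp
    also have "\<dots> = e" using I by (simp add: \<epsilon>_def)
    finally show ?thesis .
  qed
  then have "\<bar>\<Phi> q - \<Phi> p\<bar> \<le> 0" by (rule field_le_epsilon[of _ 0, simplified])
  then show ?thesis by simp
qed

text \<open>Uniform continuity is borrowed from the compact unit cube, which covers the torus and
  carries a metric.\<close>

lemma torus_uniformly_continuous:
  fixes F :: "real \<Rightarrow> 'n::finite torus \<Rightarrow> 'b::real_normed_vector"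
  assumes F: "continuous_on ({p..q} \<times> UNIV) (\<lambda>(t, x). F t x)" and e: "e > 0"
  obtains d where "d > 0" "\<And>s t x. s \<in> {p..q} \<Longrightarrow> t \<in> {p..q} \<Longrightarrow> \<bar>s - t\<bar> < d \<Longrightarrow> norm (F s x - F t x) < e"
proof -
  let ?K = "{p..q} \<times> cbox 0 (1 :: real^'n)"
  have "continuous_on ?K (\<lambda>z. F (fst z) (torus_proj (snd z)))"
    by (rule continuous_on_compose2[OF F, where f="\<lambda>z. (fst z, torus_proj (snd z))", simplified])
       (auto intro!: continuous_intros continuous_on_compose2[OF continuous_on_torus_proj])
  then have "uniformly_continuous_on ?K (\<lambda>z. F (fst z) (torus_proj (snd z)))"
    by (rule compact_uniformly_continuous) (intro compact_Times compact_Icc compact_cbox)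
  then obtain d where d: "d > 0" "\<And>z z'. z \<in> ?K \<Longrightarrow> z' \<in> ?K \<Longrightarrow> dist z' z < d \<Longrightarrow>
      dist (F (fst z') (torus_proj (snd z'))) (F (fst z) (torus_proj (snd z))) < e"
    unfolding uniformly_continuous_on_def using e by metis
  show thesis
  proof (rule that[OF d(1)])
    fix s t and x :: "'n torus" assume st: "s \<in> {p..q}" "t \<in> {p..q}" "\<bar>s - t\<bar> < d"
    have "x \<in> torus_proj ` cbox 0 1" by (simp add: torus_proj_cube)
    then obtain y where y: "x = torus_proj y" "y \<in> cbox 0 1" by blast
    show "norm (F s x - F t x) < e"
      using d(2)[of "(t, y)" "(s, y)"] st y by (simp add: dist_Pair_Pair dist_norm)
  qed
qed

section \<open>Heat perturbation of a curve\<close>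

text \<open>The kernel set to 0 at nonpositive heat times, which makes it Borel on the whole space:
  an affine heating profile leaves the positive range outside its own interval.\<close>

definition hk0 :: "real \<Rightarrow> 'n::finite torus \<Rightarrow> 'n torus \<Rightarrow> real" where
  "hk0 s x y = (if 0 < s then hk s x y else 0)"

lemma hk0_measurable: "(\<lambda>p. hk0 (fst p) (fst (snd p)) (snd (snd p))) \<in> borel_measurable (borel :: (real \<times> 'n::finite torus \<times> 'n torus) measure)"
proof -
  let ?A = "{p :: real \<times> 'n torus \<times> 'n torus. 0 < fst p}"
  have "open ?A" by (intro open_Collect_less continuous_intros)
  then have "(\<lambda>p. if p \<in> ?A then hk (fst p) (fst (snd p)) (snd (snd p)) else 0) \<in> borel_measurable borel"
    by (intro borel_measurable_continuous_on_if continuous_on_hk continuous_intros) auto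
  then show ?thesis by (simp add: hk0_def)
qed

text \<open>The integrated tangent inequality. The constant in the slope 1 + ln v drops out because
  the two densities have equal mass.\<close>

lemma ent_tangent:
  fixes u v :: "'n::finite torus \<Rightarrow> real"
  assumes u: "continuous_on UNIV u" "\<And>x. 0 < u x" and v: "continuous_on UNIV v" "\<And>x. 0 < v x"
    and eq: "(LINT x|Leb. u x) = (LINT x|Leb. v x)"
  shows "(LINT x|Leb. ln (v x) * u x) - (LINT x|Leb. ln (v x) * v x) \<le> ent u - ent v"
proof -
  note lv = ent_integrable(1)[OF v] and iu = ent_integrable(3)[OF u] and iv = ent_integrable(3)[OF v]
  have i: "integrable Leb u" "integrable Leb v" "integrable Leb (\<lambda>x. ln (v x) * u x)" "integrable Leb (\<lambda>x. ln (v x) * v x)"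
    by (intro continuous_integrable_Leb continuous_on_mult lv u v)+
  have "(LINT x|Leb. v x * ln (v x) + ((u x - v x) + (ln (v x) * u x - ln (v x) * v x))) \<le> ent u"
    unfolding ent_def
  proof (rule integral_mono)
    show "v x * ln (v x) + ((u x - v x) + (ln (v x) * u x - ln (v x) * v x)) \<le> u x * ln (u x)" for x
      using xlnx_tangent[OF less_imp_le[OF u(2)] v(2), of x x] by (simp add: algebra_simps)
  qed (use i iu iv in auto)
  moreover have "(LINT x|Leb. v x * ln (v x) + ((u x - v x) + (ln (v x) * u x - ln (v x) * v x)))
      = ent v + ((LINT x|Leb. u x) - (LINT x|Leb. v x) + ((LINT x|Leb. ln (v x) * u x) - (LINT x|Leb. ln (v x) * v x)))"
    unfolding ent_def
    by (subst Bochner_Integration.integral_add Bochner_Integration.integral_diff, use i iv in \<open>auto simp del: Bochner_Integration.integral_add Bochner_Integration.integral_diff\<close>)+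
  ultimately show ?thesis using eq by simp
qed

context torus_curve
begin

text \<open>On an affine piece of the heating profile, \<open>\<gamma> + \<beta> * t\<close> is the heat time applied at time \<open>t\<close>.
  The heated curve solves the continuity equation with momentum \<open>flux\<close>: heating at rate \<open>\<beta>\<close> adds the
  diffusive part \<open>- \<beta> * grad\<close> to the smoothed momentum of the original curve.\<close>

definition dens :: "real \<Rightarrow> real \<Rightarrow> real \<Rightarrow> 'n torus \<Rightarrow> real" where
  "dens \<gamma> \<beta> t = hdens (\<gamma> + \<beta> * t) (\<kappa> t)"

definition grad :: "real \<Rightarrow> real \<Rightarrow> real \<Rightarrow> 'n torus \<Rightarrow> real^'n" where
  "grad \<gamma> \<beta> t = hgrad (\<gamma> + \<beta> * t) (\<kappa> t) (\<lambda>_. 1)"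

definition mom :: "real \<Rightarrow> real \<Rightarrow> real \<Rightarrow> 'n torus \<Rightarrow> real^'n" where
  "mom \<gamma> \<beta> t = hconv (\<gamma> + \<beta> * t) (\<kappa> t) (c t)"

definition flux :: "real \<Rightarrow> real \<Rightarrow> real \<Rightarrow> 'n torus \<Rightarrow> real^'n" where
  "flux \<gamma> \<beta> t x = mom \<gamma> \<beta> t x - \<beta> *\<^sub>R grad \<gamma> \<beta> t x"

lemma one_integrable: "integrable (\<kappa> t) (\<lambda>_. 1 :: real)"
proof -
  interpret prob_space "\<kappa> t" by (rule prob_space_\<kappa>)
  show ?thesis by simp
qed

lemma dens_props:
  assumes s: "0 < \<gamma> + \<beta> * t"
  shows "0 < dens \<gamma> \<beta> t x" "continuous_on UNIV (dens \<gamma> \<beta> t)" "C1_torus (dens \<gamma> \<beta> t) (grad \<gamma> \<beta> t)"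
    "(LINT x|Leb. dens \<gamma> \<beta> t x) = 1" "continuous_on UNIV (grad \<gamma> \<beta> t)" "continuous_on UNIV (mom \<gamma> \<beta> t)"
    "continuous_on UNIV (flux \<gamma> \<beta> t)"
proof -
  note h = hdens_props[OF s prob[of t]]
  show "0 < dens \<gamma> \<beta> t x" "continuous_on UNIV (dens \<gamma> \<beta> t)" "C1_torus (dens \<gamma> \<beta> t) (grad \<gamma> \<beta> t)"
    "(LINT x|Leb. dens \<gamma> \<beta> t x) = 1"
    using h by (auto simp: dens_def grad_def)
  show g: "continuous_on UNIV (grad \<gamma> \<beta> t)" using C1_torus_continuous(2)[OF h(3)] by (simp add: grad_def)
  show m: "continuous_on UNIV (mom \<gamma> \<beta> t)"
    unfolding mom_def by (rule hconv_continuous[OF s sets_\<kappa> c_integrable(3)])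
  show "continuous_on UNIV (flux \<gamma> \<beta> t)" unfolding flux_def by (intro continuous_intros g m)
qed

section \<open>Regularity of the heated density, its gradient and the smoothed momentum\<close>

lemma hdens_curve_continuous:
  assumes h: "continuous_on UNIV h"
  shows "continuous_on ({t. 0 < h t} \<times> UNIV) (\<lambda>(t, x). hdens (h t) (\<kappa> t) x)"
proof -
  have hf: "continuous_on S (\<lambda>p. h (f p))" if "continuous_on S f" for S :: "'x::topological_space set" and f
    by (rule continuous_on_compose2[OF h that]) auto
  have "continuous_on ({t. 0 < h t} \<times> UNIV) (\<lambda>p. LINT y|\<kappa> (fst p). hk (h (fst p)) (snd p) y)"
    by (rule continuous_on_narrow_integral[OF prob narrow])
       (auto simp: case_prod_unfold intro!: continuous_on_hk hf continuous_intros)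
  then show ?thesis by (simp add: hconv_def case_prod_unfold)
qed

lemma hgrad_curve_continuous:
  assumes h: "continuous_on UNIV h"
  shows "continuous_on ({t. 0 < h t} \<times> UNIV) (\<lambda>(t, x). hgrad (h t) (\<kappa> t) (\<lambda>_. 1) x)"
proof -
  have hf: "continuous_on S (\<lambda>p. h (f p))" if "continuous_on S f" for S :: "'x::topological_space set" and f
    by (rule continuous_on_compose2[OF h that]) auto
  \<comment> \<open>Narrow continuity is available for real test functions, so the vector-valued
    kernel is handled by components.\<close>
  have eq: "hgrad (h t) (\<kappa> t) (\<lambda>_. 1) x = (\<chi> i. LINT y|\<kappa> t. hkD (h t) x y $ i)" if "0 < h t" for t x
  proof -
    have "integrable (\<kappa> t) (hkD (h t) x)"
      by (rule continuous_Leb_integrable[OF finite_\<kappa> sets_\<kappa> hk_continuous1(5)[OF that]])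
    then show ?thesis by (simp add: hgrad_def vec_eq_iff LINT_vec_nth)
  qed
  have "continuous_on ({t. 0 < h t} \<times> UNIV) (\<lambda>p. \<chi> i. LINT y|\<kappa> (fst p). hkD (h (fst p)) (snd p) y $ i)"
  proof (rule continuous_on_vec_lambda)
    fix i
    have "continuous_on (({t. 0 < h t} \<times> UNIV) \<times> UNIV) (\<lambda>q :: (real \<times> 'n torus) \<times> 'n torus. hkD (h (fst (fst q))) (snd (fst q)) (snd q))"
      by (intro continuous_on_hk hf continuous_intros) auto
    then show "continuous_on ({t. 0 < h t} \<times> UNIV) (\<lambda>p. LINT y|\<kappa> (fst p). hkD (h (fst p)) (snd p) y $ i)"
      by (intro continuous_on_narrow_integral[OF prob narrow])
         (auto simp: case_prod_unfold intro!: continuous_on_component continuous_intros)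
  qed
  then show ?thesis
    by (rule continuous_on_eq) (auto simp: eq)
qed

lemma affine_continuous: "continuous_on UNIV (\<lambda>t. \<gamma> + \<beta> * t :: real)"
  by (intro continuous_intros)

lemma dens_continuous: "continuous_on ({t. 0 < \<gamma> + \<beta> * t} \<times> UNIV) (\<lambda>(t, x). dens \<gamma> \<beta> t x)"
  unfolding dens_def by (rule hdens_curve_continuous[OF affine_continuous])

lemma grad_continuous: "continuous_on ({t. 0 < \<gamma> + \<beta> * t} \<times> UNIV) (\<lambda>(t, x). grad \<gamma> \<beta> t x)"
  unfolding grad_def by (rule hgrad_curve_continuous[OF affine_continuous])

text \<open>The momentum inherits only measurability in time from \<open>c\<close>, in contrast to
  \<open>dens\<close> and \<open>grad\<close>, which are continuous; so it is treated as an integral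
  against a measurable kernel.\<close>

lemma mom_measurable: "(\<lambda>(t, x). if 0 < \<gamma> + \<beta> * t then mom \<gamma> \<beta> t x else 0) \<in> borel_measurable (borel \<Otimes>\<^sub>M borel)"
proof -
  have "(\<lambda>p. LINT y|\<kappa> (fst p). hk0 (\<gamma> + \<beta> * fst p) (snd p) y *\<^sub>R c (fst p) y) \<in> borel_measurable (borel \<Otimes>\<^sub>M borel)"
  proof (rule integral_measurable_kernel[where N=borel])
    have [measurable]: "(\<lambda>p :: (real \<times> 'n torus) \<times> 'n torus. hk0 (\<gamma> + \<beta> * fst (fst p)) (snd (fst p)) (snd p)) \<in> borel_measurable ((borel \<Otimes>\<^sub>M borel) \<Otimes>\<^sub>M borel)"
    proof -
      have "(\<lambda>p. (\<gamma> + \<beta> * fst (fst p), snd (fst p), snd p)) \<in> ((borel \<Otimes>\<^sub>M borel) \<Otimes>\<^sub>M borel) \<rightarrow>\<^sub>M (borel \<Otimes>\<^sub>M (borel \<Otimes>\<^sub>M borel) :: (real \<times> 'n torus \<times> 'n torus) measure)"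
        by measurable
      then have "(\<lambda>p. (\<gamma> + \<beta> * fst (fst p), snd (fst p), snd p)) \<in> ((borel \<Otimes>\<^sub>M borel) \<Otimes>\<^sub>M borel) \<rightarrow>\<^sub>M (borel :: (real \<times> 'n torus \<times> 'n torus) measure)"
        unfolding borel_prod .
      from measurable_compose[OF this hk0_measurable] show ?thesis by simp
    qed
    have [measurable]: "(\<lambda>p :: (real \<times> 'n torus) \<times> 'n torus. c (fst (fst p)) (snd p)) \<in> borel_measurable ((borel \<Otimes>\<^sub>M borel) \<Otimes>\<^sub>M borel)"
      using measurable_compose[OF _ c_measurable, of "\<lambda>p :: (real \<times> 'n torus) \<times> 'n torus. (fst (fst p), snd p)"] by simp
    show "(\<lambda>(p, y). hk0 (\<gamma> + \<beta> * fst p) (snd p) y *\<^sub>R c (fst p) y) \<in> borel_measurable ((borel \<Otimes>\<^sub>M borel) \<Otimes>\<^sub>M borel)"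
      unfolding case_prod_unfold by measurable
    show "(\<lambda>p. \<kappa> (fst p)) \<in> borel \<Otimes>\<^sub>M borel \<rightarrow>\<^sub>M subprob_algebra borel"
      by (rule measurable_compose[OF measurable_fst kernel_\<kappa>])
  qed
  also have "(\<lambda>p. LINT y|\<kappa> (fst p). hk0 (\<gamma> + \<beta> * fst p) (snd p) y *\<^sub>R c (fst p) y)
      = (\<lambda>(t, x). if 0 < \<gamma> + \<beta> * t then mom \<gamma> \<beta> t x else 0)"
    by (auto simp: fun_eq_iff hk0_def mom_def hconv_def)
  finally show ?thesis .
qed

lemma positive_part_measurable:
  fixes F :: "real \<Rightarrow> 'n torus \<Rightarrow> 'b::{real_normed_vector, second_countable_topology}"
  assumes h: "continuous_on UNIV h" and "continuous_on ({t. 0 < h t} \<times> UNIV) (\<lambda>(t, x). F t x)"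
  shows "(\<lambda>(t, x). if 0 < (h t :: real) then F t x else 0) \<in> borel_measurable (borel \<Otimes>\<^sub>M borel)"
proof -
  let ?A = "{t. 0 < h t} \<times> (UNIV :: 'n torus set)"
  have "open ?A" using h by (intro open_Times open_Collect_less continuous_intros) auto
  then have "(\<lambda>p. if p \<in> ?A then F (fst p) (snd p) else 0) \<in> borel_measurable borel"
    using assms(2) by (intro borel_measurable_continuous_on_if continuous_intros) (auto simp: case_prod_unfold)
  then show ?thesis unfolding borel_prod by (simp add: case_prod_unfold mem_Times_iff)
qed

lemma flux_measurable: "(\<lambda>(t, x). if 0 < \<gamma> + \<beta> * t then flux \<gamma> \<beta> t x else 0) \<in> borel_measurable (borel \<Otimes>\<^sub>M borel)"
proof -
  have "(\<lambda>p. (if 0 < \<gamma> + \<beta> * fst p then mom \<gamma> \<beta> (fst p) (snd p) else 0) - \<beta> *\<^sub>R (if 0 < \<gamma> + \<beta> * fst p then grad \<gamma> \<beta> (fst p) (snd p) else 0)) \<in> borel_measurable (borel \<Otimes>\<^sub>M borel)"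
    using mom_measurable[of \<gamma> \<beta>] positive_part_measurable[OF affine_continuous grad_continuous, of \<gamma> \<beta>] unfolding case_prod_unfold
    by (intro borel_measurable_diff borel_measurable_scaleR borel_measurable_const)
  then show ?thesis by (rule measurable_cong[THEN iffD1, rotated]) (auto simp: flux_def)
qed

text \<open>The equation of \<kappa> is tested with the heated function P \<psi> at heat time
  \<gamma> + \<beta> t. Duality moves P to the measure, which gives \<open>dens\<close> and
  \<open>mom\<close>. The time dependence of P contributes \<beta> times a Laplacian, and one
  integration by parts turns it into -\<beta> times the pairing of \<psi>x with \<open>grad\<close>:
  the diffusive part of \<open>flux\<close>.\<close>

lemma smoothed_CE:
  assumes pq: "0 \<le> p" "p < q" "q \<le> 1" and g: "\<And>t. t \<in> {p..q} \<Longrightarrow> 0 < \<gamma> + \<beta> * t"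
    and \<psi>: "C1_spacetime UNIV \<psi> \<psi>t \<psi>x"
  shows "set_integrable lborel {p..q} (\<lambda>t. LINT x|Leb. \<psi>t t x * dens \<gamma> \<beta> t x + \<psi>x t x \<bullet> flux \<gamma> \<beta> t x)"
    and "(LINT t:{p..q}|lborel. (LINT x|Leb. \<psi>t t x * dens \<gamma> \<beta> t x + \<psi>x t x \<bullet> flux \<gamma> \<beta> t x))
      = (LINT x|Leb. \<psi> q x * dens \<gamma> \<beta> q x) - (LINT x|Leb. \<psi> p x * dens \<gamma> \<beta> p x)"
proof -
  have sub: "{p..q} \<subseteq> {t. 0 < \<gamma> + \<beta> * t}" using g by auto
  note D = C1_spacetimeD[OF \<psi>] and c\<psi> = C1_spacetime_continuous[OF \<psi>]
  note CE = integrated_CE[OF pq hconv_C1_spacetime[OF \<psi>] sub]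
  have E: "(LINT y|\<kappa> t. hconv (\<gamma> + \<beta> * t) Leb (\<psi> t) y) = (LINT x|Leb. \<psi> t x * dens \<gamma> \<beta> t x)" if "0 < \<gamma> + \<beta> * t" for t
    using hconv_adjoint(1)[OF that finite_\<kappa> sets_\<kappa> one_integrable continuous_integrable_Leb[OF continuous_slice[OF c\<psi> UNIV_I]]]
    by (simp add: dens_def)
  have DD: "(LINT y|\<kappa> t. \<beta> * (LINT x|Leb. hkS (\<gamma> + \<beta> * t) y x * \<psi> t x) + hconv (\<gamma> + \<beta> * t) Leb (\<psi>t t) y + hconv (\<gamma> + \<beta> * t) Leb (\<psi>x t) y \<bullet> c t y)
      = (LINT x|Leb. \<psi>t t x * dens \<gamma> \<beta> t x + \<psi>x t x \<bullet> flux \<gamma> \<beta> t x)" if s: "0 < \<gamma> + \<beta> * t" for t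
  proof -
    let ?s = "\<gamma> + \<beta> * t"
    note ct = continuous_slice[OF D(2) UNIV_I, of t] and cx = continuous_slice[OF D(3) UNIV_I, of t]
    note it = continuous_integrable_Leb[OF ct] and ix = continuous_integrable_Leb[OF cx]
    note d = dens_props[OF s]
    have S: "(LINT x|Leb. hkS ?s y x * \<psi> t x) = - (LINT x|Leb. \<psi>x t x \<bullet> hkD ?s x y)" for y
      using integral_hkS[OF s C1_spacetime_slice[OF \<psi> UNIV_I], of t y] by (simp add: hkS_sym[OF s, of y] mult.commute)
    have cD: "continuous_on UNIV (\<lambda>y. LINT x|Leb. \<psi>x t x \<bullet> hkD ?s x y)"
    proof -
      have "continuous_on (UNIV \<times> UNIV) (\<lambda>(y, x). hkD ?s x y)"
        unfolding case_prod_unfold using s by (intro continuous_on_hk continuous_intros) auto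
      from continuous_on_integral_kernel[OF bounded_bilinear.flip[OF bounded_bilinear_inner] sets_Leb ix this]
      show ?thesis by simp
    qed
    have i1: "integrable (\<kappa> t) (\<lambda>y. LINT x|Leb. \<psi>x t x \<bullet> hkD ?s x y)"
      by (rule continuous_Leb_integrable[OF finite_\<kappa> sets_\<kappa> cD])
    have i2: "integrable (\<kappa> t) (hconv ?s Leb (\<psi>t t))"
      by (rule continuous_Leb_integrable[OF finite_\<kappa> sets_\<kappa> hconv_continuous[OF s sets_Leb it]])
    note A = hconv_adjoint[OF s finite_\<kappa> sets_\<kappa> c_integrable(3) ix]
    have "(LINT y|\<kappa> t. \<beta> * (LINT x|Leb. hkS ?s y x * \<psi> t x) + hconv ?s Leb (\<psi>t t) y + hconv ?s Leb (\<psi>x t) y \<bullet> c t y)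
      = (LINT y|\<kappa> t. (- \<beta>) * (LINT x|Leb. \<psi>x t x \<bullet> hkD ?s x y)) + (LINT y|\<kappa> t. hconv ?s Leb (\<psi>t t) y) + (LINT y|\<kappa> t. hconv ?s Leb (\<psi>x t) y \<bullet> c t y)"
      unfolding S using i1 i2 A(3) by simp
    also have "(LINT y|\<kappa> t. (- \<beta>) * (LINT x|Leb. \<psi>x t x \<bullet> hkD ?s x y)) = (- \<beta>) * (LINT x|Leb. \<psi>x t x \<bullet> grad \<gamma> \<beta> t x)"
      using hgrad_adjoint[OF s finite_\<kappa> sets_\<kappa> one_integrable ix] by (simp add: grad_def)
    also have "(LINT y|\<kappa> t. hconv ?s Leb (\<psi>t t) y) = (LINT x|Leb. \<psi>t t x * dens \<gamma> \<beta> t x)"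
      using hconv_adjoint(1)[OF s finite_\<kappa> sets_\<kappa> one_integrable it] by (simp add: dens_def)
    also have "(LINT y|\<kappa> t. hconv ?s Leb (\<psi>x t) y \<bullet> c t y) = (LINT x|Leb. \<psi>x t x \<bullet> mom \<gamma> \<beta> t x)"
      using A(1) by (simp add: mom_def)
    finally have 1: "(LINT y|\<kappa> t. \<beta> * (LINT x|Leb. hkS ?s y x * \<psi> t x) + hconv ?s Leb (\<psi>t t) y + hconv ?s Leb (\<psi>x t) y \<bullet> c t y)
      = (- \<beta>) * (LINT x|Leb. \<psi>x t x \<bullet> grad \<gamma> \<beta> t x) + (LINT x|Leb. \<psi>t t x * dens \<gamma> \<beta> t x) + (LINT x|Leb. \<psi>x t x \<bullet> mom \<gamma> \<beta> t x)" .
    have j: "integrable Leb (\<lambda>x. \<psi>x t x \<bullet> grad \<gamma> \<beta> t x)" "integrable Leb (\<lambda>x. \<psi>t t x * dens \<gamma> \<beta> t x)" "integrable Leb (\<lambda>x. \<psi>x t x \<bullet> mom \<gamma> \<beta> t x)"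
      by (intro continuous_integrable_Leb continuous_on_inner continuous_on_mult ct cx d)+
    have "(LINT x|Leb. \<psi>t t x * dens \<gamma> \<beta> t x + \<psi>x t x \<bullet> flux \<gamma> \<beta> t x)
      = (LINT x|Leb. (- \<beta>) * (\<psi>x t x \<bullet> grad \<gamma> \<beta> t x) + \<psi>t t x * dens \<gamma> \<beta> t x + \<psi>x t x \<bullet> mom \<gamma> \<beta> t x)"
      by (simp add: flux_def inner_diff_right algebra_simps)
    also have "\<dots> = (- \<beta>) * (LINT x|Leb. \<psi>x t x \<bullet> grad \<gamma> \<beta> t x) + (LINT x|Leb. \<psi>t t x * dens \<gamma> \<beta> t x) + (LINT x|Leb. \<psi>x t x \<bullet> mom \<gamma> \<beta> t x)"
      using j by simp
    finally show ?thesis using 1 by simp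
  qed
  have eq: "indicator {p..q} t *\<^sub>R (LINT y|\<kappa> t. \<beta> * (LINT x|Leb. hkS (\<gamma> + \<beta> * t) y x * \<psi> t x) + hconv (\<gamma> + \<beta> * t) Leb (\<psi>t t) y + hconv (\<gamma> + \<beta> * t) Leb (\<psi>x t) y \<bullet> c t y)
      = indicator {p..q} t *\<^sub>R (LINT x|Leb. \<psi>t t x * dens \<gamma> \<beta> t x + \<psi>x t x \<bullet> flux \<gamma> \<beta> t x)" for t
    by (cases "t \<in> {p..q}") (use DD g in auto)
  show "set_integrable lborel {p..q} (\<lambda>t. LINT x|Leb. \<psi>t t x * dens \<gamma> \<beta> t x + \<psi>x t x \<bullet> flux \<gamma> \<beta> t x)"
    using CE(1) unfolding set_integrable_def eq .
  show "(LINT t:{p..q}|lborel. (LINT x|Leb. \<psi>t t x * dens \<gamma> \<beta> t x + \<psi>x t x \<bullet> flux \<gamma> \<beta> t x))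
      = (LINT x|Leb. \<psi> q x * dens \<gamma> \<beta> q x) - (LINT x|Leb. \<psi> p x * dens \<gamma> \<beta> p x)"
    using CE(2) pq g unfolding set_lebesgue_integral_def eq by (simp add: E)
qed

text \<open>Smoothing does not increase the total mass of the momentum, and \<open>grad\<close> is
  bounded on a compact time interval. The bound is affine in \<open>en\<close>, hence integrable in
  time.\<close>

lemma flux_L1_bound:
  assumes g: "\<And>t. t \<in> {p..q} \<Longrightarrow> 0 < \<gamma> + \<beta> * t"
  obtains C where "0 < C" "\<And>t. t \<in> {p..q} \<Longrightarrow> (LINT x|Leb. norm (flux \<gamma> \<beta> t x)) \<le> C + en t"
proof -
  have "continuous_on ({p..q} \<times> UNIV) (\<lambda>(t, x). grad \<gamma> \<beta> t x)"
    by (rule continuous_on_subset[OF grad_continuous]) (use g in auto)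
  then obtain B where B: "0 < B" "\<And>t x. t \<in> {p..q} \<Longrightarrow> norm (grad \<gamma> \<beta> t x) \<le> B"
    by (rule compact_product_bounded) (rule that)
  show thesis
  proof (rule that[of "1 + \<bar>\<beta>\<bar> * B"])
    show "0 < 1 + \<bar>\<beta>\<bar> * B" using B(1) by (simp add: add_pos_nonneg)
    fix t assume t: "t \<in> {p..q}"
    let ?s = "\<gamma> + \<beta> * t"
    have s: "0 < ?s" by (rule g[OF t])
    have ih: "integrable Leb (hconv ?s (\<kappa> t) (\<lambda>y. norm (c t y)))"
      by (rule continuous_integrable_Leb[OF hconv_continuous[OF s sets_\<kappa> c_integrable(2)]])
    have bd: "norm (flux \<gamma> \<beta> t x) \<le> hconv ?s (\<kappa> t) (\<lambda>y. norm (c t y)) x + \<bar>\<beta>\<bar> * B" for x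
    proof -
      have "norm (mom \<gamma> \<beta> t x) \<le> hconv ?s (\<kappa> t) (\<lambda>y. norm (c t y)) x"
        unfolding mom_def hconv_def
        by (intro norm_integral_le integrable_hk_scaleR[OF s sets_\<kappa>] c_integrable) (simp add: hk_nonneg[OF s])
      moreover have "norm (\<beta> *\<^sub>R grad \<gamma> \<beta> t x) \<le> \<bar>\<beta>\<bar> * B" using B(2)[OF t] by (simp add: mult_left_mono)
      ultimately show ?thesis unfolding flux_def by (intro order_trans[OF norm_triangle_ineq4] add_mono)
    qed
    have "(LINT x|Leb. norm (flux \<gamma> \<beta> t x)) \<le> (LINT x|Leb. hconv ?s (\<kappa> t) (\<lambda>y. norm (c t y)) x + \<bar>\<beta>\<bar> * B)"
      using bd by (intro integral_mono continuous_integrable_Leb continuous_on_norm dens_props[OF s] Bochner_Integration.integrable_add ih) auto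
    also have "\<dots> = (LINT y|\<kappa> t. norm (c t y)) + \<bar>\<beta>\<bar> * B"
      using ih integral_hconv[OF s finite_\<kappa> sets_\<kappa> c_integrable(2)] by simp
    also have "\<dots> \<le> (1 + \<bar>\<beta>\<bar> * B) + en t" using norm_integral_le_en[of t] by simp
    finally show "(LINT x|Leb. norm (flux \<gamma> \<beta> t x)) \<le> (1 + \<bar>\<beta>\<bar> * B) + en t" .
  qed
qed

lemma flux_test_bound:
  assumes s: "0 < \<gamma> + \<beta> * t" and b: "continuous_on UNIV b" "\<And>x. norm (b x) \<le> B"
    and C: "(LINT x|Leb. norm (flux \<gamma> \<beta> t x)) \<le> C"
  shows "\<bar>LINT x|Leb. b x \<bullet> flux \<gamma> \<beta> t x\<bar> \<le> B * C"
proof -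
  note d = dens_props[OF s]
  have B: "0 \<le> B" using order_trans[OF norm_ge_zero b(2)] by blast
  have "norm (LINT x|Leb. b x \<bullet> flux \<gamma> \<beta> t x) \<le> (LINT x|Leb. B * norm (flux \<gamma> \<beta> t x))"
  proof (rule norm_integral_le)
    show "norm (b x \<bullet> flux \<gamma> \<beta> t x) \<le> B * norm (flux \<gamma> \<beta> t x)" for x
      using order_trans[OF Cauchy_Schwarz_ineq2 mult_right_mono[OF b(2) norm_ge_zero]] by simp
  qed (intro continuous_integrable_Leb continuous_intros b d)+
  also have "\<dots> \<le> B * C" using C B by (simp add: mult_left_mono)
  finally show ?thesis by simp
qed

lemma flux_integrable:
  assumes pq: "0 \<le> p" "q \<le> 1" and g: "\<And>t. t \<in> {p..q} \<Longrightarrow> 0 < \<gamma> + \<beta> * t"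
    and b: "continuous_on ({p..q} \<times> UNIV) (\<lambda>(t, x). b t x)"
  shows "set_integrable lborel {p..q} (\<lambda>t. LINT x|Leb. b t x \<bullet> flux \<gamma> \<beta> t x)"
proof -
  obtain B where B: "0 < B" "\<And>t x. t \<in> {p..q} \<Longrightarrow> norm (b t x) \<le> B" by (rule compact_product_bounded[OF b]) (rule that)
  obtain C where C: "0 < C" "\<And>t. t \<in> {p..q} \<Longrightarrow> (LINT x|Leb. norm (flux \<gamma> \<beta> t x)) \<le> C + en t"
    by (rule flux_L1_bound[of p q \<gamma> \<beta>]) (erule g, rule that)
  have "(\<lambda>(t, x). (indicator {p..q} t *\<^sub>R b t x) \<bullet> (if 0 < \<gamma> + \<beta> * t then flux \<gamma> \<beta> t x else 0)) \<in> borel_measurable (borel \<Otimes>\<^sub>M borel)"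
    using indicator_continuous_measurable[OF b] flux_measurable
    unfolding case_prod_unfold by (intro borel_measurable_inner)
  then have "(\<lambda>t. LINT x|Leb. (indicator {p..q} t *\<^sub>R b t x) \<bullet> (if 0 < \<gamma> + \<beta> * t then flux \<gamma> \<beta> t x else 0)) \<in> borel_measurable borel"
    by (rule integral_measurable_kernel[where N=borel])
       (auto intro!: measurable_const simp: space_subprob_algebra prob_space_imp_subprob_space Leb.prob_space_axioms)
  also have "(\<lambda>t. LINT x|Leb. (indicator {p..q} t *\<^sub>R b t x) \<bullet> (if 0 < \<gamma> + \<beta> * t then flux \<gamma> \<beta> t x else 0))
      = (\<lambda>t. indicator {p..q} t *\<^sub>R (LINT x|Leb. b t x \<bullet> flux \<gamma> \<beta> t x))"
    using g by (auto simp: fun_eq_iff indicator_def)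
  finally have meas: "(\<lambda>t. indicator {p..q} t *\<^sub>R (LINT x|Leb. b t x \<bullet> flux \<gamma> \<beta> t x)) \<in> borel_measurable borel" .
  have bd: "\<bar>LINT x|Leb. b t x \<bullet> flux \<gamma> \<beta> t x\<bar> \<le> B * (C + en t)" if t: "t \<in> {p..q}" for t
    by (rule flux_test_bound[OF g[OF t] continuous_slice[OF b t] B(2)[OF t] C(2)[OF t]])
  have "set_integrable lborel {p..q} (\<lambda>t. B * (C + en t))"
    by (intro set_integral_add(1) set_integrable_mult_right en_integrable pq borel_integrable_atLeastAtMost' continuous_intros)
  then show ?thesis
  proof (rule set_integrable_bound)
    show "set_borel_measurable lborel {p..q} (\<lambda>t. LINT x|Leb. b t x \<bullet> flux \<gamma> \<beta> t x)"
      unfolding set_borel_measurable_def using meas by simp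
    show "AE t in lborel. t \<in> {p..q} \<longrightarrow> norm (LINT x|Leb. b t x \<bullet> flux \<gamma> \<beta> t x) \<le> norm (B * (C + en t))"
      using order_trans[OF bd abs_ge_self] by (intro AE_I2) auto
  qed
qed

section \<open>Entropy dissipation and energy on an affine piece of the heating profile\<close>

definition score :: "real \<Rightarrow> real \<Rightarrow> real \<Rightarrow> 'n torus \<Rightarrow> real^'n" where
  "score \<gamma> \<beta> t x = (1 / dens \<gamma> \<beta> t x) *\<^sub>R grad \<gamma> \<beta> t x"

lemma score_continuous: "continuous_on ({t. 0 < \<gamma> + \<beta> * t} \<times> UNIV) (\<lambda>(t, x). score \<gamma> \<beta> t x)"
  using dens_continuous[of \<gamma> \<beta>] grad_continuous[of \<gamma> \<beta>] dens_props(1)[of \<gamma> \<beta>] unfolding score_def case_prod_unfold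
  by (intro continuous_intros) (auto simp: less_imp_neq[symmetric])

lemma score_C1:
  assumes "0 < \<gamma> + \<beta> * t" shows "C1_torus (\<lambda>x. ln (dens \<gamma> \<beta> t x)) (score \<gamma> \<beta> t)"
  unfolding score_def by (rule C1_torus_ln[OF dens_props(3,1)[OF assms]])

text \<open>The convexity inequalities of the entropy at both ends of a short time interval bound its increment
  from both sides, so no second derivative of the density is needed.\<close>

lemma entropy_dissipation:
  assumes pq: "0 \<le> p" "p < q" "q \<le> 1" and g: "\<And>t. t \<in> {p..q} \<Longrightarrow> 0 < \<gamma> + \<beta> * t"
  defines "J \<equiv> \<lambda>t. LINT x|Leb. score \<gamma> \<beta> t x \<bullet> flux \<gamma> \<beta> t x"
  shows "set_integrable lborel {p..q} J" "(LINT t:{p..q}|lborel. J t) = ent (dens \<gamma> \<beta> q) - ent (dens \<gamma> \<beta> p)"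
proof -
  have cs: "continuous_on ({p..q} \<times> UNIV) (\<lambda>(t, x). score \<gamma> \<beta> t x)"
    by (rule continuous_on_subset[OF score_continuous]) (use g in auto)
  show iJ: "set_integrable lborel {p..q} J" unfolding J_def by (rule flux_integrable[OF pq(1,3) g cs])
  obtain C where C: "0 < C" "\<And>t. t \<in> {p..q} \<Longrightarrow> (LINT x|Leb. norm (flux \<gamma> \<beta> t x)) \<le> C + en t"
    by (rule flux_L1_bound[of p q \<gamma> \<beta>]) (erule g, rule that)
  have iW: "set_integrable lborel {p..q} (\<lambda>t. C + en t)"
    by (intro set_integral_add(1) en_integrable pq borel_integrable_atLeastAtMost' continuous_intros)
  \<comment> \<open>The entropy minus the integral of its expected derivative, to be shown constant
    by comparing nearby times.\<close>
  define \<Phi> where "\<Phi> t = ent (dens \<gamma> \<beta> t) - (LINT r:{p..t}|lborel. J r)" for t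
  have "\<Phi> q = \<Phi> p"
  proof (rule small_increments_constant[OF pq(2) iW])
    show "0 \<le> C + en t" for t using C(1) en_nonneg[of t] by simp
    fix \<epsilon> :: real assume e: "\<epsilon> > 0"
    obtain d where d: "d > 0" "\<And>s t x. s \<in> {p..q} \<Longrightarrow> t \<in> {p..q} \<Longrightarrow> \<bar>s - t\<bar> < d \<Longrightarrow> norm (score \<gamma> \<beta> s x - score \<gamma> \<beta> t x) < \<epsilon>"
      by (rule torus_uniformly_continuous[OF cs e]) (rule that)
    have "\<bar>\<Phi> t2 - \<Phi> t1\<bar> \<le> \<epsilon> * (LINT t:{t1..t2}|lborel. C + en t)" if t: "p \<le> t1" "t1 < t2" "t2 \<le> q" "t2 - t1 < d" for t1 t2
    proof -
      have sub: "{t1..t2} \<subseteq> {p..q}" using t by auto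
      have g12: "\<And>r. r \<in> {t1..t2} \<Longrightarrow> 0 < \<gamma> + \<beta> * r" using g sub by auto
      have g1: "0 < \<gamma> + \<beta> * t1" and g2: "0 < \<gamma> + \<beta> * t2" using g12 t by auto
      note T = order_trans[OF pq(1) t(1)] t(2) order_trans[OF t(3) pq(3)]
      note d1 = dens_props[OF g1] and d2 = dens_props[OF g2]
      have iJ': "set_integrable lborel {t1..t2} J" by (rule set_integrable_subset[OF iJ]) (use sub in auto)
      have iW': "set_integrable lborel {t1..t2} (\<lambda>t. C + en t)" by (rule set_integrable_subset[OF iW]) (use sub in auto)
      have diff: "\<Phi> t2 - \<Phi> t1 = ent (dens \<gamma> \<beta> t2) - ent (dens \<gamma> \<beta> t1) - (LINT r:{t1..t2}|lborel. J r)"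
        using set_integral_split[of p t1 t2 J] set_integrable_subset[OF iJ, of "{p..t2}"] t by (simp add: \<Phi>_def)
      \<comment> \<open>With s frozen, the logarithm of the density at s is a time-independent C1
        test function, whose increment the continuity equation gives exactly. Replacing its score by
        that at time t costs \<epsilon> times the L1 norm of the flux.\<close>
      have key: "\<bar>((LINT x|Leb. ln (dens \<gamma> \<beta> s x) * dens \<gamma> \<beta> t2 x) - (LINT x|Leb. ln (dens \<gamma> \<beta> s x) * dens \<gamma> \<beta> t1 x))
          - (LINT r:{t1..t2}|lborel. J r)\<bar> \<le> \<epsilon> * (LINT t:{t1..t2}|lborel. C + en t)" if s: "s \<in> {t1..t2}" for s
      proof -
        note gs = g12[OF s]
        note css = C1_torus_continuous(2)[OF score_C1[OF gs]]
        note CE = smoothed_CE[OF T g12 C1_torus_spacetime[OF score_C1[OF gs]]]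
        have i1: "set_integrable lborel {t1..t2} (\<lambda>t. LINT x|Leb. score \<gamma> \<beta> s x \<bullet> flux \<gamma> \<beta> t x)" using CE(1) by simp
        have "((LINT x|Leb. ln (dens \<gamma> \<beta> s x) * dens \<gamma> \<beta> t2 x) - (LINT x|Leb. ln (dens \<gamma> \<beta> s x) * dens \<gamma> \<beta> t1 x))
          - (LINT r:{t1..t2}|lborel. J r) = (LINT t:{t1..t2}|lborel. (LINT x|Leb. score \<gamma> \<beta> s x \<bullet> flux \<gamma> \<beta> t x) - J t)"
          using CE(2) i1 iJ' by (simp add: set_integral_diff)
        also have "\<bar>\<dots>\<bar> \<le> (LINT t:{t1..t2}|lborel. \<epsilon> * (C + en t))"
        proof -
          have "\<bar>(LINT x|Leb. score \<gamma> \<beta> s x \<bullet> flux \<gamma> \<beta> t x) - J t\<bar> \<le> \<epsilon> * (C + en t)" if tt: "t \<in> {t1..t2}" for t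
          proof -
            note gt = g12[OF tt] and tpq = subsetD[OF sub tt]
            note cst = C1_torus_continuous(2)[OF score_C1[OF gt]] and cf = dens_props(7)[OF gt]
            have "(LINT x|Leb. score \<gamma> \<beta> s x \<bullet> flux \<gamma> \<beta> t x) - J t = (LINT x|Leb. score \<gamma> \<beta> s x \<bullet> flux \<gamma> \<beta> t x - score \<gamma> \<beta> t x \<bullet> flux \<gamma> \<beta> t x)"
              unfolding J_def
              by (rule Bochner_Integration.integral_diff[symmetric]; intro continuous_integrable_Leb continuous_on_inner css cst cf)
            also have "\<dots> = (LINT x|Leb. (score \<gamma> \<beta> s x - score \<gamma> \<beta> t x) \<bullet> flux \<gamma> \<beta> t x)" by (simp add: inner_diff_left)
            also have "\<bar>\<dots>\<bar> \<le> \<epsilon> * (C + en t)"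
            proof (rule flux_test_bound[OF gt _ _ C(2)[OF tpq]])
              show "continuous_on UNIV (\<lambda>x. score \<gamma> \<beta> s x - score \<gamma> \<beta> t x)" by (intro continuous_intros css cst)
              show "norm (score \<gamma> \<beta> s x - score \<gamma> \<beta> t x) \<le> \<epsilon>" for x
              proof -
                have "\<bar>s - t\<bar> < d" using s tt t(4) by auto
                from d(2)[OF subsetD[OF sub s] tpq this, of x] show ?thesis by simp
              qed
            qed
            finally show ?thesis .
          qed
          then have "norm (indicator {t1..t2} t *\<^sub>R ((LINT x|Leb. score \<gamma> \<beta> s x \<bullet> flux \<gamma> \<beta> t x) - J t)) \<le> indicator {t1..t2} t *\<^sub>R (\<epsilon> * (C + en t))" for t
            by (auto simp: indicator_def)
          then have "norm (LINT t:{t1..t2}|lborel. (LINT x|Leb. score \<gamma> \<beta> s x \<bullet> flux \<gamma> \<beta> t x) - J t) \<le> (LINT t:{t1..t2}|lborel. \<epsilon> * (C + en t))"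
            unfolding set_lebesgue_integral_def
            by (intro norm_integral_le set_integral_diff(1)[OF i1 iJ', unfolded set_integrable_def] set_integrable_mult_right[OF iW', unfolded set_integrable_def])
          then show ?thesis by simp
        qed
        also have "\<dots> = \<epsilon> * (LINT t:{t1..t2}|lborel. C + en t)" by simp
        finally show ?thesis .
      qed
      \<comment> \<open>The tangent at t1 bounds the increment of the entropy from below, the
        tangent at t2 from above; they correspond to s = t1 and s = t2 in
        \<open>key\<close>.\<close>
      note lo = ent_tangent[OF d2(2,1) d1(2,1)] and up = ent_tangent[OF d1(2,1) d2(2,1)]
      show ?thesis using key[of t1] key[of t2] lo up d1(4) d2(4) t(2) unfolding diff by auto
    qed
    then show "\<exists>\<delta>>0. \<forall>t1 t2. p \<le> t1 \<longrightarrow> t1 < t2 \<longrightarrow> t2 \<le> q \<longrightarrow> t2 - t1 < \<delta> \<longrightarrow>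
      \<bar>\<Phi> t2 - \<Phi> t1\<bar> \<le> \<epsilon> * (LINT t:{t1..t2}|lborel. C + en t)" using d(1) by blast
  qed
  moreover have "(LINT r:{p..p}|lborel. J r) = 0"
    unfolding set_lebesgue_integral_def
    by (rule integral_eq_zero_AE) (use AE_lborel_singleton[of p] in \<open>eventually_elim, auto\<close>)
  ultimately show "(LINT t:{p..q}|lborel. J t) = ent (dens \<gamma> \<beta> q) - ent (dens \<gamma> \<beta> p)" by (simp add: \<Phi>_def)
qed

text \<open>Solving flux = mom - \<beta> grad for \<open>mom\<close> gives \<bar>flux\<bar>^2 =
  \<bar>mom\<bar>^2 - 2 \<beta> grad . flux - \<beta>^2 \<bar>grad\<bar>^2, and the last square is
  dropped. The cross term is kept with \<open>flux\<close> instead of \<open>mom\<close>, because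
  the pairing of score and flux is what the entropy dissipation integrates.\<close>

lemma flux_energy_le:
  assumes s: "0 < \<gamma> + \<beta> * t"
  shows "(\<integral>\<^sup>+x. ennreal ((norm (flux \<gamma> \<beta> t x))\<^sup>2 / dens \<gamma> \<beta> t x) \<partial>Leb)
      \<le> ennreal (en t - 2 * \<beta> * (LINT x|Leb. score \<gamma> \<beta> t x \<bullet> flux \<gamma> \<beta> t x))"
    and "0 \<le> en t - 2 * \<beta> * (LINT x|Leb. score \<gamma> \<beta> t x \<bullet> flux \<gamma> \<beta> t x)"
proof -
  let ?s = "\<gamma> + \<beta> * t"
  note d = dens_props[OF s] and cs = C1_torus_continuous(2)[OF score_C1[OF s]]
  define E where "E = hconv ?s (\<kappa> t) (\<lambda>y. (norm (c t y))\<^sup>2)"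
  have iE: "integrable Leb E"
    unfolding E_def by (rule continuous_integrable_Leb[OF hconv_continuous[OF s sets_\<kappa> c_integrable(1)]])
  have iJ: "integrable Leb (\<lambda>x. score \<gamma> \<beta> t x \<bullet> flux \<gamma> \<beta> t x)" by (intro continuous_integrable_Leb continuous_on_inner cs d)
  have pt: "(norm (flux \<gamma> \<beta> t x))\<^sup>2 / dens \<gamma> \<beta> t x \<le> E x - 2 * \<beta> * (score \<gamma> \<beta> t x \<bullet> flux \<gamma> \<beta> t x)" for x
  proof -
    have "(norm (hconv ?s (\<kappa> t) (\<lambda>y. 1 *\<^sub>R c t y) x))\<^sup>2 \<le> hconv ?s (\<kappa> t) (\<lambda>y. 1\<^sup>2) x * E x"
      unfolding E_def
    proof (rule hconv_Cauchy_Schwarz[OF s finite_\<kappa> sets_\<kappa> c_integrable(1) c_slice_measurable])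
      show "integrable (\<kappa> t) (\<lambda>y. (1 :: real)\<^sup>2)" using one_integrable[of t] by (simp only: power_one)
    qed (rule borel_measurable_const)
    then have m: "(norm (mom \<gamma> \<beta> t x))\<^sup>2 \<le> dens \<gamma> \<beta> t x * E x" by (simp add: mom_def dens_def)
    have "(norm (flux \<gamma> \<beta> t x))\<^sup>2 = (norm (mom \<gamma> \<beta> t x))\<^sup>2 - 2 * \<beta> * (grad \<gamma> \<beta> t x \<bullet> flux \<gamma> \<beta> t x) - (norm (\<beta> *\<^sub>R grad \<gamma> \<beta> t x))\<^sup>2"
      unfolding power2_norm_eq_inner flux_def by (simp add: algebra_simps inner_commute)
    also have "\<dots> \<le> dens \<gamma> \<beta> t x * E x - 2 * \<beta> * (grad \<gamma> \<beta> t x \<bullet> flux \<gamma> \<beta> t x)"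
      using m zero_le_power2[of "norm (\<beta> *\<^sub>R grad \<gamma> \<beta> t x)"] by linarith
    finally show ?thesis using d(1)[of x] by (simp add: score_def field_simps)
  qed
  have i: "integrable Leb (\<lambda>x. E x - 2 * \<beta> * (score \<gamma> \<beta> t x \<bullet> flux \<gamma> \<beta> t x))" using iE iJ by auto
  have nn: "0 \<le> E x - 2 * \<beta> * (score \<gamma> \<beta> t x \<bullet> flux \<gamma> \<beta> t x)" for x
    by (rule order_trans[OF _ pt]) (simp add: less_imp_le[OF d(1)])
  have eq: "(LINT x|Leb. E x - 2 * \<beta> * (score \<gamma> \<beta> t x \<bullet> flux \<gamma> \<beta> t x)) = en t - 2 * \<beta> * (LINT x|Leb. score \<gamma> \<beta> t x \<bullet> flux \<gamma> \<beta> t x)"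
    using iE iJ integral_hconv[OF s finite_\<kappa> sets_\<kappa> c_integrable(1)] by (simp add: E_def en_def)
  show "0 \<le> en t - 2 * \<beta> * (LINT x|Leb. score \<gamma> \<beta> t x \<bullet> flux \<gamma> \<beta> t x)"
    unfolding eq[symmetric] using nn by (intro Bochner_Integration.integral_nonneg) auto
  have "(\<integral>\<^sup>+x. ennreal ((norm (flux \<gamma> \<beta> t x))\<^sup>2 / dens \<gamma> \<beta> t x) \<partial>Leb) \<le> (\<integral>\<^sup>+x. ennreal (E x - 2 * \<beta> * (score \<gamma> \<beta> t x \<bullet> flux \<gamma> \<beta> t x)) \<partial>Leb)"
    by (intro nn_integral_mono ennreal_leI pt)
  also have "\<dots> = ennreal (en t - 2 * \<beta> * (LINT x|Leb. score \<gamma> \<beta> t x \<bullet> flux \<gamma> \<beta> t x))"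
    unfolding eq[symmetric] using nn by (intro nn_integral_eq_integral i) auto
  finally show "(\<integral>\<^sup>+x. ennreal ((norm (flux \<gamma> \<beta> t x))\<^sup>2 / dens \<gamma> \<beta> t x) \<partial>Leb)
      \<le> ennreal (en t - 2 * \<beta> * (LINT x|Leb. score \<gamma> \<beta> t x \<bullet> flux \<gamma> \<beta> t x))" .
qed

lemma flux_energy_interval:
  assumes pq: "0 \<le> p" "p < q" "q \<le> 1" and g: "\<And>t. t \<in> {p..q} \<Longrightarrow> 0 < \<gamma> + \<beta> * t"
  shows "(\<integral>\<^sup>+t\<in>{p..q}. (\<integral>\<^sup>+x. ennreal ((norm (flux \<gamma> \<beta> t x))\<^sup>2 / dens \<gamma> \<beta> t x) \<partial>Leb) \<partial>lborel)
      \<le> ennreal ((LINT t:{p..q}|lborel. en t) - 2 * \<beta> * (ent (dens \<gamma> \<beta> q) - ent (dens \<gamma> \<beta> p)))"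
    and "0 \<le> (LINT t:{p..q}|lborel. en t) - 2 * \<beta> * (ent (dens \<gamma> \<beta> q) - ent (dens \<gamma> \<beta> p))"
proof -
  define J where "J t = (LINT x|Leb. score \<gamma> \<beta> t x \<bullet> flux \<gamma> \<beta> t x)" for t
  note ED = entropy_dissipation[OF pq g, folded J_def]
  note F = flux_energy_le[of \<gamma> \<beta>, folded J_def]
  note ie = en_integrable[OF pq(1,3)]
  have i: "set_integrable lborel {p..q} (\<lambda>t. en t - 2 * \<beta> * J t)"
    by (intro set_integral_diff(1) ie set_integrable_mult_right ED(1))
  have "(\<integral>\<^sup>+t\<in>{p..q}. (\<integral>\<^sup>+x. ennreal ((norm (flux \<gamma> \<beta> t x))\<^sup>2 / dens \<gamma> \<beta> t x) \<partial>Leb) \<partial>lborel)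
    \<le> (\<integral>\<^sup>+t. ennreal (indicator {p..q} t *\<^sub>R (en t - 2 * \<beta> * J t)) \<partial>lborel)"
    using F(1)[OF g] by (intro nn_integral_mono) (auto simp: indicator_def)
  also have "\<dots> = ennreal (LINT t:{p..q}|lborel. en t - 2 * \<beta> * J t)"
    unfolding set_lebesgue_integral_def
    using F(2)[OF g] by (intro nn_integral_eq_integral i[unfolded set_integrable_def] AE_I2) (auto simp: indicator_def)
  also have eq: "(LINT t:{p..q}|lborel. en t - 2 * \<beta> * J t) = (LINT t:{p..q}|lborel. en t) - 2 * \<beta> * (ent (dens \<gamma> \<beta> q) - ent (dens \<gamma> \<beta> p))"
    using ie ED by (simp add: set_integral_diff set_integrable_mult_right)
  finally show "(\<integral>\<^sup>+t\<in>{p..q}. (\<integral>\<^sup>+x. ennreal ((norm (flux \<gamma> \<beta> t x))\<^sup>2 / dens \<gamma> \<beta> t x) \<partial>Leb) \<partial>lborel)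
      \<le> ennreal ((LINT t:{p..q}|lborel. en t) - 2 * \<beta> * (ent (dens \<gamma> \<beta> q) - ent (dens \<gamma> \<beta> p)))" .
  show "0 \<le> (LINT t:{p..q}|lborel. en t) - 2 * \<beta> * (ent (dens \<gamma> \<beta> q) - ent (dens \<gamma> \<beta> p))"
    unfolding eq[symmetric] unfolding set_lebesgue_integral_def
    using F(2)[OF g] by (intro Bochner_Integration.integral_nonneg) (auto simp: indicator_def)
qed

text \<open>Fatou's lemma in space and in time removes the shift of the heat time; the time interval
  is open because the heat time may be 0 at an end. The bound \<open>X\<close> stands for the
  entropy terms: at an end where the heat time tends to 0 the heated entropy is estimated from above
  rather than followed to its limit.\<close>

lemma energy_limit:
  assumes pq: "0 \<le> p" "p < q" "q \<le> 1"
    and g: "\<And>t. p < t \<Longrightarrow> t < q \<Longrightarrow> 0 < \<gamma> + \<beta> * t" "\<And>t. t \<in> {p..q} \<Longrightarrow> 0 \<le> \<gamma> + \<beta> * t"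
    and X: "\<And>n. - 2 * \<beta> * (ent (dens (\<gamma> + heat_time n) \<beta> q) - ent (dens (\<gamma> + heat_time n) \<beta> p)) \<le> X n" "X \<longlonglongrightarrow> L"
  shows "(\<integral>\<^sup>+t\<in>{p<..<q}. (\<integral>\<^sup>+x. ennreal ((norm (flux \<gamma> \<beta> t x))\<^sup>2 / dens \<gamma> \<beta> t x) \<partial>Leb) \<partial>lborel)
      \<le> ennreal ((LINT t:{p..q}|lborel. en t) + L)"
    and "0 \<le> (LINT t:{p..q}|lborel. en t) + L"
proof -
  define F where "F \<delta> t x = ennreal ((norm (flux (\<gamma> + \<delta>) \<beta> t x))\<^sup>2 / dens (\<gamma> + \<delta>) \<beta> t x)" for \<delta> t x
  let ?\<delta> = heat_time
  have pos: "0 < (\<gamma> + ?\<delta> n) + \<beta> * t" if "t \<in> {p..q}" for t n using g(2)[OF that] heat_time_pos[of n] by linarith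
  have Fm: "(\<lambda>t. \<integral>\<^sup>+x. F (?\<delta> n) t x * indicator {p<..<q} t \<partial>Leb) \<in> borel_measurable borel" for n
  proof -
    have "(\<lambda>p. ennreal ((norm (if 0 < (\<gamma> + ?\<delta> n) + \<beta> * fst p then flux (\<gamma> + ?\<delta> n) \<beta> (fst p) (snd p) else 0))\<^sup>2
        / (if 0 < (\<gamma> + ?\<delta> n) + \<beta> * fst p then dens (\<gamma> + ?\<delta> n) \<beta> (fst p) (snd p) else 0))) \<in> borel_measurable (borel \<Otimes>\<^sub>M Leb)"
      using flux_measurable[of "\<gamma> + ?\<delta> n" \<beta>] positive_part_measurable[OF affine_continuous dens_continuous, of "\<gamma> + ?\<delta> n" \<beta>]
      unfolding case_prod_unfold by measurable
    then have "(\<lambda>(t, x). ennreal ((norm (if 0 < (\<gamma> + ?\<delta> n) + \<beta> * t then flux (\<gamma> + ?\<delta> n) \<beta> t x else 0))\<^sup>2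
        / (if 0 < (\<gamma> + ?\<delta> n) + \<beta> * t then dens (\<gamma> + ?\<delta> n) \<beta> t x else 0)) * indicator {p<..<q} t) \<in> borel_measurable (borel \<Otimes>\<^sub>M Leb)"
      unfolding case_prod_unfold by measurable
    from Leb.borel_measurable_nn_integral[OF this]
    show ?thesis
      by (rule measurable_cong[THEN iffD1, rotated]) (use pos[of _ n] in \<open>auto simp: F_def indicator_def intro!: nn_integral_cong\<close>)
  qed
  have lim: "(\<lambda>n. F (?\<delta> n) t x) \<longlonglongrightarrow> F 0 t x" if t: "t \<in> {p<..<q}" for t x
  proof -
    have s: "0 < \<gamma> + \<beta> * t" using g(1) t by auto
    let ?S = "{r. 0 < r}"
    have "continuous_on ?S (\<lambda>r. hdens r (\<kappa> t) x)" "continuous_on ?S (\<lambda>r. hgrad r (\<kappa> t) (\<lambda>_. 1) x)" "continuous_on ?S (\<lambda>r. hconv r (\<kappa> t) (c t) x)"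
      by (intro hconv_continuous_time hgrad_continuous_time sets_\<kappa> one_integrable c_integrable continuous_intros; simp)+
    then have c: "isCont (\<lambda>r. hdens r (\<kappa> t) x) (\<gamma> + \<beta> * t)" "isCont (\<lambda>r. hgrad r (\<kappa> t) (\<lambda>_. 1) x) (\<gamma> + \<beta> * t)" "isCont (\<lambda>r. hconv r (\<kappa> t) (c t) x) (\<gamma> + \<beta> * t)"
      using s by (auto simp: continuous_on_eq_continuous_at open_Collect_less continuous_on_id continuous_on_const)
    have "(\<lambda>n. (\<gamma> + ?\<delta> n) + \<beta> * t) \<longlonglongrightarrow> (\<gamma> + 0) + \<beta> * t" by (intro tendsto_intros heat_time_lim)
    then have l: "(\<lambda>n. (\<gamma> + ?\<delta> n) + \<beta> * t) \<longlonglongrightarrow> \<gamma> + \<beta> * t" by simp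
    show ?thesis
      unfolding F_def flux_def mom_def grad_def dens_def add_0_right
      by (intro tendsto_ennrealI tendsto_divide tendsto_power tendsto_norm tendsto_diff tendsto_scaleR tendsto_const
          isCont_tendsto_compose[OF c(1) l] isCont_tendsto_compose[OF c(2) l] isCont_tendsto_compose[OF c(3) l])
         (use dens_props(1)[OF s, of x] in \<open>simp add: dens_def\<close>)
  qed
  have bound: "(\<integral>\<^sup>+t. (\<integral>\<^sup>+x. F (?\<delta> n) t x * indicator {p<..<q} t \<partial>Leb) \<partial>lborel) \<le> ennreal ((LINT t:{p..q}|lborel. en t) + X n)" for n
  proof -
    have "(\<integral>\<^sup>+t. (\<integral>\<^sup>+x. F (?\<delta> n) t x * indicator {p<..<q} t \<partial>Leb) \<partial>lborel)
      \<le> (\<integral>\<^sup>+t\<in>{p..q}. (\<integral>\<^sup>+x. ennreal ((norm (flux (\<gamma> + ?\<delta> n) \<beta> t x))\<^sup>2 / dens (\<gamma> + ?\<delta> n) \<beta> t x) \<partial>Leb) \<partial>lborel)"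
      by (intro nn_integral_mono) (auto simp: F_def indicator_def)
    also have "\<dots> \<le> ennreal ((LINT t:{p..q}|lborel. en t) - 2 * \<beta> * (ent (dens (\<gamma> + ?\<delta> n) \<beta> q) - ent (dens (\<gamma> + ?\<delta> n) \<beta> p)))"
      by (rule flux_energy_interval(1)[OF pq pos])
    also have "\<dots> \<le> ennreal ((LINT t:{p..q}|lborel. en t) + X n)" using X(1)[of n] by (intro ennreal_leI) simp
    finally show ?thesis .
  qed
  have "(\<integral>\<^sup>+t\<in>{p<..<q}. (\<integral>\<^sup>+x. ennreal ((norm (flux \<gamma> \<beta> t x))\<^sup>2 / dens \<gamma> \<beta> t x) \<partial>Leb) \<partial>lborel)
      \<le> (\<integral>\<^sup>+t. liminf (\<lambda>n. \<integral>\<^sup>+x. F (?\<delta> n) t x * indicator {p<..<q} t \<partial>Leb) \<partial>lborel)"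
  proof (rule nn_integral_mono)
    fix t
    show "(\<integral>\<^sup>+x. ennreal ((norm (flux \<gamma> \<beta> t x))\<^sup>2 / dens \<gamma> \<beta> t x) \<partial>Leb) * indicator {p<..<q} t
      \<le> liminf (\<lambda>n. \<integral>\<^sup>+x. F (?\<delta> n) t x * indicator {p<..<q} t \<partial>Leb)"
    proof (cases "t \<in> {p<..<q}")
      case True
      then have tpq: "t \<in> {p..q}" by auto
      have "(\<integral>\<^sup>+x. ennreal ((norm (flux \<gamma> \<beta> t x))\<^sup>2 / dens \<gamma> \<beta> t x) \<partial>Leb) = (\<integral>\<^sup>+x. liminf (\<lambda>n. F (?\<delta> n) t x) \<partial>Leb)"
        using lim_imp_Liminf[OF sequentially_bot lim[OF True]] by (simp add: F_def)
      also have "\<dots> \<le> liminf (\<lambda>n. \<integral>\<^sup>+x. F (?\<delta> n) t x \<partial>Leb)"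
      proof (rule nn_integral_liminf)
        fix n
        show "F (?\<delta> n) t \<in> borel_measurable Leb"
          using continuous_torus_measurable[OF dens_props(7)[OF pos[OF tpq]]] continuous_torus_measurable[OF dens_props(2)[OF pos[OF tpq]]]
          unfolding F_def by measurable
      qed
      finally show ?thesis using True by simp
    qed simp
  qed
  also have "\<dots> \<le> liminf (\<lambda>n. \<integral>\<^sup>+t. (\<integral>\<^sup>+x. F (?\<delta> n) t x * indicator {p<..<q} t \<partial>Leb) \<partial>lborel)"
    using Fm by (intro nn_integral_liminf) simp
  also have "\<dots> \<le> liminf (\<lambda>n. ennreal ((LINT t:{p..q}|lborel. en t) + X n))"
    by (intro Liminf_mono always_eventually allI bound)
  also have "\<dots> = ennreal ((LINT t:{p..q}|lborel. en t) + L)"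
    by (intro lim_imp_Liminf tendsto_ennrealI tendsto_intros X(2)) simp
  finally show "(\<integral>\<^sup>+t\<in>{p<..<q}. (\<integral>\<^sup>+x. ennreal ((norm (flux \<gamma> \<beta> t x))\<^sup>2 / dens \<gamma> \<beta> t x) \<partial>Leb) \<partial>lborel)
      \<le> ennreal ((LINT t:{p..q}|lborel. en t) + L)" .
  have "0 \<le> (LINT t:{p..q}|lborel. en t) + X n" for n
    using flux_energy_interval(2)[OF pq pos, of n] X(1)[of n] by linarith
  then show "0 \<le> (LINT t:{p..q}|lborel. en t) + L"
    by (intro LIMSEQ_le_const[OF tendsto_add[OF tendsto_const X(2)]]) auto
qed

end

section \<open>The competitor\<close>

text \<open>Heat time 0 leaves the measure as it is, so outside the support of the heating profile
  the competitor agrees with the curve by definition. \<open>heat_fun\<close> is the dual operation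
  on test functions.\<close>

definition heat_measure :: "real \<Rightarrow> 'n::finite torus measure \<Rightarrow> 'n torus measure" where
  "heat_measure s \<mu> = (if 0 < s then density Leb (\<lambda>x. ennreal (hdens s \<mu> x)) else \<mu>)"

definition heat_fun :: "real \<Rightarrow> ('n::finite torus \<Rightarrow> real) \<Rightarrow> 'n torus \<Rightarrow> real" where
  "heat_fun s \<phi> y = (if 0 < s then hconv s Leb \<phi> y else \<phi> y)"

lemma heat_measure_prob: "\<mu> \<in> prob_measures \<Longrightarrow> heat_measure s \<mu> \<in> prob_measures"
  by (simp add: heat_measure_def hdens_props(7))

lemma integral_heat_measure:
  fixes \<phi> :: "'n::finite torus \<Rightarrow> real"
  assumes \<mu>: "\<mu> \<in> prob_measures" and \<phi>: "continuous_on UNIV \<phi>"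
  shows "(LINT x|heat_measure s \<mu>. \<phi> x) = (LINT y|\<mu>. heat_fun s \<phi> y)"
proof (cases "0 < s")
  case True
  have \<mu>': "finite_measure \<mu>" "sets \<mu> = sets borel" "prob_space \<mu>"
    using \<mu> by (auto simp: prob_measures_def prob_space.finite_measure)
  have one: "integrable \<mu> (\<lambda>_. 1 :: real)" by (rule finite_measure.integrable_const[OF \<mu>'(1)])
  note d = hdens_props[OF True \<mu>]
  have "(LINT x|heat_measure s \<mu>. \<phi> x) = (LINT x|Leb. hdens s \<mu> x *\<^sub>R \<phi> x)"
  proof -
    have "heat_measure s \<mu> = density Leb (\<lambda>x. ennreal (hdens s \<mu> x))" using True by (simp add: heat_measure_def)
    moreover have [measurable]: "\<phi> \<in> borel_measurable borel" "hdens s \<mu> \<in> borel_measurable borel"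
      by (intro continuous_torus_measurable \<phi> d)+
    ultimately show ?thesis
      using d(1) by (simp only:, intro integral_density) (auto simp: less_imp_le)
  qed
  also have "\<dots> = (LINT x|Leb. \<phi> x \<bullet> hdens s \<mu> x)" by (simp add: mult.commute)
  also have "\<dots> = (LINT y|\<mu>. hconv s Leb \<phi> y \<bullet> 1)"
    by (rule hconv_adjoint(1)[OF True \<mu>'(1,2) one continuous_integrable_Leb[OF \<phi>]])
  finally show ?thesis using True by (simp add: heat_fun_def)
qed (simp add: heat_measure_def heat_fun_def)

text \<open>The critical case is heat time 0: there the uniform convergence of the mollified
  functions gives joint continuity in heat time and point.\<close>

lemma heat_fun_continuous:
  fixes \<phi> :: "'n::finite torus \<Rightarrow> real"
  assumes \<phi>: "continuous_on UNIV \<phi>"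
  shows "continuous_on (UNIV \<times> UNIV) (\<lambda>(s, y). heat_fun s \<phi> y)"
proof (rule continuous_on_param_torus_lift, unfold case_prod_unfold UNIV_Times_UNIV, intro continuous_at_imp_continuous_on ballI)
  fix p :: "real \<times> (real^'n)"
  have cproj: "continuous_on S (\<lambda>p. torus_proj (snd p))" for S :: "(real \<times> (real^'n)) set"
    by (rule continuous_on_compose2[OF continuous_on_torus_proj]) (auto intro: continuous_intros)
  have csnd: "continuous_on S (\<lambda>p. \<phi> (torus_proj (snd p)))" for S :: "(real \<times> (real^'n)) set"
    by (rule continuous_on_compose2[OF \<phi> cproj]) auto
  consider "0 < fst p" | "fst p < 0" | "fst p = 0" by linarith
  then show "isCont (\<lambda>p. heat_fun (fst p) \<phi> (torus_proj (snd p))) p"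
  proof cases
    case 1
    let ?S = "{p :: real \<times> (real^'n). 0 < fst p}"
    have "continuous_on ?S (\<lambda>p. hconv (fst p) Leb \<phi> (torus_proj (snd p)))"
      by (rule hconv_continuous_time[OF sets_Leb continuous_integrable_Leb[OF \<phi>] _ cproj]) (auto intro: continuous_intros)
    then have "continuous_on ?S (\<lambda>p. heat_fun (fst p) \<phi> (torus_proj (snd p)))"
      by (rule continuous_on_eq) (auto simp: heat_fun_def)
    moreover have "open ?S" by (intro open_Collect_less continuous_intros)
    ultimately show ?thesis using 1 by (auto dest!: continuous_on_eq_continuous_at[THEN iffD1, rotated])
  next
    case 2
    let ?S = "{p :: real \<times> (real^'n). fst p < 0}"
    have "continuous_on ?S (\<lambda>p. heat_fun (fst p) \<phi> (torus_proj (snd p)))"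
      by (rule continuous_on_eq[OF csnd]) (auto simp: heat_fun_def)
    moreover have "open ?S" by (intro open_Collect_less continuous_intros)
    ultimately show ?thesis using 2 by (auto dest!: continuous_on_eq_continuous_at[THEN iffD1, rotated])
  next
    case 3
    show ?thesis
      unfolding isCont_def
    proof (rule tendstoI)
      fix e :: real assume e: "0 < e"
      obtain s0 where s0: "s0 > 0" "\<And>s y. 0 < s \<Longrightarrow> s < s0 \<Longrightarrow> norm (hconv s Leb \<phi> y - \<phi> y) \<le> e / 2"
        by (rule hconv_uniform_approx[OF \<phi>, of "e / 2"]) (use e that in auto)
      have "isCont (\<lambda>p. \<phi> (torus_proj (snd p))) p" by (rule continuous_on_interior[OF csnd[of UNIV]]) simp
      then have "((\<lambda>p. \<phi> (torus_proj (snd p))) \<longlongrightarrow> \<phi> (torus_proj (snd p))) (at p)" by (simp add: isCont_def)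
      from tendstoD[OF this, of "e / 2"]
      have 1: "\<forall>\<^sub>F q in at p. dist (\<phi> (torus_proj (snd q))) (\<phi> (torus_proj (snd p))) < e / 2" using e by simp
      have "(fst \<longlongrightarrow> fst p) (at p)" by (intro tendsto_intros)
      then have "\<forall>\<^sub>F q in at p. fst q < s0" by (rule order_tendstoD) (use 3 s0 in simp)
      with 1 show "\<forall>\<^sub>F q in at p. dist (heat_fun (fst q) \<phi> (torus_proj (snd q))) (heat_fun (fst p) \<phi> (torus_proj (snd p))) < e"
      proof eventually_elim
        case (elim q)
        have "\<bar>heat_fun (fst q) \<phi> (torus_proj (snd q)) - \<phi> (torus_proj (snd q))\<bar> \<le> e / 2"
          using s0(2)[of "fst q" "torus_proj (snd q)"] elim e by (auto simp: heat_fun_def)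
        moreover have "heat_fun (fst p) \<phi> (torus_proj (snd p)) = \<phi> (torus_proj (snd p))" using 3 by (simp add: heat_fun_def)
        ultimately show ?case using elim(1) unfolding dist_real_def by linarith
      qed
    qed
  qed
qed

section \<open>Limits and gluing along the heated curve\<close>

lemma ent_hdens_tendsto:
  fixes \<mu> :: "'n::finite torus measure"
  assumes \<mu>: "\<mu> \<in> prob_measures" and s: "s > 0" and X: "X \<longlonglongrightarrow> s" "\<And>n. X n > 0"
  shows "(\<lambda>n. ent (hdens (X n) \<mu>)) \<longlonglongrightarrow> ent (hdens s \<mu>)"
proof -
  have \<mu>': "finite_measure \<mu>" "sets \<mu> = sets borel"
    using \<mu> by (auto simp: prob_measures_def prob_space.finite_measure)
  have one: "integrable \<mu> (\<lambda>_. 1 :: real)" by (rule finite_measure.integrable_const[OF \<mu>'(1)])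
  let ?S = "{r :: real. 0 < r}"
  have c: "continuous_on (?S \<times> UNIV) (\<lambda>p. hdens (fst p) \<mu> (snd p))"
    by (rule hconv_continuous_time[OF \<mu>'(2) one]) (auto intro: continuous_intros)
  have ne: "hdens (fst p) \<mu> (snd p) \<noteq> 0" if "p \<in> ?S \<times> UNIV" for p
    using hdens_props(1)[OF _ \<mu>, of "fst p" "snd p"] that by (auto simp: less_imp_neq[symmetric])
  have "continuous_on (?S \<times> UNIV) (\<lambda>(r, x). hdens r \<mu> x * ln (hdens r \<mu> x))"
    unfolding case_prod_unfold using ne by (intro continuous_intros c) auto
  from continuous_on_integral_kernel[OF bounded_bilinear_mult sets_Leb continuous_integrable_Leb[OF continuous_on_const] this, of 1]
  have "continuous_on ?S (\<lambda>r. ent (hdens r \<mu>))" by (simp add: ent_def)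
  from continuous_on_tendsto_compose[OF this X(1)] show ?thesis using s X(2) by auto
qed

text \<open>On a heated piece the identity is available on compact subintervals of the open
  interval, where the heat time stays positive. Both sides are continuous in the end points, so it
  extends to the closed interval.\<close>

lemma set_integral_FTC_closure:
  fixes K E :: "real \<Rightarrow> real"
  assumes K: "set_integrable lborel {0..1} K" and E: "continuous_on {0..1} E" and pq: "0 \<le> p" "p \<le> q" "q \<le> 1"
    and eq: "\<And>p' q'. p < p' \<Longrightarrow> p' < q' \<Longrightarrow> q' < q \<Longrightarrow> (LINT t:{p'..q'}|lborel. K t) = E q' - E p'"
  shows "(LINT t:{p..q}|lborel. K t) = E q - E p"
proof (cases "p = q")
  case True
  have "(LINT t:{p..p}|lborel. K t) = 0"
    unfolding set_lebesgue_integral_def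
    by (rule integral_eq_zero_AE) (use AE_lborel_singleton[of p] in \<open>eventually_elim, auto\<close>)
  then show ?thesis using True by simp
next
  case False
  then have lt: "p < q" using pq by simp
  define m where "m = (p + q) / 2"
  have m: "p < m" "m < q" using lt by (auto simp: m_def)
  define I where "I t = (LINT r:{0..t}|lborel. K r)" for t
  have sub: "set_integrable lborel {x..y} K" if "0 \<le> x" "y \<le> 1" for x y
    by (rule set_integrable_subset[OF K]) (use that in auto)
  have Idiff: "I y - I x = (LINT t:{x..y}|lborel. K t)" if "0 \<le> x" "x \<le> y" "y \<le> 1" for x y
    using set_integral_split[OF that(1,2) sub] that unfolding I_def by simp
  have cI: "continuous_on {0..1} I"
  proof (rule continuous_on_eq)
    show "continuous_on {0..1} (\<lambda>t. integral {0..t} K)"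
      by (rule indefinite_integral_continuous_1[OF set_borel_integral_eq_integral(1)[OF K]])
    show "integral {0..t} K = I t" if "t \<in> {0..1}" for t
      using set_borel_integral_eq_integral(2)[OF sub[of 0 t]] that by (simp add: I_def)
  qed
  have const: "I t - E t = I m - E m" if "t \<in> closure {p<..<q}" for t
  proof (rule continuous_constant_on_closure[OF _ _ that, where f="\<lambda>t. I t - E t"])
    show "continuous_on (closure {p<..<q}) (\<lambda>t. I t - E t)"
      by (rule continuous_on_subset[of "{0..1}"]) (use lt pq in \<open>auto intro!: continuous_intros cI E\<close>)
    fix t assume t: "t \<in> {p<..<q}"
    consider "t = m" | "t < m" | "m < t" by linarith
    then show "I t - E t = I m - E m"
    proof cases
      case 2 then show ?thesis using Idiff[of t m] eq[of t m] t m pq by auto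
    next
      case 3 then show ?thesis using Idiff[of m t] eq[of m t] t m pq by auto
    qed simp
  qed
  have "I q - E q = I p - E p" using const[of p] const[of q] lt by simp
  then show ?thesis using Idiff[OF pq] by simp
qed

text \<open>The four intervals cover [0, 1] up to the time s, which the condition
  \<open>f s = 0\<close> takes care of.\<close>

lemma nn_integral_interval_partition:
  assumes [measurable]: "f \<in> borel_measurable lborel" and "f s = 0" and "0 \<le> a" "a < s" "s < b" "b \<le> (1 :: real)"
  shows "(\<integral>\<^sup>+t\<in>{0..1}. f t \<partial>lborel) \<le> (\<integral>\<^sup>+t\<in>{0..a}. f t \<partial>lborel) + (\<integral>\<^sup>+t\<in>{a<..<s}. f t \<partial>lborel)
    + (\<integral>\<^sup>+t\<in>{s<..<b}. f t \<partial>lborel) + (\<integral>\<^sup>+t\<in>{b..1}. f t \<partial>lborel)"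
proof -
  have "(\<integral>\<^sup>+t\<in>{0..1}. f t \<partial>lborel) \<le> (\<integral>\<^sup>+t. f t * indicator {0..a} t + f t * indicator {a<..<s} t
      + f t * indicator {s<..<b} t + f t * indicator {b..1} t \<partial>lborel)"
  proof (rule nn_integral_mono)
    fix t
    consider "t \<notin> {0..1}" | "t \<in> {0..a}" | "t \<in> {a<..<s}" | "t = s" | "t \<in> {s<..<b}" | "t \<in> {b..1}" by force
    then show "f t * indicator {0..1} t \<le> f t * indicator {0..a} t + f t * indicator {a<..<s} t
      + f t * indicator {s<..<b} t + f t * indicator {b..1} t"
      by cases (use assms in \<open>auto simp: indicator_def\<close>)
  qed
  also have "\<dots> = (\<integral>\<^sup>+t\<in>{0..a}. f t \<partial>lborel) + (\<integral>\<^sup>+t\<in>{a<..<s}. f t \<partial>lborel)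
    + (\<integral>\<^sup>+t\<in>{s<..<b}. f t \<partial>lborel) + (\<integral>\<^sup>+t\<in>{b..1}. f t \<partial>lborel)"
    by (simp add: nn_integral_add)
  finally show ?thesis .
qed

text \<open>By duality the slice integral is that of \<open>heat_fun (h t) \<phi>\<close> against
  \<open>\<kappa> t\<close>, with an integrand continuous in time and space even where
  \<open>h\<close> reaches 0.\<close>

lemma (in torus_field) heat_curve_narrow:
  fixes \<phi> :: "'n torus \<Rightarrow> real"
  assumes h: "continuous_on UNIV h" and \<phi>: "continuous_on UNIV \<phi>"
  shows "continuous_on UNIV (\<lambda>t. LINT x|heat_measure (h t) (\<kappa> t). \<phi> x)"
proof -
  have "continuous_on (UNIV \<times> UNIV) (\<lambda>(t, y). heat_fun (h t) \<phi> y)"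
    unfolding case_prod_unfold
    by (rule continuous_on_compose2[OF heat_fun_continuous[OF \<phi>], where f="\<lambda>p. (h (fst p), snd p)", simplified])
       (auto intro!: continuous_intros continuous_on_compose2[OF h])
  from continuous_on_narrow_integral[OF prob narrow this continuous_on_id]
  show ?thesis by (simp add: integral_heat_measure[OF prob \<phi>])
qed

section \<open>Velocity field of a heated piece\<close>

context torus_curve
begin

definition velocity :: "real \<Rightarrow> real \<Rightarrow> real \<Rightarrow> 'n torus \<Rightarrow> real^'n" where
  "velocity \<gamma> \<beta> t x = (1 / dens \<gamma> \<beta> t x) *\<^sub>R flux \<gamma> \<beta> t x"

lemma velocity_energy:
  assumes s: "0 < \<gamma> + \<beta> * t"
  shows "(\<integral>\<^sup>+x. ennreal ((norm (velocity \<gamma> \<beta> t x))\<^sup>2) \<partial>density Leb (\<lambda>x. ennreal (dens \<gamma> \<beta> t x)))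
    = (\<integral>\<^sup>+x. ennreal ((norm (flux \<gamma> \<beta> t x))\<^sup>2 / dens \<gamma> \<beta> t x) \<partial>Leb)"
proof -
  note d = dens_props[OF s]
  have [measurable]: "dens \<gamma> \<beta> t \<in> borel_measurable borel" "flux \<gamma> \<beta> t \<in> borel_measurable borel"
    using d by (auto intro: continuous_torus_measurable)
  have pt: "ennreal (dens \<gamma> \<beta> t x) * ennreal ((norm (velocity \<gamma> \<beta> t x))\<^sup>2) = ennreal ((norm (flux \<gamma> \<beta> t x))\<^sup>2 / dens \<gamma> \<beta> t x)" for x
  proof -
    have "dens \<gamma> \<beta> t x * (norm (velocity \<gamma> \<beta> t x))\<^sup>2 = (norm (flux \<gamma> \<beta> t x))\<^sup>2 / dens \<gamma> \<beta> t x"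
      using d(1)[of x] by (simp add: velocity_def power_mult_distrib power2_eq_square field_simps)
    then show ?thesis using d(1)[of x] by (simp flip: ennreal_mult)
  qed
  have "(\<integral>\<^sup>+x. ennreal ((norm (velocity \<gamma> \<beta> t x))\<^sup>2) \<partial>density Leb (\<lambda>x. ennreal (dens \<gamma> \<beta> t x)))
    = (\<integral>\<^sup>+x. ennreal (dens \<gamma> \<beta> t x) * ennreal ((norm (velocity \<gamma> \<beta> t x))\<^sup>2) \<partial>Leb)"
    by (rule nn_integral_density) (simp_all add: velocity_def)
  then show ?thesis unfolding pt .
qed

lemma integral_velocity:
  assumes s: "0 < \<gamma> + \<beta> * t" and f: "continuous_on UNIV f" and g: "continuous_on UNIV g"
  shows "(LINT x|density Leb (\<lambda>x. ennreal (dens \<gamma> \<beta> t x)). f x + g x \<bullet> velocity \<gamma> \<beta> t x)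
    = (LINT x|Leb. f x * dens \<gamma> \<beta> t x + g x \<bullet> flux \<gamma> \<beta> t x)"
proof -
  note d = dens_props[OF s]
  have [measurable]: "dens \<gamma> \<beta> t \<in> borel_measurable borel" "flux \<gamma> \<beta> t \<in> borel_measurable borel"
    "f \<in> borel_measurable borel" "g \<in> borel_measurable borel"
    using d f g by (auto intro: continuous_torus_measurable)
  have "(LINT x|density Leb (\<lambda>x. ennreal (dens \<gamma> \<beta> t x)). f x + g x \<bullet> velocity \<gamma> \<beta> t x)
    = (LINT x|Leb. dens \<gamma> \<beta> t x *\<^sub>R (f x + g x \<bullet> velocity \<gamma> \<beta> t x))"
    by (rule integral_density) (use d(1) in \<open>auto simp: velocity_def less_imp_le\<close>)
  also have "\<dots> = (LINT x|Leb. f x * dens \<gamma> \<beta> t x + g x \<bullet> flux \<gamma> \<beta> t x)"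
  proof (rule Bochner_Integration.integral_cong)
    fix x
    show "dens \<gamma> \<beta> t x *\<^sub>R (f x + g x \<bullet> velocity \<gamma> \<beta> t x) = f x * dens \<gamma> \<beta> t x + g x \<bullet> flux \<gamma> \<beta> t x"
      using d(1)[of x] by (simp add: velocity_def field_simps)
  qed simp
  finally show ?thesis .
qed

lemma velocity_measurable:
  "(\<lambda>(t, x). if 0 < \<gamma> + \<beta> * t then velocity \<gamma> \<beta> t x else 0) \<in> borel_measurable (borel \<Otimes>\<^sub>M borel)"
proof -
  have "(\<lambda>p. (1 / (if 0 < \<gamma> + \<beta> * fst p then dens \<gamma> \<beta> (fst p) (snd p) else 0)) *\<^sub>R (if 0 < \<gamma> + \<beta> * fst p then flux \<gamma> \<beta> (fst p) (snd p) else 0))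
      \<in> borel_measurable (borel \<Otimes>\<^sub>M borel)"
    using flux_measurable[of \<gamma> \<beta>] positive_part_measurable[OF affine_continuous dens_continuous, of \<gamma> \<beta>] unfolding case_prod_unfold
    by (intro borel_measurable_scaleR borel_measurable_divide borel_measurable_const)
  then show ?thesis by (rule measurable_cong[THEN iffD1, rotated]) (auto simp: velocity_def)
qed

lemma velocity_CE:
  assumes pq: "0 \<le> p" "p < q" "q \<le> 1" and g: "\<And>t. t \<in> {p..q} \<Longrightarrow> 0 < \<gamma> + \<beta> * t"
    and \<psi>: "C1_spacetime UNIV \<psi> \<psi>t \<psi>x"
    and \<sigma>: "\<And>t. t \<in> {p..q} \<Longrightarrow> \<sigma> t = density Leb (\<lambda>x. ennreal (dens \<gamma> \<beta> t x))" "\<And>t. t \<in> {p..q} \<Longrightarrow> V t = velocity \<gamma> \<beta> t"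
  shows "(LINT t:{p..q}|lborel. (LINT x|\<sigma> t. \<psi>t t x + \<psi>x t x \<bullet> V t x)) = (LINT x|\<sigma> q. \<psi> q x) - (LINT x|\<sigma> p. \<psi> p x)"
proof -
  note D = C1_spacetimeD[OF \<psi>] and c\<psi> = C1_spacetime_continuous[OF \<psi>]
  have E: "(LINT x|\<sigma> t. \<psi> t x) = (LINT x|Leb. \<psi> t x * dens \<gamma> \<beta> t x)" if "t \<in> {p..q}" for t
    using integral_velocity[OF g[OF that] continuous_slice[OF c\<psi> UNIV_I, of t], of "\<lambda>_. 0"] \<sigma>(1)[OF that]
    by (simp add: continuous_on_const)
  have eq: "indicator {p..q} t *\<^sub>R (LINT x|\<sigma> t. \<psi>t t x + \<psi>x t x \<bullet> V t x)
      = indicator {p..q} t *\<^sub>R (LINT x|Leb. \<psi>t t x * dens \<gamma> \<beta> t x + \<psi>x t x \<bullet> flux \<gamma> \<beta> t x)" for t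
    using integral_velocity[OF g continuous_slice[OF D(2) UNIV_I, of t] continuous_slice[OF D(3) UNIV_I, of t]] \<sigma>
    by (cases "t \<in> {p..q}") auto
  show ?thesis
    using smoothed_CE(2)[OF pq g \<psi>] E[of p] E[of q] pq unfolding set_lebesgue_integral_def eq by simp
qed

end

text \<open>The entropies at a and b are recorded as real numbers. At s only the entropy of the
  heated measure will occur, which is finite in any case.\<close>

locale tent_perturbation = torus_curve \<kappa> c
  for \<kappa> :: "real \<Rightarrow> 'n::finite torus measure" and c :: "real \<Rightarrow> 'n torus \<Rightarrow> real^'n" +
  fixes a s b \<epsilon> Ha Hb :: real
  assumes ab: "0 \<le> a" "a < s" "s < b" "b \<le> 1" and \<epsilon>: "0 < \<epsilon>"
    and Ha: "entropy_H (\<kappa> a) = ereal Ha" and Hb: "entropy_H (\<kappa> b) = ereal Hb"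
begin

text \<open>Slopes and intercepts such that \<open>\<gamma>1 + \<beta>1 * t\<close> rises from 0 at
  a to \<epsilon> at s and \<open>\<gamma>2 + \<beta>2 * t\<close> falls from \<epsilon> at s to 0
  at b. \<open>tent\<close> is their minimum, cut off at 0.\<close>

definition "\<beta>1 = \<epsilon> / (s - a)"
definition "\<gamma>1 = - a * \<beta>1"
definition "\<beta>2 = - (\<epsilon> / (b - s))"
definition "\<gamma>2 = - b * \<beta>2"
definition "tent t = max 0 (min (\<gamma>1 + \<beta>1 * t) (\<gamma>2 + \<beta>2 * t))"

lemma tent_props:
  shows "t \<le> a \<or> b \<le> t \<Longrightarrow> tent t = 0" "tent s = \<epsilon>"
    and "t \<in> {a..s} \<Longrightarrow> 0 \<le> \<gamma>1 + \<beta>1 * t" "t \<in> {s..b} \<Longrightarrow> 0 \<le> \<gamma>2 + \<beta>2 * t"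
    and "a < t \<Longrightarrow> t < s \<Longrightarrow> tent t = \<gamma>1 + \<beta>1 * t" "s < t \<Longrightarrow> t < b \<Longrightarrow> tent t = \<gamma>2 + \<beta>2 * t"
    and "a < t \<Longrightarrow> t < s \<Longrightarrow> 0 < \<gamma>1 + \<beta>1 * t" "s < t \<Longrightarrow> t < b \<Longrightarrow> 0 < \<gamma>2 + \<beta>2 * t"
    and "\<gamma>1 + \<beta>1 * a = 0" "\<gamma>1 + \<beta>1 * s = \<epsilon>" "\<gamma>2 + \<beta>2 * s = \<epsilon>" "\<gamma>2 + \<beta>2 * b = 0" "0 < \<beta>1" "\<beta>2 < 0"
proof -
  show b: "0 < \<beta>1" "\<beta>2 < 0" using ab \<epsilon> by (auto simp: \<beta>1_def \<beta>2_def)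
  have 1: "\<gamma>1 + \<beta>1 * t = \<beta>1 * (t - a)" and 2: "\<gamma>2 + \<beta>2 * t = (- \<beta>2) * (b - t)" for t
    by (simp_all add: \<gamma>1_def \<gamma>2_def algebra_simps)
  have s1: "\<beta>1 * (s - a) = \<epsilon>" and s2: "(- \<beta>2) * (b - s) = \<epsilon>" using ab by (auto simp: \<beta>1_def \<beta>2_def)
  show "\<gamma>1 + \<beta>1 * a = 0" "\<gamma>1 + \<beta>1 * s = \<epsilon>" "\<gamma>2 + \<beta>2 * s = \<epsilon>" "\<gamma>2 + \<beta>2 * b = 0"
    unfolding 1 2 using s1 s2 by auto
  have up1: "\<beta>1 * (t - a) \<le> \<epsilon>" "\<epsilon> \<le> (- \<beta>2) * (b - t)" if "t \<le> s" for t
    by (rule order_trans[OF mult_left_mono eq_refl[OF s1]] order_trans[OF eq_refl[OF s2[symmetric]] mult_left_mono]; use that b in simp)+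
  have up2: "\<epsilon> \<le> \<beta>1 * (t - a)" "(- \<beta>2) * (b - t) \<le> \<epsilon>" if "s \<le> t" for t
    by (rule order_trans[OF eq_refl[OF s1[symmetric]] mult_left_mono] order_trans[OF mult_left_mono eq_refl[OF s2]]; use that b in simp)+
  have p1: "0 < \<beta>1 * (t - a)" if "a < t" for t using that b by simp
  have p2: "0 < (- \<beta>2) * (b - t)" if "t < b" for t using that b by (simp add: mult_neg_pos)
  have n1: "\<beta>1 * (t - a) \<le> 0" if "t \<le> a" for t using that b by (simp add: mult_nonneg_nonpos)
  have n2: "(- \<beta>2) * (b - t) \<le> 0" if "b \<le> t" for t using that b by (simp add: mult_nonpos_nonpos)
  show "tent t = 0" if "t \<le> a \<or> b \<le> t" using that n1[of t] n2[of t] unfolding tent_def 1 2 by linarith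
  show "tent s = \<epsilon>" using s1 s2 \<epsilon> unfolding tent_def 1 2 by simp
  show "0 \<le> \<gamma>1 + \<beta>1 * t" if "t \<in> {a..s}" using that b unfolding 1 by simp
  show "0 \<le> \<gamma>2 + \<beta>2 * t" if "t \<in> {s..b}" using that b unfolding 2 by (simp add: mult_nonpos_nonneg)
  show "0 < \<gamma>1 + \<beta>1 * t" if "a < t" "t < s" using p1 that unfolding 1 by blast
  show "0 < \<gamma>2 + \<beta>2 * t" if "s < t" "t < b" using p2 that unfolding 2 by blast
  show "tent t = \<gamma>1 + \<beta>1 * t" if "a < t" "t < s"
    using up1[of t] p1[of t] that unfolding tent_def 1 2 by linarith
  show "tent t = \<gamma>2 + \<beta>2 * t" if "s < t" "t < b"
    using up2[of t] p2[of t] that unfolding tent_def 1 2 by linarith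
qed

lemma tent_continuous: "continuous_on UNIV tent"
  unfolding tent_def by (intro continuous_intros)

definition \<sigma> :: "real \<Rightarrow> 'n torus measure" where
  "\<sigma> t = heat_measure (tent t) (\<kappa> t)"

text \<open>At the single time s, where the two affine pieces meet, the value 0 keeps the slice
  energy finite, as \<open>torus_field\<close> demands at every time.\<close>

definition V :: "real \<Rightarrow> 'n torus \<Rightarrow> real^'n" where
  "V t = (if a < t \<and> t < s then velocity \<gamma>1 \<beta>1 t else if t = s then (\<lambda>_. 0)
    else if s < t \<and> t < b then velocity \<gamma>2 \<beta>2 t else c t)"

lemma \<sigma>_eq:
  "a < t \<Longrightarrow> t < s \<Longrightarrow> \<sigma> t = density Leb (\<lambda>x. ennreal (dens \<gamma>1 \<beta>1 t x))"
  "s < t \<Longrightarrow> t < b \<Longrightarrow> \<sigma> t = density Leb (\<lambda>x. ennreal (dens \<gamma>2 \<beta>2 t x))"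
  "t \<le> a \<or> b \<le> t \<Longrightarrow> \<sigma> t = \<kappa> t"
  using tent_props(1,5-8)[of t] by (auto simp: \<sigma>_def heat_measure_def dens_def)

lemma V_eq:
  "a < t \<Longrightarrow> t < s \<Longrightarrow> V t = velocity \<gamma>1 \<beta>1 t" "V s = (\<lambda>_. 0)"
  "s < t \<Longrightarrow> t < b \<Longrightarrow> V t = velocity \<gamma>2 \<beta>2 t" "t \<le> a \<or> b \<le> t \<Longrightarrow> V t = c t"
  using ab by (auto simp: V_def)

lemma \<sigma>_prob: "\<sigma> t \<in> prob_measures"
  unfolding \<sigma>_def by (rule heat_measure_prob[OF prob])

lemma \<sigma>_narrow: "continuous_on UNIV \<phi> \<Longrightarrow> continuous_on UNIV (\<lambda>t. LINT x|\<sigma> t. \<phi> x)" for \<phi> :: "'n torus \<Rightarrow> real"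
  unfolding \<sigma>_def by (rule heat_curve_narrow[OF tent_continuous])

lemma V_measurable: "(\<lambda>(t, x). V t x) \<in> borel_measurable (borel \<Otimes>\<^sub>M borel)"
proof -
  define A where "A \<gamma> \<beta> = (\<lambda>(t, x). if 0 < \<gamma> + \<beta> * t then velocity \<gamma> \<beta> t x else 0)" for \<gamma> \<beta>
  have [measurable]: "A \<gamma> \<beta> \<in> borel_measurable (borel \<Otimes>\<^sub>M borel)" for \<gamma> \<beta>
    unfolding A_def by (rule velocity_measurable)
  have [measurable]: "(\<lambda>p. c (fst p) (snd p)) \<in> borel_measurable (borel \<Otimes>\<^sub>M borel)"
    using c_measurable by (simp add: case_prod_unfold)
  have m: "(\<lambda>p. if a < fst p \<and> fst p < s then A \<gamma>1 \<beta>1 p else if fst p = s then 0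
      else if s < fst p \<and> fst p < b then A \<gamma>2 \<beta>2 p else c (fst p) (snd p)) \<in> borel_measurable (borel \<Otimes>\<^sub>M borel)"
    by measurable
  show ?thesis
    by (rule measurable_cong[THEN iffD1, OF _ m]) (use tent_props(7,8) in \<open>auto simp: V_def A_def\<close>)
qed

lemma V_energy:
  "a < t \<Longrightarrow> t < s \<Longrightarrow> (\<integral>\<^sup>+x. ennreal ((norm (V t x))\<^sup>2) \<partial>\<sigma> t) = (\<integral>\<^sup>+x. ennreal ((norm (flux \<gamma>1 \<beta>1 t x))\<^sup>2 / dens \<gamma>1 \<beta>1 t x) \<partial>Leb)"
  "(\<integral>\<^sup>+x. ennreal ((norm (V s x))\<^sup>2) \<partial>\<sigma> s) = 0"
  "s < t \<Longrightarrow> t < b \<Longrightarrow> (\<integral>\<^sup>+x. ennreal ((norm (V t x))\<^sup>2) \<partial>\<sigma> t) = (\<integral>\<^sup>+x. ennreal ((norm (flux \<gamma>2 \<beta>2 t x))\<^sup>2 / dens \<gamma>2 \<beta>2 t x) \<partial>Leb)"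
  "t \<le> a \<or> b \<le> t \<Longrightarrow> (\<integral>\<^sup>+x. ennreal ((norm (V t x))\<^sup>2) \<partial>\<sigma> t) = ennreal (en t)"
  by (simp_all add: \<sigma>_eq V_eq velocity_energy tent_props(7,8) en_nn)

text \<open>An upper bound for the change of the kinetic energy: -2 times slope times entropy
  increment, summed over both pieces. At a and b the entropies are those of the curve itself, at s
  that of the heated measure.\<close>

definition gain :: real where
  "gain = - 2 * \<beta>1 * (ent (hdens \<epsilon> (\<kappa> s)) - Ha) - 2 * \<beta>2 * (Hb - ent (hdens \<epsilon> (\<kappa> s)))"

lemma kinetic_energy_V:
  "kinetic_energy \<sigma> V \<le> ennreal ((LINT t:{0..1}|lborel. en t) + gain)" "0 \<le> (LINT t:{0..1}|lborel. en t) + gain"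
proof -
  define f where "f t = (\<integral>\<^sup>+x. ennreal ((norm (V t x))\<^sup>2) \<partial>\<sigma> t)" for t
  define Es where "Es = ent (hdens \<epsilon> (\<kappa> s))"
  define En where "En n = ent (hdens (\<epsilon> + heat_time n) (\<kappa> s))" for n
  let ?L1 = "- 2 * \<beta>1 * (Es - Ha)" and ?L2 = "- 2 * \<beta>2 * (Hb - Es)"
  let ?I = "\<lambda>p q. LINT t:{p..q}|lborel. en t"
  have "\<sigma> \<in> borel \<rightarrow>\<^sub>M subprob_algebra borel"
    by (rule measurable_prob_algebraD[OF narrow_continuous_kernel[OF \<sigma>_prob \<sigma>_narrow]])
  then have "f \<in> borel_measurable borel"
    unfolding f_def using V_measurable
    by (intro nn_integral_measurable_subprob_algebra2[where N=borel]) (simp_all add: case_prod_unfold)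
  then have fm: "f \<in> borel_measurable lborel" by simp
  have "(\<lambda>n. \<epsilon> + heat_time n) \<longlonglongrightarrow> \<epsilon> + 0" by (intro tendsto_intros heat_time_lim)
  then have En: "En \<longlonglongrightarrow> Es"
    unfolding En_def Es_def
    by (intro ent_hdens_tendsto prob \<epsilon>) (use \<epsilon> heat_time_pos in \<open>auto intro: add_pos_pos\<close>)
  \<comment> \<open>The entropies at a and b enter the energy bound with the positive coefficients 2
    \<open>\<beta>1\<close> and -2 \<open>\<beta>2\<close>, so these upper bounds point in the right
    direction on both pieces.\<close>
  have enda: "ent (hdens (heat_time n) (\<kappa> a)) \<le> Ha" and endb: "ent (hdens (heat_time n) (\<kappa> b)) \<le> Hb" for n
    using hdens_entropy_le[OF heat_time_pos prob, of n a] hdens_entropy_le[OF heat_time_pos prob, of n b] Ha Hb by auto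
  have d: "dens (\<gamma>1 + heat_time n) \<beta>1 s = hdens (\<epsilon> + heat_time n) (\<kappa> s)" "dens (\<gamma>1 + heat_time n) \<beta>1 a = hdens (heat_time n) (\<kappa> a)"
    "dens (\<gamma>2 + heat_time n) \<beta>2 s = hdens (\<epsilon> + heat_time n) (\<kappa> s)" "dens (\<gamma>2 + heat_time n) \<beta>2 b = hdens (heat_time n) (\<kappa> b)" for n
  proof -
    have "\<gamma>1 + heat_time n + \<beta>1 * s = \<epsilon> + heat_time n" "\<gamma>1 + heat_time n + \<beta>1 * a = heat_time n"
      "\<gamma>2 + heat_time n + \<beta>2 * s = \<epsilon> + heat_time n" "\<gamma>2 + heat_time n + \<beta>2 * b = heat_time n"
      using tent_props(9-12) by linarith+
    then show "dens (\<gamma>1 + heat_time n) \<beta>1 s = hdens (\<epsilon> + heat_time n) (\<kappa> s)" "dens (\<gamma>1 + heat_time n) \<beta>1 a = hdens (heat_time n) (\<kappa> a)"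
      "dens (\<gamma>2 + heat_time n) \<beta>2 s = hdens (\<epsilon> + heat_time n) (\<kappa> s)" "dens (\<gamma>2 + heat_time n) \<beta>2 b = hdens (heat_time n) (\<kappa> b)"
      by (simp_all only: dens_def)
  qed
  have L1: "(\<integral>\<^sup>+t\<in>{a<..<s}. (\<integral>\<^sup>+x. ennreal ((norm (flux \<gamma>1 \<beta>1 t x))\<^sup>2 / dens \<gamma>1 \<beta>1 t x) \<partial>Leb) \<partial>lborel) \<le> ennreal (?I a s + ?L1)" "0 \<le> ?I a s + ?L1"
  proof -
    have X: "- 2 * \<beta>1 * (ent (dens (\<gamma>1 + heat_time n) \<beta>1 s) - ent (dens (\<gamma>1 + heat_time n) \<beta>1 a)) \<le> - 2 * \<beta>1 * (En n - Ha)" for n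
      using enda[of n] tent_props(13) unfolding d En_def[symmetric] by (intro mult_left_mono_neg) auto
    have L: "(\<lambda>n. - 2 * \<beta>1 * (En n - Ha)) \<longlonglongrightarrow> ?L1" by (intro tendsto_intros En)
    have "s \<le> 1" using ab by simp
    note lim = energy_limit[OF ab(1,2) this tent_props(7,3) X L]
    show "(\<integral>\<^sup>+t\<in>{a<..<s}. (\<integral>\<^sup>+x. ennreal ((norm (flux \<gamma>1 \<beta>1 t x))\<^sup>2 / dens \<gamma>1 \<beta>1 t x) \<partial>Leb) \<partial>lborel) \<le> ennreal (?I a s + ?L1)" "0 \<le> ?I a s + ?L1"
      by (rule lim; assumption)+
  qed
  have L2: "(\<integral>\<^sup>+t\<in>{s<..<b}. (\<integral>\<^sup>+x. ennreal ((norm (flux \<gamma>2 \<beta>2 t x))\<^sup>2 / dens \<gamma>2 \<beta>2 t x) \<partial>Leb) \<partial>lborel) \<le> ennreal (?I s b + ?L2)" "0 \<le> ?I s b + ?L2"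
  proof -
    have X: "- 2 * \<beta>2 * (ent (dens (\<gamma>2 + heat_time n) \<beta>2 b) - ent (dens (\<gamma>2 + heat_time n) \<beta>2 s)) \<le> - 2 * \<beta>2 * (Hb - En n)" for n
      using endb[of n] tent_props(14) unfolding d En_def[symmetric] by (intro mult_left_mono) auto
    have L: "(\<lambda>n. - 2 * \<beta>2 * (Hb - En n)) \<longlonglongrightarrow> ?L2" by (intro tendsto_intros En)
    have "0 \<le> s" using ab by simp
    note lim = energy_limit[OF this ab(3,4) tent_props(8,4) X L]
    show "(\<integral>\<^sup>+t\<in>{s<..<b}. (\<integral>\<^sup>+x. ennreal ((norm (flux \<gamma>2 \<beta>2 t x))\<^sup>2 / dens \<gamma>2 \<beta>2 t x) \<partial>Leb) \<partial>lborel) \<le> ennreal (?I s b + ?L2)" "0 \<le> ?I s b + ?L2"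
      by (rule lim; assumption)+
  qed
  have outer: "(\<integral>\<^sup>+t\<in>{p..q}. f t \<partial>lborel) = ennreal (?I p q)" "0 \<le> ?I p q" if "0 \<le> p" "q \<le> 1" "q \<le> a \<or> b \<le> p" for p q
  proof -
    have "(\<integral>\<^sup>+t\<in>{p..q}. f t \<partial>lborel) = (\<integral>\<^sup>+t. ennreal (indicator {p..q} t *\<^sub>R en t) \<partial>lborel)"
      using that(3) by (intro nn_integral_cong) (auto simp: f_def V_energy indicator_def)
    also have "\<dots> = ennreal (?I p q)"
      unfolding set_lebesgue_integral_def using en_nonneg
      by (intro nn_integral_eq_integral en_integrable[OF that(1,2), unfolded set_integrable_def]) auto
    finally show "(\<integral>\<^sup>+t\<in>{p..q}. f t \<partial>lborel) = ennreal (?I p q)" .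
    show "0 \<le> ?I p q" unfolding set_lebesgue_integral_def using en_nonneg by (intro Bochner_Integration.integral_nonneg) auto
  qed
  have i: "(\<integral>\<^sup>+t\<in>{a<..<s}. f t \<partial>lborel) = (\<integral>\<^sup>+t\<in>{a<..<s}. (\<integral>\<^sup>+x. ennreal ((norm (flux \<gamma>1 \<beta>1 t x))\<^sup>2 / dens \<gamma>1 \<beta>1 t x) \<partial>Leb) \<partial>lborel)"
    "(\<integral>\<^sup>+t\<in>{s<..<b}. f t \<partial>lborel) = (\<integral>\<^sup>+t\<in>{s<..<b}. (\<integral>\<^sup>+x. ennreal ((norm (flux \<gamma>2 \<beta>2 t x))\<^sup>2 / dens \<gamma>2 \<beta>2 t x) \<partial>Leb) \<partial>lborel)"
    by (intro nn_integral_cong; simp add: f_def V_energy indicator_def)+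
  have sum: "?I 0 1 = ?I 0 a + ?I a s + ?I s b + ?I b 1"
    using ab set_integral_split[of 0 a 1 en] set_integral_split[of a s 1 en] set_integral_split[of s b 1 en]
      en_integrable[of 0 1] en_integrable[of a 1] en_integrable[of s 1] by simp
  have eq: "?I 0 1 + gain = ?I 0 a + (?I a s + ?L1) + (?I s b + ?L2) + ?I b 1"
    unfolding sum gain_def Es_def[symmetric] by simp
  note nn = outer(2)[of 0 a] outer(2)[of b 1] L1(2) L2(2)
  show "0 \<le> ?I 0 1 + gain" unfolding eq using nn ab by simp
  have "kinetic_energy \<sigma> V = (\<integral>\<^sup>+t\<in>{0..1}. f t \<partial>lborel)" by (simp add: kinetic_energy_def f_def)
  also have "\<dots> \<le> (\<integral>\<^sup>+t\<in>{0..a}. f t \<partial>lborel) + (\<integral>\<^sup>+t\<in>{a<..<s}. f t \<partial>lborel) + (\<integral>\<^sup>+t\<in>{s<..<b}. f t \<partial>lborel) + (\<integral>\<^sup>+t\<in>{b..1}. f t \<partial>lborel)"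
    by (rule nn_integral_interval_partition[OF fm _ ab]) (simp add: f_def V_energy)
  also have "\<dots> \<le> ennreal (?I 0 a) + ennreal (?I a s + ?L1) + ennreal (?I s b + ?L2) + ennreal (?I b 1)"
    unfolding i using outer(1)[of 0 a] outer(1)[of b 1] L1(1) L2(1) ab by (intro add_mono) auto
  also have "\<dots> = ennreal (?I 0 1 + gain)"
    unfolding eq using nn ab by (simp flip: ennreal_plus)
  finally show "kinetic_energy \<sigma> V \<le> ennreal (?I 0 1 + gain)" .
qed

lemma \<sigma>_field: "torus_field \<sigma> V"
proof (unfold_locales)
  show "(\<integral>\<^sup>+x. ennreal ((norm (V t x))\<^sup>2) \<partial>\<sigma> t) < \<infinity>" for t
  proof -
    consider "t \<le> a \<or> b \<le> t" | "a < t" "t < s" | "t = s" | "s < t" "t < b" by linarith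
    then show ?thesis
    proof cases
      case 2
      show ?thesis using le_less_trans[OF flux_energy_le(1)[OF tent_props(7)[OF 2]]] by (simp add: V_energy 2)
    next
      case 4
      show ?thesis using le_less_trans[OF flux_energy_le(1)[OF tent_props(8)[OF 4]]] by (simp add: V_energy 4)
    qed (simp_all add: V_energy)
  qed
  show "kinetic_energy \<sigma> V < \<infinity>" by (rule le_less_trans[OF kinetic_energy_V(1)]) simp
qed (rule \<sigma>_prob \<sigma>_narrow V_measurable; assumption)+

text \<open>On each of the four closed intervals the integral of \<open>K\<close> is the increment
  of \<open>E\<close>: directly where the curve is unchanged, by
  \<open>set_integral_FTC_closure\<close> where it is heated. Continuity of \<open>E\<close>
  excludes jumps at a, s and b, so the increments telescope, and a test function vanishes at times 0
  and 1.\<close>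

lemma \<sigma>_continuity_eq: "continuity_eq \<sigma> V"
  unfolding continuity_eq_def
proof (intro allI impI)
  fix \<psi> \<psi>t and \<psi>x :: "real \<Rightarrow> 'n torus \<Rightarrow> real^'n" assume test: "spacetime_test \<psi> \<psi>t \<psi>x"
  then have \<psi>: "C1_spacetime UNIV \<psi> \<psi>t \<psi>x" by (rule spacetime_test_C1)
  interpret F: torus_field \<sigma> V by (rule \<sigma>_field)
  note D = C1_spacetimeD[OF \<psi>] and c\<psi> = C1_spacetime_continuous[OF \<psi>]
  define K where "K t = (LINT x|\<sigma> t. \<psi>t t x + \<psi>x t x \<bullet> V t x)" for t
  define E where "E t = (LINT x|\<sigma> t. \<psi> t x)" for t
  have K: "set_integrable lborel {0..1} K"
    unfolding K_def
    by (rule F.D_integrable(1)[OF order_refl order_refl]; rule continuous_on_subset[OF D(2)] continuous_on_subset[OF D(3)]; simp)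
  have E: "continuous_on {0..1} E"
    unfolding E_def
    by (rule continuous_on_narrow_integral[OF \<sigma>_prob \<sigma>_narrow continuous_on_subset[OF c\<psi>] continuous_on_id]) auto
  note glue = set_integral_FTC_closure[OF K E]
  have inner: "(LINT t:{p..q}|lborel. K t) = E q - E p" if pq: "0 \<le> p" "p < q" "q \<le> 1" and out: "q \<le> a \<or> b \<le> p" for p q
  proof -
    have "K t = (LINT x|\<kappa> t. \<psi>t t x + \<psi>x t x \<bullet> c t x)" if "t \<in> {p..q}" for t
    proof -
      have t: "t \<le> a \<or> b \<le> t" using out that by auto
      show ?thesis unfolding K_def \<sigma>_eq(3)[OF t] V_eq(4)[OF t] ..
    qed
    then have "(LINT t:{p..q}|lborel. K t) = (LINT t:{p..q}|lborel. (LINT x|\<kappa> t. \<psi>t t x + \<psi>x t x \<bullet> c t x))"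
      by (intro set_lebesgue_integral_cong) auto
    also have "\<dots> = E q - E p"
    proof -
      have "\<sigma> p = \<kappa> p" "\<sigma> q = \<kappa> q" by (rule \<sigma>_eq(3); use pq out in auto)+
      then show ?thesis using integrated_CE(2)[OF pq \<psi>] by (simp add: E_def)
    qed
    finally show ?thesis .
  qed
  have 1: "(LINT t:{0..a}|lborel. K t) = E a - E 0" by (rule glue) (use ab inner in auto)
  have 2: "(LINT t:{a..s}|lborel. K t) = E s - E a"
  proof (rule glue)
    fix p q assume "a < p" "p < q" "q < s"
    then show "(LINT t:{p..q}|lborel. K t) = E q - E p"
      unfolding K_def E_def using ab tent_props(7)
      by (intro velocity_CE[OF _ _ _ _ \<psi>, of p q \<gamma>1 \<beta>1]) (auto simp: \<sigma>_eq V_eq)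
  qed (use ab in auto)
  have 3: "(LINT t:{s..b}|lborel. K t) = E b - E s"
  proof (rule glue)
    fix p q assume "s < p" "p < q" "q < b"
    then show "(LINT t:{p..q}|lborel. K t) = E q - E p"
      unfolding K_def E_def using ab tent_props(8)
      by (intro velocity_CE[OF _ _ _ _ \<psi>, of p q \<gamma>2 \<beta>2]) (auto simp: \<sigma>_eq V_eq)
  qed (use ab in auto)
  have 4: "(LINT t:{b..1}|lborel. K t) = E 1 - E b" by (rule glue) (use ab inner in auto)
  have iK: "set_integrable lborel {p..1} K" if "0 \<le> p" for p by (rule set_integrable_subset[OF K]) (use that in auto)
  have "(LINT t:{0..1}|lborel. K t) = E 1 - E 0"
    using ab 1 2 3 4 set_integral_split[of 0 a 1 K] set_integral_split[of a s 1 K] set_integral_split[of s b 1 K] iK by simp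
  moreover have "\<psi> 0 = (\<lambda>_. 0)" "\<psi> 1 = (\<lambda>_. 0)"
    using test unfolding spacetime_test_def by fastforce+
  ultimately show "(LINT t:{0..1}|lborel. (LINT x|\<sigma> t. \<psi>t t x + \<psi>x t x \<bullet> V t x)) = 0"
    by (simp add: K_def E_def)
qed

lemma \<sigma>_AC2: "\<sigma> \<in> AC2" "action \<sigma> \<le> ennreal (((LINT t:{0..1}|lborel. en t) + gain) / 2)"
proof -
  have V: "V \<in> velocity_fields \<sigma>"
    unfolding velocity_fields_def using V_measurable \<sigma>_continuity_eq torus_field.c_energy[OF \<sigma>_field] by simp
  show AC: "\<sigma> \<in> AC2"
    unfolding AC2_def narrowly_continuous_def using V \<sigma>_prob \<sigma>_narrow
    by (auto intro: continuous_on_subset)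
  have "action \<sigma> \<le> kinetic_energy \<sigma> V / 2" unfolding action_def using AC V by (auto intro: INF_lower)
  also have "\<dots> \<le> ennreal ((LINT t:{0..1}|lborel. en t) + gain) / 2"
    by (intro divide_right_mono_ennreal kinetic_energy_V)
  finally show "action \<sigma> \<le> ennreal (((LINT t:{0..1}|lborel. en t) + gain) / 2)"
    using kinetic_energy_V(2) by (simp add: ennreal_divide_numeral)
qed

text \<open>Every admissible pair of root and gradient for \<open>\<kappa>\<close> is turned into
  one for \<open>\<sigma>\<close>: where the tent is positive, the root of the heated density, which
  is positive and C1, with its classical gradient; elsewhere the given pair. Slice by slice
  \<open>heat_fisher_le\<close> compares the two, so the infima compare.\<close>

lemma fisher_\<sigma>: "fisher \<sigma> \<le> fisher \<kappa>"
  unfolding fisher_def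
proof (rule Inf_greatest)
  fix z assume "z \<in> {(\<integral>\<^sup>+t\<in>{0..1}. (\<integral>\<^sup>+x. ennreal ((norm (g t x))\<^sup>2) \<partial>Leb) \<partial>lborel) / 2 | u g. sqrt_density \<kappa> u \<and> L2_H1 u g}"
  then obtain u g where z: "z = (\<integral>\<^sup>+t\<in>{0..1}. (\<integral>\<^sup>+x. ennreal ((norm (g t x))\<^sup>2) \<partial>Leb) \<partial>lborel) / 2"
    and u: "sqrt_density \<kappa> u" and L2: "L2_H1 u g" by blast
  have um: "(\<lambda>(t, x). u t x) \<in> borel_measurable (borel \<Otimes>\<^sub>M borel)" and gm: "(\<lambda>(t, x). g t x) \<in> borel_measurable (borel \<Otimes>\<^sub>M borel)"
    and gE: "(\<integral>\<^sup>+t\<in>{0..1}. (\<integral>\<^sup>+x. ennreal ((norm (g t x))\<^sup>2) \<partial>Leb) \<partial>lborel) < \<infinity>"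
    and wg: "AE t in lborel. t \<in> {0..1} \<longrightarrow> weak_gradient (u t) (g t)"
    using L2 by (auto simp: L2_H1_def)
  have uslice: "u t \<in> borel_measurable borel" and gslice: "g t \<in> borel_measurable borel" for t
    using measurable_compose[OF measurable_Pair1' um, of t] measurable_compose[OF measurable_Pair1' gm, of t] by simp_all
  have u0: "0 \<le> u t x" for t x using u by (simp add: sqrt_density_def)
  have ud: "AE t in lborel. t \<in> {0..1} \<longrightarrow> \<kappa> t = density Leb (\<lambda>x. ennreal ((u t x)\<^sup>2))" using u by (simp add: sqrt_density_def)
  define w where "w t x = (if 0 < tent t then sqrt (hdens (tent t) (\<kappa> t) x) else u t x)" for t x
  define G where "G t x = (if 0 < tent t then (1 / (2 * sqrt (hdens (tent t) (\<kappa> t) x))) *\<^sub>R hgrad (tent t) (\<kappa> t) (\<lambda>_. 1) x else g t x)" for t x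
  note hp = hdens_props[OF _ prob]
  have wd: "AE t in lborel. t \<in> {0..1} \<longrightarrow> \<sigma> t = density Leb (\<lambda>x. ennreal ((w t x)\<^sup>2))"
    using ud
  proof eventually_elim
    case (elim t)
    show ?case
    proof (cases "0 < tent t")
      case True
      then show ?thesis using less_imp_le[OF hp(1)[OF True, of t]] by (simp add: \<sigma>_def heat_measure_def w_def)
    next
      case False
      then show ?thesis using elim by (simp add: \<sigma>_def heat_measure_def w_def)
    qed
  qed
  have [measurable]: "tent \<in> borel_measurable borel" by (rule borel_measurable_continuous_onI[OF tent_continuous])
  have m1: "(\<lambda>(t, x). if 0 < tent t then hdens (tent t) (\<kappa> t) x else 0) \<in> borel_measurable (borel \<Otimes>\<^sub>M borel)"
    "(\<lambda>(t, x). if 0 < tent t then hgrad (tent t) (\<kappa> t) (\<lambda>_. 1) x else 0) \<in> borel_measurable (borel \<Otimes>\<^sub>M borel)"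
    by (intro positive_part_measurable hdens_curve_continuous hgrad_curve_continuous tent_continuous)+
  have wm: "(\<lambda>(t, x). w t x) \<in> borel_measurable (borel \<Otimes>\<^sub>M borel)"
  proof -
    have "(\<lambda>p. if 0 < tent (fst p) then sqrt (if 0 < tent (fst p) then hdens (tent (fst p)) (\<kappa> (fst p)) (snd p) else 0) else u (fst p) (snd p)) \<in> borel_measurable (borel \<Otimes>\<^sub>M borel)"
      using m1 um unfolding case_prod_unfold by measurable
    then show ?thesis by (rule measurable_cong[THEN iffD1, rotated]) (auto simp: w_def)
  qed
  have Gm: "(\<lambda>(t, x). G t x) \<in> borel_measurable (borel \<Otimes>\<^sub>M borel)"
  proof -
    have "(\<lambda>p. if 0 < tent (fst p) then (1 / (2 * sqrt (if 0 < tent (fst p) then hdens (tent (fst p)) (\<kappa> (fst p)) (snd p) else 0)))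
       *\<^sub>R (if 0 < tent (fst p) then hgrad (tent (fst p)) (\<kappa> (fst p)) (\<lambda>_. 1) (snd p) else 0) else g (fst p) (snd p)) \<in> borel_measurable (borel \<Otimes>\<^sub>M borel)"
      using m1 gm unfolding case_prod_unfold by measurable
    then show ?thesis by (rule measurable_cong[THEN iffD1, rotated]) (auto simp: G_def)
  qed
  have GE: "(\<integral>\<^sup>+t\<in>{0..1}. (\<integral>\<^sup>+x. ennreal ((norm (G t x))\<^sup>2) \<partial>Leb) \<partial>lborel) \<le> (\<integral>\<^sup>+t\<in>{0..1}. (\<integral>\<^sup>+x. ennreal ((norm (g t x))\<^sup>2) \<partial>Leb) \<partial>lborel)"
  proof (rule nn_integral_mono_AE)
    show "AE t in lborel. (\<integral>\<^sup>+x. ennreal ((norm (G t x))\<^sup>2) \<partial>Leb) * indicator {0..1} t \<le> (\<integral>\<^sup>+x. ennreal ((norm (g t x))\<^sup>2) \<partial>Leb) * indicator {0..1} t"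
      using ud wg
    proof eventually_elim
      case (elim t)
      show ?case
      proof (cases "t \<in> {0..1} \<and> 0 < tent t \<and> (\<integral>\<^sup>+x. ennreal ((norm (g t x))\<^sup>2) \<partial>Leb) < \<infinity>")
        case True
        then have \<kappa>t: "\<kappa> t = density Leb (\<lambda>x. ennreal ((u t x)\<^sup>2))" and wgt: "weak_gradient (u t) (g t)" using elim by auto
        have "(\<integral>\<^sup>+x. ennreal ((u t x)\<^sup>2) \<partial>Leb) = emeasure (\<kappa> t) UNIV"
          unfolding \<kappa>t using uslice[of t] by (subst emeasure_density) (auto simp: space_Leb)
        also have "\<dots> = 1"
          using prob_space.emeasure_space_1[OF prob_space_\<kappa>, of t] sets_eq_imp_space_eq[OF sets_\<kappa>, of t] by simp
        finally have "integrable Leb (\<lambda>x. (u t x)\<^sup>2)" using uslice[of t] by (intro integrableI_nonneg) auto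
        moreover have "integrable Leb (\<lambda>x. (norm (g t x))\<^sup>2)" using gslice[of t] True by (intro integrableI_nonneg) auto
        ultimately have "(\<integral>\<^sup>+x. ennreal ((norm (G t x))\<^sup>2) \<partial>Leb) \<le> (\<integral>\<^sup>+x. ennreal ((norm (g t x))\<^sup>2) \<partial>Leb)"
          using heat_fisher_le[OF wgt uslice gslice _ _ prob \<kappa>t, of "tent t"] True by (simp add: G_def)
        then show ?thesis by (rule mult_right_mono) simp
      next
        case False
        then consider "t \<notin> {0..1}" | "\<not> 0 < tent t" | "t \<in> {0..1}" "(\<integral>\<^sup>+x. ennreal ((norm (g t x))\<^sup>2) \<partial>Leb) = \<infinity>"
          by (auto simp: less_top[symmetric])
        then show ?thesis by cases (auto simp: G_def)
      qed
    qed
  qed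
  have "L2_H1 w G"
    unfolding L2_H1_def
  proof (intro conjI wm Gm)
    have "(\<integral>\<^sup>+t\<in>{0..1}. (\<integral>\<^sup>+x. ennreal ((w t x)\<^sup>2) \<partial>Leb) \<partial>lborel) \<le> (\<integral>\<^sup>+t. indicator {0..1 :: real} t \<partial>lborel)"
    proof (rule nn_integral_mono_AE)
      show "AE t in lborel. (\<integral>\<^sup>+x. ennreal ((w t x)\<^sup>2) \<partial>Leb) * indicator {0..1} t \<le> indicator {0..1} t"
        using wd
      proof eventually_elim
        case (elim t)
        have [measurable]: "w t \<in> borel_measurable borel" using measurable_compose[OF measurable_Pair1' wm, of t] by simp
        have "(\<integral>\<^sup>+x. ennreal ((w t x)\<^sup>2) \<partial>Leb) = 1" if "t \<in> {0..1}"
        proof -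
          have \<sigma>t: "\<sigma> t = density Leb (\<lambda>x. ennreal ((w t x)\<^sup>2))" using elim that by simp
          have "prob_space (\<sigma> t)" "sets (\<sigma> t) = sets borel" using \<sigma>_prob[of t] by (auto simp: prob_measures_def)
          then have "emeasure (\<sigma> t) UNIV = 1"
            using prob_space.emeasure_space_1 sets_eq_imp_space_eq[of "\<sigma> t" borel] by fastforce
          then show ?thesis unfolding \<sigma>t by (subst (asm) emeasure_density) (auto simp: space_Leb)
        qed
        then show ?case by (auto simp: indicator_def)
      qed
    qed
    also have "\<dots> < \<infinity>" by simp
    finally show "(\<integral>\<^sup>+t\<in>{0..1}. (\<integral>\<^sup>+x. ennreal ((w t x)\<^sup>2) \<partial>Leb) \<partial>lborel) < \<infinity>" .
    show "(\<integral>\<^sup>+t\<in>{0..1}. (\<integral>\<^sup>+x. ennreal ((norm (G t x))\<^sup>2) \<partial>Leb) \<partial>lborel) < \<infinity>" by (rule le_less_trans[OF GE gE])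
    show "AE t in lborel. t \<in> {0..1} \<longrightarrow> weak_gradient (w t) (G t)"
      using wg
    proof eventually_elim
      case (elim t)
      show ?case
      proof (cases "0 < tent t")
        case True
        then have "w t = (\<lambda>x. sqrt (hdens (tent t) (\<kappa> t) x))"
          "G t = (\<lambda>x. (1 / (2 * sqrt (hdens (tent t) (\<kappa> t) x))) *\<^sub>R hgrad (tent t) (\<kappa> t) (\<lambda>_. 1) x)"
          by (auto simp: w_def G_def)
        then show ?thesis
          using C1_weak_gradient[OF C1_torus_sqrt[OF hp(3,1)[OF True]], of t] by simp
      next
        case False
        then have "w t = u t" "G t = g t" by (auto simp: w_def G_def)
        then show ?thesis using elim by simp
      qed
    qed
  qed
  moreover have "sqrt_density \<sigma> w" unfolding sqrt_density_def using wd u0 by (auto simp: w_def hp(1) less_imp_le)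
  ultimately have "Inf {(\<integral>\<^sup>+t\<in>{0..1}. (\<integral>\<^sup>+x. ennreal ((norm (g t x))\<^sup>2) \<partial>Leb) \<partial>lborel) / 2 | u g. sqrt_density \<sigma> u \<and> L2_H1 u g}
      \<le> (\<integral>\<^sup>+t\<in>{0..1}. (\<integral>\<^sup>+x. ennreal ((norm (G t x))\<^sup>2) \<partial>Leb) \<partial>lborel) / 2"
    by (intro Inf_lower) blast
  also have "\<dots> \<le> z" unfolding z by (intro divide_right_mono_ennreal GE)
  finally show "Inf {(\<integral>\<^sup>+t\<in>{0..1}. (\<integral>\<^sup>+x. ennreal ((norm (g t x))\<^sup>2) \<partial>Leb) \<partial>lborel) / 2 | u g. sqrt_density \<sigma> u \<and> L2_H1 u g} \<le> z" .
qed

end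

section \<open>Minimality and convexity\<close>

text \<open>Clamping time to [0, 1] extends the curve narrowly continuously to the line. The
  velocity is set to 0 outside [0, 1] and on the null set of times with infinite slice energy; the
  weak equation is unaffected and the energy does not increase.\<close>

lemma AC2_torus_curve:
  fixes \<rho> :: "real \<Rightarrow> 'n::finite torus measure"
  assumes \<rho>: "\<rho> \<in> AC2" and c: "c \<in> velocity_fields \<rho>"
  obtains c' where "torus_curve (\<lambda>t. \<rho> (max 0 (min 1 t))) c'" "kinetic_energy (\<lambda>t. \<rho> (max 0 (min 1 t))) c' \<le> kinetic_energy \<rho> c"
proof -
  let ?\<kappa> = "\<lambda>t. \<rho> (max 0 (min 1 t))"
  have prob: "?\<kappa> t \<in> prob_measures" for t using \<rho> by (auto simp: AC2_def)
  have narrow: "continuous_on UNIV (\<lambda>t. LINT x|?\<kappa> t. \<phi> x)" if "continuous_on UNIV \<phi>" for \<phi> :: "'n torus \<Rightarrow> real"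
  proof -
    have "continuous_on {0..1} (\<lambda>t. LINT x|\<rho> t. \<phi> x)" using \<rho> that by (auto simp: AC2_def narrowly_continuous_def)
    then show ?thesis
      by (rule continuous_on_compose2[where f="\<lambda>t. max 0 (min 1 t)"]) (auto intro!: continuous_intros)
  qed
  have kernel: "?\<kappa> \<in> borel \<rightarrow>\<^sub>M subprob_algebra borel"
    by (rule measurable_prob_algebraD[OF narrow_continuous_kernel[OF prob narrow]])
  have cm: "(\<lambda>(t, x). c t x) \<in> borel_measurable (borel \<Otimes>\<^sub>M borel)" and cE: "kinetic_energy \<rho> c < \<infinity>" and CE: "continuity_eq \<rho> c"
    using c by (auto simp: velocity_fields_def)
  define e where "e t = (\<integral>\<^sup>+x. ennreal ((norm (c t x))\<^sup>2) \<partial>?\<kappa> t)" for t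
  have em [measurable]: "e \<in> borel_measurable borel"
    unfolding e_def by (rule nn_integral_measurable_subprob_algebra2[OF _ kernel]) (use cm in \<open>simp add: case_prod_unfold\<close>)
  have KE: "kinetic_energy \<rho> c = (\<integral>\<^sup>+t\<in>{0..1}. e t \<partial>lborel)"
    unfolding kinetic_energy_def e_def by (intro nn_integral_cong) (auto simp: indicator_def)
  have "AE t in lborel. e t * indicator {0..1} t \<noteq> \<infinity>"
    by (rule nn_integral_PInf_AE) (use cE KE in auto)
  then have fin: "AE t in lborel. t \<in> {0..1} \<longrightarrow> e t < \<infinity>"
    by eventually_elim (auto simp: less_top indicator_def)
  define c' where "c' t x = (if t \<in> {0..1} \<and> e t < \<infinity> then c t x else 0)" for t x
  have c'm: "(\<lambda>(t, x). c' t x) \<in> borel_measurable (borel \<Otimes>\<^sub>M borel)"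
    using cm unfolding c'_def case_prod_unfold by measurable
  have c'e: "(\<integral>\<^sup>+x. ennreal ((norm (c' t x))\<^sup>2) \<partial>?\<kappa> t) = (if t \<in> {0..1} \<and> e t < \<infinity> then e t else 0)" for t
  proof (cases "t \<in> {0..1} \<and> e t < \<infinity>")
    case True
    then have "c' t = c t" by (simp add: c'_def fun_eq_iff)
    then show ?thesis using True by (simp only: e_def) simp
  next
    case False
    then have "c' t = (\<lambda>_. 0)" by (intro ext) (simp only: c'_def if_False)
    then show ?thesis using False by (simp only: if_False) simp
  qed
  have KE': "kinetic_energy ?\<kappa> c' \<le> kinetic_energy \<rho> c"
    unfolding KE unfolding kinetic_energy_def c'e by (intro nn_integral_mono) (auto simp: indicator_def)
  have "continuity_eq ?\<kappa> c'"
    unfolding continuity_eq_def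
  proof (intro allI impI)
    fix \<psi> \<psi>t and \<psi>x :: "real \<Rightarrow> 'n torus \<Rightarrow> real^'n" assume t: "spacetime_test \<psi> \<psi>t \<psi>x"
    then have cont: "continuous_on UNIV (\<lambda>(t, x). \<psi>t t x)" "continuous_on UNIV (\<lambda>(t, x). \<psi>x t x)"
      by (auto simp: spacetime_test_def)
    note m = cont[THEN borel_pair_continuous]
    have meas: "(\<lambda>t. LINT x|?\<kappa> t. \<psi>t t x + \<psi>x t x \<bullet> f t x) \<in> borel_measurable borel"
      if "(\<lambda>(t, x). f t x) \<in> borel_measurable (borel \<Otimes>\<^sub>M borel)" for f
      by (rule integral_measurable_kernel[OF _ kernel])
         (use m that in \<open>unfold case_prod_unfold, intro borel_measurable_add borel_measurable_inner\<close>)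
    have "(LINT t:{0..1}|lborel. (LINT x|?\<kappa> t. \<psi>t t x + \<psi>x t x \<bullet> c' t x)) = (LINT t:{0..1}|lborel. (LINT x|?\<kappa> t. \<psi>t t x + \<psi>x t x \<bullet> c t x))"
      unfolding set_lebesgue_integral_def
    proof (rule integral_cong_AE)
      show "AE t in lborel. indicator {0..1} t *\<^sub>R (LINT x|?\<kappa> t. \<psi>t t x + \<psi>x t x \<bullet> c' t x) = indicator {0..1} t *\<^sub>R (LINT x|?\<kappa> t. \<psi>t t x + \<psi>x t x \<bullet> c t x)"
        using fin by eventually_elim (auto simp: c'_def indicator_def)
    qed (use meas[OF cm] meas[OF c'm] in auto)
    also have "\<dots> = (LINT t:{0..1}|lborel. (LINT x|\<rho> t. \<psi>t t x + \<psi>x t x \<bullet> c t x))"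
      by (intro set_lebesgue_integral_cong) auto
    also have "\<dots> = 0" using CE t by (simp add: continuity_eq_def)
    finally show "(LINT t:{0..1}|lborel. (LINT x|?\<kappa> t. \<psi>t t x + \<psi>x t x \<bullet> c' t x)) = 0" .
  qed
  then have "torus_curve ?\<kappa> c'"
    using prob narrow c'm le_less_trans[OF KE' cE] by unfold_locales (auto simp: c'e)
  then show thesis using KE' by (rule that)
qed

lemma fisher_cong:
  assumes "\<And>t. t \<in> {0..1} \<Longrightarrow> \<rho> t = \<sigma> t" shows "fisher \<rho> = fisher \<sigma>"
proof -
  have "sqrt_density \<rho> u = sqrt_density \<sigma> u" for u
    unfolding sqrt_density_def using assms by (intro conj_cong refl AE_cong) auto
  then show ?thesis by (simp add: fisher_def)
qed

text \<open>Minimality is used only against competitors whose Fisher information is no larger, and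
  only for the action; in this form it holds for both variational problems. A negative
  \<open>gain\<close> would produce such a competitor with strictly smaller action.\<close>

lemma entropy_three_points:
  fixes \<rho> :: "real \<Rightarrow> 'n::finite torus measure"
  assumes \<rho>: "\<rho> \<in> AC2"
    and min: "\<And>\<sigma>. \<sigma> \<in> AC2 \<Longrightarrow> \<sigma> 0 = \<rho> 0 \<Longrightarrow> \<sigma> 1 = \<rho> 1 \<Longrightarrow> fisher \<sigma> \<le> fisher \<rho> \<Longrightarrow> action \<rho> \<le> action \<sigma>"
    and ab: "0 \<le> a" "a < s" "s < b" "b \<le> 1"
    and H: "entropy_H (\<rho> a) = ereal Ha" "entropy_H (\<rho> b) = ereal Hb"
  shows "entropy_H (\<rho> s) \<le> ereal ((b - s) / (b - a) * Ha + (s - a) / (b - a) * Hb)"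
proof -
  let ?\<kappa> = "\<lambda>t. \<rho> (max 0 (min 1 t))"
  have clamp: "?\<kappa> t = \<rho> t" if "t \<in> {0..1}" for t using that by (auto simp: max_def min_def)
  have heat: "ent (hdens \<epsilon> (\<rho> s)) \<le> (b - s) / (b - a) * Ha + (s - a) / (b - a) * Hb" if \<epsilon>: "0 < \<epsilon>" for \<epsilon>
  proof -
    define Es where "Es = ent (hdens \<epsilon> (\<rho> s))"
    \<comment> \<open>The \<open>gain\<close> of the tent perturbation, written out before a
      velocity field is chosen, since its value depends only on the curve.\<close>
    define g where "g = - 2 * (\<epsilon> / (s - a)) * (Es - Ha) + 2 * (\<epsilon> / (b - s)) * (Hb - Es)"
    have "0 \<le> g"
    proof (rule ccontr)
      assume "\<not> 0 \<le> g"
      then have g: "g < 0" by simp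
      have "velocity_fields \<rho> \<noteq> {}" using \<rho> by (simp add: AC2_def)
      then obtain c0 where c0: "c0 \<in> velocity_fields \<rho>" by blast
      have act: "action \<rho> = (INF c\<in>velocity_fields \<rho>. kinetic_energy \<rho> c / 2)" using \<rho> by (simp add: action_def)
      have "action \<rho> \<le> kinetic_energy \<rho> c0 / 2" unfolding act by (rule INF_lower[OF c0])
      also have "\<dots> < \<infinity>"
        using c0 by (cases "kinetic_energy \<rho> c0") (auto simp: velocity_fields_def ennreal_divide_numeral)
      finally obtain A where A: "action \<rho> = ennreal A" "0 \<le> A" by (cases "action \<rho>") auto
      have "action \<rho> < ennreal (A - g / 2)" unfolding A using g A(2) by (intro ennreal_lessI) auto
      \<comment> \<open>A velocity field exceeding the minimal action by less than -g / 2, which is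
        what the perturbation wins back.\<close>
      then obtain c where c: "c \<in> velocity_fields \<rho>" "kinetic_energy \<rho> c / 2 < ennreal (A - g / 2)"
        unfolding act INF_less_iff by blast
      obtain c' where c': "torus_curve ?\<kappa> c'" "kinetic_energy ?\<kappa> c' \<le> kinetic_energy \<rho> c"
        by (rule AC2_torus_curve[OF \<rho> c(1)]) (rule that)
      interpret C: torus_curve ?\<kappa> c' by (rule c'(1))
      interpret T: tent_perturbation ?\<kappa> c' a s b \<epsilon> Ha Hb
        by unfold_locales (use ab \<epsilon> H clamp[of a] clamp[of b] in auto)
      define I where "I = (LINT t:{0..1}|lborel. C.en t)"
      have I: "0 \<le> I" unfolding I_def set_lebesgue_integral_def using C.en_nonneg by (intro Bochner_Integration.integral_nonneg) auto
      have KE: "kinetic_energy ?\<kappa> c' = ennreal I"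
      proof -
        have "kinetic_energy ?\<kappa> c' = (\<integral>\<^sup>+t. ennreal (indicator {0..1} t *\<^sub>R C.en t) \<partial>lborel)"
          unfolding C.kinetic_energy_en by (intro nn_integral_cong) (auto simp: indicator_def)
        also have "\<dots> = ennreal I"
          unfolding I_def set_lebesgue_integral_def using C.en_nonneg
          by (intro nn_integral_eq_integral C.en_integrable[of 0 1, unfolded set_integrable_def]) auto
        finally show ?thesis .
      qed
      have "ennreal (I / 2) = kinetic_energy ?\<kappa> c' / 2" unfolding KE using I by (simp add: ennreal_divide_numeral)
      also have "\<dots> \<le> kinetic_energy \<rho> c / 2" by (rule divide_right_mono_ennreal[OF c'(2)])
      finally have IA: "I / 2 < A - g / 2" using c(2) I by (auto dest: le_less_trans simp: ennreal_less_iff)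
      have gain: "T.gain = g"
        using clamp[of s] ab by (simp add: T.gain_def g_def Es_def T.\<beta>1_def T.\<beta>2_def)
      have "fisher T.\<sigma> \<le> fisher \<rho>" using T.fisher_\<sigma> fisher_cong[of ?\<kappa> \<rho>] clamp by simp
      moreover have "T.\<sigma> 0 = \<rho> 0" "T.\<sigma> 1 = \<rho> 1" using T.\<sigma>_eq(3)[of 0] T.\<sigma>_eq(3)[of 1] ab by auto
      ultimately have "action \<rho> \<le> action T.\<sigma>" by (intro min T.\<sigma>_AC2(1))
      also have "\<dots> \<le> ennreal ((I + g) / 2)" using T.\<sigma>_AC2(2) unfolding gain I_def .
      finally have "A \<le> (I + g) / 2"
        using A T.kinetic_energy_V(2) unfolding gain I_def[symmetric] by simp
      then show False using IA by simp
    qed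
    \<comment> \<open>The factor clears both slopes and cancels \<epsilon>, leaving the three-point
      inequality for the heated entropy at s.\<close>
    then have "0 \<le> g * ((s - a) * (b - s) / (2 * \<epsilon>))" using ab \<epsilon> by simp
    also have "\<dots> = (Hb - Es) * (s - a) - (Es - Ha) * (b - s)"
    proof -
      have "(- 2 * (\<epsilon> / P) * (Es - Ha) + 2 * (\<epsilon> / Q) * (Hb - Es)) * (P * Q / (2 * \<epsilon>)) = (Hb - Es) * P - (Es - Ha) * Q"
        if "P > 0" "Q > 0" for P Q using that \<epsilon> by (simp add: field_simps)
      then show ?thesis using ab by (simp add: g_def)
    qed
    finally have "Es * (b - a) \<le> (b - s) * Ha + (s - a) * Hb" by (simp add: algebra_simps)
    then have "Es \<le> ((b - s) * Ha + (s - a) * Hb) / (b - a)" using ab by (simp add: pos_le_divide_eq)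
    then show ?thesis unfolding Es_def[symmetric] by (simp add: add_divide_distrib)
  qed
  have "\<rho> s \<in> prob_measures" using \<rho> ab by (auto simp: AC2_def)
  from entropy_H_le_heat_limit[OF this zero_less_one heat] show ?thesis by simp
qed

theorem proposition2p7:
  fixes \<rho>0 \<rho>1 :: "'n::finite torus measure"
    and \<rho> :: "real \<Rightarrow> 'n torus measure"
    and \<alpha> :: real
  assumes "\<rho>0 \<in> prob_measures" and "\<rho>1 \<in> prob_measures"
    and "entropy_H \<rho>0 < \<infinity>" and "entropy_H \<rho>1 < \<infinity>"
    and "\<alpha> > 0"
    and "OT_solution \<rho>0 \<rho>1 \<rho> \<or> Sch_solution \<alpha> \<rho>0 \<rho>1 \<rho>"
  shows "ereal_convex_on {0..1} (\<lambda>t. entropy_H (\<rho> t))"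
proof -
  have \<rho>: "\<rho> \<in> AC2"
    using assms(6) by (auto simp: OT_solution_def Sch_solution_def is_arg_min_def curves_between_def)
  have min: "action \<rho> \<le> action \<sigma>" if \<sigma>: "\<sigma> \<in> AC2" "\<sigma> 0 = \<rho> 0" "\<sigma> 1 = \<rho> 1" "fisher \<sigma> \<le> fisher \<rho>" for \<sigma>
    using assms(6)
  proof
    assume "OT_solution \<rho>0 \<rho>1 \<rho>"
    then show ?thesis using \<sigma> by (auto simp: OT_solution_def is_arg_min_def curves_between_def not_less)
  next
    assume "Sch_solution \<alpha> \<rho>0 \<rho>1 \<rho>"
    then have fin: "fisher \<rho> < \<infinity>" and le: "sch_functional \<alpha> \<rho> \<le> sch_functional \<alpha> \<sigma>"
      using \<sigma> by (auto simp: Sch_solution_def is_arg_min_def curves_between_def not_less intro: le_less_trans)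
    \<comment> \<open>The Fisher term of \<sigma> is raised to that of \<rho>; as the latter is
      finite it cancels, and only the comparison of actions remains.\<close>
    note le
    also have "sch_functional \<alpha> \<sigma> \<le> action \<sigma> + ennreal (\<alpha>\<^sup>2) * fisher \<rho>"
      unfolding sch_functional_def by (intro add_left_mono mult_left_mono \<sigma>(4)) simp
    finally show ?thesis
      unfolding sch_functional_def using fin
      by (subst (asm) (1 2) add.commute) (auto simp: ennreal_add_left_cancel_le ennreal_mult_eq_top_iff)
  qed
  let ?H = "\<lambda>t. entropy_H (\<rho> t)"
  have three: "?H s \<le> ereal ((b - s) / (b - a) * Ha + (s - a) / (b - a) * Hb)"
    if "0 \<le> a" "a < s" "s < b" "b \<le> 1" "?H a = ereal Ha" "?H b = ereal Hb" for a s b Ha Hb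
    by (rule entropy_three_points[OF \<rho> _ that]) (rule min)
  have seg: "?H ((1 - l) * x + l * y) \<le> ereal (1 - l) * ?H x + ereal l * ?H y"
    if xy: "x \<in> {0..1}" "y \<in> {0..1}" and l: "l \<in> {0..1}" for x y l
  proof -
    \<comment> \<open>In \<open>ereal\<close> the product of 0 and \<infinity> is 0, so the cases l
      = 0 and l = 1 hold by evaluation. With 0 < l < 1 an infinite entropy at either end makes the
      right-hand side infinite, since the value -\<infinity> does not occur.\<close>
    consider "l = 0" | "l = 1" | "x = y" | "?H x = \<infinity>" "0 < l" "l < 1" | "?H y = \<infinity>" "0 < l" "l < 1"
      | "0 < l" "l < 1" "x \<noteq> y" "?H x \<noteq> \<infinity>" "?H y \<noteq> \<infinity>"
      using l by fastforce
    then show ?thesis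
    proof cases
      case 3
      have "(1 - l) * y + l * y = y" by (simp add: algebra_simps)
      moreover have "ereal (1 - l) * ?H y + ereal l * ?H y = ?H y"
        using l entropy_H_not_minf[of "\<rho> y"] by (cases "?H y") (auto simp: algebra_simps)
      ultimately show ?thesis using 3 by simp
    next
      case 4
      then show ?thesis using entropy_H_not_minf[of "\<rho> y"] by (cases "?H y") auto
    next
      case 5
      then show ?thesis using entropy_H_not_minf[of "\<rho> x"] by (cases "?H x") auto
    next
      case 6
      obtain Hx Hy where H: "?H x = ereal Hx" "?H y = ereal Hy"
        using 6 entropy_H_not_minf[of "\<rho> x"] entropy_H_not_minf[of "\<rho> y"] by (cases "?H x"; cases "?H y") auto
      define z where "z = (1 - l) * x + l * y"
      have zx: "z - x = l * (y - x)" and yz: "y - z = (1 - l) * (y - x)" by (simp_all add: z_def algebra_simps)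
      have "?H z \<le> ereal ((1 - l) * Hx + l * Hy)"
      proof (cases "x < y")
        case True
        then have "0 < z - x" "0 < y - z" unfolding zx yz using 6(1,2) by simp_all
        then have "x < z" "z < y" by simp_all
        with three[of x z y Hx Hy] xy H show ?thesis using True by (simp add: zx yz)
      next
        case False
        then have "y < x" using 6 by simp
        have xz: "x - z = l * (x - y)" and zy: "z - y = (1 - l) * (x - y)" by (simp_all add: z_def algebra_simps)
        have "0 < x - z" "0 < z - y" unfolding xz zy using 6(1,2) \<open>y < x\<close> by simp_all
        then have "y < z" "z < x" by simp_all
        with three[of y z x Hy Hx] xy H show ?thesis using \<open>y < x\<close> by (simp add: xz zy add.commute)
      qed
      then show ?thesis by (simp add: z_def H)
    qed (simp_all flip: zero_ereal_def)
  qed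
  show ?thesis unfolding ereal_convex_on_def using seg by auto
qed

end
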